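(* Let $\mathcal{N}\in\mathrm{Ch}(A'B',AB)$ and regard $\mathcal N^{\otimes n}$ as a bipartite channel from $A'^nB'^n$ to $A^nB^n$. Then \[ \lim_{\varepsilon\to0^+}\lim_{n\to\infty}\frac1n S^\varepsilon_\infty[A^n|B^n]_{\mathcal{N}^{\otimes n}}\le S(R_AA|R_BB)_{\Phi^{\mathcal N}}-\log|A'|. \] If moreover $\mathcal{N}$ is tele-covariant, then \[ \lim_{\varepsilon\to0^+}\lim_{n\to\infty}\frac1n S^\varepsilon_\infty[A^n|B^n]_{\mathcal{N}^{\otimes n}}\le S[A|B]_{\mathcal N}, \qquad \lim_{n\to\infty}\frac1n S^\varepsilon_\infty[A^n|B^n]_{\mathcal{N}^{\otimes n}}\ge S[A|B]_{\mathcal N}\ \text{ for every }\varepsilon\in(0,1). \]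
   Context: All systems are finite-dimensional; $|X|$ denotes dimension; $\log$ is base 2. $\mathrm{St}(X)$: density operators; $\mathrm{Ch}(X',X)$: quantum channels. Maximally entangled state $\Phi_{RX}:=\frac1d\sum_{i,j}|ii\rangle\langle jj|$, $d=|X|$; Choi state of $\mathcal N\in\mathrm{Ch}(A'B',AB)$: $\Phi^{\mathcal N}_{R_AAR_BB}:=(\mathrm{id}\otimes\mathcal N)(\Phi_{R_AA'}\otimes\Phi_{R_BB'})$. $\mathcal R^{\mathbb 1}_{A'\to A}(X):=\operatorname{tr}(X)\mathbb 1_A$. $D(\rho\|\sigma)=\operatorname{tr}\rho(\log\rho-\log\sigma)$ (quantum relative entropy), $D_\infty(\rho\|\sigma):=\log\inf\{\lambda:\rho\le\lambda\sigma\}$; channel versions $\mathbf D[\mathcal M\|\mathcal M']:=\sup_{\rho\in\mathrm{St}(RX')}\mathbf D((\mathrm{id}_R\otimes\mathcal M)(\rho)\|(\mathrm{id}_R\otimes\mathcal M')(\rho))$. Von Neumann conditional channel entropy: $S[A|B]_{\mathcal N}:=-\inf_{\mathcal Q\in\mathrm{Ch}(B',B)}D[\mathcal N\|\mathcal R^{\mathbb1}_{A'\to A}\otimes\mathcal Q]$. For states, $S(X|Y)_\rho:=S(XY)_\rho-S(Y)_\rho$. Purified distance of channels: $P[\mathcal M_1,\mathcal M_2]:=\sup_{\rho}\sqrt{1-F((\mathrm{id}\otimes\mathcal M_1)(\rho),(\mathrm{id}\otimes\mathcal M_2)(\rho))}$ with $F(\rho,\sigma)=\|\sqrt\rho\sqrt\sigma\|_1^2$.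 Smoothed conditional channel min-entropy: $S^\varepsilon_\infty[A|B]_{\mathcal N}:=-\inf_{\mathcal Q\in\mathrm{Ch}(B',B)}\inf\{D_\infty[\widetilde{\mathcal N}\|\mathcal R^{\mathbb 1}_{A'\to A}\otimes\mathcal Q]:\widetilde{\mathcal N}\in\mathrm{Ch}(A'B',AB),\ P[\mathcal N,\widetilde{\mathcal N}]\le\varepsilon\}$. Tele-covariance: $\mathcal N$ is tele-covariant if there are finite groups $G,H$ and unitary representations $g\mapsto U^{(g)}$ on $A'$, $h\mapsto V^{(h)}$ on $B'$, $(g,h)\mapsto W^{(g,h)}$ on $A$, $(g,h)\mapsto Z^{(g,h)}$ on $B$ such that for all states $\rho_{A'B'}$ and all $g,h$: $\mathcal N((U^{(g)}\otimes V^{(h)})\rho(U^{(g)}\otimes V^{(h)})^\dagger)=(W^{(g,h)}\otimes Z^{(g,h)})\mathcal N(\rho)(W^{(g,h)}\otimes Z^{(g,h)})^\dagger$, and $\frac1{|G|}\sum_g U^{(g)}\rho_{A'}U^{(g)\dagger}=\mathbb 1_{A'}/|A'|$, $\frac1{|H|}\sum_h V^{(h)}\rho_{B'}V^{(h)\dagger}=\mathbb 1_{B'}/|B'|$ for all states $\rho_{A'},\rho_{B'}$. *)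

theory Defs
  imports "Jordan_Normal_Form.Schur_Decomposition" "HOL-Algebra.Group"
    "HOL-Library.Extended_Real" "HOL-Library.Liminf_Limsup"
begin

type_synonym cmat = "complex mat"

definition q_tr :: "cmat \<Rightarrow> complex" where
  "q_tr A = (\<Sum>i<dim_row A. A $$ (i,i))"

definition q_hermitian :: "cmat \<Rightarrow> bool" where
  "q_hermitian A \<longleftrightarrow> square_mat A \<and> mat_adjoint A = A"

definition q_psd :: "nat \<Rightarrow> cmat \<Rightarrow> bool" where
  "q_psd n A \<longleftrightarrow> A \<in> carrier_mat n n \<and> q_hermitian A \<and>
     (\<forall>v \<in> carrier_vec n. 0 \<le> Re (v \<bullet>c (A *\<^sub>v v)))"

definition q_state :: "nat \<Rightarrow> cmat \<Rightarrow> bool" where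
  "q_state n \<rho> \<longleftrightarrow> q_psd n \<rho> \<and> q_tr \<rho> = 1"

definition q_unitary :: "nat \<Rightarrow> cmat \<Rightarrow> bool" where
  "q_unitary n U \<longleftrightarrow> U \<in> carrier_mat n n \<and> mat_adjoint U * U = 1\<^sub>m n \<and> U * mat_adjoint U = 1\<^sub>m n"

definition q_kron :: "cmat \<Rightarrow> cmat \<Rightarrow> cmat" where
  "q_kron A B = mat (dim_row A * dim_row B) (dim_col A * dim_col B)
     (\<lambda>(i,j). A $$ (i div dim_row B, j div dim_col B) * B $$ (i mod dim_row B, j mod dim_col B))"

definition q_matfun :: "(real \<Rightarrow> real) \<Rightarrow> cmat \<Rightarrow> cmat" where
  "q_matfun f A = (let n = dim_row A;
      p = (SOME p. q_unitary n (fst p) \<and>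
             A = fst p * mat_diag n (\<lambda>i. complex_of_real (snd p i)) * mat_adjoint (fst p))
    in fst p * mat_diag n (\<lambda>i. complex_of_real (f (snd p i))) * mat_adjoint (fst p))"

definition q_log :: "cmat \<Rightarrow> cmat" where
  "q_log A = q_matfun (\<lambda>x. if x > 0 then log 2 x else 0) A"

definition q_sqrt :: "cmat \<Rightarrow> cmat" where
  "q_sqrt A = q_matfun sqrt A"

definition q_entropy :: "cmat \<Rightarrow> real" where
  "q_entropy \<rho> = - Re (q_tr (\<rho> * q_log \<rho>))"

definition q_ptrace1 :: "nat \<Rightarrow> nat \<Rightarrow> cmat \<Rightarrow> cmat" where
  "q_ptrace1 d1 d2 \<rho> = mat d2 d2 (\<lambda>(i,j). \<Sum>a<d1. \<rho> $$ (a * d2 + i, a * d2 + j))"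

definition q_cond_entropy :: "nat \<Rightarrow> nat \<Rightarrow> cmat \<Rightarrow> real" where
  "q_cond_entropy dX dY \<rho> = q_entropy \<rho> - q_entropy (q_ptrace1 dX dY \<rho>)"

text \<open>Quantum relative entropy (= +infinity unless supp rho is contained in supp sigma).\<close>
definition q_rel_ent :: "cmat \<Rightarrow> cmat \<Rightarrow> ereal" where
  "q_rel_ent \<rho> \<sigma> =
    (if (\<forall>v \<in> carrier_vec (dim_row \<sigma>). \<sigma> *\<^sub>v v = 0\<^sub>v (dim_row \<sigma>) \<longrightarrow> \<rho> *\<^sub>v v = 0\<^sub>v (dim_row \<rho>))
     then ereal (Re (q_tr (\<rho> * (q_log \<rho> - q_log \<sigma>)))) else \<infinity>)"

text \<open>Max-relative entropy D_infty(rho||sigma) = log inf {lambda : rho <= lambda sigma}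
  (inf of the empty set = +infinity).\<close>
definition q_Dmax :: "cmat \<Rightarrow> cmat \<Rightarrow> ereal" where
  "q_Dmax \<rho> \<sigma> = Inf {ereal (log 2 c) | c. c > 0 \<and>
       q_psd (dim_row \<rho>) (complex_of_real c \<cdot>\<^sub>m \<sigma> - \<rho>)}"

definition q_trace_norm :: "cmat \<Rightarrow> real" where
  "q_trace_norm A = Re (q_tr (q_sqrt (mat_adjoint A * A)))"

definition q_fidelity :: "cmat \<Rightarrow> cmat \<Rightarrow> real" where
  "q_fidelity \<rho> \<sigma> = (q_trace_norm (q_sqrt \<rho> * q_sqrt \<sigma>))\<^sup>2"

definition q_ketbra :: "nat \<Rightarrow> nat \<Rightarrow> nat \<Rightarrow> cmat" where
  "q_ketbra n i j = mat n n (\<lambda>(a,b). if a = i \<and> b = j then 1 else 0)"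

definition q_id_tensor :: "nat \<Rightarrow> nat \<Rightarrow> nat \<Rightarrow> (cmat \<Rightarrow> cmat) \<Rightarrow> cmat \<Rightarrow> cmat" where
  "q_id_tensor k din dout M X = mat (k * dout) (k * dout)
     (\<lambda>(r,c). M (mat din din (\<lambda>(a,b). X $$ ((r div dout) * din + a, (c div dout) * din + b)))
               $$ (r mod dout, c mod dout))"

definition q_channel :: "nat \<Rightarrow> nat \<Rightarrow> (cmat \<Rightarrow> cmat) \<Rightarrow> bool" where
  "q_channel din dout M \<longleftrightarrow>
     (\<forall>A \<in> carrier_mat din din. M A \<in> carrier_mat dout dout) \<and>
     (\<forall>A \<in> carrier_mat din din. \<forall>B \<in> carrier_mat din din. M (A + B) = M A + M B) \<and>
     (\<forall>A \<in> carrier_mat din din. \<forall>c. M (c \<cdot>\<^sub>m A) = c \<cdot>\<^sub>m M A) \<and>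
     (\<forall>A \<in> carrier_mat din din. q_tr (M A) = q_tr A) \<and>
     (\<forall>k X. q_psd (k * din) X \<longrightarrow> q_psd (k * dout) (q_id_tensor k din dout M X))"

definition q_tensor_map :: "nat \<Rightarrow> nat \<Rightarrow> nat \<Rightarrow> nat \<Rightarrow> (cmat \<Rightarrow> cmat) \<Rightarrow> (cmat \<Rightarrow> cmat) \<Rightarrow> cmat \<Rightarrow> cmat" where
  "q_tensor_map dA' dB' dA dB M1 M2 X = mat (dA * dB) (dA * dB) (\<lambda>(i,j).
     \<Sum>k<dA' * dB'. \<Sum>l<dA' * dB'. X $$ (k,l)
        * M1 (q_ketbra dA' (k div dB') (l div dB')) $$ (i div dB, j div dB)
        * M2 (q_ketbra dB' (k mod dB') (l mod dB')) $$ (i mod dB, j mod dB))"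

definition q_replacer :: "nat \<Rightarrow> cmat \<Rightarrow> cmat" where
  "q_replacer dA X = q_tr X \<cdot>\<^sub>m 1\<^sub>m dA"

definition q_chan_div :: "(cmat \<Rightarrow> cmat \<Rightarrow> ereal) \<Rightarrow> nat \<Rightarrow> nat \<Rightarrow> (cmat \<Rightarrow> cmat) \<Rightarrow> (cmat \<Rightarrow> cmat) \<Rightarrow> ereal" where
  "q_chan_div Dv din dout M M' =
     (SUP p \<in> {(k, \<rho>). 0 < k \<and> q_state (k * din) \<rho>}.
        Dv (q_id_tensor (fst p) din dout M (snd p)) (q_id_tensor (fst p) din dout M' (snd p)))"

definition q_pdist :: "nat \<Rightarrow> nat \<Rightarrow> (cmat \<Rightarrow> cmat) \<Rightarrow> (cmat \<Rightarrow> cmat) \<Rightarrow> real" where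
  "q_pdist din dout M1 M2 =
     (SUP p \<in> {(k, \<rho>). 0 < k \<and> q_state (k * din) \<rho>}.
        sqrt (1 - q_fidelity (q_id_tensor (fst p) din dout M1 (snd p)) (q_id_tensor (fst p) din dout M2 (snd p))))"

definition q_cond_chan_entropy :: "nat \<Rightarrow> nat \<Rightarrow> nat \<Rightarrow> nat \<Rightarrow> (cmat \<Rightarrow> cmat) \<Rightarrow> ereal" where
  "q_cond_chan_entropy dA' dB' dA dB N =
     - (INF Q \<in> {Q. q_channel dB' dB Q}.
          q_chan_div q_rel_ent (dA' * dB') (dA * dB) N (q_tensor_map dA' dB' dA dB (q_replacer dA) Q))"

definition q_smooth_min_entropy :: "real \<Rightarrow> nat \<Rightarrow> nat \<Rightarrow> nat \<Rightarrow> nat \<Rightarrow> (cmat \<Rightarrow> cmat) \<Rightarrow> ereal" where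
  "q_smooth_min_entropy \<epsilon> dA' dB' dA dB N =
     - (INF Q \<in> {Q. q_channel dB' dB Q}.
         INF Nt \<in> {Nt. q_channel (dA' * dB') (dA * dB) Nt \<and> q_pdist (dA' * dB') (dA * dB) N Nt \<le> \<epsilon>}.
          q_chan_div q_Dmax (dA' * dB') (dA * dB) Nt (q_tensor_map dA' dB' dA dB (q_replacer dA) Q))"

text \<open>m-th base-d digit (most significant first) of x in an n-digit representation.\<close>
definition q_digit :: "nat \<Rightarrow> nat \<Rightarrow> nat \<Rightarrow> nat \<Rightarrow> nat" where
  "q_digit d n m x = (x div d ^ (n - 1 - m)) mod d"

text \<open>For an index x of X^n Y^n (|X| = dX, |Y| = dY), the index of the m-th copy of XY.\<close>
definition q_bip_idx :: "nat \<Rightarrow> nat \<Rightarrow> nat \<Rightarrow> nat \<Rightarrow> nat \<Rightarrow> nat" where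
  "q_bip_idx dX dY n m x = q_digit dX n m (x div dY ^ n) * dY + q_digit dY n m (x mod dY ^ n)"

text \<open>N^{(x)n} regarded as a bipartite channel from A'^n B'^n to A^n B^n (defined by linearity).\<close>
definition q_chan_pow :: "nat \<Rightarrow> nat \<Rightarrow> nat \<Rightarrow> nat \<Rightarrow> nat \<Rightarrow> (cmat \<Rightarrow> cmat) \<Rightarrow> cmat \<Rightarrow> cmat" where
  "q_chan_pow dA' dB' dA dB n N X = mat (dA ^ n * dB ^ n) (dA ^ n * dB ^ n) (\<lambda>(i,j).
     \<Sum>k<dA' ^ n * dB' ^ n. \<Sum>l<dA' ^ n * dB' ^ n. X $$ (k,l) *
       (\<Prod>m<n. N (q_ketbra (dA' * dB') (q_bip_idx dA' dB' n m k) (q_bip_idx dA' dB' n m l))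
                 $$ (q_bip_idx dA dB n m i, q_bip_idx dA dB n m j)))"

text \<open>Choi state on R_A A R_B B (in this order), |R_A| = dA', |R_B| = dB'.\<close>
definition q_choi :: "nat \<Rightarrow> nat \<Rightarrow> nat \<Rightarrow> nat \<Rightarrow> (cmat \<Rightarrow> cmat) \<Rightarrow> cmat" where
  "q_choi dA' dB' dA dB N = mat (dA' * dA * dB' * dB) (dA' * dA * dB' * dB) (\<lambda>(i,j).
     let ra = i div (dA * dB' * dB); al = (i div (dB' * dB)) mod dA;
         rb = (i div dB) mod dB'; be = i mod dB;
         ra2 = j div (dA * dB' * dB); al2 = (j div (dB' * dB)) mod dA;
         rb2 = (j div dB) mod dB'; be2 = j mod dB
     in N (q_ketbra (dA' * dB') (ra * dB' + rb) (ra2 * dB' + rb2)) $$ (al * dB + be, al2 * dB + be2)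
        / of_nat (dA' * dB'))"

definition q_unitary_rep :: "('g, 'x) monoid_scheme \<Rightarrow> nat \<Rightarrow> ('g \<Rightarrow> cmat) \<Rightarrow> bool" where
  "q_unitary_rep G d U \<longleftrightarrow> (\<forall>g \<in> carrier G. q_unitary d (U g)) \<and>
     (\<forall>g \<in> carrier G. \<forall>g' \<in> carrier G. U (g \<otimes>\<^bsub>G\<^esub> g') = U g * U g')"

definition q_unitary_rep2 :: "('g, 'x) monoid_scheme \<Rightarrow> ('h, 'y) monoid_scheme \<Rightarrow> nat \<Rightarrow> ('g \<Rightarrow> 'h \<Rightarrow> cmat) \<Rightarrow> bool" where
  "q_unitary_rep2 G H d W \<longleftrightarrow> (\<forall>g \<in> carrier G. \<forall>h \<in> carrier H. q_unitary d (W g h)) \<and>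
     (\<forall>g \<in> carrier G. \<forall>g' \<in> carrier G. \<forall>h \<in> carrier H. \<forall>h' \<in> carrier H.
        W (g \<otimes>\<^bsub>G\<^esub> g') (h \<otimes>\<^bsub>H\<^esub> h') = W g h * W g' h')"

definition q_twirl :: "('g, 'x) monoid_scheme \<Rightarrow> nat \<Rightarrow> ('g \<Rightarrow> cmat) \<Rightarrow> cmat \<Rightarrow> cmat" where
  "q_twirl G d U \<rho> = mat d d (\<lambda>(i,j).
     (\<Sum>g \<in> carrier G. (U g * \<rho> * mat_adjoint (U g)) $$ (i,j)) / of_nat (card (carrier G)))"

definition q_tele_covariant :: "('g, 'x) monoid_scheme \<Rightarrow> ('h, 'y) monoid_scheme \<Rightarrow>
    ('g \<Rightarrow> cmat) \<Rightarrow> ('h \<Rightarrow> cmat) \<Rightarrow> ('g \<Rightarrow> 'h \<Rightarrow> cmat) \<Rightarrow> ('g \<Rightarrow> 'h \<Rightarrow> cmat) \<Rightarrow>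
    nat \<Rightarrow> nat \<Rightarrow> nat \<Rightarrow> nat \<Rightarrow> (cmat \<Rightarrow> cmat) \<Rightarrow> bool" where
  "q_tele_covariant G H U V W Z dA' dB' dA dB N \<longleftrightarrow>
     group G \<and> group H \<and> finite (carrier G) \<and> finite (carrier H) \<and>
     q_unitary_rep G dA' U \<and> q_unitary_rep H dB' V \<and>
     q_unitary_rep2 G H dA W \<and> q_unitary_rep2 G H dB Z \<and>
     (\<forall>\<rho> g h. q_state (dA' * dB') \<rho> \<and> g \<in> carrier G \<and> h \<in> carrier H \<longrightarrow>
        N (q_kron (U g) (V h) * \<rho> * mat_adjoint (q_kron (U g) (V h))) =
        q_kron (W g h) (Z g h) * N \<rho> * mat_adjoint (q_kron (W g h) (Z g h))) \<and>
     (\<forall>\<rho>. q_state dA' \<rho> \<longrightarrow> q_twirl G dA' U \<rho> = (1 / of_nat dA') \<cdot>\<^sub>m 1\<^sub>m dA') \<and>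
     (\<forall>\<rho>. q_state dB' \<rho> \<longrightarrow> q_twirl H dB' V \<rho> = (1 / of_nat dB') \<cdot>\<^sub>m 1\<^sub>m dB')"

end

(* All quantities are governed by the Choi state phi of N and rate = S(R_A A|R_B B)_phi - log |A'|.
   Let Pi and Pi_Y be the typical spectral projections of the tensor powers of phi and of its
   marginal on R_B B.

   Converse: a channel whose Choi matrix is at most c (1 x sigma) passes the test Pi_Y Pi Pi_Y with
   probability at most c 2^(n (rate + O(delta))), whereas every channel close to the n-th power of N
   passes it with probability bounded away from 0. Evaluating the relative entropy on phi itself
   gives S[A|B]_N <= rate.

   Achievability: with K = Pi_Y Pi, the operator K phi^n K* is at most 2^(-n (S(phi) - delta)) Pi_Y, hence
   at most a power of 2 times the tensor power of the marginal. For tele-covariant N the projections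
   commute with the group action, so K phi^n K* is invariant, its input marginal is scalar, and after
   normalization it is the Choi state of a genuine channel close to the n-th power of N for every
   input. This yields the min-entropy bound. The inequality rate <= S[A|B]_N, usually obtained from
   data processing, follows from the same simulating channels: applied to n copies of an arbitrary
   input, they bound the relative entropy by a typicality test as n tends to infinity. *)

theory Submission
  imports Defs "Jordan_Normal_Form.Spectral_Radius" "HOL-Library.FuncSet"
begin

text \<open>The obstacle throughout is noncommutativity: \<open>Pi\<close> and the lifted
  \<open>Pi_Y\<close> need not commute, so the cut-down operator \<open>K w adj K\<close> need not
  lie below \<open>w\<close>. With \<open>L = 1 - K\<close> the substitute is
  \<open>w \<le> (1 + s) K w adj K + (1 + 1/s) L w adj L\<close>, and the second term has trace at
  most \<open>s\<close> once each projection misses mass at most \<open>s^2 / (4 (1 + s))\<close>.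
  Being an inequality between Choi operators, it can be applied to every input; if the error term
  has a scalar input marginal, its trace is the same for all inputs. This is where tele-covariance
  enters. Relative entropies are never compared by monotonicity. Both \<open>tr (w log w)\<close>
  and \<open>tr (w log t)\<close> are exponents of typical projections, so an entropy inequality
  follows by bounding a positive constant by \<open>2 powr (n x)\<close> for all large
  \<open>n\<close> and concluding \<open>0 \<le> x\<close>. Fidelity is used in two ways only: it is
  bounded below through a common upper bound of the two states (achievability), and it transfers the
  acceptance of a test from one state to the other (converse).\<close>

text \<open>Operators are matrices with infinite index set and finite support, so that all dimensions share
  one type, an instance of the ring and order classes with the Loewner order as \<open>\<le>\<close>; \<open>bdd D\<close>
  bounds the support. The conversions from and to matrices are \<open>fo\<close> and \<open>to_mat\<close>.\<close>

typedef fop = "{A :: nat \<Rightarrow> nat \<Rightarrow> complex. \<exists>D. \<forall>i j. D \<le> i \<or> D \<le> j \<longrightarrow> A i j = 0}"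
  morphisms ent Abs_fop by (rule exI[of _ "\<lambda>_ _. 0"]) auto

setup_lifting type_definition_fop

definition bdd :: "nat \<Rightarrow> fop \<Rightarrow> bool" where
  "bdd D A \<longleftrightarrow> (\<forall>i j. D \<le> i \<or> D \<le> j \<longrightarrow> ent A i j = 0)"

lemma ex_bdd: "\<exists>D. bdd D A"
  unfolding bdd_def using ent[of A] by auto

lemma bdd_mono: "bdd D A \<Longrightarrow> D \<le> D' \<Longrightarrow> bdd D' A"
  unfolding bdd_def by auto

lemma ex_bdd2: "\<exists>D. bdd D A \<and> bdd D B"
  using ex_bdd[of A] ex_bdd[of B] bdd_mono by (meson max.cobounded1 max.cobounded2)

lemma ex_bdd3: "\<exists>D. bdd D A \<and> bdd D B \<and> bdd D C"
  using ex_bdd2[of A B] ex_bdd[of C] bdd_mono by (meson max.cobounded1 max.cobounded2)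

lemma fop_eqI: "(\<And>i j. ent A i j = ent B i j) \<Longrightarrow> A = B"
  by (simp add: ent_inject[symmetric] ext)

lift_definition mkop :: "nat \<Rightarrow> (nat \<Rightarrow> nat \<Rightarrow> complex) \<Rightarrow> fop" is
  "\<lambda>D f i j. if i < D \<and> j < D then f i j else 0"
  by (rule_tac x="nat" in exI) auto

lemma ent_mkop: "ent (mkop D f) i j = (if i < D \<and> j < D then f i j else 0)"
  by (simp add: mkop.rep_eq)

lemma bdd_mkop [simp]: "bdd D (mkop D f)"
  by (auto simp: bdd_def ent_mkop)

lemma mkop_cong: "(\<And>i j. i < D \<Longrightarrow> j < D \<Longrightarrow> f i j = g i j) \<Longrightarrow> mkop D f = mkop D g"
  by (rule fop_eqI) (auto simp: ent_mkop)

lemma mkop_ent: "bdd D A \<Longrightarrow> mkop D (ent A) = A"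
  by (rule fop_eqI) (auto simp: ent_mkop bdd_def)

lemma fop_eq_bddI:
  assumes "bdd D A" "bdd D B" "\<And>i j. i < D \<Longrightarrow> j < D \<Longrightarrow> ent A i j = ent B i j"
  shows "A = B"
  by (rule fop_eqI) (metis assms bdd_def not_le)

section \<open>Algebra of finitely supported operators\<close>

instantiation fop :: ring
begin

lift_definition zero_fop :: fop is "\<lambda>_ _. 0" by auto
lift_definition plus_fop :: "fop \<Rightarrow> fop \<Rightarrow> fop" is "\<lambda>A B i j. A i j + B i j"
proof -
  fix A B :: "nat \<Rightarrow> nat \<Rightarrow> complex"
  assume "\<exists>D. \<forall>i j. D \<le> i \<or> D \<le> j \<longrightarrow> A i j = 0" "\<exists>D. \<forall>i j. D \<le> i \<or> D \<le> j \<longrightarrow> B i j = 0"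
  then obtain D1 D2 where "\<forall>i j. D1 \<le> i \<or> D1 \<le> j \<longrightarrow> A i j = 0" "\<forall>i j. D2 \<le> i \<or> D2 \<le> j \<longrightarrow> B i j = 0" by auto
  then show "\<exists>D. \<forall>i j. D \<le> i \<or> D \<le> j \<longrightarrow> A i j + B i j = 0"
    by (intro exI[of _ "max D1 D2"]) auto
qed
lift_definition uminus_fop :: "fop \<Rightarrow> fop" is "\<lambda>A i j. - A i j" by auto
definition minus_fop :: "fop \<Rightarrow> fop \<Rightarrow> fop" where "minus_fop A B = A + (- B)"
text \<open>The index set is finite because \<open>A\<close> has finite support. There is no
  identity element among finitely supported operators, hence the class \<open>ring\<close>;
  \<open>idn D\<close> below is a unit only for operators bounded by \<open>D\<close>.\<close>

lift_definition times_fop :: "fop \<Rightarrow> fop \<Rightarrow> fop" is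
  "\<lambda>A B i k. \<Sum>j | A i j \<noteq> 0. A i j * B j k"
proof -
  fix A B :: "nat \<Rightarrow> nat \<Rightarrow> complex"
  assume "\<exists>D. \<forall>i j. D \<le> i \<or> D \<le> j \<longrightarrow> A i j = 0" "\<exists>D. \<forall>i j. D \<le> i \<or> D \<le> j \<longrightarrow> B i j = 0"
  then obtain D1 D2 where "\<forall>i j. D1 \<le> i \<or> D1 \<le> j \<longrightarrow> A i j = 0" "\<forall>i j. D2 \<le> i \<or> D2 \<le> j \<longrightarrow> B i j = 0" by auto
  then show "\<exists>D. \<forall>i k. D \<le> i \<or> D \<le> k \<longrightarrow> (\<Sum>j | A i j \<noteq> 0. A i j * B j k) = 0"
    by (intro exI[of _ "max D1 D2"]) auto
qed

lemma ent_plus: "ent (A + B) i j = ent A i j + ent B i j" by transfer simp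
lemma ent_uminus: "ent (- A) i j = - ent A i j" by transfer simp
lemma ent_zero: "ent 0 i j = 0" by transfer simp
lemma ent_minus: "ent (A - B) i j = ent A i j - ent B i j"
  by (simp add: minus_fop_def ent_plus ent_uminus)

lemma ent_times_left:
  assumes "bdd D A"
  shows "ent (A * B) i k = (\<Sum>j<D. ent A i j * ent B j k)"
proof -
  have "ent (A * B) i k = (\<Sum>j | ent A i j \<noteq> 0. ent A i j * ent B j k)" by transfer simp
  also have "\<dots> = (\<Sum>j<D. ent A i j * ent B j k)"
    by (rule sum.mono_neutral_left) (use assms not_le in \<open>auto simp: bdd_def\<close>)
  finally show ?thesis .
qed

lemma ent_times_right:
  assumes "bdd D B"
  shows "ent (A * B) i k = (\<Sum>j<D. ent A i j * ent B j k)"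
proof -
  obtain E where E: "bdd E A" using ex_bdd by auto
  have "ent (A * B) i k = (\<Sum>j<max D E. ent A i j * ent B j k)"
    by (rule ent_times_left) (rule bdd_mono[OF E], simp)
  also have "\<dots> = (\<Sum>j<D. ent A i j * ent B j k)"
    by (rule sum.mono_neutral_right) (use assms in \<open>auto simp: bdd_def not_less\<close>)
  finally show ?thesis .
qed

instance
proof
  fix A B C :: fop
  show "A + B + C = A + (B + C)" by (rule fop_eqI) (simp add: ent_plus)
  show "A + B = B + A" by (rule fop_eqI) (simp add: ent_plus)
  show "0 + A = A" by (rule fop_eqI) (simp add: ent_plus ent_zero)
  show "- A + A = 0" by (rule fop_eqI) (simp add: ent_plus ent_zero ent_uminus)
  show "A - B = A + - B" by (simp add: minus_fop_def)
  show "(A + B) * C = A * C + B * C"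
  proof (rule fop_eqI)
    obtain D where D: "bdd D C" using ex_bdd by auto
    show "ent ((A + B) * C) i j = ent (A * C + B * C) i j" for i j
      by (simp add: ent_plus ent_times_right[OF D] sum.distrib algebra_simps)
  qed
  show "A * (B + C) = A * B + A * C"
  proof (rule fop_eqI)
    obtain D where D: "bdd D A" using ex_bdd by auto
    show "ent (A * (B + C)) i j = ent (A * B + A * C) i j" for i j
      by (simp add: ent_plus ent_times_left[OF D] sum.distrib algebra_simps)
  qed
  show "A * B * C = A * (B * C)"
  proof (rule fop_eqI)
    fix i l
    obtain D where D: "bdd D A" using ex_bdd by auto
    obtain E where E: "bdd E C" using ex_bdd by auto
    have "ent (A * B * C) i l = (\<Sum>k<E. \<Sum>j<D. ent A i j * ent B j k * ent C k l)"
      by (simp add: ent_times_right[OF E] ent_times_left[OF D] sum_distrib_right)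
    also have "\<dots> = (\<Sum>j<D. \<Sum>k<E. ent A i j * ent B j k * ent C k l)" by (rule sum.swap)
    also have "\<dots> = ent (A * (B * C)) i l"
      by (simp add: ent_times_right[OF E] ent_times_left[OF D] sum_distrib_left mult.assoc)
    finally show "ent (A * B * C) i l = ent (A * (B * C)) i l" .
  qed
qed

end

instantiation fop :: real_algebra
begin

lift_definition scaleR_fop :: "real \<Rightarrow> fop \<Rightarrow> fop" is "\<lambda>r A i j. r *\<^sub>R A i j" by auto

lemma ent_scaleR: "ent (r *\<^sub>R A) i j = r *\<^sub>R ent A i j" by transfer simp

instance
proof
  fix A B :: fop and a b :: real
  show "a *\<^sub>R (A + B) = a *\<^sub>R A + a *\<^sub>R B" by (rule fop_eqI) (simp add: ent_plus ent_scaleR algebra_simps)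
  show "(a + b) *\<^sub>R A = a *\<^sub>R A + b *\<^sub>R A" by (rule fop_eqI) (simp add: ent_plus ent_scaleR algebra_simps)
  show "a *\<^sub>R b *\<^sub>R A = (a * b) *\<^sub>R A" by (rule fop_eqI) (simp add: ent_scaleR algebra_simps)
  show "1 *\<^sub>R A = A" by (rule fop_eqI) (simp add: ent_scaleR)
  obtain D where D: "bdd D B" using ex_bdd by auto
  show "a *\<^sub>R A * B = a *\<^sub>R (A * B)"
    by (rule fop_eqI) (simp add: ent_scaleR ent_times_right[OF D] scaleR_sum_right)
  show "A * a *\<^sub>R B = a *\<^sub>R (A * B)"
  proof (rule fop_eqI)
    fix i j
    have "ent (A * a *\<^sub>R B) i j = (\<Sum>k<D. ent A i k * ent (a *\<^sub>R B) k j)"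
      by (rule ent_times_right) (use D in \<open>auto simp: bdd_def ent_scaleR\<close>)
    then show "ent (A * a *\<^sub>R B) i j = ent (a *\<^sub>R (A * B)) i j"
      by (simp add: ent_scaleR ent_times_right[OF D] scaleR_sum_right)
  qed
qed

end

lemmas ent_simps = ent_plus ent_minus ent_uminus ent_zero ent_scaleR

lemma bdd_simps [simp]:
  "bdd D 0" "bdd D A \<Longrightarrow> bdd D B \<Longrightarrow> bdd D (A + B)" "bdd D A \<Longrightarrow> bdd D B \<Longrightarrow> bdd D (A - B)"
  "bdd D A \<Longrightarrow> bdd D (- A)" "bdd D A \<Longrightarrow> bdd D (r *\<^sub>R A)"
  by (auto simp: bdd_def ent_simps)

lemma bdd_times [simp]: "bdd D A \<Longrightarrow> bdd D B \<Longrightarrow> bdd D (A * B)"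
  unfolding bdd_def[of D "A * B"] by (simp add: ent_times_left) (simp add: bdd_def)

section \<open>Adjoint, trace and quadratic form\<close>

lift_definition adj :: "fop \<Rightarrow> fop" is "\<lambda>A i j. cnj (A j i)" by auto

lemma ent_adj: "ent (adj A) i j = cnj (ent A j i)" by transfer simp

lemma bdd_adj [simp]: "bdd D (adj A) \<longleftrightarrow> bdd D A" by (auto simp: bdd_def ent_adj)

lemma adj_simps [simp]:
  "adj 0 = 0" "adj (A + B) = adj A + adj B" "adj (A - B) = adj A - adj B" "adj (- A) = - adj A"
  "adj (r *\<^sub>R A) = r *\<^sub>R adj A" "adj (adj A) = A"
  by (auto intro!: fop_eqI simp: ent_simps ent_adj)

lemma adj_times [simp]: "adj (A * B) = adj B * adj A"
proof (rule fop_eqI)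
  fix i j
  obtain D where D: "bdd D A" using ex_bdd by auto
  then have D': "bdd D (adj A)" by simp
  show "ent (adj (A * B)) i j = ent (adj B * adj A) i j"
    by (simp add: ent_adj ent_times_left[OF D] ent_times_right[OF D'] mult.commute)
qed

definition ctr :: "fop \<Rightarrow> complex" where "ctr A = (\<Sum>i | ent A i i \<noteq> 0. ent A i i)"
definition tr :: "fop \<Rightarrow> real" where "tr A = Re (ctr A)"

lemma ctr_bdd: "bdd D A \<Longrightarrow> ctr A = (\<Sum>i<D. ent A i i)"
  unfolding ctr_def by (rule sum.mono_neutral_left) (use not_le in \<open>auto simp: bdd_def\<close>)

lemma ctr_simps: "ctr 0 = 0" "ctr (A + B) = ctr A + ctr B" "ctr (A - B) = ctr A - ctr B"
  "ctr (r *\<^sub>R A) = r *\<^sub>R ctr A" "ctr (- A) = - ctr A" "ctr (adj A) = cnj (ctr A)"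
proof -
  obtain D where D: "bdd D A" "bdd D B" using ex_bdd2 by blast
  then show "ctr 0 = 0" "ctr (A + B) = ctr A + ctr B" "ctr (A - B) = ctr A - ctr B"
   "ctr (r *\<^sub>R A) = r *\<^sub>R ctr A" "ctr (- A) = - ctr A" "ctr (adj A) = cnj (ctr A)"
    by (simp_all add: ctr_bdd[of D] ent_simps ent_adj sum.distrib sum_subtractf scaleR_sum_right sum_negf)
qed

lemma tr_simps [simp]: "tr 0 = 0" "tr (A + B) = tr A + tr B" "tr (A - B) = tr A - tr B"
  "tr (r *\<^sub>R A) = r * tr A" "tr (- A) = - tr A" "tr (adj A) = tr A"
  by (simp_all add: tr_def ctr_simps)

lemma ctr_mult_commute: "ctr (A * B) = ctr (B * A)"
proof -
  obtain D where D: "bdd D A" "bdd D B" using ex_bdd2 by blast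
  have "ctr (A * B) = (\<Sum>i<D. \<Sum>j<D. ent A i j * ent B j i)"
    by (simp add: ctr_bdd[of D] D ent_times_left[of D])
  also have "\<dots> = (\<Sum>j<D. \<Sum>i<D. ent A i j * ent B j i)" by (rule sum.swap)
  also have "\<dots> = ctr (B * A)"
    by (simp add: ctr_bdd[of D] D ent_times_left[of D] mult.commute)
  finally show ?thesis .
qed

lemma tr_mult_commute: "tr (A * B) = tr (B * A)" by (simp add: tr_def ctr_mult_commute)

text \<open>The argument is an arbitrary sequence, so that forms of operators of different sizes can
  be compared at the same vector. The least bound only serves to make the value well defined; by
  \<open>qf_bdd\<close> any bound gives the same sum.\<close>

definition qf :: "fop \<Rightarrow> (nat \<Rightarrow> complex) \<Rightarrow> complex" where
  "qf A v = (let D = (LEAST D. bdd D A) in \<Sum>i<D. \<Sum>j<D. cnj (v i) * ent A i j * v j)"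

lemma qf_bdd:
  assumes "bdd D A"
  shows "qf A v = (\<Sum>i<D. \<Sum>j<D. cnj (v i) * ent A i j * v j)"
proof -
  define L where "L = (LEAST D. bdd D A)"
  have L: "bdd L A" "L \<le> D"
    using LeastI[of "\<lambda>D. bdd D A", OF assms] Least_le[of "\<lambda>D. bdd D A", OF assms] by (simp_all add: L_def)
  have z: "ent A i j = 0" if "L \<le> i \<or> L \<le> j" for i j using L(1) that unfolding bdd_def by blast
  have "(\<Sum>i<D. \<Sum>j<D. cnj (v i) * ent A i j * v j) = (\<Sum>i<L. \<Sum>j<D. cnj (v i) * ent A i j * v j)"
    by (rule sum.mono_neutral_right) (use L(2) z in auto)
  also have "\<dots> = (\<Sum>i<L. \<Sum>j<L. cnj (v i) * ent A i j * v j)"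
    by (intro sum.cong refl sum.mono_neutral_right) (use L(2) z in auto)
  finally show ?thesis by (simp add: qf_def Let_def L_def)
qed

lemma qf_simps: "qf 0 v = 0" "qf (A + B) v = qf A v + qf B v" "qf (A - B) v = qf A v - qf B v"
  "qf (- A) v = - qf A v" "qf (r *\<^sub>R A) v = r *\<^sub>R qf A v" "qf (adj A) v = cnj (qf A v)"
proof -
  obtain D where D: "bdd D A" "bdd D B" using ex_bdd2 by blast
  then have D': "bdd D (A + B)" "bdd D (A - B)" "bdd D (- A)" "bdd D (r *\<^sub>R A)" "bdd D (adj A)" "bdd D 0"
    by simp_all
  note q = D[THEN qf_bdd] D'[THEN qf_bdd]
  show "qf 0 v = 0" unfolding q ent_simps by simp
  show "qf (A + B) v = qf A v + qf B v"
    unfolding q ent_simps by (simp only: distrib_left distrib_right sum.distrib)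
  show "qf (A - B) v = qf A v - qf B v"
    unfolding q ent_simps by (simp only: left_diff_distrib right_diff_distrib sum_subtractf)
  show "qf (- A) v = - qf A v" unfolding q ent_simps by (simp add: sum_negf)
  show "qf (r *\<^sub>R A) v = r *\<^sub>R qf A v"
    unfolding q ent_simps scaleR_sum_right by (simp only: mult_scaleR_left mult_scaleR_right)
  have "qf (adj A) v = (\<Sum>j<D. \<Sum>i<D. cnj (v i) * cnj (ent A j i) * v j)"
    unfolding q ent_adj by (rule sum.swap)
  also have "\<dots> = cnj (qf A v)"
    unfolding q cnj_sum complex_cnj_mult complex_cnj_cnj by (intro sum.cong refl) simp
  finally show "qf (adj A) v = cnj (qf A v)" .
qed

text \<open>Complex polarization: on vectors supported on \<open>{i,j}\<close> the values (1,1) and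
  (1,\<i>) isolate \<open>f i j + f j i\<close> and \<open>f i j - f j i\<close>, once (1,0) and
  (0,1) have removed the diagonal terms.\<close>

lemma sesq_zero:
  fixes f :: "nat \<Rightarrow> nat \<Rightarrow> complex"
  assumes z: "\<And>v. (\<Sum>i<D. \<Sum>j<D. cnj (v i) * f i j * v j) = 0" and ij: "i < D" "j < D"
  shows "f i j = 0"
proof -
  have form: "cnj a * f i i * a + cnj a * f i j * b + cnj b * f j i * a + cnj b * f j j * b = 0"
    if ne: "i \<noteq> j" for a b
  proof -
    define v where "v = (\<lambda>k. if k = i then a else if k = j then b else 0)"
    have inner: "(\<Sum>l<D. cnj (v k) * f k l * v l) = cnj (v k) * f k i * a + cnj (v k) * f k j * b" for k
    proof -
      have "(\<Sum>l<D. cnj (v k) * f k l * v l) = (\<Sum>l\<in>{i,j}. cnj (v k) * f k l * v l)"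
        by (rule sum.mono_neutral_right) (use ij in \<open>auto simp: v_def\<close>)
      then show ?thesis using ne by (simp add: v_def)
    qed
    have "(\<Sum>k<D. \<Sum>l<D. cnj (v k) * f k l * v l) = (\<Sum>k\<in>{i,j}. cnj (v k) * f k i * a + cnj (v k) * f k j * b)"
      unfolding inner by (rule sum.mono_neutral_right) (use ij in \<open>auto simp: v_def\<close>)
    also have "\<dots> = cnj a * f i i * a + cnj a * f i j * b + (cnj b * f j i * a + cnj b * f j j * b)"
      using ne by (simp add: v_def)
    finally show ?thesis using z[of v] by (simp add: add.assoc)
  qed
  show ?thesis
  proof (cases "i = j")
    case True
    have inner: "(\<Sum>l<D. cnj (if k = i then 1 else 0) * f k l * (if l = i then 1 else 0)) = (if k = i then f i i else 0)" for k
    proof -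
      have "(\<Sum>l<D. cnj (if k = i then 1 else 0) * f k l * (if l = i then 1 else 0))
        = (\<Sum>l<D. if l = i then (if k = i then f i i else 0) else 0)"
        by (rule sum.cong) auto
      then show ?thesis using ij by (simp add: sum.delta)
    qed
    have "(\<Sum>k<D. \<Sum>l<D. cnj (if k = i then 1 else 0) * f k l * (if l = i then 1 else 0)) = f i i"
      unfolding inner using ij by (simp add: sum.delta)
    with z[of "\<lambda>k. if k = i then 1 else 0"] True show ?thesis by simp
  next
    case False
    from form[OF False, of 1 0] form[OF False, of 0 1] have d: "f i i = 0" "f j j = 0" by simp_all
    from form[OF False, of 1 1] form[OF False, of 1 \<i>] d have "f i j + f j i = 0" "f i j * \<i> - \<i> * f j i = 0"
      by simp_all
    then have "f i j = f j i" by (simp add: mult.commute)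
    with \<open>f i j + f j i = 0\<close> show ?thesis by simp
  qed
qed

lemma qf_zero: assumes "\<And>v. qf A v = 0" shows "A = 0"
proof -
  obtain D where D: "bdd D A" using ex_bdd by auto
  have "ent A i j = 0" if "i < D" "j < D" for i j
    by (rule sesq_zero[OF _ that]) (use assms D in \<open>simp add: qf_bdd\<close>)
  then show ?thesis by (intro fop_eq_bddI[OF D]) (auto simp: ent_simps)
qed

section \<open>The Loewner order\<close>

instantiation fop :: ordered_real_vector
begin

text \<open>The order of the complex numbers makes \<open>0 \<le> qf (B - A) v\<close> say that the
  value is real as well. Self-adjointness is therefore contained in \<open>0 \<le> A\<close>, and
  \<open>psd_adj\<close> extracts it.\<close>

definition less_eq_fop :: "fop \<Rightarrow> fop \<Rightarrow> bool" where "A \<le> B \<longleftrightarrow> (\<forall>v. 0 \<le> qf (B - A) v)"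
definition less_fop :: "fop \<Rightarrow> fop \<Rightarrow> bool" where "A < B \<longleftrightarrow> A \<le> B \<and> \<not> B \<le> (A::fop)"

lemma fop_le_iff: "A \<le> B \<longleftrightarrow> (\<forall>v. qf A v \<le> qf B v)"
  by (simp add: less_eq_fop_def qf_simps)

instance
proof
  fix A B C :: fop and a b :: real
  show "(A < B) = (A \<le> B \<and> \<not> B \<le> A)" by (simp add: less_fop_def)
  show "A \<le> A" by (simp add: fop_le_iff)
  show "A \<le> B \<Longrightarrow> B \<le> C \<Longrightarrow> A \<le> C" unfolding fop_le_iff by (meson order_trans)
  show "A \<le> B \<Longrightarrow> B \<le> A \<Longrightarrow> A = B"
    using qf_zero[of "A - B"] by (simp add: fop_le_iff qf_simps order_antisym)
  show "A \<le> B \<Longrightarrow> C + A \<le> C + B" by (simp add: fop_le_iff qf_simps)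
  show "A \<le> B \<Longrightarrow> 0 \<le> a \<Longrightarrow> a *\<^sub>R A \<le> a *\<^sub>R B"
    by (simp add: fop_le_iff qf_simps less_eq_complex_def mult_left_mono)
  show "a \<le> b \<Longrightarrow> 0 \<le> A \<Longrightarrow> a *\<^sub>R A \<le> b *\<^sub>R A"
    by (simp add: fop_le_iff qf_simps less_eq_complex_def mult_right_mono)
qed

end

lemma psd_iff: "0 \<le> A \<longleftrightarrow> (\<forall>v. 0 \<le> qf A v)" by (simp add: fop_le_iff qf_simps)

lemma psd_adj: "0 \<le> A \<Longrightarrow> adj A = A"
  using qf_zero[of "adj A - A"] by (simp add: psd_iff qf_simps complex_eq_iff less_eq_complex_def)

lemma qf_conj:
  assumes "bdd D A" "bdd D X"
  shows "qf (adj X * A * X) v = qf A (\<lambda>i. \<Sum>k<D. ent X i k * v k)"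
proof -
  have X: "bdd D (adj X)" using assms by simp
  define F where "F = (\<lambda>i j k l. cnj (v i) * cnj (ent X k i) * ent A k l * ent X l j * v j)"
  have e: "ent (adj X * A * X) i j = (\<Sum>l<D. \<Sum>k<D. cnj (ent X k i) * ent A k l * ent X l j)" for i j
    using assms X by (simp add: ent_times_right[of D] ent_adj sum_distrib_right)
  have "qf (adj X * A * X) v = (\<Sum>i<D. \<Sum>j<D. \<Sum>l<D. \<Sum>k<D. F i j k l)"
    unfolding qf_bdd[of D "adj X * A * X", OF bdd_times[OF bdd_times[OF X assms(1)] assms(2)]] e F_def
    by (simp add: sum_distrib_left sum_distrib_right mult.assoc)
  also have "\<dots> = (\<Sum>i<D. \<Sum>j<D. \<Sum>k<D. \<Sum>l<D. F i j k l)"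
    by (rule sum.cong[OF refl], rule sum.cong[OF refl], rule sum.swap)
  also have "\<dots> = (\<Sum>i<D. \<Sum>k<D. \<Sum>j<D. \<Sum>l<D. F i j k l)"
    by (rule sum.cong[OF refl], rule sum.swap)
  also have "\<dots> = (\<Sum>k<D. \<Sum>i<D. \<Sum>j<D. \<Sum>l<D. F i j k l)"
    by (rule sum.swap)
  also have "\<dots> = (\<Sum>k<D. \<Sum>i<D. \<Sum>l<D. \<Sum>j<D. F i j k l)"
    by (rule sum.cong[OF refl], rule sum.cong[OF refl], rule sum.swap)
  also have "\<dots> = (\<Sum>k<D. \<Sum>l<D. \<Sum>i<D. \<Sum>j<D. F i j k l)"
    by (rule sum.cong[OF refl], rule sum.swap)
  also have "\<dots> = (\<Sum>k<D. \<Sum>l<D. (\<Sum>i<D. cnj (v i) * cnj (ent X k i) * ent A k l) * (\<Sum>j<D. ent X l j * v j))"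
    unfolding F_def sum_product by (simp add: mult.assoc)
  also have "\<dots> = qf A (\<lambda>i. \<Sum>k<D. ent X i k * v k)"
    unfolding qf_bdd[OF assms(1)] cnj_sum complex_cnj_mult sum_distrib_right[symmetric]
    by (simp only: mult.commute)
  finally show ?thesis .
qed

lemma conj_mono: "A \<le> B \<Longrightarrow> adj X * A * X \<le> adj X * B * X"
proof -
  assume le: "A \<le> B"
  obtain D where D: "bdd D A" "bdd D B" "bdd D X" using ex_bdd3 by blast
  from le show ?thesis unfolding fop_le_iff by (simp add: qf_conj[of D] D)
qed

lemma conj_mono': "A \<le> B \<Longrightarrow> X * A * adj X \<le> X * B * adj X"
  using conj_mono[of A B "adj X"] by simp

lemma conj_psd: "0 \<le> A \<Longrightarrow> 0 \<le> adj X * A * X" using conj_mono[of 0 A X] by simp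
lemma conj_psd': "0 \<le> A \<Longrightarrow> 0 \<le> X * A * adj X" using conj_mono'[of 0 A X] by simp

section \<open>Diagonal operators and traces of positive operators\<close>

definition dg :: "nat \<Rightarrow> (nat \<Rightarrow> real) \<Rightarrow> fop" where
  "dg D f = mkop D (\<lambda>i j. if i = j then complex_of_real (f i) else 0)"
abbreviation idn :: "nat \<Rightarrow> fop" where "idn D \<equiv> dg D (\<lambda>_. 1)"

lemma bdd_dg [simp]: "bdd D (dg D f)" by (simp add: dg_def)
lemma ent_dg: "ent (dg D f) i j = (if i = j \<and> i < D then complex_of_real (f i) else 0)"
  by (simp add: dg_def ent_mkop)
lemma adj_dg [simp]: "adj (dg D f) = dg D f" by (rule fop_eqI) (simp add: ent_adj ent_dg)

lemma ent_dg_times: "ent (dg D f * A) i j = (if i < D then complex_of_real (f i) * ent A i j else 0)"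
proof -
  have "ent (dg D f * A) i j = (\<Sum>k<D. if k = i then complex_of_real (f i) * ent A i j else 0)"
    unfolding ent_times_left[OF bdd_dg] by (intro sum.cong) (auto simp: ent_dg)
  then show ?thesis by (simp add: sum.delta)
qed

lemma ent_times_dg: "ent (A * dg D f) i j = (if j < D then ent A i j * complex_of_real (f j) else 0)"
proof -
  have "ent (A * dg D f) i j = (\<Sum>k<D. if k = j then ent A i j * complex_of_real (f j) else 0)"
    unfolding ent_times_right[OF bdd_dg] by (intro sum.cong) (auto simp: ent_dg)
  then show ?thesis by (simp add: sum.delta)
qed

lemma idn_times [simp]: "bdd D A \<Longrightarrow> idn D * A = A" "bdd D A \<Longrightarrow> A * idn D = A"
  by (auto intro!: fop_eqI simp: ent_dg_times ent_times_dg bdd_def)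

lemma dg_times: "dg D f * dg D g = dg D (\<lambda>i. f i * g i)"
  by (rule fop_eqI) (simp add: ent_dg_times ent_dg)
lemma dg_plus: "dg D f + dg D g = dg D (\<lambda>i. f i + g i)"
  by (rule fop_eqI) (simp add: ent_simps ent_dg)
lemma dg_minus: "dg D f - dg D g = dg D (\<lambda>i. f i - g i)"
  by (rule fop_eqI) (simp add: ent_simps ent_dg)
lemma dg_scaleR: "r *\<^sub>R dg D f = dg D (\<lambda>i. r * f i)"
  by (rule fop_eqI) (simp add: ent_simps ent_dg scaleR_conv_of_real)
lemma dg_cong: "(\<And>i. i < D \<Longrightarrow> f i = g i) \<Longrightarrow> dg D f = dg D g"
  by (rule fop_eqI) (simp add: ent_dg)
lemma tr_dg: "tr (dg D f) = (\<Sum>i<D. f i)"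
  by (simp add: tr_def ctr_bdd[of D] ent_dg)

lemma qf_dg: "qf (dg D f) v = (\<Sum>i<D. complex_of_real (f i * (cmod (v i))\<^sup>2))"
proof -
  have c: "cnj z * complex_of_real r * z = complex_of_real (r * (cmod z)\<^sup>2)" for z r
    unfolding of_real_mult complex_norm_square by (simp only: mult_ac)
  have "qf (dg D f) v = (\<Sum>i<D. \<Sum>j<D. if j = i then cnj (v i) * complex_of_real (f i) * v i else 0)"
    unfolding qf_bdd[OF bdd_dg] ent_dg by (intro sum.cong refl) auto
  also have "\<dots> = (\<Sum>i<D. cnj (v i) * complex_of_real (f i) * v i)" by (simp add: sum.delta)
  finally show ?thesis unfolding c .
qed

lemma dg_mono: "(\<And>i. i < D \<Longrightarrow> f i \<le> g i) \<Longrightarrow> dg D f \<le> dg D g"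
  unfolding fop_le_iff qf_dg of_real_sum[symmetric] by (auto simp: less_eq_complex_def intro!: sum_mono mult_right_mono)

lemma dg_psd: "(\<And>i. i < D \<Longrightarrow> 0 \<le> f i) \<Longrightarrow> 0 \<le> dg D f"
  unfolding psd_iff qf_dg of_real_sum[symmetric] by (auto simp: less_eq_complex_def intro!: sum_nonneg)

lemma psd_sq: "0 \<le> adj X * X"
proof -
  obtain D where "bdd D X" using ex_bdd by auto
  then have "adj X * X = adj X * idn D * X" by (simp add: mult.assoc)
  then show ?thesis using conj_psd[OF dg_psd, of D "\<lambda>_. 1" X] by simp
qed

lemma psd_ent_diag: assumes "0 \<le> A" shows "0 \<le> ent A i i"
proof -
  obtain E where E: "bdd E A" using ex_bdd by auto
  define D where "D = max E (Suc i)"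
  have D: "bdd D A" by (rule bdd_mono[OF E]) (simp add: D_def)
  have i: "i < D" by (simp add: D_def)
  let ?d = "\<lambda>k. if k = i then 1 else 0 :: complex"
  have inner: "(\<Sum>l<D. cnj (?d k) * ent A k l * ?d l) = (if k = i then ent A i i else 0)" for k
  proof -
    have "(\<Sum>l<D. cnj (?d k) * ent A k l * ?d l) = (\<Sum>l<D. if l = i then cnj (?d k) * ent A k i else 0)"
      by (intro sum.cong) auto
    then show ?thesis using i by (simp add: sum.delta)
  qed
  have "qf A ?d = ent A i i"
    unfolding qf_bdd[OF D] inner using i by (simp add: sum.delta)
  then show ?thesis using assms unfolding psd_iff by metis
qed

lemma tr_psd: assumes "0 \<le> A" shows "0 \<le> tr A"
proof -
  obtain D where D: "bdd D A" using ex_bdd by auto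
  show ?thesis unfolding tr_def ctr_bdd[OF D] Re_sum
    by (intro sum_nonneg) (use psd_ent_diag[OF assms] in \<open>auto simp: less_eq_complex_def\<close>)
qed

lemma tr_mono: "A \<le> B \<Longrightarrow> tr A \<le> tr B" using tr_psd[of "B - A"] by simp

lemma psd_ctr: assumes "0 \<le> A" shows "ctr A = complex_of_real (tr A)"
proof -
  have "cnj (ctr A) = ctr A" using psd_adj[OF assms] ctr_simps(6)[of A] by simp
  then show ?thesis by (simp add: complex_eq_iff tr_def)
qed

definition unitary_on :: "nat \<Rightarrow> fop \<Rightarrow> bool" where
  "unitary_on D U \<longleftrightarrow> bdd D U \<and> U * adj U = idn D \<and> adj U * U = idn D"

section \<open>Translation between matrices and operators\<close>

definition fo :: "cmat \<Rightarrow> fop" where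
  "fo A = mkop (max (dim_row A) (dim_col A)) (\<lambda>i j. if i < dim_row A \<and> j < dim_col A then A $$ (i,j) else 0)"

lemma ent_fo: "ent (fo A) i j = (if i < dim_row A \<and> j < dim_col A then A $$ (i,j) else 0)"
  by (auto simp: fo_def ent_mkop)

lemma ent_fo_carrier: "A \<in> carrier_mat D D \<Longrightarrow> ent (fo A) i j = (if i < D \<and> j < D then A $$ (i,j) else 0)"
  by (auto simp: ent_fo)

lemma bdd_fo: "A \<in> carrier_mat D D \<Longrightarrow> bdd D (fo A)"
  by (auto simp: bdd_def ent_fo)

lemma fo_mat: "fo (mat D D (\<lambda>(i,j). f i j)) = mkop D f"
  by (rule fop_eqI) (auto simp: ent_fo ent_mkop)

lemma fo_inj: "A \<in> carrier_mat D D \<Longrightarrow> B \<in> carrier_mat D D \<Longrightarrow> fo A = fo B \<Longrightarrow> A = B"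
  by (rule eq_matI) (metis carrier_matD ent_fo_carrier, auto)

lemma mat_adjoint_carrier: "A \<in> carrier_mat m n \<Longrightarrow> mat_adjoint A \<in> carrier_mat n m"
  by (auto simp: mat_adjoint_def mat_of_rows_def)

lemma mat_adjoint_index:
  "i < dim_col A \<Longrightarrow> j < dim_row A \<Longrightarrow> mat_adjoint A $$ (i,j) = cnj (A $$ (j,i))"
  by (auto simp: mat_adjoint_def mat_of_rows_def)

lemma fo_adj: "A \<in> carrier_mat D D \<Longrightarrow> fo (mat_adjoint A) = adj (fo A)"
  by (rule fop_eqI) (auto simp: ent_fo_carrier[OF mat_adjoint_carrier] ent_adj ent_fo_carrier mat_adjoint_index)

lemma fo_times:
  assumes "A \<in> carrier_mat D D" "B \<in> carrier_mat D D"
  shows "fo (A * B) = fo A * fo B"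
proof (rule fop_eq_bddI[of D])
  fix i j assume ij: "i < D" "j < D"
  have "(A * B) $$ (i,j) = (\<Sum>k = 0..<D. A $$ (i,k) * B $$ (k,j))"
    using assms ij by (auto simp: scalar_prod_def)
  then show "ent (fo (A * B)) i j = ent (fo A * fo B) i j"
    using assms ij by (simp add: ent_times_left[OF bdd_fo[OF assms(1)]] ent_fo atLeast0LessThan)
qed (use assms in \<open>auto intro!: bdd_fo bdd_times\<close>)

lemma fo_minus: "A \<in> carrier_mat D D \<Longrightarrow> B \<in> carrier_mat D D \<Longrightarrow> fo (A - B) = fo A - fo B"
  by (rule fop_eqI) (auto simp: ent_fo ent_simps)

lemma fo_smult: "fo (complex_of_real c \<cdot>\<^sub>m A) = c *\<^sub>R fo A"
  by (rule fop_eqI) (auto simp: ent_fo ent_simps scaleR_conv_of_real)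

lemma fo_one: "fo (1\<^sub>m D) = idn D"
  by (rule fop_eqI) (auto simp: ent_fo ent_dg)

lemma fo_diag: "fo (mat_diag D (\<lambda>i. complex_of_real (f i))) = dg D f"
  by (rule fop_eqI) (auto simp: ent_fo ent_dg mat_diag_def)

lemma q_tr_fo: "A \<in> carrier_mat D D \<Longrightarrow> q_tr A = ctr (fo A)"
  by (auto simp: q_tr_def ctr_bdd[OF bdd_fo] ent_fo)

text \<open>The product \<open>\<bullet>c\<close> conjugates its second argument, whereas
  \<open>qf\<close> conjugates the left vector; hence the \<open>cnj\<close>.\<close>

lemma qf_fo:
  assumes A: "A \<in> carrier_mat D D"
  shows "v \<in> carrier_vec D \<Longrightarrow> v \<bullet>c (A *\<^sub>v v) = cnj (qf (fo A) (\<lambda>i. v $ i))"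
proof -
  assume v: "v \<in> carrier_vec D"
  have e: "i < D \<Longrightarrow> (A *\<^sub>v v) $ i = (\<Sum>j<D. A $$ (i,j) * v $ j)" for i
    using A v by (auto simp: scalar_prod_def atLeast0LessThan)
  have "v \<bullet>c (A *\<^sub>v v) = (\<Sum>i<D. v $ i * cnj ((A *\<^sub>v v) $ i))"
    using A v by (auto simp: scalar_prod_def atLeast0LessThan intro!: sum.cong)
  also have "\<dots> = (\<Sum>i<D. \<Sum>j<D. v $ i * cnj (A $$ (i,j) * v $ j))"
    by (intro sum.cong refl) (auto simp: e sum_distrib_left)
  also have "\<dots> = cnj (qf (fo A) (\<lambda>i. v $ i))"
    unfolding qf_bdd[OF bdd_fo[OF A]] cnj_sum
    by (intro sum.cong refl) (use A in \<open>auto simp: ent_fo\<close>)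
  finally show ?thesis .
qed

lemma qf_cong: "bdd D A \<Longrightarrow> (\<And>i. i < D \<Longrightarrow> v i = w i) \<Longrightarrow> qf A v = qf A w"
  by (auto simp: qf_bdd intro!: sum.cong)

text \<open>Two readings of positivity meet here: \<open>q_psd\<close> asks for Hermiticity and a
  nonnegative real part, the order on operators for a nonnegative complex value. Hermiticity makes
  the form real, and \<open>psd_adj\<close> gives it back.\<close>

lemma q_psd_fo: "q_psd D A \<longleftrightarrow> A \<in> carrier_mat D D \<and> 0 \<le> fo A"
proof -
  have "q_psd D A \<longleftrightarrow> 0 \<le> fo A" if A: "A \<in> carrier_mat D D"
  proof
    assume p: "q_psd D A"
    then have "mat_adjoint A = A" by (simp add: q_psd_def q_hermitian_def)
    then have h: "adj (fo A) = fo A" using fo_adj[OF A] by simp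
    show "0 \<le> fo A" unfolding psd_iff
    proof
      fix v
      have "0 \<le> Re (vec D v \<bullet>c (A *\<^sub>v vec D v))" using p by (simp add: q_psd_def)
      moreover have "qf (fo A) (\<lambda>i. vec D v $ i) = qf (fo A) v"
        by (rule qf_cong[OF bdd_fo[OF A]]) simp
      ultimately have "0 \<le> Re (qf (fo A) v)" by (simp add: qf_fo[OF A])
      moreover have "cnj (qf (fo A) v) = qf (fo A) v" using qf_simps(6)[of "fo A" v] h by simp
      ultimately show "0 \<le> qf (fo A) v" by (simp add: less_eq_complex_def complex_eq_iff)
    qed
  next
    assume p: "0 \<le> fo A"
    have "mat_adjoint A = A"
      by (rule fo_inj[OF mat_adjoint_carrier[OF A] A]) (simp add: fo_adj[OF A] psd_adj[OF p])
    then show "q_psd D A" unfolding q_psd_def q_hermitian_def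
      using A p by (auto simp: qf_fo psd_iff less_eq_complex_def)
  qed
  then show ?thesis by (auto simp: q_psd_def)
qed

lemma q_state_fo: "q_state D A \<longleftrightarrow> A \<in> carrier_mat D D \<and> 0 \<le> fo A \<and> tr (fo A) = 1"
  unfolding q_state_def q_psd_fo by (auto simp: q_tr_fo psd_ctr)

lemma q_unitary_fo: "q_unitary D U \<longleftrightarrow> U \<in> carrier_mat D D \<and> unitary_on D (fo U)"
proof -
  have "q_unitary D U \<longleftrightarrow> unitary_on D (fo U)" if U: "U \<in> carrier_mat D D"
  proof -
    note U' = mat_adjoint_carrier[OF U]
    have "mat_adjoint U * U = 1\<^sub>m D \<longleftrightarrow> adj (fo U) * fo U = idn D"
      using fo_inj[of "mat_adjoint U * U" D "1\<^sub>m D"] U U' by (auto simp: fo_times fo_adj fo_one) (metis fo_adj fo_one fo_times)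
    moreover have "U * mat_adjoint U = 1\<^sub>m D \<longleftrightarrow> fo U * adj (fo U) = idn D"
      using fo_inj[of "U * mat_adjoint U" D "1\<^sub>m D"] U U' by (auto simp: fo_times fo_adj fo_one) (metis fo_adj fo_one fo_times)
    ultimately show ?thesis using U by (auto simp: q_unitary_def unitary_on_def bdd_fo)
  qed
  then show ?thesis by (auto simp: q_unitary_def)
qed

definition to_mat :: "nat \<Rightarrow> fop \<Rightarrow> cmat" where "to_mat D A = mat D D (\<lambda>(i,j). ent A i j)"

lemma to_mat_carrier [simp]: "to_mat D A \<in> carrier_mat D D" by (simp add: to_mat_def)
lemma fo_tm: "bdd D A \<Longrightarrow> fo (to_mat D A) = A" unfolding to_mat_def fo_mat by (rule mkop_ent)

section \<open>Spectral theorem\<close>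

lemma eigenvector_exists:
  assumes "0 < D" "bdd D A"
  obtains k v where "\<exists>i<D. v i \<noteq> (0::complex)" "\<And>i. i < D \<Longrightarrow> (\<Sum>j<D. ent A i j * v j) = k * v i"
proof -
  from spectrum_non_empty[OF to_mat_carrier[of D A]] assms(1)
  obtain k where "k \<in> spectrum (to_mat D A)" by auto
  then have "eigenvalue (to_mat D A) k" by (simp add: spectrum_def)
  then obtain w where w: "w \<in> carrier_vec D" "w \<noteq> 0\<^sub>v D" "to_mat D A *\<^sub>v w = k \<cdot>\<^sub>v w"
    unfolding eigenvalue_def eigenvector_def by (auto simp: to_mat_def)
  show ?thesis
  proof
    show "\<exists>i<D. w $ i \<noteq> 0" using w(1,2) by (auto simp: vec_eq_iff)
    fix i assume i: "i < D"
    have "(to_mat D A *\<^sub>v w) $ i = (\<Sum>j<D. ent A i j * w $ j)"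
      using i w(1) by (auto simp: to_mat_def scalar_prod_def atLeast0LessThan intro!: sum.cong)
    then show "(\<Sum>j<D. ent A i j * w $ j) = k * w $ i" using w i by simp
  qed
qed

text \<open>Induction on the dimension: a Householder reflection maps the last basis vector to a
  unit eigenvector whose last coordinate has been made nonpositive by a phase, so that no
  case distinction is needed.\<close>

lemma spectral:
  assumes "bdd D A" "adj A = A"
  shows "\<exists>U q. unitary_on D U \<and> A = U * dg D q * adj U"
  using assms
proof (induction D arbitrary: A)
  case 0
  have z: "B = 0" if "bdd 0 B" for B using that by (intro fop_eqI) (simp add: bdd_def ent_simps)
  have "idn 0 = 0" "A = 0" using z[of "idn 0"] z[of A] 0 by simp_all
  then show ?case by (intro exI[of _ 0]) (simp add: unitary_on_def)
next
  case (Suc n)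
  let ?D = "Suc n"
  obtain k v where v0: "\<exists>i<?D. v i \<noteq> (0::complex)"
    and ev: "\<And>i. i < ?D \<Longrightarrow> (\<Sum>j<?D. ent A i j * v j) = k * v i"
    using eigenvector_exists[OF zero_less_Suc Suc.prems(1)] by metis
  define N where "N = (\<Sum>i<?D. (cmod (v i))\<^sup>2)"
  obtain i0 where "i0 < ?D" "v i0 \<noteq> 0" using v0 by auto
  then have N: "0 < N" unfolding N_def by (intro sum_pos2[of _ i0]) auto
  define c where "c = (if v n = 0 then 1 else - cnj (sgn (v n))) / complex_of_real (sqrt N)"
  define u where "u = (\<lambda>i. c * v i)"
  have cc: "cmod c = 1 / sqrt N"
    using N by (simp add: c_def norm_divide norm_sgn)
  have un: "\<exists>r\<le>0. u n = complex_of_real r"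
  proof (cases "v n = 0")
    case False
    have "cnj (sgn (v n)) * v n = complex_of_real (cmod (v n))"
      using False by (simp add: sgn_eq complex_norm_square[symmetric] power2_eq_square flip: of_real_mult)
        (simp add: mult.commute complex_norm_square[symmetric] power2_eq_square field_simps)
    then have "u n = complex_of_real (- cmod (v n) / sqrt N)"
      using False N by (simp add: u_def c_def)
    moreover have "- cmod (v n) / sqrt N \<le> 0" using N by simp
    ultimately show ?thesis by blast
  qed (auto simp: u_def)
  then obtain r where r: "r \<le> 0" "u n = complex_of_real r" by auto
  have nu: "(\<Sum>i<?D. (cmod (u i))\<^sup>2) = 1"
    using N by (simp add: u_def norm_mult cc power_mult_distrib power_divide N_def[symmetric] sum_divide_distrib[symmetric] del: sum.lessThan_Suc)
  have evu: "(\<Sum>j<?D. ent A i j * u j) = k * u i" if "i < ?D" for i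
    using ev[OF that] unfolding u_def by (simp only: mult.left_commute[of _ c] sum_distrib_left[symmetric])
  define E where "E = dg ?D (\<lambda>i. if i = n then 1 else 0)"
  have entE: "ent E i j = (if i = n \<and> j = n then 1 else 0)" for i j by (auto simp: E_def ent_dg)
  have bE: "bdd ?D E" by (simp add: E_def)
  define x where "x = (\<lambda>i. (if i = n then 1 else 0) - u i)"
  define X where "X = mkop ?D (\<lambda>i j. if j = n then x i else 0)"
  \<comment> \<open>Since \<open>r\<close> is nonpositive, \<open>s\<close> is at least 1. The
    squared norm of \<open>x = e_n - u\<close> is \<open>2 s\<close>, so \<open>H\<close> below is
    the reflection \<open>1 - 2 x adj x / |x|^2\<close>; \<open>X\<close> carries \<open>x\<close>
    as its last column.\<close>
  define s where "s = 1 - r"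
  have s: "0 < s" using r by (simp add: s_def)
  have bX: "bdd ?D X" by (simp add: X_def)
  have xn: "x n = complex_of_real s" by (simp add: x_def r s_def)
  have sumx: "(\<Sum>i<?D. (cmod (x i))\<^sup>2) = 2 * s"
  proof -
    have "(cmod (x i))\<^sup>2 = (cmod (u i))\<^sup>2 + (if i = n then 1 - 2 * r else 0)" for i
      by (auto simp: x_def r cmod_power2) (simp add: power2_eq_square algebra_simps)
    then have "(\<Sum>i<?D. (cmod (x i))\<^sup>2) = 1 + (\<Sum>i<?D. if i = n then 1 - 2 * r else 0)"
      by (simp only: sum.distrib nu)
    then show ?thesis by (simp add: s_def)
  qed
  have XX: "adj X * X = (2 * s) *\<^sub>R E"
  proof (rule fop_eqI)
    fix i j
    have "ent (adj X * X) i j = (\<Sum>k<?D. cnj (ent X k i) * ent X k j)"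
      unfolding ent_times_right[OF bX] by (simp add: ent_adj)
    also have "\<dots> = (if i = n \<and> j = n then complex_of_real (\<Sum>k<?D. (cmod (x k))\<^sup>2) else 0)"
      unfolding of_real_sum complex_norm_square
      by (auto simp: X_def ent_mkop mult.commute simp del: sum.lessThan_Suc intro!: sum.neutral sum.cong)
    finally show "ent (adj X * X) i j = ent ((2 * s) *\<^sub>R E) i j"
      unfolding sumx by (simp add: ent_simps entE scaleR_conv_of_real)
  qed
  have XE: "X * E = X"
    unfolding E_def by (rule fop_eqI) (auto simp: ent_times_dg X_def ent_mkop)
  define H where "H = idn ?D - (1 / s) *\<^sub>R (X * adj X)"
  have bH: "bdd ?D H" by (simp add: H_def bX)
  have aH: "adj H = H" by (simp add: H_def)
  have "X * adj X * (X * adj X) = X * (adj X * X) * adj X" by (simp only: mult.assoc)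
  also have "\<dots> = (2 * s) *\<^sub>R (X * adj X)" by (simp add: XX XE)
  finally have XXXX: "X * adj X * (X * adj X) = (2 * s) *\<^sub>R (X * adj X)" .
  have HH: "H * H = idn ?D"
    unfolding H_def left_diff_distrib right_diff_distrib mult_scaleR_left mult_scaleR_right XXXX
    using s by (simp add: bX dg_times) (simp add: scaleR_left_diff_distrib[symmetric] scaleR_left.add[symmetric] algebra_simps)
  have HE: "ent (H * E) i j = (if j = n \<and> i < ?D then u i else 0)" for i j
  proof -
    have "ent (X * adj X) i n = (if i < ?D then x i * complex_of_real s else 0)"
    proof -
      have "ent (X * adj X) i n = (\<Sum>k<?D. if k = n then ent X i n * cnj (ent X n n) else 0)"
        unfolding ent_times_left[OF bX] by (intro sum.cong) (auto simp: ent_adj X_def ent_mkop)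
      then show ?thesis by (simp add: X_def ent_mkop xn)
    qed
    then show ?thesis using s
      by (auto simp: E_def ent_times_dg H_def ent_simps ent_dg scaleR_conv_of_real x_def)
  qed
  define B where "B = H * A * H"
  have bB: "bdd ?D B" using bH Suc.prems by (simp add: B_def)
  have aB: "adj B = B" by (simp add: B_def aH Suc.prems mult.assoc)
  \<comment> \<open>\<open>H\<close> exchanges \<open>e_n\<close> and \<open>u\<close>, so
    \<open>e_n\<close> is an eigenvector of \<open>B\<close>. Self-adjointness then makes
    \<open>k\<close> real and clears the last row too, leaving a block of size \<open>n\<close> for
    the induction hypothesis.\<close>
  have Bn: "ent B i n = (if i = n then k else 0)" for i
  proof -
    have AHE: "ent (A * (H * E)) j n = k * ent (H * E) j n" for j
    proof (cases "j < ?D")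
      case True
      have "ent (A * (H * E)) j n = (\<Sum>l<?D. ent A j l * u l)"
        unfolding ent_times_left[OF Suc.prems(1)] by (intro sum.cong) (auto simp: HE)
      then show ?thesis using evu[OF True] True by (simp add: HE del: sum.lessThan_Suc)
    next
      case False
      then have "ent A j l = 0" for l using Suc.prems(1) by (simp add: bdd_def)
      then show ?thesis unfolding ent_times_left[OF Suc.prems(1)] using False by (simp add: HE)
    qed
    have "ent (B * E) i n = ent (H * (A * (H * E))) i n" by (simp add: B_def mult.assoc)
    also have "\<dots> = k * ent (H * (H * E)) i n"
      unfolding ent_times_left[OF bH] AHE sum_distrib_left by (intro sum.cong refl) (simp only: mult.left_commute)
    also have "H * (H * E) = E" using HH bE by (metis mult.assoc idn_times(1))
    finally have "ent (B * E) i n = k * ent E i n" .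
    then show ?thesis by (simp add: E_def ent_times_dg ent_dg split: if_splits)
  qed
  have "cnj k = k" using Bn[of n] arg_cong[OF aB, of "\<lambda>B. ent B n n"] by (simp add: ent_adj)
  then have kr: "k = complex_of_real (Re k)" by (simp add: complex_eq_iff)
  have Bn': "ent B n i = (if i = n then k else 0)" for i
    using arg_cong[OF aB, of "\<lambda>B. ent B n i"] Bn[of i] \<open>cnj k = k\<close> by (simp add: ent_adj split: if_splits)
  define B' where "B' = mkop n (ent B)"
  have BB: "B = B' + Re k *\<^sub>R E"
  proof (rule fop_eq_bddI[of ?D, OF bB])
    show "bdd ?D (B' + Re k *\<^sub>R E)" using bdd_mono[of n B' ?D] bE by (simp add: B'_def)
    fix i j assume "i < ?D" "j < ?D"
    then show "ent B i j = ent (B' + Re k *\<^sub>R E) i j"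
      using Bn[of i] Bn'[of j] kr by (auto simp: ent_simps B'_def ent_mkop entE scaleR_conv_of_real less_Suc_eq)
  qed
  have "bdd n B'" "adj B' = B'"
    using aB by (auto intro!: fop_eqI simp: B'_def ent_adj ent_mkop) (metis ent_adj)+
  from Suc.IH[OF this] obtain V q where V: "unitary_on n V" and B'V: "B' = V * dg n q * adj V" by auto
  have bV: "bdd n V" "bdd n (adj V)" using V by (simp_all add: unitary_on_def)
  have VE: "Y * E = 0" "E * Y = 0" if "bdd n Y" for Y
    using that unfolding E_def by (auto intro!: fop_eqI simp: ent_times_dg ent_dg_times ent_simps bdd_def)
  have EE: "E * E = E" by (simp add: E_def dg_times if_distrib cong: if_cong)
  have aE: "adj E = E" by (simp add: E_def)
  define W where "W = V + E"
  have bV': "bdd ?D V" using bdd_mono[OF bV(1)] by simp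
  have id: "idn ?D = idn n + E" by (rule fop_eqI) (auto simp: ent_simps ent_dg entE)
  have W: "unitary_on ?D W"
    unfolding unitary_on_def W_def using V bV' bE
    by (simp add: unitary_on_def aE distrib_left distrib_right VE[OF bV(1)] VE[OF bV(2)] EE id)
  define q' where "q' = q(n := Re k)"
  have dq: "dg ?D q' = dg n q + Re k *\<^sub>R E"
    by (rule fop_eqI) (auto simp: ent_simps ent_dg entE q'_def scaleR_conv_of_real)
  have bq: "bdd n (dg n q)" by simp
  have WW: "W * dg ?D q' * adj W = B"
    unfolding W_def dq BB B'V
    by (simp add: aE distrib_left distrib_right VE[OF bV(1)] VE[OF bV(2)] VE[OF bq] EE mult.assoc)
  have "unitary_on ?D (H * W)"
  proof -
    have "H * W * adj (H * W) = H * (W * adj W) * H" by (simp add: aH mult.assoc)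
    also have "\<dots> = idn ?D" using W bH HH by (simp add: unitary_on_def)
    finally have 1: "H * W * adj (H * W) = idn ?D" .
    have "adj (H * W) * (H * W) = adj W * (H * H) * W" by (simp add: aH mult.assoc)
    also have "\<dots> = idn ?D" using W by (simp add: unitary_on_def HH)
    finally show ?thesis using 1 W bH by (simp add: unitary_on_def)
  qed
  moreover have "A = H * W * dg ?D q' * adj (H * W)"
  proof -
    have "H * W * dg ?D q' * adj (H * W) = H * (W * dg ?D q' * adj W) * H" by (simp add: aH mult.assoc)
    also have "\<dots> = (H * H) * A * (H * H)" unfolding WW B_def by (simp only: mult.assoc)
    also have "\<dots> = A" using Suc.prems by (simp add: HH)
    finally show ?thesis by simp
  qed
  ultimately show ?case by blast
qed


lemma unitary_onD:
  assumes "unitary_on D U"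
  shows "bdd D U" "bdd D (adj U)" "U * adj U = idn D" "adj U * U = idn D"
  using assms by (simp_all add: unitary_on_def)

lemma unitary_cancel:
  assumes "unitary_on D U" "bdd D X"
  shows "adj U * (U * X) = X" "U * (adj U * X) = X"
  using assms by (simp_all add: unitary_onD mult.assoc[symmetric])

lemma unitary_diag:
  assumes "unitary_on D U"
  shows "adj U * (U * dg D q * adj U) * U = dg D q"
  using assms by (simp add: mult.assoc unitary_cancel unitary_onD)

lemma dg_psdD: "0 \<le> dg D q \<Longrightarrow> i < D \<Longrightarrow> 0 \<le> q i"
  using psd_ent_diag[of "dg D q" i] by (simp add: ent_dg less_eq_complex_def)

lemma psd_spectral:
  assumes "bdd D A" "0 \<le> A"
  shows "\<exists>U q. unitary_on D U \<and> (\<forall>i<D. 0 \<le> q i) \<and> A = U * dg D q * adj U"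
proof -
  obtain U q where U: "unitary_on D U" "A = U * dg D q * adj U"
    using spectral[OF assms(1) psd_adj[OF assms(2)]] by auto
  have "0 \<le> dg D q" using conj_psd[OF assms(2), of U] unitary_diag[OF U(1)] U(2) by simp
  then have "\<forall>i<D. 0 \<le> q i" using dg_psdD by blast
  with U show ?thesis by blast
qed

section \<open>Positive square roots\<close>

lemma psd_sqrt:
  assumes "bdd D A" "0 \<le> A"
  shows "\<exists>R. bdd D R \<and> 0 \<le> R \<and> R * R = A"
proof -
  obtain U q where U: "unitary_on D U" "\<forall>i<D. 0 \<le> q i" "A = U * dg D q * adj U"
    using psd_spectral[OF assms] by auto
  let ?R = "U * dg D (\<lambda>i. sqrt (q i)) * adj U"
  have "?R * ?R = U * (dg D (\<lambda>i. sqrt (q i)) * dg D (\<lambda>i. sqrt (q i))) * adj U"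
    using U(1) by (simp add: mult.assoc unitary_cancel unitary_onD)
  also have "\<dots> = A" unfolding dg_times U(3) by (intro arg_cong2[where f="(*)"] refl dg_cong) (use U(2) in auto)
  finally have "?R * ?R = A" .
  moreover have "0 \<le> ?R" by (rule conj_psd'[OF dg_psd]) (use U(2) in auto)
  ultimately show ?thesis using unitary_onD[OF U(1)] by (intro exI[of _ ?R]) simp
qed

lemma tr_mult_psd: assumes "0 \<le> A" "0 \<le> B" shows "0 \<le> tr (A * B)"
proof -
  obtain D where "bdd D A" using ex_bdd by auto
  then obtain R where R: "0 \<le> R" "R * R = A" using psd_sqrt[OF _ assms(1)] by blast
  have "tr (A * B) = tr (R * (R * B))" by (simp add: R(2)[symmetric] mult.assoc)
  also have "\<dots> = tr (R * B * adj R)" by (subst tr_mult_commute) (simp add: psd_adj[OF R(1)] mult.assoc)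
  finally show ?thesis using tr_psd[OF conj_psd'[OF assms(2)]] by simp
qed

lemma tr_mult_mono: "A \<le> B \<Longrightarrow> 0 \<le> C \<Longrightarrow> tr (A * C) \<le> tr (B * C)"
  using tr_mult_psd[of "B - A" C] by (simp add: left_diff_distrib)

text \<open>Operator monotonicity of the square root: conjugate to the eigenbasis of \<open>B - A\<close>
  and compare diagonal entries.\<close>

lemma sqrt_mono:
  fixes A B :: fop
  assumes "0 \<le> A" "0 \<le> B" "A * A \<le> B * B"
  shows "A \<le> B"
proof -
  obtain D where D: "bdd D A" "bdd D B" using ex_bdd2 by blast
  obtain U q where U: "unitary_on D U" "B - A = U * dg D q * adj U"
    using spectral[of D "B - A"] D psd_adj assms by fastforce
  define A' B' where "A' = adj U * A * U" and "B' = adj U * B * U"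
  have BA: "B' = A' + dg D q"
    using unitary_diag[OF U(1), of q] unfolding U(2)[symmetric] A'_def B'_def
    by (simp add: algebra_simps)
  have p: "0 \<le> A'" "0 \<le> B'" unfolding A'_def B'_def using assms by (auto intro: conj_psd)
  have sq: "A' * A' = adj U * (A * A) * U" "B' * B' = adj U * (B * B) * U"
    unfolding A'_def B'_def using U(1) D by (simp_all add: mult.assoc unitary_cancel unitary_onD)
  then have le: "A' * A' \<le> B' * B'" using conj_mono[OF assms(3)] by simp
  have "0 \<le> q i" if i: "i < D" for i
  proof (rule ccontr)
    assume neg: "\<not> 0 \<le> q i"
    have "0 \<le> ent (B' * B' - A' * A') i i" using le by (intro psd_ent_diag) simp
    also have "B' * B' - A' * A' = A' * dg D q + dg D q * A' + dg D (\<lambda>i. q i * q i)"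
      unfolding BA by (simp add: algebra_simps dg_times)
    finally have 1: "0 \<le> 2 * q i * Re (ent A' i i) + q i * q i"
      using i by (simp add: ent_simps ent_dg_times ent_times_dg ent_dg less_eq_complex_def)
    have "0 \<le> Re (ent A' i i) + q i"
      using psd_ent_diag[OF p(2), of i] i by (simp add: BA ent_simps ent_dg less_eq_complex_def)
    then have "2 * q i * Re (ent A' i i) \<le> 2 * q i * (- q i)"
      using neg by (intro mult_left_mono_neg) auto
    with 1 have "q i * q i \<le> 0" by simp
    then show False using neg by (simp add: mult_le_0_iff)
  qed
  then have "0 \<le> B - A" unfolding U(2) by (intro conj_psd' dg_psd) auto
  then show ?thesis by simp
qed

section \<open>Matrix functions, trace norm and fidelity\<close>

lemma q_matfun_spectral:
  assumes A: "A \<in> carrier_mat D D" and h: "adj (fo A) = fo A"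
  shows "\<exists>U q. unitary_on D U \<and> fo A = U * dg D q * adj U \<and>
    (\<forall>f. q_matfun f A \<in> carrier_mat D D \<and> fo (q_matfun f A) = U * dg D (\<lambda>i. f (q i)) * adj U)"
proof -
  let ?P = "\<lambda>p. q_unitary D (fst p) \<and>
             A = fst p * mat_diag D (\<lambda>i. complex_of_real (snd p i)) * mat_adjoint (fst p)"
  have dc: "mat_diag D (\<lambda>i. complex_of_real (f i)) \<in> carrier_mat D D" for f
    by (simp add: mat_diag_def)
  have foU: "fo (V * mat_diag D (\<lambda>i. complex_of_real (f i)) * mat_adjoint V) = fo V * dg D f * adj (fo V)"
    and cU: "V * mat_diag D (\<lambda>i. complex_of_real (f i)) * mat_adjoint V \<in> carrier_mat D D"
    if V: "V \<in> carrier_mat D D" for V f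
    using V mat_adjoint_carrier[OF V] dc[of f] by (auto simp: fo_times[of _ D] fo_adj fo_diag)
  obtain U q where U: "unitary_on D U" "fo A = U * dg D q * adj U"
    using spectral[OF bdd_fo[OF A] h] by auto
  then have "fo (to_mat D U) = U" by (simp add: fo_tm unitary_onD)
  then have "?P (to_mat D U, q)"
    using U by (auto simp: q_unitary_fo intro!: fo_inj[OF A cU] simp: foU)
  \<comment> \<open>The choice made in \<open>q_matfun\<close> depends on \<open>A\<close> alone and
    not on \<open>f\<close>, so one diagonalization serves all functions at once. In particular
    \<open>q_log A\<close> is diagonal in an eigenbasis of \<open>A\<close> whose eigenvalues are
    known.\<close>
  define p where "p = (SOME p. ?P p)"
  have p: "?P p" unfolding p_def by (rule someI[of ?P]) fact
  then have pc: "fst p \<in> carrier_mat D D" by (simp add: q_unitary_def)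
  have m: "q_matfun f A = fst p * mat_diag D (\<lambda>i. complex_of_real (f (snd p i))) * mat_adjoint (fst p)" for f
    using A by (simp add: q_matfun_def Let_def p_def)
  have "fo A = fo (fst p) * dg D (snd p) * adj (fo (fst p))" using p foU[OF pc, of "snd p"] by metis
  moreover have "q_matfun f A \<in> carrier_mat D D" "fo (q_matfun f A) = fo (fst p) * dg D (\<lambda>i. f (snd p i)) * adj (fo (fst p))" for f
    unfolding m by (rule cU[OF pc], rule foU[OF pc])
  moreover have "unitary_on D (fo (fst p))" using p by (simp add: q_unitary_fo)
  ultimately show ?thesis by blast
qed

lemma q_sqrt_fo:
  assumes A: "A \<in> carrier_mat D D" and p: "0 \<le> fo A"
  shows "q_sqrt A \<in> carrier_mat D D" "0 \<le> fo (q_sqrt A)" "fo (q_sqrt A) * fo (q_sqrt A) = fo A"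
proof -
  obtain U q where U: "unitary_on D U" "fo A = U * dg D q * adj U"
    and f: "\<And>f. q_matfun f A \<in> carrier_mat D D \<and> fo (q_matfun f A) = U * dg D (\<lambda>i. f (q i)) * adj U"
    using q_matfun_spectral[OF A psd_adj[OF p]] by blast
  show "q_sqrt A \<in> carrier_mat D D" using f by (simp add: q_sqrt_def)
  have "0 \<le> dg D q" using conj_psd[OF p, of U] unitary_diag[OF U(1)] U(2) by simp
  then have q: "\<forall>i<D. 0 \<le> q i" using dg_psdD by blast
  have s: "fo (q_sqrt A) = U * dg D (\<lambda>i. sqrt (q i)) * adj U" using f by (simp add: q_sqrt_def)
  show "0 \<le> fo (q_sqrt A)" unfolding s by (rule conj_psd'[OF dg_psd]) (use q in auto)
  have "fo (q_sqrt A) * fo (q_sqrt A) = U * (dg D (\<lambda>i. sqrt (q i)) * dg D (\<lambda>i. sqrt (q i))) * adj U"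
    unfolding s using U(1) by (simp add: mult.assoc unitary_cancel unitary_onD)
  also have "\<dots> = fo A" unfolding dg_times U(2) by (intro arg_cong2[where f="(*)"] refl dg_cong) (use q in auto)
  finally show "fo (q_sqrt A) * fo (q_sqrt A) = fo A" .
qed

lemma q_trace_norm_fo:
  assumes M: "M \<in> carrier_mat D D"
  shows "\<exists>S. bdd D S \<and> 0 \<le> S \<and> S * S = adj (fo M) * fo M \<and> q_trace_norm M = tr S"
proof -
  let ?A = "mat_adjoint M * M"
  have A: "?A \<in> carrier_mat D D" using M mat_adjoint_carrier[OF M] by simp
  have fA: "fo ?A = adj (fo M) * fo M" using M mat_adjoint_carrier[OF M] by (simp add: fo_times fo_adj)
  note r = q_sqrt_fo[OF A, unfolded fA, OF psd_sq]
  show ?thesis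
    by (intro exI[of _ "fo (q_sqrt ?A)"])
      (use r bdd_fo[OF r(1)] in \<open>simp add: q_trace_norm_def q_tr_fo tr_def\<close>)
qed

text \<open>In the eigenbasis of \<open>S\<close> the columns of \<open>M\<close> have norms
  \<open>s i\<close>, because \<open>adj M * M = S * S\<close> is diagonal there. Each diagonal
  entry is bounded by the norm of its column; this takes the place of a polar decomposition.\<close>

lemma re_tr_le_abs:
  assumes "bdd D M" "bdd D S" "0 \<le> S" "S * S = adj M * M"
  shows "tr M \<le> tr S"
proof -
  obtain U s where U: "unitary_on D U" "\<forall>i<D. 0 \<le> s i" "S = U * dg D s * adj U"
    using psd_spectral[OF assms(2,3)] by auto
  define M' where "M' = adj U * M * U"
  have bM': "bdd D M'" using assms U(1) by (simp add: M'_def unitary_onD)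
  have tr_c: "tr (adj U * X * U) = tr X" if "bdd D X" for X
    using that U(1) by (simp add: tr_mult_commute[of "adj U * X"] mult.assoc[symmetric] unitary_onD)
  have "adj M' * M' = adj U * (adj M * M) * U"
    unfolding M'_def using U(1) assms(1) by (simp add: mult.assoc unitary_cancel unitary_onD)
  also have "\<dots> = adj U * S * U * (adj U * S * U)"
    unfolding assms(4)[symmetric] using U(1) assms(2) by (simp add: mult.assoc unitary_cancel unitary_onD)
  also have "\<dots> = dg D (\<lambda>i. s i * s i)" unfolding U(3) unitary_diag[OF U(1)] dg_times ..
  finally have sq: "adj M' * M' = dg D (\<lambda>i. s i * s i)" .
  have "Re (ent M' i i) \<le> s i" if i: "i < D" for i
  proof -
    have "complex_of_real (s i * s i) = (\<Sum>k<D. cnj (ent M' k i) * ent M' k i)"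
      using arg_cong[OF sq, of "\<lambda>X. ent X i i"] i
      by (simp add: ent_times_right[OF bM'] ent_adj ent_dg)
    also have "\<dots> = complex_of_real (\<Sum>k<D. (cmod (ent M' k i))\<^sup>2)"
      unfolding of_real_sum complex_norm_square by (simp only: mult.commute)
    finally have "s i * s i = (\<Sum>k<D. (cmod (ent M' k i))\<^sup>2)" by (simp only: of_real_eq_iff)
    moreover have "(cmod (ent M' i i))\<^sup>2 \<le> (\<Sum>k<D. (cmod (ent M' k i))\<^sup>2)"
      using i by (intro member_le_sum) auto
    ultimately have "(cmod (ent M' i i))\<^sup>2 \<le> (s i)\<^sup>2" by (simp add: power2_eq_square)
    then have "cmod (ent M' i i) \<le> s i" using U(2) i by (simp add: power2_le_iff_abs_le)
    then show ?thesis using complex_Re_le_cmod[of "ent M' i i"] by simp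
  qed
  then have "tr M' \<le> (\<Sum>i<D. s i)" unfolding tr_def ctr_bdd[OF bM'] Re_sum by (intro sum_mono) auto
  also have "\<dots> = tr S" using tr_c[OF assms(2)] unfolding U(3) unitary_diag[OF U(1)] tr_dg by simp
  finally show ?thesis using tr_c[OF assms(1)] by (simp add: M'_def)
qed

text \<open>Let \<open>Q\<close> be the square root of \<open>T\<close>. Monotonicity of the square
  root puts both \<open>R1\<close> and \<open>R2\<close> below \<open>Q\<close>, so
  \<open>tr ((Q - R1) * (Q - R2))\<close> is nonnegative; with
  \<open>tr (Ri * Ri) \<le> tr (Q * Ri)\<close> this gives
  \<open>tr (R1 * R2) \<ge> tr \<rho> + tr \<sigma> - tr T\<close>, and the trace norm of
  \<open>R1 * R2\<close> is at least its trace.\<close>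

lemma q_fidelity_lower:
  assumes \<rho>: "\<rho> \<in> carrier_mat D D" "0 \<le> fo \<rho>" and \<sigma>: "\<sigma> \<in> carrier_mat D D" "0 \<le> fo \<sigma>"
    and T: "fo \<rho> \<le> T" "fo \<sigma> \<le> T" and c: "0 \<le> c" "c \<le> tr (fo \<rho>) + tr (fo \<sigma>) - tr T"
  shows "c\<^sup>2 \<le> q_fidelity \<rho> \<sigma>"
proof -
  obtain E where E: "bdd E T" using ex_bdd by auto
  have "0 \<le> T" using \<rho>(2) T(1) by (rule order_trans)
  then obtain Q where Q: "0 \<le> Q" "Q * Q = T" using psd_sqrt[OF E] by blast
  define R1 R2 where "R1 = fo (q_sqrt \<rho>)" and "R2 = fo (q_sqrt \<sigma>)"
  note r1 = q_sqrt_fo[OF \<rho>, folded R1_def] and r2 = q_sqrt_fo[OF \<sigma>, folded R2_def]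
  have le: "R1 \<le> Q" "R2 \<le> Q" using r1 r2 Q T by (auto intro: sqrt_mono)
  have "0 \<le> tr ((Q - R1) * (Q - R2))" using le by (intro tr_mult_psd) auto
  moreover have "tr (R2 * R2) \<le> tr (Q * R2)" "tr (R1 * R1) \<le> tr (Q * R1)"
    using tr_mult_mono[OF le(2) r2(2)] tr_mult_mono[OF le(1) r1(2)] by simp_all
  ultimately have "tr (fo \<rho>) + tr (fo \<sigma>) - tr T \<le> tr (R1 * R2)"
    using r1(3) r2(3) Q(2) tr_mult_commute[of Q R1] by (simp add: algebra_simps)
  moreover have M: "q_sqrt \<rho> * q_sqrt \<sigma> \<in> carrier_mat D D" using r1 r2 by simp
  from q_trace_norm_fo[OF this] obtain S where S: "bdd D S" "0 \<le> S"
    "S * S = adj (fo (q_sqrt \<rho> * q_sqrt \<sigma>)) * fo (q_sqrt \<rho> * q_sqrt \<sigma>)"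
    "q_trace_norm (q_sqrt \<rho> * q_sqrt \<sigma>) = tr S" by auto
  have "tr (R1 * R2) \<le> tr S"
    using re_tr_le_abs[OF bdd_fo[OF M] S(1,2,3)] r1(1) r2(1) by (simp add: R1_def R2_def fo_times)
  ultimately show ?thesis using c S(4) by (simp add: q_fidelity_def power_mono)
qed

lemma tr_cauchy_amgm:
  assumes "0 \<le> T" "0 < c"
  shows "2 * tr (adj A * T * B) \<le> c * tr (adj A * T * A) + (1 / c) * tr (adj B * T * B)"
proof -
  define X where "X = sqrt c *\<^sub>R A - (1 / sqrt c) *\<^sub>R B"
  have sw: "tr (adj B * T * A) = tr (adj A * T * B)"
    using tr_simps(6)[of "adj B * T * A"] psd_adj[OF assms(1)] by (simp add: mult.assoc)
  have "0 \<le> tr (adj X * T * X)" using assms by (intro tr_psd conj_psd)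
  also have "tr (adj X * T * X) = c * tr (adj A * T * A) - 2 * tr (adj A * T * B) + (1 / c) * tr (adj B * T * B)"
    using assms(2) sw by (simp add: X_def algebra_simps)
  finally show ?thesis by simp
qed

text \<open>The singular value decomposition of \<open>R1 * R2\<close> turns its trace norm into
  \<open>tr (adj (R1 * W) * (R2 * U))\<close> with contractions \<open>W\<close>, \<open>U\<close>; inserting
  \<open>idn D = T + T'\<close> and applying Cauchy-Schwarz (in its arithmetic mean form) to both terms
  bounds it by the measurement statistics.\<close>

lemma abs_tr_test_bound:
  assumes b: "bdd D R1" "bdd D R2" "bdd D S" and p: "0 \<le> R1" "0 \<le> R2" "0 \<le> S"
    and S: "S * S = adj (R1 * R2) * (R1 * R2)"
    and T: "0 \<le> T" "0 \<le> T'" "T + T' = idn D" and c: "0 < c" "0 < c'"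
  shows "2 * tr S \<le> c * tr (R1 * R1 * T) + (1 / c) * tr (R2 * R2 * T)
      + (c' * tr (R1 * R1 * T') + (1 / c') * tr (R2 * R2 * T'))"
proof -
  obtain U s where U: "unitary_on D U" "\<forall>i<D. 0 \<le> s i" "S = U * dg D s * adj U"
    using psd_spectral[OF b(3) p(3)] by auto
  \<comment> \<open>The singular values are inverted where they are nonzero and replaced by 0
    elsewhere. So \<open>W\<close> is a partial isometry, which is enough for
    \<open>W * adj W \<le> idn D\<close> even if \<open>S\<close> is singular.\<close>
  define d where "d = dg D (\<lambda>i. if s i = 0 then 0 else 1 / s i)"
  define M where "M = R1 * R2"
  define W where "W = M * U * d"
  have bM: "bdd D M" using b by (simp add: M_def)
  have bW: "bdd D W" using bM U(1) by (simp add: W_def d_def unitary_onD)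
  have MM: "adj U * (adj M * M) * U = dg D (\<lambda>i. s i * s i)"
  proof -
    have "adj U * (adj M * M) * U = adj U * S * U * (adj U * S * U)"
      unfolding S[folded M_def, symmetric] using U(1) b(3) by (simp add: mult.assoc unitary_cancel unitary_onD)
    also have "\<dots> = dg D (\<lambda>i. s i * s i)" unfolding U(3) unitary_diag[OF U(1)] dg_times ..
    finally show ?thesis .
  qed
  have ad: "adj d = d" by (simp add: d_def)
  have WMU: "adj W * M * U = dg D s"
  proof -
    have "adj W * M * U = d * (adj U * (adj M * M) * U)" by (simp add: W_def ad mult.assoc)
    also have "\<dots> = dg D s" unfolding MM d_def dg_times by (intro dg_cong) simp
    finally show ?thesis .
  qed
  have "adj W * W = d * (adj U * (adj M * M) * U) * d" by (simp add: W_def ad mult.assoc)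
  also have "\<dots> = dg D (\<lambda>i. if s i = 0 then 0 else 1)" unfolding MM d_def dg_times by (intro dg_cong) simp
  finally have WW: "adj W * W = dg D (\<lambda>i. if s i = 0 then 0 else 1)" .
  have WP: "W * dg D (\<lambda>i. if s i = 0 then 0 else 1) = W"
  proof -
    have "d * dg D (\<lambda>i. if s i = 0 then 0 else 1) = d" unfolding d_def dg_times by (intro dg_cong) simp
    then show ?thesis by (simp add: W_def mult.assoc)
  qed
  have "W * adj W * (W * adj W) = W * (adj W * W) * adj W" by (simp only: mult.assoc)
  then have idem: "W * adj W * (W * adj W) = W * adj W" by (simp add: WW WP)
  have "0 \<le> adj (idn D - W * adj W) * (idn D - W * adj W)" by (rule psd_sq)
  also have "\<dots> = idn D - W * adj W" using bW by (simp add: algebra_simps idem[unfolded mult.assoc] dg_times)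
  finally have Wc: "W * adj W \<le> idn D" by simp
  have a1: "adj R1 = R1" "adj R2 = R2" using p psd_adj by auto
  have bound1: "tr (adj (R1 * W) * Q * (R1 * W)) \<le> tr (R1 * R1 * Q)" if Q: "0 \<le> Q" for Q
  proof -
    have "tr (adj (R1 * W) * Q * (R1 * W)) = tr (adj W * (R1 * Q * R1 * W))" by (simp add: a1 mult.assoc)
    also have "\<dots> = tr (W * adj W * (R1 * Q * R1))"
      using tr_mult_commute[of "adj W" "R1 * Q * R1 * W"] tr_mult_commute[of "R1 * Q * R1" "W * adj W"]
      by (simp add: mult.assoc)
    also have "\<dots> \<le> tr (idn D * (R1 * Q * R1))"
      by (rule tr_mult_mono[OF Wc]) (use conj_psd[OF Q, of R1] a1 in simp)
    also have "\<dots> = tr (R1 * (Q * R1))" using b by (simp add: mult.assoc[symmetric])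
    also have "\<dots> = tr (R1 * R1 * Q)" by (subst tr_mult_commute) (simp add: mult.assoc tr_mult_commute[of Q])
    finally show ?thesis .
  qed
  have bound2: "tr (adj (R2 * U) * Q * (R2 * U)) = tr (R2 * R2 * Q)" for Q
  proof -
    have "tr (adj (R2 * U) * Q * (R2 * U)) = tr (adj U * (R2 * Q * R2 * U))" by (simp add: a1 mult.assoc)
    also have "\<dots> = tr (R2 * Q * (R2 * (U * adj U)))"
      by (subst tr_mult_commute) (simp add: mult.assoc)
    also have "\<dots> = tr (R2 * (Q * R2))" using U(1) b by (simp add: unitary_onD mult.assoc)
    also have "\<dots> = tr (R2 * R2 * Q)" by (subst tr_mult_commute) (simp add: mult.assoc tr_mult_commute[of Q])
    finally show ?thesis .
  qed
  have "tr S = tr (dg D s)"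
    unfolding U(3) using U(1) by (simp add: tr_mult_commute[of "U * dg D s"] mult.assoc[symmetric] unitary_onD)
  also have "\<dots> = tr (adj (R1 * W) * (T + T') * (R2 * U))"
    unfolding T(3) WMU[symmetric] using b by (simp add: a1 M_def mult.assoc)
  finally have trS: "tr S = tr (adj (R1 * W) * T * (R2 * U)) + tr (adj (R1 * W) * T' * (R2 * U))"
    by (simp only: distrib_left distrib_right tr_simps)
  have "2 * tr (adj (R1 * W) * T * (R2 * U)) \<le> c * tr (R1 * R1 * T) + (1 / c) * tr (R2 * R2 * T)"
    using tr_cauchy_amgm[OF T(1) c(1), of "R1 * W" "R2 * U"] bound1[OF T(1)] c(1)
    unfolding bound2 by (meson add_right_mono mult_left_mono order_trans less_imp_le)
  moreover have "2 * tr (adj (R1 * W) * T' * (R2 * U)) \<le> c' * tr (R1 * R1 * T') + (1 / c') * tr (R2 * R2 * T')"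
    using tr_cauchy_amgm[OF T(2) c(2), of "R1 * W" "R2 * U"] bound1[OF T(2)] c(2)
    unfolding bound2 by (meson add_right_mono mult_left_mono order_trans less_imp_le)
  ultimately show ?thesis unfolding trS by (simp add: distrib_left)
qed

text \<open>What the converse uses about smoothing: a state close to \<open>\<rho>\<close> cannot
  evade a test that \<open>\<rho>\<close> passes almost surely. The number \<open>9/16\<close> is
  the square of the bound \<open>3/4\<close> on the trace norm.\<close>

lemma q_fidelity_test:
  assumes \<rho>: "q_state D \<rho>" and \<sigma>: "q_state D \<sigma>" and F: "9/16 \<le> q_fidelity \<rho> \<sigma>"
    and T: "0 \<le> T" "0 \<le> idn D - T" and \<eta>: "tr (fo \<rho> * (idn D - T)) \<le> 1/16"
  shows "1/4 \<le> tr (fo \<sigma> * T)"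
proof -
  define R1 R2 where "R1 = fo (q_sqrt \<rho>)" and "R2 = fo (q_sqrt \<sigma>)"
  have \<rho>': "\<rho> \<in> carrier_mat D D" "0 \<le> fo \<rho>" "tr (fo \<rho>) = 1"
    and \<sigma>': "\<sigma> \<in> carrier_mat D D" "0 \<le> fo \<sigma>" "tr (fo \<sigma>) = 1"
    using \<rho> \<sigma> by (auto simp: q_state_fo)
  note r1 = q_sqrt_fo[OF \<rho>'(1,2), folded R1_def] and r2 = q_sqrt_fo[OF \<sigma>'(1,2), folded R2_def]
  have M: "q_sqrt \<rho> * q_sqrt \<sigma> \<in> carrier_mat D D" using r1 r2 by simp
  from q_trace_norm_fo[OF this] obtain S where S: "bdd D S" "0 \<le> S"
    "S * S = adj (R1 * R2) * (R1 * R2)" "q_trace_norm (q_sqrt \<rho> * q_sqrt \<sigma>) = tr S"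
    using r1(1) r2(1) by (auto simp: R1_def R2_def fo_times)
  have b: "bdd D R1" "bdd D R2" using bdd_fo r1(1) r2(1) by (auto simp: R1_def R2_def)
  \<comment> \<open>The weights 1/2 and 4 are chosen so that, with acceptance
    \<open>x = tr (fo \<sigma> * T)\<close>, the estimate becomes
    \<open>3/2 \<le> 2 tr S \<le> 1/2 + 2 x + 1/4 + 1/4\<close>, hence
    \<open>1/4 \<le> x\<close>.\<close>
  have "2 * tr S \<le> (1/2) * tr (R1 * R1 * T) + (1 / (1/2)) * tr (R2 * R2 * T)
      + (4 * tr (R1 * R1 * (idn D - T)) + (1 / 4) * tr (R2 * R2 * (idn D - T)))"
    by (rule abs_tr_test_bound[OF b S(1) r1(2) r2(2) S(2,3) T]) auto
  then have *: "2 * tr S \<le> (1/2) * tr (fo \<rho> * T) + 2 * tr (fo \<sigma> * T)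
      + (4 * tr (fo \<rho> * (idn D - T)) + (1 / 4) * tr (fo \<sigma> * (idn D - T)))"
    unfolding r1(3) r2(3) by simp
  have "tr (fo \<rho> * T) = 1 - tr (fo \<rho> * (idn D - T))" "tr (fo \<sigma> * T) = 1 - tr (fo \<sigma> * (idn D - T))"
    using \<rho>' \<sigma>' bdd_fo by (simp_all add: right_diff_distrib)
  moreover have "0 \<le> tr (fo \<rho> * (idn D - T))" "0 \<le> tr (fo \<sigma> * (idn D - T))" "0 \<le> tr (fo \<sigma> * T)"
    using \<rho>' \<sigma>' T by (auto intro!: tr_mult_psd)
  ultimately have "2 * tr S \<le> 1/2 + 2 * tr (fo \<sigma> * T) + 1/4 + 1/4" using * \<eta> by argo
  moreover have "3/4 \<le> tr S"
  proof (rule ccontr)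
    assume "\<not> 3/4 \<le> tr S"
    moreover have "0 \<le> tr S" using S(2) by (rule tr_psd)
    ultimately have "(tr S)\<^sup>2 < (3/4)\<^sup>2" by (intro power_strict_mono) auto
    then show False using F S(4) by (simp add: q_fidelity_def power2_eq_square)
  qed
  ultimately show ?thesis by simp
qed

section \<open>Tensor powers over abstract codes\<close>

text \<open>\<open>e x m\<close> is the \<open>m\<close>-th letter of the word encoded by \<open>x\<close>. Powers of a channel in the bipartite
  order and powers of its Choi matrix enumerate the same words differently; leaving the encoding
  abstract makes them instances of one tensor power \<open>tp\<close>.\<close>

definition code :: "nat \<Rightarrow> nat \<Rightarrow> nat \<Rightarrow> (nat \<Rightarrow> nat \<Rightarrow> nat) \<Rightarrow> bool" where
  "code d n D e \<longleftrightarrow> bij_betw (\<lambda>x. restrict (e x) {..<n}) {..<D} ({..<n} \<rightarrow>\<^sub>E {..<d})"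

definition tp :: "nat \<Rightarrow> nat \<Rightarrow> (nat \<Rightarrow> nat \<Rightarrow> nat) \<Rightarrow> (nat \<Rightarrow> fop) \<Rightarrow> fop" where
  "tp D n e A = mkop D (\<lambda>x y. \<Prod>m<n. ent (A m) (e x m) (e y m))"

lemma ent_tp: "ent (tp D n e A) x y = (if x < D \<and> y < D then \<Prod>m<n. ent (A m) (e x m) (e y m) else 0)"
  by (simp add: tp_def ent_mkop)

lemma bdd_tp [simp]: "bdd D (tp D n e A)" by (simp add: tp_def)

lemma code_lt: "code d n D e \<Longrightarrow> x < D \<Longrightarrow> m < n \<Longrightarrow> e x m < d"
  using bij_betwE[of "\<lambda>x. restrict (e x) {..<n}"] unfolding code_def by (fastforce simp: PiE_iff)

lemma code_inj: "code d n D e \<Longrightarrow> x < D \<Longrightarrow> y < D \<Longrightarrow> (\<And>m. m < n \<Longrightarrow> e x m = e y m) \<Longrightarrow> x = y"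
  unfolding code_def bij_betw_def inj_on_def by (metis (no_types, lifting) lessThan_iff restrict_ext)

text \<open>Distributivity: as \<open>z\<close> runs through the codes, its word runs through all
  words exactly once, so a product of sums expands into one sum over codes. Products, traces,
  partial traces and channel actions of tensor powers all factor through this identity.\<close>

lemma sum_code:
  fixes F :: "nat \<Rightarrow> nat \<Rightarrow> 'a::comm_semiring_1"
  assumes "code d n D e"
  shows "(\<Sum>z<D. \<Prod>m<n. F m (e z m)) = (\<Prod>m<n. \<Sum>j<d. F m j)"
proof -
  have "(\<Prod>m<n. \<Sum>j<d. F m j) = (\<Sum>g\<in>{..<n} \<rightarrow>\<^sub>E {..<d}. \<Prod>m<n. F m (g m))"
    by (rule prod_sum_PiE) auto
  also have "\<dots> = (\<Sum>z<D. \<Prod>m<n. F m (restrict (e z) {..<n} m))"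
    using assms unfolding code_def by (rule sum.reindex_bij_betw[symmetric])
  finally show ?thesis by simp
qed

lemma tp_cong: "code d n D e \<Longrightarrow> (\<And>m. m < n \<Longrightarrow> A m = B m) \<Longrightarrow> tp D n e A = tp D n e B"
  unfolding tp_def by (intro mkop_cong prod.cong) auto

lemma tp_times:
  assumes "code d n D e" "\<And>m. m < n \<Longrightarrow> bdd d (A m)"
  shows "tp D n e A * tp D n e B = tp D n e (\<lambda>m. A m * B m)"
proof (rule fop_eq_bddI[of D])
  fix x y assume xy: "x < D" "y < D"
  have "ent (tp D n e A * tp D n e B) x y = (\<Sum>z<D. \<Prod>m<n. ent (A m) (e x m) (e z m) * ent (B m) (e z m) (e y m))"
    unfolding ent_times_left[OF bdd_tp] by (intro sum.cong) (use xy in \<open>auto simp: ent_tp prod.distrib\<close>)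
  also have "\<dots> = (\<Prod>m<n. \<Sum>j<d. ent (A m) (e x m) j * ent (B m) j (e y m))"
    by (rule sum_code[OF assms(1)])
  also have "\<dots> = ent (tp D n e (\<lambda>m. A m * B m)) x y"
    using xy assms(2) by (auto simp: ent_tp ent_times_left[of d] intro!: prod.cong)
  finally show "ent (tp D n e A * tp D n e B) x y = ent (tp D n e (\<lambda>m. A m * B m)) x y" .
qed auto

lemma tp_adj: "adj (tp D n e A) = tp D n e (\<lambda>m. adj (A m))"
  by (rule fop_eqI) (simp add: ent_adj ent_tp cnj_prod)

lemma tp_dg:
  assumes "code d n D e"
  shows "tp D n e (\<lambda>m. dg d (f m)) = dg D (\<lambda>x. \<Prod>m<n. f m (e x m))"
proof (rule fop_eq_bddI[of D])
  fix x y assume xy: "x < D" "y < D"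
  show "ent (tp D n e (\<lambda>m. dg d (f m))) x y = ent (dg D (\<lambda>x. \<Prod>m<n. f m (e x m))) x y"
  proof (cases "x = y")
    case True
    then show ?thesis using xy code_lt[OF assms] by (auto simp: ent_tp ent_dg intro!: prod.cong)
  next
    case False
    then obtain m where m: "m < n" "e x m \<noteq> e y m" using code_inj[OF assms xy] by blast
    then have "(\<Prod>m<n. ent (dg d (f m)) (e x m) (e y m)) = 0"
      by (intro prod_zero) (auto simp: ent_dg)
    then show ?thesis using xy False by (simp add: ent_tp ent_dg)
  qed
qed auto

lemma tp_idn: "code d n D e \<Longrightarrow> tp D n e (\<lambda>_. idn d) = idn D"
  using tp_dg[of d n D e "\<lambda>_ _. 1"] by simp

lemma ctr_tp:
  assumes "code d n D e" "\<And>m. m < n \<Longrightarrow> bdd d (A m)"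
  shows "ctr (tp D n e A) = (\<Prod>m<n. ctr (A m))"
proof -
  have "ctr (tp D n e A) = (\<Sum>z<D. \<Prod>m<n. ent (A m) (e z m) (e z m))"
    by (simp add: ctr_bdd[OF bdd_tp] ent_tp)
  also have "\<dots> = (\<Prod>m<n. \<Sum>j<d. ent (A m) j j)" by (rule sum_code[OF assms(1)])
  also have "\<dots> = (\<Prod>m<n. ctr (A m))" using assms(2) by (auto simp: ctr_bdd[of d] intro!: prod.cong)
  finally show ?thesis .
qed

lemma tp_unitary:
  assumes "code d n D e" "\<And>m. m < n \<Longrightarrow> unitary_on d (U m)"
  shows "unitary_on D (tp D n e U)"
proof -
  have "tp D n e U * adj (tp D n e U) = tp D n e (\<lambda>m. U m * adj (U m))"
    unfolding tp_adj by (rule tp_times[OF assms(1)]) (use assms(2) in \<open>auto simp: unitary_on_def\<close>)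
  also have "\<dots> = idn D"
    unfolding tp_idn[OF assms(1), symmetric]
    by (rule tp_cong[OF assms(1)]) (use assms(2) in \<open>auto simp: unitary_on_def\<close>)
  moreover have "adj (tp D n e U) * tp D n e U = tp D n e (\<lambda>m. adj (U m) * U m)"
    unfolding tp_adj by (rule tp_times[OF assms(1)]) (use assms(2) in \<open>auto simp: unitary_on_def\<close>)
  moreover have "\<dots> = idn D"
    unfolding tp_idn[OF assms(1), symmetric]
    by (rule tp_cong[OF assms(1)]) (use assms(2) in \<open>auto simp: unitary_on_def\<close>)
  ultimately show ?thesis by (simp add: unitary_on_def)
qed

lemma tp_psd:
  assumes "code d n D e" "\<And>m. m < n \<Longrightarrow> bdd d (A m)" "\<And>m. m < n \<Longrightarrow> 0 \<le> A m"
  shows "0 \<le> tp D n e A"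
proof -
  have "\<forall>m. \<exists>R. m < n \<longrightarrow> bdd d R \<and> 0 \<le> R \<and> R * R = A m" using psd_sqrt assms(2,3) by metis
  then obtain R where R: "\<And>m. m < n \<Longrightarrow> bdd d (R m) \<and> 0 \<le> R m \<and> R m * R m = A m" by metis
  have "tp D n e A = tp D n e (\<lambda>m. R m * R m)" by (rule tp_cong[OF assms(1)]) (simp add: R)
  also have "\<dots> = tp D n e R * tp D n e R" by (rule tp_times[OF assms(1), symmetric]) (simp add: R)
  also have "tp D n e R = adj (tp D n e R)"
    unfolding tp_adj by (rule tp_cong[OF assms(1)]) (simp add: R psd_adj)
  then have "tp D n e R * tp D n e R = adj (tp D n e R) * tp D n e R" by simp
  finally show ?thesis using psd_sq by simp
qed

lemma tp_scaleR: "tp D n e (\<lambda>m. c *\<^sub>R A m) = c ^ n *\<^sub>R tp D n e A"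
  by (rule fop_eqI) (simp add: ent_tp ent_simps scaleR_conv_of_real prod.distrib)

lemma tp_spectral:
  assumes "code d n D e" "unitary_on d U"
  shows "tp D n e (\<lambda>_. U * dg d q * adj U)
    = tp D n e (\<lambda>_. U) * dg D (\<lambda>x. \<Prod>m<n. q (e x m)) * adj (tp D n e (\<lambda>_. U))"
  unfolding tp_dg[OF assms(1), of "\<lambda>_. q", symmetric]
  using assms(1) unitary_onD[OF assms(2)] by (simp add: tp_times[of d] tp_adj)

section \<open>Large deviations and typical projections\<close>

lemma chernoff:
  fixes r f :: "nat \<Rightarrow> real"
  assumes r: "\<And>j. j < d \<Longrightarrow> 0 \<le> r j" "(\<Sum>j<d. r j) = 1" and \<delta>: "0 < \<delta>"
  defines "t \<equiv> (\<Sum>j<d. r j * f j)"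
  shows "\<exists>c. 0 \<le> c \<and> c < 1 \<and> (\<forall>n D e. code d n D e \<longrightarrow>
    (\<Sum>x<D. (\<Prod>m<n. r (e x m)) * (if real n * (t + \<delta>) < (\<Sum>m<n. f (e x m)) then 1 else 0)) \<le> c ^ n)"
proof -
  \<comment> \<open>The moment generating function of \<open>f - t - \<delta>\<close>. It equals 1
    at 0 and has slope \<open>- \<delta>\<close> there, so it drops below 1 at some positive
    \<open>s\<close>. The exponential Markov inequality and independence of the letters then bound
    the tail by \<open>g s ^ n\<close>, uniformly in the code.\<close>
  define g where "g = (\<lambda>s. \<Sum>j<d. r j * exp (s * (f j - t - \<delta>)))"
  have "((\<lambda>s. r j * exp (s * (f j - t - \<delta>))) has_real_derivative r j * (f j - t - \<delta>)) (at 0)" for j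
    by (auto intro!: derivative_eq_intros)
  then have "(g has_real_derivative (\<Sum>j<d. r j * (f j - t - \<delta>))) (at 0)"
    unfolding g_def by (intro DERIV_sum)
  moreover have "(\<Sum>j<d. r j * (f j - t - \<delta>)) = - \<delta>"
    unfolding right_diff_distrib sum_subtractf sum_distrib_right[symmetric] r(2) by (simp add: t_def)
  ultimately have "(g has_real_derivative - \<delta>) (at 0)" by simp
  from DERIV_neg_dec_right[OF this] \<delta> obtain b where b: "0 < b" "\<And>h. 0 < h \<Longrightarrow> h < b \<Longrightarrow> g (0 + h) < g 0" by auto
  define s where "s = b / 2"
  have s: "0 < s" "g s < 1" using b(1) b(2)[of s] r(2) by (auto simp: s_def g_def)
  have g0: "0 \<le> g s" unfolding g_def by (intro sum_nonneg) (auto simp: r)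
  have "(\<Sum>x<D. (\<Prod>m<n. r (e x m)) * (if real n * (t + \<delta>) < (\<Sum>m<n. f (e x m)) then 1 else 0)) \<le> g s ^ n"
    if c: "code d n D e" for n D e
  proof -
    have "(\<Sum>x<D. (\<Prod>m<n. r (e x m)) * (if real n * (t + \<delta>) < (\<Sum>m<n. f (e x m)) then 1 else 0))
      \<le> (\<Sum>x<D. (\<Prod>m<n. r (e x m)) * exp (\<Sum>m<n. s * (f (e x m) - t - \<delta>)))"
    proof (intro sum_mono mult_left_mono prod_nonneg)
      fix x assume "x \<in> {..<D}"
      then show "0 \<le> r (e x m)" if "m \<in> {..<n}" for m using that code_lt[OF c] r by auto
      have "(\<Sum>m<n. s * (f (e x m) - t - \<delta>)) = s * ((\<Sum>m<n. f (e x m)) - real n * (t + \<delta>))"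
        by (simp add: sum_distrib_left[symmetric] sum_subtractf algebra_simps)
      then show "(if real n * (t + \<delta>) < (\<Sum>m<n. f (e x m)) then 1 else 0) \<le> exp (\<Sum>m<n. s * (f (e x m) - t - \<delta>))"
        using s(1) by simp
    qed
    also have "\<dots> = (\<Sum>x<D. \<Prod>m<n. r (e x m) * exp (s * (f (e x m) - t - \<delta>)))"
      by (simp add: exp_sum prod.distrib)
    also have "\<dots> = g s ^ n" using sum_code[OF c, of "\<lambda>_ j. r j * exp (s * (f j - t - \<delta>))"] by (simp add: g_def)
    finally show ?thesis .
  qed
  then show ?thesis using s(2) g0 by (intro exI[of _ "g s"]) auto
qed

lemma conj_proj_commute:
  assumes P: "P * P = P" "adj P = P" and c: "P * A = A * P" and A: "0 \<le> A"
  shows "A * P \<le> A"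
proof -
  obtain D where D: "bdd D A" "bdd D P" using ex_bdd2 by blast
  have "adj (idn D - P) * A * (idn D - P) = A - A * P - P * A + P * A * P"
    using D P by (simp add: algebra_simps)
  also have "P * A * P = A * P" using c P by (metis mult.assoc)
  finally have "adj (idn D - P) * A * (idn D - P) = A - A * P" using c by simp
  then show ?thesis using conj_psd[OF A, of "idn D - P"] by simp
qed

text \<open>Measuring \<open>\<omega>\<close> in an eigenbasis of \<open>\<tau>\<close> makes \<open>log \<tau>\<close> a sum of independent,
  identically distributed variables; Chebyshev's inequality bounds the mass of its
  atypical eigenspaces.\<close>

lemma typical_projection:
  fixes \<omega> \<tau> :: fop
  assumes \<omega>: "bdd d \<omega>" "0 \<le> \<omega>" "tr \<omega> = 1"
    and U: "unitary_on d U" and q: "\<And>j. j < d \<Longrightarrow> 0 \<le> q j" and \<tau>: "\<tau> = U * dg d q * adj U"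
    and supp: "\<And>j. j < d \<Longrightarrow> q j = 0 \<Longrightarrow> ent (adj U * \<omega> * U) j j = 0"
    and \<delta>: "0 < \<delta>" and \<eta>: "0 < \<eta>"
  defines "t \<equiv> tr (\<omega> * (U * dg d (\<lambda>j. if q j > 0 then log 2 (q j) else 0) * adj U))"
  shows "\<exists>n0. \<forall>n\<ge>n0. \<forall>D e. code d n D e \<longrightarrow> (\<exists>P. bdd D P \<and> adj P = P \<and> P * P = P \<and>
    tr (tp D n e (\<lambda>_. \<omega>) * (idn D - P)) \<le> \<eta> \<and>
    P * tp D n e (\<lambda>_. \<tau>) = tp D n e (\<lambda>_. \<tau>) * P \<and>
    2 powr (real n * (t - \<delta>)) *\<^sub>R P \<le> tp D n e (\<lambda>_. \<tau>) * P \<and>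
    tp D n e (\<lambda>_. \<tau>) * P \<le> 2 powr (real n * (t + \<delta>)) *\<^sub>R P \<and>
    (\<forall>M. bdd D M \<longrightarrow> M * tp D n e (\<lambda>_. \<tau>) = tp D n e (\<lambda>_. \<tau>) * M \<longrightarrow> M * P = P * M))"
proof -
  define \<omega>' where "\<omega>' = adj U * \<omega> * U"
  define r where "r = (\<lambda>j. Re (ent \<omega>' j j))"
  define f where "f = (\<lambda>j. if q j > 0 then log 2 (q j) else 0)"
  note u = unitary_onD[OF U]
  have b\<omega>': "bdd d \<omega>'" using u \<omega> by (simp add: \<omega>'_def)
  have p\<omega>': "0 \<le> \<omega>'" unfolding \<omega>'_def by (rule conj_psd[OF \<omega>(2)])
  have er: "ent \<omega>' j j = complex_of_real (r j)" "0 \<le> r j" for j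
    using psd_ent_diag[OF p\<omega>', of j] by (auto simp: r_def less_eq_complex_def complex_eq_iff)
  have "tr \<omega>' = 1" unfolding \<omega>'_def
    using \<omega> u by (simp add: tr_mult_commute[of "adj U * \<omega>"] mult.assoc[symmetric])
  then have r1: "(\<Sum>j<d. r j) = 1" by (simp add: tr_def ctr_bdd[OF b\<omega>'] r_def)
  have t: "t = (\<Sum>j<d. r j * f j)"
  proof -
    have "t = tr (\<omega>' * dg d f)"
      unfolding t_def \<omega>'_def f_def[symmetric]
      using tr_mult_commute[of "\<omega> * U * dg d f" "adj U"] by (simp add: mult.assoc)
    also have "\<dots> = (\<Sum>j<d. r j * f j)"
      by (simp add: tr_def ctr_bdd[of d] b\<omega>' ent_times_dg er(1))
    finally show ?thesis .
  qed
  \<comment> \<open>The upper tail is \<open>chernoff\<close> for \<open>f\<close>, the lower tail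
    \<open>chernoff\<close> for \<open>- f\<close>. Both decay exponentially in \<open>n\<close>
    with constants that do not depend on the code.\<close>
  obtain c1 where c1: "0 \<le> c1" "c1 < 1" "\<And>n D e. code d n D e \<Longrightarrow>
    (\<Sum>x<D. (\<Prod>m<n. r (e x m)) * (if real n * (t + \<delta>) < (\<Sum>m<n. f (e x m)) then 1 else 0)) \<le> c1 ^ n"
    using chernoff[OF er(2) r1 \<delta>, of f] unfolding t by blast
  have t': "(\<Sum>j<d. r j * - f j) = - t" by (simp add: t sum_negf)
  obtain c2 where c2: "0 \<le> c2" "c2 < 1" "\<And>n D e. code d n D e \<Longrightarrow>
    (\<Sum>x<D. (\<Prod>m<n. r (e x m)) * (if real n * (- t + \<delta>) < (\<Sum>m<n. - f (e x m)) then 1 else 0)) \<le> c2 ^ n"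
    using chernoff[OF er(2) r1 \<delta>, of "\<lambda>j. - f j"] unfolding t' by blast
  have "(\<lambda>n. c1 ^ n + c2 ^ n) \<longlonglongrightarrow> 0 + 0"
    using c1 c2 by (intro tendsto_add LIMSEQ_realpow_zero) auto
  then have "eventually (\<lambda>n. c1 ^ n + c2 ^ n < \<eta>) sequentially" using \<eta> by (simp add: order_tendstoD(2))
  then obtain n0 where n0: "\<And>n. n0 \<le> n \<Longrightarrow> c1 ^ n + c2 ^ n < \<eta>" by (auto simp: eventually_sequentially)
  show ?thesis
  proof (intro exI[of _ n0] allI impI)
    fix n D e assume n: "n0 \<le> n" and c: "code d n D e"
    define V where "V = tp D n e (\<lambda>_. U)"
    have V: "unitary_on D V" unfolding V_def by (rule tp_unitary[OF c U])
    note v = unitary_onD[OF V]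
    define Q where "Q = (\<lambda>x. \<Prod>m<n. q (e x m))"
    define \<tau>n where "\<tau>n = tp D n e (\<lambda>_. \<tau>)"
    define \<omega>n where "\<omega>n = tp D n e (\<lambda>_. \<omega>)"
    have \<tau>n: "\<tau>n = V * dg D Q * adj V"
      unfolding \<tau>n_def \<tau> V_def Q_def by (rule tp_spectral[OF c U])
    have b\<omega>n: "bdd D \<omega>n" by (simp add: \<omega>n_def)
    have \<omega>n': "adj V * \<omega>n * V = tp D n e (\<lambda>_. \<omega>')"
      unfolding V_def \<omega>n_def \<omega>'_def tp_adj using c u \<omega>(1) by (simp add: tp_times[of d])
    define lo hi where "lo = 2 powr (real n * (t - \<delta>))" and "hi = 2 powr (real n * (t + \<delta>))"
    \<comment> \<open>The window restricts the eigenvalue \<open>Q x\<close>, not the word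
      \<open>x\<close>. Hence \<open>P\<close> is a function of the operator \<open>\<tau>n\<close>:
      a matrix commuting with \<open>\<tau>n\<close> has no entries between different eigenvalues,
      and \<open>\<chi>\<close> is constant on equal ones.\<close>
    define \<chi> where "\<chi> = (\<lambda>x. if lo \<le> Q x \<and> Q x \<le> hi then 1 else 0 :: real)"
    have \<chi>0: "0 \<le> \<chi> x" for x by (simp add: \<chi>_def)
    define P where "P = V * dg D \<chi> * adj V"
    have mul: "V * dg D a * adj V * (V * dg D b * adj V) = V * dg D (\<lambda>x. a x * b x) * adj V" for a b
    proof -
      have "V * dg D a * adj V * (V * dg D b * adj V) = V * (dg D a * dg D b) * adj V"
        by (simp add: mult.assoc unitary_cancel[OF V] v)
      then show ?thesis by (simp add: dg_times)
    qed
    have bP: "bdd D P" by (simp add: P_def v)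
    have PP: "P * P = P" unfolding P_def mul by (simp add: \<chi>_def if_distrib cong: if_cong)
    have aP: "adj P = P" by (simp add: P_def mult.assoc)
    have Pt: "P * \<tau>n = \<tau>n * P" unfolding P_def \<tau>n mul by (simp add: mult.commute)
    have low: "lo *\<^sub>R P \<le> \<tau>n * P"
    proof -
      have "lo *\<^sub>R P = V * dg D (\<lambda>x. lo * \<chi> x) * adj V" by (simp add: P_def dg_scaleR[symmetric])
      also have "\<dots> \<le> \<tau>n * P" unfolding P_def \<tau>n mul by (intro conj_mono' dg_mono) (auto simp: \<chi>_def)
      finally show ?thesis .
    qed
    have upp: "\<tau>n * P \<le> hi *\<^sub>R P"
    proof -
      have "\<tau>n * P \<le> V * dg D (\<lambda>x. hi * \<chi> x) * adj V" unfolding P_def \<tau>n mul by (intro conj_mono' dg_mono) (auto simp: \<chi>_def)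
      also have "\<dots> = hi *\<^sub>R P" by (simp add: P_def dg_scaleR[symmetric])
      finally show ?thesis .
    qed
    have com: "M * P = P * M" if M: "bdd D M" "M * \<tau>n = \<tau>n * M" for M
    proof -
      define M' where "M' = adj V * M * V"
      have M'c: "adj V * (M * (V * dg D a * adj V)) * V = M' * dg D a"
        "adj V * (V * dg D a * adj V * M) * V = dg D a * M'" for a
        unfolding M'_def using M(1) by (simp_all add: mult.assoc unitary_cancel[OF V] v)
      have "M' * dg D Q = dg D Q * M'" using M'c[of Q] M(2) unfolding \<tau>n by simp
      then have e': "ent (M' * dg D Q) i j = ent (dg D Q * M') i j" for i j by (rule arg_cong)
      have e: "ent M' i j * complex_of_real (Q j) = complex_of_real (Q i) * ent M' i j" if "i < D" "j < D" for i j
        using that e'[of i j] unfolding ent_times_dg ent_dg_times by simp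
      have "M' * dg D \<chi> = dg D \<chi> * M'"
      proof (rule fop_eq_bddI[of D])
        fix i j assume ij: "i < D" "j < D"
        show "ent (M' * dg D \<chi>) i j = ent (dg D \<chi> * M') i j"
        proof (cases "Q i = Q j")
          case True
          then show ?thesis using ij by (simp add: ent_times_dg ent_dg_times \<chi>_def)
        next
          case False
          then have "ent M' i j = 0" using e[OF ij] by (auto simp: mult.commute)
          then show ?thesis using ij by (simp add: ent_times_dg ent_dg_times)
        qed
      qed (use M(1) v in \<open>auto simp: M'_def\<close>)
      then have "V * (adj V * (M * P) * V) * adj V = V * (adj V * (P * M) * V) * adj V"
        unfolding P_def M'c by simp
      then show ?thesis using M(1) bP v by (simp add: mult.assoc unitary_cancel[OF V])
    qed
    have "tr (\<omega>n * (idn D - P)) = tr (adj V * \<omega>n * V * dg D (\<lambda>x. 1 - \<chi> x))"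
    proof -
      have "idn D - P = V * dg D (\<lambda>x. 1 - \<chi> x) * adj V"
        unfolding P_def dg_minus[symmetric] using v by (simp add: algebra_simps)
      then have "tr (\<omega>n * (idn D - P)) = tr (\<omega>n * V * dg D (\<lambda>x. 1 - \<chi> x) * adj V)" by (simp add: mult.assoc)
      then show ?thesis using tr_mult_commute[of "\<omega>n * V * dg D (\<lambda>x. 1 - \<chi> x)" "adj V"] by (simp add: mult.assoc)
    qed
    also have "\<dots> = (\<Sum>x<D. (\<Prod>m<n. r (e x m)) * (1 - \<chi> x))"
      unfolding \<omega>n' by (simp add: tr_def ctr_bdd[of D] ent_times_dg ent_tp er(1) flip: of_real_prod)
    also have "\<dots> \<le> (\<Sum>x<D. (\<Prod>m<n. r (e x m)) * (if real n * (t + \<delta>) < (\<Sum>m<n. f (e x m)) then 1 else 0)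
        + (\<Prod>m<n. r (e x m)) * (if real n * (- t + \<delta>) < (\<Sum>m<n. - f (e x m)) then 1 else 0))"
    proof (intro sum_mono)
      fix x assume x: "x \<in> {..<D}"
      define R where "R = (\<Prod>m<n. r (e x m))"
      have R0: "0 \<le> R" unfolding R_def by (intro prod_nonneg) (simp add: er)
      have "R * (1 - \<chi> x) \<le> R * (if real n * (t + \<delta>) < (\<Sum>m<n. f (e x m)) then 1 else 0)
        + R * (if real n * (- t + \<delta>) < (\<Sum>m<n. - f (e x m)) then 1 else 0)"
      proof (cases "R = 0 \<or> \<chi> x = 1")
        case True
        then show ?thesis using R0 by (elim disjE) auto
      next
        case False
        \<comment> \<open>A word of positive weight uses only letters with \<open>r > 0\<close>, and
          by the support hypothesis these have \<open>q > 0\<close>. The default value 0 of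
          \<open>f\<close> is therefore never met, and \<open>Q x\<close> is 2 to the power of the
          sum of the \<open>f\<close>.\<close>
        then have "r (e x m) \<noteq> 0" if "m < n" for m using that unfolding R_def by auto
        then have qp: "0 < q (e x m)" if "m < n" for m
          using supp[OF code_lt[OF c _ that, of x], folded \<omega>'_def] q[OF code_lt[OF c _ that, of x]] x that
          by (force simp: er(1))
        have "2 powr (\<Sum>m<n. f (e x m)) = (\<Prod>m<n. 2 powr f (e x m))" by (rule powr_sum) auto
        also have "\<dots> = Q x" unfolding Q_def by (rule prod.cong[OF refl]) (simp add: f_def qp)
        finally have Q: "Q x = 2 powr (\<Sum>m<n. f (e x m))" by simp
        have "\<not> (lo \<le> Q x \<and> Q x \<le> hi)" using False unfolding \<chi>_def by presburger
        then have "real n * (t + \<delta>) < (\<Sum>m<n. f (e x m)) \<or> (\<Sum>m<n. f (e x m)) < real n * (t - \<delta>)"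
          unfolding Q lo_def hi_def by (simp add: not_le) linarith
        moreover have "real n * (- t + \<delta>) < (\<Sum>m<n. - f (e x m)) \<longleftrightarrow> (\<Sum>m<n. f (e x m)) < real n * (t - \<delta>)"
          by (simp add: sum_negf algebra_simps)
        ultimately have "1 - \<chi> x \<le> (if real n * (t + \<delta>) < (\<Sum>m<n. f (e x m)) then 1 else 0)
          + (if real n * (- t + \<delta>) < (\<Sum>m<n. - f (e x m)) then 1 else 0)"
          using \<chi>0[of x] by auto
        from mult_left_mono[OF this R0] show ?thesis by (simp only: distrib_left)
      qed
      then show "(\<Prod>m<n. r (e x m)) * (1 - \<chi> x) \<le> (\<Prod>m<n. r (e x m)) * (if real n * (t + \<delta>) < (\<Sum>m<n. f (e x m)) then 1 else 0)
        + (\<Prod>m<n. r (e x m)) * (if real n * (- t + \<delta>) < (\<Sum>m<n. - f (e x m)) then 1 else 0)"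
        unfolding R_def .
    qed
    also have "\<dots> \<le> c1 ^ n + c2 ^ n" unfolding sum.distrib by (intro add_mono c1(3)[OF c] c2(3)[OF c])
    also have "\<dots> \<le> \<eta>" using n0[OF n] by simp
    finally have tail: "tr (\<omega>n * (idn D - P)) \<le> \<eta>" .
    show "\<exists>P. bdd D P \<and> adj P = P \<and> P * P = P \<and>
      tr (tp D n e (\<lambda>_. \<omega>) * (idn D - P)) \<le> \<eta> \<and>
      P * tp D n e (\<lambda>_. \<tau>) = tp D n e (\<lambda>_. \<tau>) * P \<and>
      2 powr (real n * (t - \<delta>)) *\<^sub>R P \<le> tp D n e (\<lambda>_. \<tau>) * P \<and>
      tp D n e (\<lambda>_. \<tau>) * P \<le> 2 powr (real n * (t + \<delta>)) *\<^sub>R P \<and>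
      (\<forall>M. bdd D M \<longrightarrow> M * tp D n e (\<lambda>_. \<tau>) = tp D n e (\<lambda>_. \<tau>) * M \<longrightarrow> M * P = P * M)"
      unfolding lo_def[symmetric] hi_def[symmetric] \<tau>n_def[symmetric] \<omega>n_def[symmetric]
      using bP PP aP Pt low upp com tail by blast
  qed
qed

section \<open>Smoothing with two noncommuting projections\<close>

lemma conj_sum_le:
  fixes \<omega> X Y :: fop
  assumes "0 \<le> \<omega>" "0 < t"
  shows "(X + Y) * \<omega> * adj (X + Y) \<le> (1 + t) *\<^sub>R (X * \<omega> * adj X) + (1 + 1 / t) *\<^sub>R (Y * \<omega> * adj Y)"
proof -
  \<comment> \<open>Completing the square: the right side of the claim minus its left side is
    exactly \<open>Z * \<omega> * adj Z\<close>.\<close>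
  define Z where "Z = sqrt t *\<^sub>R X - (1 / sqrt t) *\<^sub>R Y"
  have "Z * \<omega> * adj Z = t *\<^sub>R (X * \<omega> * adj X) - X * \<omega> * adj Y - Y * \<omega> * adj X + (1 / t) *\<^sub>R (Y * \<omega> * adj Y)"
    using assms(2) by (simp add: Z_def algebra_simps)
  then have "(1 + t) *\<^sub>R (X * \<omega> * adj X) + (1 + 1 / t) *\<^sub>R (Y * \<omega> * adj Y) - (X + Y) * \<omega> * adj (X + Y) = Z * \<omega> * adj Z"
    by (simp add: algebra_simps)
  then have "0 \<le> (1 + t) *\<^sub>R (X * \<omega> * adj X) + (1 + 1 / t) *\<^sub>R (Y * \<omega> * adj Y) - (X + Y) * \<omega> * adj (X + Y)"
    using conj_psd'[OF assms(1), of Z] by (simp only:)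
  then show ?thesis by (simp only: diff_ge_0_iff_ge)
qed

definition proj_on :: "nat \<Rightarrow> fop \<Rightarrow> bool" where
  "proj_on D P \<longleftrightarrow> bdd D P \<and> adj P = P \<and> P * P = P"

lemma proj_onD: "proj_on D P \<Longrightarrow> bdd D P" "proj_on D P \<Longrightarrow> adj P = P" "proj_on D P \<Longrightarrow> P * P = P"
  by (simp_all add: proj_on_def)

lemma proj_compl: "proj_on D P \<Longrightarrow> proj_on D (idn D - P)"
  by (simp add: proj_on_def algebra_simps)

lemma proj_psd: "proj_on D P \<Longrightarrow> 0 \<le> P" using psd_sq[of P] by (simp add: proj_on_def)
lemma proj_le: "proj_on D P \<Longrightarrow> P \<le> idn D" using proj_psd[OF proj_compl[of D P]] by simp

text \<open>The discarded part splits as \<open>L = (1 - P') + P' (1 - P)\<close>, one summand per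
  projection. Splitting costs a factor 2 and there are two terms, so masses of
  \<open>s^2 / (4 (1 + s))\<close> give \<open>tr (L \<omega> adj L) \<le> s^2 / (1 + s)\<close>,
  which the weight \<open>1 + 1/s = (1 + s)/s\<close> turns into exactly \<open>s\<close>.\<close>

lemma smoothing:
  assumes \<omega>: "bdd D \<omega>" "0 \<le> \<omega>" and P: "proj_on D P" "proj_on D P'" and s: "0 < s"
    and \<eta>: "tr (\<omega> * (idn D - P)) \<le> s\<^sup>2 / (4 * (1 + s))" "tr (\<omega> * (idn D - P')) \<le> s\<^sup>2 / (4 * (1 + s))"
  defines "K \<equiv> P' * P" and "L \<equiv> idn D - P' * P"
  shows "\<omega> \<le> (1 + s) *\<^sub>R (K * \<omega> * adj K) + (1 + 1 / s) *\<^sub>R (L * \<omega> * adj L)"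
    and "(1 + 1 / s) * tr (L * \<omega> * adj L) \<le> s"
proof -
  show "\<omega> \<le> (1 + s) *\<^sub>R (K * \<omega> * adj K) + (1 + 1 / s) *\<^sub>R (L * \<omega> * adj L)"
    using conj_sum_le[OF \<omega>(2) s, of K L] \<omega>(1) by (simp add: K_def L_def del: adj_simps(2-3))
  define A where "A = idn D - P'"
  define B where "B = idn D - P"
  have proj: "proj_on D A" "proj_on D B" unfolding A_def B_def using P by (auto intro: proj_compl)
  have L: "L = A + P' * B" unfolding L_def A_def B_def using P by (simp add: algebra_simps proj_onD)
  have pr: "tr (Q * \<omega> * adj Q) = tr (\<omega> * Q)" if Q: "proj_on D Q" for Q
    using tr_mult_commute[of "Q" "\<omega> * Q"] Q by (simp add: proj_onD[OF Q] mult.assoc)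
  have "tr (L * \<omega> * adj L) \<le> tr ((1 + 1) *\<^sub>R (A * \<omega> * adj A) + (1 + 1 / 1) *\<^sub>R (P' * B * \<omega> * adj (P' * B)))"
    unfolding L by (intro tr_mono conj_sum_le \<omega>) simp
  also have "\<dots> = 2 * tr (A * \<omega> * adj A) + 2 * tr (P' * (B * \<omega> * adj B) * adj P')" by (simp add: mult.assoc)
  also have "tr (P' * (B * \<omega> * adj B) * adj P') = tr (P' * (B * \<omega> * adj B))"
    using tr_mult_commute[of "P' * (B * \<omega> * adj B)" P'] proj_onD[OF P(2)] by (simp add: mult.assoc[symmetric])
  also have "\<dots> \<le> tr (idn D * (B * \<omega> * adj B))"
    by (intro tr_mult_mono proj_le P conj_psd' \<omega>)
  also have "\<dots> = tr (B * \<omega> * adj B)" using \<omega> proj by (simp add: proj_onD)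
  also have "2 * tr (A * \<omega> * adj A) + 2 * tr (B * \<omega> * adj B) \<le> 4 * (s\<^sup>2 / (4 * (1 + s)))"
    using \<eta> pr[OF proj(1)] pr[OF proj(2)] by (simp add: A_def B_def)
  finally have "tr (L * \<omega> * adj L) \<le> 4 * (s\<^sup>2 / (4 * (1 + s)))" by simp
  moreover have "4 * (s\<^sup>2 / (4 * (1 + s))) = s\<^sup>2 / (1 + s)"
    by (simp only: times_divide_eq_right mult_divide_mult_cancel_left)
  ultimately have "tr (L * \<omega> * adj L) \<le> s\<^sup>2 / (1 + s)" by simp
  then have "(1 + 1 / s) * tr (L * \<omega> * adj L) \<le> (1 + 1 / s) * (s\<^sup>2 / (1 + s))"
    using s by (intro mult_left_mono) auto
  also have "\<dots> = (1 + s) / s * (s\<^sup>2 / (1 + s))" using s by (simp add: add_divide_distrib)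
  also have "\<dots> = s" using s by (simp add: power2_eq_square)
  finally show "(1 + 1 / s) * tr (L * \<omega> * adj L) \<le> s" .
qed

lemma smoothing_trace:
  assumes \<omega>: "bdd D \<omega>" "0 \<le> \<omega>" "tr \<omega> = 1" and P: "proj_on D P" "proj_on D P'" and s: "0 < s"
    and \<eta>: "tr (\<omega> * (idn D - P)) \<le> s\<^sup>2 / (4 * (1 + s))" "tr (\<omega> * (idn D - P')) \<le> s\<^sup>2 / (4 * (1 + s))"
  shows "(1 - s) / (1 + s) \<le> tr (P' * P * \<omega> * adj (P' * P))"
proof -
  have "1 \<le> (1 + s) * tr (P' * P * \<omega> * adj (P' * P)) + s"
    using tr_mono[OF smoothing(1)[OF \<omega>(1,2) P s \<eta>]] smoothing(2)[OF \<omega>(1,2) P s \<eta>] \<omega>(3)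
    unfolding tr_simps(2,4) by linarith
  then show ?thesis using s by (simp add: field_simps)
qed

text \<open>Measuring \<open>P'\<close> and then \<open>P\<close> is a single effect
  \<open>P' P P'\<close>. Its acceptance probability is the trace of a smoothed state with the roles
  of the projections exchanged, so \<open>smoothing_trace\<close> bounds it from below.\<close>

lemma sandwich_test:
  assumes P: "proj_on D P" "proj_on D P'"
  shows "0 \<le> P' * P * P'" "P' * P * P' \<le> idn D" "tr (\<omega> * (P' * P * P')) = tr (P * P' * \<omega> * adj (P * P'))"
proof -
  show "0 \<le> P' * P * P'" using conj_psd[OF proj_psd[OF P(1)], of P'] by (simp add: proj_onD[OF P(2)])
  have "P' * P * P' \<le> P' * idn D * P'" using conj_mono[OF proj_le[OF P(1)], of P'] by (simp add: proj_onD[OF P(2)])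
  also have "\<dots> = P'" using P by (simp add: proj_onD)
  finally show "P' * P * P' \<le> idn D" using proj_le[OF P(2)] by (rule order_trans)
  have "tr (P * P' * \<omega> * adj (P * P')) = tr (P * (P' * \<omega> * P' * P))" using P by (simp add: proj_onD mult.assoc)
  also have "\<dots> = tr (P' * (\<omega> * P' * P))" using P tr_mult_commute[of P "P' * \<omega> * P' * P"]
    by (simp add: proj_onD mult.assoc)
  also have "\<dots> = tr (\<omega> * (P' * P * P'))" by (subst tr_mult_commute) (simp add: mult.assoc)
  finally show "tr (\<omega> * (P' * P * P')) = tr (P * P' * \<omega> * adj (P * P'))" by simp
qed

text \<open>The choice \<open>S = adj (X - Y)\<close> makes the squared Hilbert-Schmidt norm of the
  difference vanish. Partial traces are identified in this way, by testing.\<close>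

lemma tr_nondegenerate:
  assumes "bdd D X" "bdd D Y" "\<And>S. bdd D S \<Longrightarrow> tr (S * X) = tr (S * Y)"
  shows "X = Y"
proof -
  define Z where "Z = X - Y"
  have Z: "bdd D Z" using assms by (simp add: Z_def)
  have "tr (adj Z * Z) = 0" using assms(3)[of "adj Z"] Z by (simp add: Z_def right_diff_distrib del: adj_simps)
  also have "tr (adj Z * Z) = (\<Sum>j<D. \<Sum>i<D. (cmod (ent Z i j))\<^sup>2)"
  proof -
    have "cnj z * z = complex_of_real ((cmod z)\<^sup>2)" for z unfolding complex_norm_square by (rule mult.commute)
    then have "ent (adj Z * Z) j j = complex_of_real (\<Sum>i<D. (cmod (ent Z i j))\<^sup>2)" for j
      by (simp add: ent_times_right[OF Z] ent_adj)
    then show ?thesis using Z by (simp add: tr_def ctr_bdd[of D])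
  qed
  finally have "\<forall>j\<in>{..<D}. (\<Sum>i<D. (cmod (ent Z i j))\<^sup>2) = 0"
    by (subst (asm) sum_nonneg_eq_0_iff) (auto intro: sum_nonneg)
  then have "\<forall>j\<in>{..<D}. \<forall>i\<in>{..<D}. (cmod (ent Z i j))\<^sup>2 = 0"
    by (subst (asm) sum_nonneg_eq_0_iff) auto
  then have "Z = 0" by (intro fop_eq_bddI[OF Z]) (auto simp: ent_simps)
  then show ?thesis by (simp add: Z_def)
qed

subsection \<open>Bipartite index sets\<close>

text \<open>An index set of size \<open>D\<close> identified with a product through \<open>\<iota>\<close>, without fixing the ordering.\<close>

definition bip :: "nat \<Rightarrow> nat \<Rightarrow> nat \<Rightarrow> (nat \<Rightarrow> nat) \<Rightarrow> (nat \<Rightarrow> nat) \<Rightarrow> (nat \<Rightarrow> nat \<Rightarrow> nat) \<Rightarrow> bool" where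
  "bip D DX DY \<pi>X \<pi>Y \<iota> \<longleftrightarrow>
    (\<forall>z<D. \<pi>X z < DX \<and> \<pi>Y z < DY \<and> \<iota> (\<pi>X z) (\<pi>Y z) = z) \<and>
    (\<forall>x<DX. \<forall>y<DY. \<iota> x y < D \<and> \<pi>X (\<iota> x y) = x \<and> \<pi>Y (\<iota> x y) = y)"

definition ten :: "nat \<Rightarrow> (nat \<Rightarrow> nat) \<Rightarrow> (nat \<Rightarrow> nat) \<Rightarrow> fop \<Rightarrow> fop \<Rightarrow> fop" where
  "ten D \<pi>X \<pi>Y A B = mkop D (\<lambda>z w. ent A (\<pi>X z) (\<pi>X w) * ent B (\<pi>Y z) (\<pi>Y w))"

text \<open>The partial trace over the first factor. Since \<open>\<iota>\<close> is a parameter,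
  the same operator can be traced along different cuts: \<open>marg\<close> removes the output,
  \<open>pY\<close> removes \<open>A'A\<close>.\<close>

definition ptr :: "nat \<Rightarrow> nat \<Rightarrow> (nat \<Rightarrow> nat \<Rightarrow> nat) \<Rightarrow> fop \<Rightarrow> fop" where
  "ptr DX DY \<iota> M = mkop DY (\<lambda>y y'. \<Sum>x<DX. ent M (\<iota> x y) (\<iota> x y'))"

lemma bipD:
  assumes "bip D DX DY \<pi>X \<pi>Y \<iota>"
  shows "z < D \<Longrightarrow> \<pi>X z < DX" "z < D \<Longrightarrow> \<pi>Y z < DY" "z < D \<Longrightarrow> \<iota> (\<pi>X z) (\<pi>Y z) = z"
    "x < DX \<Longrightarrow> y < DY \<Longrightarrow> \<iota> x y < D" "x < DX \<Longrightarrow> y < DY \<Longrightarrow> \<pi>X (\<iota> x y) = x" "x < DX \<Longrightarrow> y < DY \<Longrightarrow> \<pi>Y (\<iota> x y) = y"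
  using assms unfolding bip_def by auto

lemma bip_swap: "bip D DX DY \<pi>X \<pi>Y \<iota> \<Longrightarrow> bip D DY DX \<pi>Y \<pi>X (\<lambda>y x. \<iota> x y)"
  unfolding bip_def by auto

lemma bip_div_mod: "bip (a * b) a b (\<lambda>z. z div b) (\<lambda>z. z mod b) (\<lambda>x y. x * b + y)"
proof (cases "b = 0")
  case False
  have "x * b + y < a * b" if "x < a" "y < b" for x y
  proof -
    have "x * b + y < Suc x * b" using that by simp
    also have "\<dots> \<le> a * b" using that by (intro mult_le_mono1) simp
    finally show ?thesis .
  qed
  then show ?thesis using False by (auto simp: bip_def less_mult_imp_div_less)
qed (simp add: bip_def)

lemma bip_bij: "bip D DX DY \<pi>X \<pi>Y \<iota> \<Longrightarrow> bij_betw (\<lambda>(x,y). \<iota> x y) ({..<DX} \<times> {..<DY}) {..<D}"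
  unfolding bip_def by (intro bij_betwI[where g = "\<lambda>z. (\<pi>X z, \<pi>Y z)"]) auto

lemma bip_card: assumes "bip D DX DY \<pi>X \<pi>Y \<iota>" shows "D = DX * DY"
  using bij_betw_same_card[OF bip_bij[OF assms]] by (simp add: card_cartesian_product)

lemma sum_bip: assumes "bip D DX DY \<pi>X \<pi>Y \<iota>" shows "(\<Sum>z<D. f z) = (\<Sum>x<DX. \<Sum>y<DY. f (\<iota> x y))"
proof -
  have "(\<Sum>z<D. f z) = (\<Sum>p\<in>{..<DX} \<times> {..<DY}. f (case p of (x,y) \<Rightarrow> \<iota> x y))"
    by (rule sum.reindex_bij_betw[OF bip_bij[OF assms], symmetric])
  then show ?thesis by (simp add: sum.cartesian_product case_prod_unfold)
qed

lemma bdd_ten [simp]: "bdd D (ten D \<pi>X \<pi>Y A B)" by (simp add: ten_def)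
lemma bdd_ptr [simp]: "bdd DY (ptr DX DY \<iota> M)" by (simp add: ptr_def)
lemma ent_ten: "ent (ten D \<pi>X \<pi>Y A B) z w = (if z < D \<and> w < D then ent A (\<pi>X z) (\<pi>X w) * ent B (\<pi>Y z) (\<pi>Y w) else 0)"
  by (simp add: ten_def ent_mkop)
lemma ent_ptr: "ent (ptr DX DY \<iota> M) y y' = (if y < DY \<and> y' < DY then \<Sum>x<DX. ent M (\<iota> x y) (\<iota> x y') else 0)"
  by (simp add: ptr_def ent_mkop)

lemma ten_linear:
  "ten D \<pi>X \<pi>Y A (B + C) = ten D \<pi>X \<pi>Y A B + ten D \<pi>X \<pi>Y A C"
  "ten D \<pi>X \<pi>Y A (B - C) = ten D \<pi>X \<pi>Y A B - ten D \<pi>X \<pi>Y A C"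
  "ten D \<pi>X \<pi>Y A (r *\<^sub>R B) = r *\<^sub>R ten D \<pi>X \<pi>Y A B"
  "ten D \<pi>X \<pi>Y A 0 = 0"
  "ten D \<pi>X \<pi>Y (A + A') B = ten D \<pi>X \<pi>Y A B + ten D \<pi>X \<pi>Y A' B"
  "ten D \<pi>X \<pi>Y 0 B = 0"
  by (auto intro!: fop_eqI simp: ent_ten ent_simps algebra_simps)

lemma ptr_linear:
  "ptr DX DY \<iota> (A + B) = ptr DX DY \<iota> A + ptr DX DY \<iota> B"
  "ptr DX DY \<iota> (r *\<^sub>R A) = r *\<^sub>R ptr DX DY \<iota> A"
  by (auto intro!: fop_eqI simp: ent_ptr ent_simps sum.distrib scaleR_sum_right)

lemma ten_adj: "adj (ten D \<pi>X \<pi>Y A B) = ten D \<pi>X \<pi>Y (adj A) (adj B)"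
  by (rule fop_eqI) (simp add: ent_ten ent_adj)

context
  fixes D DX DY \<pi>X \<pi>Y \<iota>
  assumes bip: "bip D DX DY \<pi>X \<pi>Y \<iota>"
begin

abbreviation (input) "tn \<equiv> ten D \<pi>X \<pi>Y"
abbreviation (input) "pt \<equiv> ptr DX DY \<iota>"

lemma ten_times:
  assumes "bdd DX A" "bdd DY B"
  shows "tn A B * tn A' B' = tn (A * A') (B * B')"
proof (rule fop_eq_bddI[of D])
  fix z w assume zw: "z < D" "w < D"
  have "ent (tn A B * tn A' B') z w = (\<Sum>x<DX. \<Sum>y<DY.
     (ent A (\<pi>X z) x * ent A' x (\<pi>X w)) * (ent B (\<pi>Y z) y * ent B' y (\<pi>Y w)))"
    unfolding ent_times_left[OF bdd_ten] sum_bip[OF bip]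
    by (intro sum.cong refl) (use zw bipD[OF bip] in \<open>simp add: ent_ten mult_ac\<close>)
  also have "\<dots> = ent (tn (A * A') (B * B')) z w"
    using zw assms by (simp add: ent_ten ent_times_left[of DX A] ent_times_left[of DY B] sum_product)
  finally show "ent (tn A B * tn A' B') z w = ent (tn (A * A') (B * B')) z w" .
qed auto

lemma ten_dg: "tn (dg DX f) (dg DY g) = dg D (\<lambda>z. f (\<pi>X z) * g (\<pi>Y z))"
proof (rule fop_eq_bddI[of D])
  fix z w assume zw: "z < D" "w < D"
  have "z = w \<longleftrightarrow> \<pi>X z = \<pi>X w \<and> \<pi>Y z = \<pi>Y w" using bipD(3)[OF bip] zw by metis
  then show "ent (tn (dg DX f) (dg DY g)) z w = ent (dg D (\<lambda>z. f (\<pi>X z) * g (\<pi>Y z))) z w"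
    using zw bipD[OF bip] by (auto simp: ent_ten ent_dg)
qed auto

lemma ten_idn: "tn (idn DX) (idn DY) = idn D" using ten_dg[of "\<lambda>_. 1" "\<lambda>_. 1"] by simp

lemma ten_unitary: "unitary_on DX A \<Longrightarrow> unitary_on DY B \<Longrightarrow> unitary_on D (tn A B)"
  by (simp add: unitary_on_def ten_adj ten_times ten_idn)

lemma ten_psd:
  assumes "bdd DX A" "bdd DY B" "0 \<le> A" "0 \<le> B"
  shows "0 \<le> tn A B"
proof -
  obtain R S where R: "bdd DX R" "0 \<le> R" "R * R = A" and S: "bdd DY S" "0 \<le> S" "S * S = B"
    using psd_sqrt assms by metis
  have "adj (tn R S) * tn R S = tn A B"
    using R S by (simp add: ten_adj ten_times psd_adj)
  then show ?thesis using psd_sq by metis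
qed

lemma ten_mono: "bdd DX A \<Longrightarrow> bdd DY B \<Longrightarrow> bdd DY C \<Longrightarrow> 0 \<le> A \<Longrightarrow> B \<le> C \<Longrightarrow> tn A B \<le> tn A C"
  using ten_psd[of A "C - B"] by (simp add: ten_linear)

lemma idn_psd: "0 \<le> idn k" by (rule dg_psd) simp

lemma ctr_ptr: assumes "bdd D M" shows "ctr (pt M) = ctr M"
  using assms by (simp add: ctr_bdd[of D] ctr_bdd[OF bdd_ptr] ent_ptr sum_bip[OF bip]) (rule sum.swap)

lemma tr_ptr: "bdd D M \<Longrightarrow> tr (pt M) = tr M" by (simp add: tr_def ctr_ptr)

lemma tr_lift: assumes "bdd DY S" "bdd D M" shows "tr (tn (idn DX) S * M) = tr (S * pt M)"
proof -
  have "pt (tn (idn DX) S * M) = S * pt M"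
  proof (rule fop_eq_bddI[of DY])
    fix y y' assume y: "y < DY" "y' < DY"
    have "ent (tn (idn DX) S * M) (\<iota> x y) (\<iota> x y') = (\<Sum>b<DY. ent S y b * ent M (\<iota> x b) (\<iota> x y'))" if x: "x < DX" for x
    proof -
      have "ent (tn (idn DX) S * M) (\<iota> x y) (\<iota> x y')
        = (\<Sum>a<DX. \<Sum>b<DY. (if a = x then ent S y b * ent M (\<iota> x b) (\<iota> x y') else 0))"
        unfolding ent_times_left[OF bdd_ten] sum_bip[OF bip]
        by (intro sum.cong refl) (use x y bipD[OF bip] in \<open>auto simp: ent_ten ent_dg\<close>)
      also have "\<dots> = (\<Sum>b<DY. \<Sum>a<DX. (if a = x then ent S y b * ent M (\<iota> x b) (\<iota> x y') else 0))"
        by (rule sum.swap)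
      finally show ?thesis using x by (simp add: sum.delta)
    qed
    then have "ent (pt (tn (idn DX) S * M)) y y' = (\<Sum>x<DX. \<Sum>b<DY. ent S y b * ent M (\<iota> x b) (\<iota> x y'))"
      using y by (simp add: ent_ptr)
    also have "\<dots> = (\<Sum>b<DY. \<Sum>x<DX. ent S y b * ent M (\<iota> x b) (\<iota> x y'))" by (rule sum.swap)
    also have "\<dots> = ent (S * pt M) y y'"
      using y by (simp add: ent_times_left[OF assms(1)] ent_ptr sum_distrib_left)
    finally show "ent (pt (tn (idn DX) S * M)) y y' = ent (S * pt M) y y'" .
  qed (use assms in auto)
  then show ?thesis using tr_ptr[of "tn (idn DX) S * M"] assms by simp
qed

text \<open>Tested against \<open>S\<close> through \<open>tr_lift\<close>: the unitary on the
  traced-out factor meets its adjoint in \<open>adj (tn A B) * tn (idn DX) S * tn A B\<close> and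
  cancels.\<close>

lemma ptr_conj:
  assumes A: "unitary_on DX A" and B: "bdd DY B" and M: "bdd D M"
  shows "pt (tn A B * M * adj (tn A B)) = B * pt M * adj B"
proof (rule tr_nondegenerate[of DY])
  fix S assume S: "bdd DY S"
  note a = unitary_onD[OF A]
  have "adj (tn A B) * (tn (idn DX) S * tn A B) = tn (idn DX) (adj B * (S * B))"
    using a B S by (simp add: ten_adj ten_times)
  moreover have "tr (tn (idn DX) S * (tn A B * M * adj (tn A B))) = tr (adj (tn A B) * (tn (idn DX) S * tn A B) * M)"
    using tr_mult_commute[of "tn (idn DX) S * tn A B * M" "adj (tn A B)"] by (simp add: mult.assoc)
  ultimately have "tr (S * pt (tn A B * M * adj (tn A B))) = tr (adj B * (S * B) * pt M)"
    using S B M by (simp add: tr_lift[symmetric])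
  then show "tr (S * pt (tn A B * M * adj (tn A B))) = tr (S * (B * pt M * adj B))"
    using tr_mult_commute[of "adj B" "S * B * pt M"] by (simp add: mult.assoc)
qed (use assms in auto)

lemma ten_sum: "finite I \<Longrightarrow> tn A (\<Sum>i\<in>I. B i) = (\<Sum>i\<in>I. tn A (B i))"
  "finite I \<Longrightarrow> tn (\<Sum>i\<in>I. B i) A = (\<Sum>i\<in>I. tn (B i) A)"
  by (induction I rule: finite_induct) (simp_all add: ten_linear)

text \<open>A pinching inequality: \<open>M\<close> is at most \<open>DX\<close> times the sum of
  its diagonal blocks \<open>P x * M * P x\<close>, and every such block is below the sum of all
  blocks, which is the partial trace.\<close>

lemma psd_le_lift_ptr:
  assumes M: "bdd D M" "0 \<le> M"
  shows "0 \<le> pt M" "M \<le> real DX *\<^sub>R tn (idn DX) (pt M)"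
proof -
  define P where "P = (\<lambda>x. dg D (\<lambda>z. if \<pi>X z = x then 1 else 0))"
  define E where "E = (\<lambda>x. dg DX (\<lambda>i. if i = x then 1 else 0))"
  define B where "B = (\<lambda>x. mkop DY (\<lambda>y y'. ent M (\<iota> x y) (\<iota> x y')))"
  have block: "P x * M * P x = tn (E x) (B x)" if "x < DX" for x
  proof (rule fop_eq_bddI[of D])
    fix z w assume "z < D" "w < D"
    then show "ent (P x * M * P x) z w = ent (tn (E x) (B x)) z w"
      using bipD[OF bip, of z] bipD[OF bip, of w] that
      by (auto simp: P_def E_def B_def ent_times_dg ent_dg_times ent_ten ent_dg ent_mkop)
  qed (use M in \<open>auto simp: P_def\<close>)
  have Bp: "0 \<le> B x" if x: "x < DX" for x unfolding psd_iff
  proof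
    fix v
    have "qf M (\<lambda>z. if \<pi>X z = x then v (\<pi>Y z) else 0)
      = (\<Sum>a<DX. \<Sum>y<DY. \<Sum>a'<DX. \<Sum>y'<DY. if a' = x then if a = x then cnj (v y) * ent M (\<iota> x y) (\<iota> x y') * v y' else 0 else 0)"
      unfolding qf_bdd[OF M(1)] sum_bip[OF bip]
      by (intro sum.cong refl) (use bipD[OF bip] in auto)
    also have "\<dots> = (\<Sum>a<DX. \<Sum>y<DY. \<Sum>y'<DY. \<Sum>a'<DX. if a' = x then if a = x then cnj (v y) * ent M (\<iota> x y) (\<iota> x y') * v y' else 0 else 0)"
      by (rule sum.cong[OF refl], rule sum.cong[OF refl], rule sum.swap)
    also have "\<dots> = (\<Sum>a<DX. \<Sum>y<DY. if a = x then (\<Sum>y'<DY. cnj (v y) * ent M (\<iota> x y) (\<iota> x y') * v y') else 0)"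
      using x by (intro sum.cong refl) (auto simp: sum.delta)
    also have "\<dots> = (\<Sum>y<DY. \<Sum>a<DX. if a = x then (\<Sum>y'<DY. cnj (v y) * ent M (\<iota> x y) (\<iota> x y') * v y') else 0)"
      by (rule sum.swap)
    also have "\<dots> = qf (B x) v"
      using x by (simp add: sum.delta B_def qf_bdd[OF bdd_mkop] ent_mkop)
    finally show "0 \<le> qf (B x) v" using M(2) unfolding psd_iff by metis
  qed
  have pt: "pt M = (\<Sum>x<DX. B x)"
  proof -
    have "ent (\<Sum>x\<in>I. B x) y y' = (\<Sum>x\<in>I. ent (B x) y y')" if "finite I" for I y y'
      using that by (induction I rule: finite_induct) (simp_all add: ent_simps)
    then have s: "ent (\<Sum>x<DX. B x) y y' = (\<Sum>x<DX. ent (B x) y y')" for y y' by simp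
    show ?thesis
    proof (rule fop_eqI)
      fix y y' show "ent (ptr DX DY \<iota> M) y y' = ent (\<Sum>x<DX. B x) y y'"
        unfolding s by (cases "y < DY \<and> y' < DY") (auto simp: ent_ptr B_def ent_mkop)
    qed
  qed
  show "0 \<le> pt M" unfolding pt by (intro sum_nonneg Bp) auto
  have bB: "bdd DY (B x)" for x by (simp add: B_def)
  have bE: "bdd DX (E x)" "0 \<le> E x" for x unfolding E_def by (auto intro: dg_psd)
  have dgsum: "(\<Sum>x\<in>I. dg k (f x)) = dg k (\<lambda>i. \<Sum>x\<in>I. f x i)" if "finite I" for I k and f :: "nat \<Rightarrow> nat \<Rightarrow> real"
    using that by (induction I rule: finite_induct) (auto intro!: fop_eqI simp: dg_plus ent_dg ent_simps)
  have sE: "(\<Sum>x<DX. E x) = idn DX" unfolding E_def by (subst dgsum) (auto intro!: dg_cong)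
  have sP: "(\<Sum>x<DX. P x) = idn D" unfolding P_def by (subst dgsum) (auto intro!: dg_cong dest: bipD(1)[OF bip])
  have diag: "(\<Sum>x<DX. P x * M * P x) \<le> tn (idn DX) (pt M)"
  proof -
    have "(\<Sum>x<DX. P x * M * P x) = (\<Sum>x<DX. tn (E x) (B x))" by (intro sum.cong) (auto simp: block)
    also have "\<dots> \<le> (\<Sum>x<DX. tn (E x) (pt M))"
    proof (intro sum_mono ten_mono bE bB bdd_ptr)
      fix x assume "x \<in> {..<DX}"
      then show "B x \<le> pt M" unfolding pt using Bp by (subst sum.remove[of _ x]) (auto intro!: sum_nonneg)
    qed
    also have "\<dots> = tn (idn DX) (pt M)" by (simp add: ten_sum(2)[symmetric] sE)
    finally show ?thesis .
  qed
  have aP: "adj (P x) = P x" for x by (simp add: P_def)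
  \<comment> \<open>Expanding the squares over all pairs gives twice \<open>DX\<close> times the
    pinched operator minus twice \<open>M\<close>, since the projections sum to the
    identity.\<close>
  have "0 \<le> (\<Sum>x<DX. \<Sum>y<DX. (P x - P y) * M * adj (P x - P y))"
    by (intro sum_nonneg conj_psd' M(2))
  also have "\<dots> = (\<Sum>x<DX. \<Sum>y<DX. P x * M * P x + P y * M * P y - P x * M * P y - P y * M * P x)"
    by (simp add: aP algebra_simps)
  also have "\<dots> = (\<Sum>x<DX. \<Sum>y<DX. P x * M * P x) + (\<Sum>x<DX. \<Sum>y<DX. P y * M * P y)
      - (\<Sum>x<DX. \<Sum>y<DX. P x * M * P y) - (\<Sum>x<DX. \<Sum>y<DX. P y * M * P x)"
    by (simp only: sum.distrib sum_subtractf)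
  also have "(\<Sum>x<DX. \<Sum>y<DX. P y * M * P x) = (\<Sum>x<DX. \<Sum>y<DX. P x * M * P y)" by (rule sum.swap)
  also have "(\<Sum>x<DX. \<Sum>y<DX. P x * M * P y) = (\<Sum>x<DX. P x) * M * (\<Sum>y<DX. P y)"
    by (simp only: sum_distrib_left sum_distrib_right) (rule sum.swap)
  also have "\<dots> = M" using M by (simp add: sP)
  also have "(\<Sum>x<DX. \<Sum>y<DX. P x * M * P x) = real DX *\<^sub>R (\<Sum>x<DX. P x * M * P x)"
    by (simp add: sum_constant_scaleR scaleR_sum_right)
  also have "(\<Sum>x<DX. \<Sum>y<DX. P y * M * P y) = real DX *\<^sub>R (\<Sum>x<DX. P x * M * P x)"
    by (simp add: sum_constant_scaleR)
  finally have "0 \<le> 2 *\<^sub>R (real DX *\<^sub>R (\<Sum>x<DX. P x * M * P x) - M)"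
    unfolding scaleR_2 by (simp only: algebra_simps)
  from scaleR_nonneg_nonneg[OF _ this, of "1/2"]
  have "M \<le> real DX *\<^sub>R (\<Sum>x<DX. P x * M * P x)" by simp
  also have "\<dots> \<le> real DX *\<^sub>R tn (idn DX) (pt M)" by (intro scaleR_left_mono diag) auto
  finally show "M \<le> real DX *\<^sub>R tn (idn DX) (pt M)" .
qed

end

section \<open>Codes and tensor powers across a bipartite cut\<close>

lemma code_card: assumes "code d n D e" shows "D = d ^ n"
  using bij_betw_same_card[OF assms[unfolded code_def]] by (simp add: card_PiE)

text \<open>Injectivity is checked in each factor and surjectivity follows by counting. Leaving the
  bijections of indices and of letters free covers both the block order of \<open>pairc\<close> and
  the mixed order of \<open>eC\<close>.\<close>

lemma code_bip:
  assumes b: "bip D DX DY \<pi>X \<pi>Y \<iota>" and b0: "bip d dX dY p0 q0 \<iota>0"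
    and cX: "code dX n DX eX" and cY: "code dY n DY eY"
    and e: "\<And>z m. z < D \<Longrightarrow> m < n \<Longrightarrow> e z m = \<iota>0 (eX (\<pi>X z) m) (eY (\<pi>Y z) m)"
  shows "code d n D e"
proof -
  have lt: "e z m < d" if "z < D" "m < n" for z m
    using that bipD[OF b] code_lt[OF cX] code_lt[OF cY] bipD(4)[OF b0] by (auto simp: e)
  have "inj_on (\<lambda>x. restrict (e x) {..<n}) {..<D}"
  proof (rule inj_onI)
    fix z w assume z: "z \<in> {..<D}" "w \<in> {..<D}" and eq: "restrict (e z) {..<n} = restrict (e w) {..<n}"
    have "eX (\<pi>X z) m = eX (\<pi>X w) m \<and> eY (\<pi>Y z) m = eY (\<pi>Y w) m" if "m < n" for m
    proof -
      have "e z m = e w m" using fun_cong[OF eq, of m] that by simp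
      then have "\<iota>0 (eX (\<pi>X z) m) (eY (\<pi>Y z) m) = \<iota>0 (eX (\<pi>X w) m) (eY (\<pi>Y w) m)" using e z that by simp
      then show ?thesis using z that bipD[OF b] code_lt[OF cX] code_lt[OF cY] bipD(5,6)[OF b0]
        by (metis lessThan_iff)
    qed
    then have "\<pi>X z = \<pi>X w" "\<pi>Y z = \<pi>Y w"
      using code_inj[OF cX, of "\<pi>X z" "\<pi>X w"] code_inj[OF cY, of "\<pi>Y z" "\<pi>Y w"] z bipD[OF b] by auto
    then show "z = w" using bipD(3)[OF b] z by (metis lessThan_iff)
  qed
  moreover have "(\<lambda>x. restrict (e x) {..<n}) ` {..<D} \<subseteq> {..<n} \<rightarrow>\<^sub>E {..<d}"
    by (intro image_subsetI iffD2[OF restrict_PiE_iff]) (use lt in auto)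
  moreover have "card ({..<n} \<rightarrow>\<^sub>E {..<d}) = card {..<D}"
    by (simp add: card_PiE bip_card[OF b] bip_card[OF b0] code_card[OF cX] code_card[OF cY] power_mult_distrib)
  ultimately show ?thesis unfolding code_def
    by (simp add: bij_betw_def card_image card_subset_eq finite_PiE)
qed

lemma ptr_tp:
  assumes b: "bip D DX DY \<pi>X \<pi>Y \<iota>" and b0: "bip d dX dY p0 q0 \<iota>0"
    and cX: "code dX n DX eX" and cY: "code dY n DY eY"
    and e: "\<And>z m. z < D \<Longrightarrow> m < n \<Longrightarrow> e z m = \<iota>0 (eX (\<pi>X z) m) (eY (\<pi>Y z) m)"
  shows "ptr DX DY \<iota> (tp D n e A) = tp DY n eY (\<lambda>m. ptr dX dY \<iota>0 (A m))"
proof (rule fop_eq_bddI[of DY])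
  fix y y' assume y: "y < DY" "y' < DY"
  have "ent (ptr DX DY \<iota> (tp D n e A)) y y'
    = (\<Sum>x<DX. \<Prod>m<n. ent (A m) (\<iota>0 (eX x m) (eY y m)) (\<iota>0 (eX x m) (eY y' m)))"
    using y bipD[OF b] by (auto simp: ent_ptr ent_tp e intro!: sum.cong prod.cong)
  also have "\<dots> = (\<Prod>m<n. \<Sum>a<dX. ent (A m) (\<iota>0 a (eY y m)) (\<iota>0 a (eY y' m)))" by (rule sum_code[OF cX])
  also have "\<dots> = ent (tp DY n eY (\<lambda>m. ptr dX dY \<iota>0 (A m))) y y'"
    using y code_lt[OF cY] by (auto simp: ent_ptr ent_tp intro!: prod.cong)
  finally show "ent (ptr DX DY \<iota> (tp D n e A)) y y' = ent (tp DY n eY (\<lambda>m. ptr dX dY \<iota>0 (A m))) y y'" .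
qed auto

lemma ten_tp:
  assumes b: "bip D DX DY \<pi>X \<pi>Y \<iota>" and b0: "bip d dX dY p0 q0 \<iota>0"
    and cX: "code dX n DX eX" and cY: "code dY n DY eY"
    and e: "\<And>z m. z < D \<Longrightarrow> m < n \<Longrightarrow> e z m = \<iota>0 (eX (\<pi>X z) m) (eY (\<pi>Y z) m)"
  shows "tp D n e (\<lambda>m. ten d p0 q0 (A m) (B m)) = ten D \<pi>X \<pi>Y (tp DX n eX A) (tp DY n eY B)"
proof (rule fop_eq_bddI[of D])
  fix z w assume zw: "z < D" "w < D"
  have *: "eX (\<pi>X v) m < dX" "eY (\<pi>Y v) m < dY" if "v < D" "m < n" for v m
    using that bipD[OF b] code_lt[OF cX] code_lt[OF cY] by auto
  have "ent (ten d p0 q0 (A m) (B m)) (e z m) (e w m)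
    = ent (A m) (eX (\<pi>X z) m) (eX (\<pi>X w) m) * ent (B m) (eY (\<pi>Y z) m) (eY (\<pi>Y w) m)" if "m < n" for m
    using that zw * bipD[OF b0] by (simp add: ent_ten e)
  then show "ent (tp D n e (\<lambda>m. ten d p0 q0 (A m) (B m))) z w
    = ent (ten D \<pi>X \<pi>Y (tp DX n eX A) (tp DY n eY B)) z w"
    using zw bipD[OF b] by (simp add: ent_tp ent_ten prod.distrib)
qed auto

lemma codeI:
  assumes "\<And>x m. x < D \<Longrightarrow> m < n \<Longrightarrow> e x m < d" "D = d ^ n"
    and "\<And>x y. x < D \<Longrightarrow> y < D \<Longrightarrow> (\<And>m. m < n \<Longrightarrow> e x m = e y m) \<Longrightarrow> x = y"
  shows "code d n D e"
proof -
  have "inj_on (\<lambda>x. restrict (e x) {..<n}) {..<D}"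
  proof (rule inj_onI)
    fix x y assume "x \<in> {..<D}" "y \<in> {..<D}" and eq: "restrict (e x) {..<n} = restrict (e y) {..<n}"
    moreover have "e x m = e y m" if "m < n" for m using fun_cong[OF eq, of m] that by simp
    ultimately show "x = y" using assms(3) by simp
  qed
  moreover have "(\<lambda>x. restrict (e x) {..<n}) ` {..<D} \<subseteq> {..<n} \<rightarrow>\<^sub>E {..<d}"
    by (intro image_subsetI iffD2[OF restrict_PiE_iff]) (use assms(1) in auto)
  ultimately show ?thesis unfolding code_def
    by (simp add: bij_betw_def card_image card_subset_eq finite_PiE card_PiE assms(2))
qed

lemma code_digit:
  assumes "0 < d"
  shows "code d n (d ^ n) (\<lambda>x m. q_digit d n m x)"
proof (rule codeI)
  fix x y assume x: "x < d ^ n" and y: "y < d ^ n" and eq: "\<And>m. m < n \<Longrightarrow> q_digit d n m x = q_digit d n m y"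
  \<comment> \<open>Digits are listed from the most significant one, so agreement of the leading
    \<open>j\<close> digits is equality of these quotients; at \<open>j = n\<close> the divisor is
    1.\<close>
  have "x div d ^ (n - j) = y div d ^ (n - j)" if "j \<le> n" for j
    using that
  proof (induction j)
    case 0
    then show ?case using x y by simp
  next
    case (Suc j)
    have p: "d ^ (n - j) = d ^ (n - Suc j) * d"
      using Suc.prems by (metis Suc_diff_Suc Suc_le_lessD power_Suc2)
    have s: "z div d ^ (n - Suc j) = z div d ^ (n - j) * d + q_digit d n j z" for z
      unfolding p div_mult2_eq by (simp add: q_digit_def)
    show ?case unfolding s[of x] s[of y] using Suc eq[of j] by simp
  qed
  from this[of n] show "x = y" by simp
qed (use assms in \<open>auto simp: q_digit_def\<close>)

definition pairc :: "nat \<Rightarrow> nat \<Rightarrow> (nat \<Rightarrow> nat \<Rightarrow> nat) \<Rightarrow> (nat \<Rightarrow> nat \<Rightarrow> nat) \<Rightarrow> nat \<Rightarrow> nat \<Rightarrow> nat" where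
  "pairc d2 D2 e1 e2 z m = e1 (z div D2) m * d2 + e2 (z mod D2) m"

lemma code_pair: "code d1 n D1 e1 \<Longrightarrow> code d2 n D2 e2 \<Longrightarrow> code (d1 * d2) n (D1 * D2) (pairc d2 D2 e1 e2)"
  by (rule code_bip[OF bip_div_mod bip_div_mod]) (simp_all add: pairc_def)

definition dgt :: "nat \<Rightarrow> nat \<Rightarrow> nat \<Rightarrow> nat \<Rightarrow> nat" where "dgt d n x m = q_digit d n m x"

lemma code_dgt: "0 < d \<Longrightarrow> code d n (d ^ n) (dgt d n)"
  using code_digit[of d n] by (simp add: dgt_def[abs_def])

lemma q_bip_idx_pairc: "q_bip_idx dX dY n m x = pairc dY (dY ^ n) (dgt dX n) (dgt dY n) x m"
  by (simp add: q_bip_idx_def pairc_def dgt_def)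

lemma mod_less_prod: "(z::nat) < a * b \<Longrightarrow> z mod b < b"
  by (cases "b = 0") auto

lemma div_less_prod: "(z::nat) < a * b \<Longrightarrow> z div b < a"
  by (rule less_mult_imp_div_less)

lemma idx_less: "x < a \<Longrightarrow> y < b \<Longrightarrow> x * b + y < a * (b::nat)"
  using bipD(4)[OF bip_div_mod] by blast

subsection \<open>Channels and Choi matrices\<close>

text \<open>Unnormalized and in the order input, output, in contrast to \<open>q_choi\<close>. With
  this scaling trace preservation is \<open>marg din dout C = idn din\<close>, and tensor powers
  carry no normalizing factors.\<close>

definition choi :: "nat \<Rightarrow> nat \<Rightarrow> (cmat \<Rightarrow> cmat) \<Rightarrow> fop" where
  "choi din dout N = mkop (din * dout)
    (\<lambda>z w. N (q_ketbra din (z div dout) (w div dout)) $$ (z mod dout, w mod dout))"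

definition chan :: "nat \<Rightarrow> nat \<Rightarrow> fop \<Rightarrow> cmat \<Rightarrow> cmat" where
  "chan din dout C X = mat dout dout
    (\<lambda>(i,j). \<Sum>k<din. \<Sum>l<din. X $$ (k,l) * ent C (k * dout + i) (l * dout + j))"

text \<open>The map id tensor channel, written through its Choi matrix. It is defined for arbitrary
  \<open>C\<close> and linear in it, so an inequality between Choi operators transfers to the
  outputs of every input state.\<close>

definition act :: "nat \<Rightarrow> nat \<Rightarrow> nat \<Rightarrow> fop \<Rightarrow> fop \<Rightarrow> fop" where
  "act k din dout C X = mkop (k * dout) (\<lambda>z w. \<Sum>a<din. \<Sum>b<din.
    ent X (z div dout * din + a) (w div dout * din + b) * ent C (a * dout + z mod dout) (b * dout + w mod dout))"

abbreviation marg :: "nat \<Rightarrow> nat \<Rightarrow> fop \<Rightarrow> fop" where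
  "marg din dout \<equiv> ptr dout din (\<lambda>i a. a * dout + i)"

lemma bip_out: "bip (din * dout) dout din (\<lambda>z. z mod dout) (\<lambda>z. z div dout) (\<lambda>i a. a * dout + i)"
  using bip_swap[OF bip_div_mod] .

definition lin_on :: "nat \<Rightarrow> (cmat \<Rightarrow> complex) \<Rightarrow> bool" where
  "lin_on d f \<longleftrightarrow> (\<forall>A\<in>carrier_mat d d. \<forall>B\<in>carrier_mat d d. f (A + B) = f A + f B) \<and>
    (\<forall>A\<in>carrier_mat d d. \<forall>c. f (c \<cdot>\<^sub>m A) = c * f A)"

lemma ketbra_carrier [simp]: "q_ketbra d k l \<in> carrier_mat d d" by (simp add: q_ketbra_def)

lemma lin_expand:
  assumes f: "lin_on d f" and X: "X \<in> carrier_mat d d"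
  shows "f X = (\<Sum>k<d. \<Sum>l<d. X $$ (k,l) * f (q_ketbra d k l))"
proof -
  define M where "M = (\<lambda>S. mat d d (\<lambda>p. if p \<in> S then X $$ p else 0))"
  have "f (M S) = (\<Sum>p\<in>S. X $$ p * f (q_ketbra d (fst p) (snd p)))" if "finite S" for S
    using that
  proof (induction S)
    case empty
    have "M {} = 0 \<cdot>\<^sub>m q_ketbra d 0 0" by (rule eq_matI) (auto simp: M_def q_ketbra_def)
    then show ?case using f by (simp add: lin_on_def)
  next
    case (insert p S)
    have "M (insert p S) = M S + X $$ p \<cdot>\<^sub>m q_ketbra d (fst p) (snd p)"
      using insert.hyps by (intro eq_matI) (auto simp: M_def q_ketbra_def)
    moreover have "M S \<in> carrier_mat d d" by (simp add: M_def)
    ultimately show ?case using insert f by (simp add: lin_on_def)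
  qed
  from this[of "{..<d} \<times> {..<d}"] have "f (M ({..<d} \<times> {..<d})) = (\<Sum>k<d. \<Sum>l<d. X $$ (k,l) * f (q_ketbra d k l))"
    by (simp add: sum.cartesian_product case_prod_unfold)
  moreover have "M ({..<d} \<times> {..<d}) = X" using X by (intro eq_matI) (auto simp: M_def)
  ultimately show ?thesis by simp
qed

text \<open>Rank-one operators built from a vector are multiples of states, and polarization
  recovers all matrix units from them. This extends the covariance and twirl conditions, which are
  assumed for states, to all matrices.\<close>

lemma lin_state_zero:
  assumes f: "lin_on d f" and z: "\<And>\<rho>. q_state d \<rho> \<Longrightarrow> f \<rho> = 0" and X: "X \<in> carrier_mat d d"
  shows "f X = 0"
proof -
  have "(\<Sum>i<d. \<Sum>j<d. cnj (v i) * f (q_ketbra d j i) * v j) = 0" for v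
  proof -
    define R where "R = mat d d (\<lambda>(a,b). v a * cnj (v b))"
    have R: "R \<in> carrier_mat d d" by (simp add: R_def)
    define n where "n = (\<Sum>i<d. (cmod (v i))\<^sup>2)"
    have n0: "0 \<le> n" unfolding n_def by (intro sum_nonneg) simp
    have psd: "0 \<le> fo R"
    proof -
      define Y where "Y = mkop (Suc d) (\<lambda>i j. if j = 0 \<and> i < d then v i else 0)"
      have "Y * adj Y = fo R"
      proof (rule fop_eqI)
        fix i j
        have "ent (Y * adj Y) i j = (\<Sum>k<Suc d. if k = 0 then ent Y i 0 * cnj (ent Y j 0) else 0)"
          unfolding ent_times_left[of "Suc d" Y, unfolded Y_def, OF bdd_mkop, folded Y_def]
          by (intro sum.cong) (auto simp: ent_adj Y_def ent_mkop)
        also have "\<dots> = ent Y i 0 * cnj (ent Y j 0)" by (simp add: sum.delta del: sum.lessThan_Suc)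
        also have "\<dots> = ent (fo R) i j" by (auto simp: Y_def ent_mkop R_def ent_fo)
        finally show "ent (Y * adj Y) i j = ent (fo R) i j" .
      qed
      then show ?thesis using psd_sq[of "adj Y"] by simp
    qed
    have trR: "tr (fo R) = n"
    proof -
      have "ctr (fo R) = (\<Sum>i<d. v i * cnj (v i))"
        unfolding ctr_bdd[OF bdd_fo[OF R]] by (intro sum.cong refl) (simp add: ent_fo R_def)
      then show ?thesis unfolding complex_norm_square[symmetric] by (simp add: tr_def n_def)
    qed
    have "f R = 0"
    proof (cases "n = 0")
      case True
      then have "v i = 0" if "i < d" for i
        using that sum_nonneg_eq_0_iff[of "{..<d}" "\<lambda>i. (cmod (v i))\<^sup>2"] by (simp add: n_def)
      then have "R = 0 \<cdot>\<^sub>m R" by (intro eq_matI) (auto simp: R_def)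
      then show ?thesis using f R by (metis lin_on_def mult_zero_left)
    next
      case False
      then have "q_state d (complex_of_real (1 / n) \<cdot>\<^sub>m R)"
        using R psd trR n0 by (auto simp: q_state_fo fo_smult simp del: of_real_divide intro!: scaleR_nonneg_nonneg)
      from z[OF this] have "complex_of_real (1 / n) * f R = 0" using f R by (simp add: lin_on_def)
      then show ?thesis using False by simp
    qed
    also have "f R = (\<Sum>k<d. \<Sum>l<d. v k * cnj (v l) * f (q_ketbra d k l))"
      unfolding lin_expand[OF f R] by (intro sum.cong refl) (simp add: R_def)
    also have "\<dots> = (\<Sum>l<d. \<Sum>k<d. v k * cnj (v l) * f (q_ketbra d k l))" by (rule sum.swap)
    also have "\<dots> = (\<Sum>i<d. \<Sum>j<d. cnj (v i) * f (q_ketbra d j i) * v j)"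
      by (intro sum.cong refl) (simp only: mult_ac)
    finally show ?thesis by simp
  qed
  from sesq_zero[OF this] have "f (q_ketbra d k l) = 0" if "k < d" "l < d" for k l using that by blast
  then show ?thesis unfolding lin_expand[OF f X] by simp
qed

lemma channel_lin:
  assumes "q_channel din dout N" "i < dout" "j < dout"
  shows "lin_on din (\<lambda>X. N X $$ (i,j))"
proof -
  have "N A \<in> carrier_mat dout dout" if "A \<in> carrier_mat din din" for A
    using assms that by (simp add: q_channel_def)
  note c = this
  have "N (A + B) $$ (i,j) = N A $$ (i,j) + N B $$ (i,j)" "N (x \<cdot>\<^sub>m A) $$ (i,j) = x * N A $$ (i,j)"
    if "A \<in> carrier_mat din din" "B \<in> carrier_mat din din" for A B x
    using carrier_matD[OF c[OF that(1)]] carrier_matD[OF c[OF that(2)]] assms that by (simp_all add: q_channel_def)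
  then show ?thesis unfolding lin_on_def by blast
qed

lemma channel_chan:
  assumes N: "q_channel din dout N" and X: "X \<in> carrier_mat din din"
  shows "N X = chan din dout (choi din dout N) X"
proof (rule eq_matI)
  have NX: "N X \<in> carrier_mat dout dout" using N X by (simp add: q_channel_def)
  then show "dim_row (N X) = dim_row (chan din dout (choi din dout N) X)"
    "dim_col (N X) = dim_col (chan din dout (choi din dout N) X)" by (auto simp: chan_def)
  fix i j assume "i < dim_row (chan din dout (choi din dout N) X)" "j < dim_col (chan din dout (choi din dout N) X)"
  then have ij: "i < dout" "j < dout" by (auto simp: chan_def)
  have "N X $$ (i,j) = (\<Sum>k<din. \<Sum>l<din. X $$ (k,l) * N (q_ketbra din k l) $$ (i,j))"
    by (rule lin_expand[OF channel_lin[OF N ij] X])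
  also have "\<dots> = chan din dout (choi din dout N) X $$ (i,j)"
    using ij by (auto simp: chan_def choi_def ent_mkop idx_less intro!: sum.cong)
  finally show "N X $$ (i,j) = chan din dout (choi din dout N) X $$ (i,j)" .
qed

lemma id_tensor_act:
  assumes M: "\<And>A. A \<in> carrier_mat din din \<Longrightarrow> M A = chan din dout C A" and X: "X \<in> carrier_mat (k * din) (k * din)"
  shows "fo (q_id_tensor k din dout M X) = act k din dout C (fo X)"
  unfolding q_id_tensor_def act_def fo_mat
proof (rule mkop_cong)
  fix z w assume zw: "z < k * dout" "w < k * dout"
  have lt: "z div dout < k" "w div dout < k" "z mod dout < dout" "w mod dout < dout"
    using zw div_less_prod mod_less_prod by auto
  then show "M (mat din din (\<lambda>(a,b). X $$ (z div dout * din + a, w div dout * din + b))) $$ (z mod dout, w mod dout)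
    = (\<Sum>a<din. \<Sum>b<din. ent (fo X) (z div dout * din + a) (w div dout * din + b) * ent C (a * dout + z mod dout) (b * dout + w mod dout))"
    using X by (auto simp: M chan_def ent_fo idx_less intro!: sum.cong)
qed

lemma id_tensor_carrier: "q_id_tensor k din dout M X \<in> carrier_mat (k * dout) (k * dout)"
  by (simp add: q_id_tensor_def)

lemma act_linear:
  "act k din dout (C + C') X = act k din dout C X + act k din dout C' X"
  "act k din dout (C - C') X = act k din dout C X - act k din dout C' X"
  "act k din dout (r *\<^sub>R C) X = r *\<^sub>R act k din dout C X"
  by (auto intro!: fop_eqI simp: act_def ent_mkop ent_simps distrib_left right_diff_distrib sum.distrib sum_subtractf scaleR_sum_right)

lemma bdd_act [simp]: "bdd (k * dout) (act k din dout C X)" by (simp add: act_def)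

text \<open>The easy half of Choi's theorem as a Gram matrix: with \<open>X = R * adj R\<close> and
  \<open>C = S * adj S\<close> the output is \<open>Y * adj Y\<close>, where the columns of
  \<open>Y\<close> are indexed by pairs of columns of \<open>R\<close> and \<open>S\<close> and the
  input index is contracted. Operators have one bound for rows and columns, so \<open>DG\<close> is
  the larger of the two.\<close>

lemma act_psd:
  assumes X: "bdd (k * din) X" "0 \<le> X" and C: "bdd (din * dout) C" "0 \<le> C"
  shows "0 \<le> act k din dout C X"
proof -
  obtain R where R: "bdd (k * din) R" "0 \<le> R" "R * R = X" using psd_sqrt[OF X] by auto
  obtain S where S: "bdd (din * dout) S" "0 \<le> S" "S * S = C" using psd_sqrt[OF C] by auto
  define DR DS where "DR = k * din" and "DS = din * dout"
  define DG where "DG = max (k * dout) (DR * DS)"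
  have Xe: "ent X u v = (\<Sum>p<DR. ent R u p * cnj (ent R v p))" for u v
  proof -
    have "X = R * adj R" using R by (simp add: psd_adj)
    then show ?thesis using R by (simp add: ent_times_left[of DR] DR_def ent_adj)
  qed
  have Ce: "ent C u v = (\<Sum>q<DS. ent S u q * cnj (ent S v q))" for u v
  proof -
    have "C = S * adj S" using S by (simp add: psd_adj)
    then show ?thesis using S by (simp add: ent_times_left[of DS] DS_def ent_adj)
  qed
  define g where "g = (\<lambda>z p q. \<Sum>a<din. ent R (z div dout * din + a) p * ent S (a * dout + z mod dout) q)"
  define Y where "Y = mkop DG (\<lambda>z c. if z < k * dout \<and> c < DR * DS then g z (c div DS) (c mod DS) else 0)"
  have "Y * adj Y = act k din dout C X"
  proof (rule fop_eqI)
    fix z w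
    show "ent (Y * adj Y) z w = ent (act k din dout C X) z w"
    proof (cases "z < k * dout \<and> w < k * dout")
      case True
      have "ent (Y * adj Y) z w = (\<Sum>c<DG. ent Y z c * cnj (ent Y w c))"
        unfolding ent_times_left[of DG Y, unfolded Y_def, OF bdd_mkop, folded Y_def] by (simp add: ent_adj)
      also have "\<dots> = (\<Sum>c<DR * DS. ent Y z c * cnj (ent Y w c))"
        by (rule sum.mono_neutral_right) (auto simp: DG_def Y_def ent_mkop)
      also have "\<dots> = (\<Sum>p<DR. \<Sum>q<DS. g z p q * cnj (g w p q))"
        unfolding sum_bip[OF bip_div_mod]
        by (intro sum.cong refl) (use True bipD(4)[OF bip_div_mod, of _ DR _ DS] in \<open>auto simp: Y_def ent_mkop DG_def less_max_iff_disj\<close>)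
      also have "\<dots> = (\<Sum>p<DR. \<Sum>q<DS. \<Sum>a<din. \<Sum>b<din.
          (ent R (z div dout * din + a) p * ent S (a * dout + z mod dout) q) *
          (cnj (ent R (w div dout * din + b) p) * cnj (ent S (b * dout + w mod dout) q)))"
        by (simp add: g_def sum_product)
      also have "\<dots> = (\<Sum>p<DR. \<Sum>a<din. \<Sum>b<din. \<Sum>q<DS.
          (ent R (z div dout * din + a) p * ent S (a * dout + z mod dout) q) *
          (cnj (ent R (w div dout * din + b) p) * cnj (ent S (b * dout + w mod dout) q)))"
        by (rule sum.cong[OF refl], subst sum.swap, rule sum.cong[OF refl], rule sum.swap)
      also have "\<dots> = (\<Sum>a<din. \<Sum>b<din. \<Sum>p<DR. \<Sum>q<DS.
          (ent R (z div dout * din + a) p * ent S (a * dout + z mod dout) q) *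
          (cnj (ent R (w div dout * din + b) p) * cnj (ent S (b * dout + w mod dout) q)))"
        by (subst sum.swap, rule sum.cong[OF refl], rule sum.swap)
      also have "\<dots> = (\<Sum>a<din. \<Sum>b<din. ent X (z div dout * din + a) (w div dout * din + b) *
          ent C (a * dout + z mod dout) (b * dout + w mod dout))"
        unfolding Xe Ce sum_product by (intro sum.cong refl) (simp only: mult_ac)
      finally show ?thesis using True by (simp add: act_def ent_mkop)
    next
      case False
      have "ent Y z c * cnj (ent Y w c) = 0" for c using False by (auto simp: Y_def ent_mkop)
      then have "ent (Y * adj Y) z w = 0"
        unfolding ent_times_left[of DG Y, unfolded Y_def, OF bdd_mkop, folded Y_def] ent_adj by (simp add: sum.neutral)
      then show ?thesis using False by (auto simp: act_def ent_mkop)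
    qed
  qed
  then show ?thesis using psd_sq[of "adj Y"] by simp
qed

lemma act_mono:
  "bdd (k * din) X \<Longrightarrow> 0 \<le> X \<Longrightarrow> bdd (din * dout) C \<Longrightarrow> bdd (din * dout) C' \<Longrightarrow> C \<le> C' \<Longrightarrow>
    act k din dout C X \<le> act k din dout C' X"
  using act_psd[of k din X dout "C' - C"] by (simp add: act_linear)

text \<open>For \<open>c = 1\<close> this is trace preservation. For the error operator of a
  simulation it makes the error the same for all inputs.\<close>

lemma ctr_act:
  assumes X: "bdd (k * din) X" and C: "marg din dout C = c *\<^sub>R idn din"
  shows "ctr (act k din dout C X) = complex_of_real c * ctr X"
proof -
  have m: "(\<Sum>i<dout. ent C (a * dout + i) (b * dout + i)) = (if a = b then complex_of_real c else 0)"
    if "a < din" "b < din" for a b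
    using arg_cong[OF C, of "\<lambda>M. ent M a b"] that by (auto simp: ent_ptr ent_simps ent_dg scaleR_conv_of_real)
  have "ctr (act k din dout C X) = (\<Sum>r<k. \<Sum>i<dout. \<Sum>a<din. \<Sum>b<din.
      ent X (r * din + a) (r * din + b) * ent C (a * dout + i) (b * dout + i))"
    unfolding ctr_bdd[OF bdd_act] sum_bip[OF bip_div_mod]
    by (intro sum.cong refl) (auto simp: act_def ent_mkop idx_less)
  also have "\<dots> = (\<Sum>r<k. \<Sum>a<din. \<Sum>b<din. \<Sum>i<dout.
      ent X (r * din + a) (r * din + b) * ent C (a * dout + i) (b * dout + i))"
    by (rule sum.cong[OF refl], subst sum.swap, rule sum.cong[OF refl], rule sum.swap)
  also have "\<dots> = (\<Sum>r<k. \<Sum>a<din. \<Sum>b<din. if b = a then complex_of_real c * ent X (r * din + a) (r * din + a) else 0)"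
    by (intro sum.cong refl) (auto simp: sum_distrib_left[symmetric] m)
  also have "\<dots> = complex_of_real c * ctr X"
    unfolding ctr_bdd[OF X] sum_bip[OF bip_div_mod] by (simp add: sum.delta sum_distrib_left)
  finally show ?thesis .
qed

lemma tr_act:
  assumes "bdd (k * din) X" "marg din dout C = c *\<^sub>R idn din"
  shows "tr (act k din dout C X) = c * tr X"
  by (simp add: tr_def ctr_act[OF assms])

lemma chan_act: "X \<in> carrier_mat din din \<Longrightarrow> fo (chan din dout C X) = act 1 din dout C (fo X)"
  unfolding chan_def fo_mat by (rule fop_eqI) (auto simp: act_def ent_mkop ent_fo intro!: sum.cong)

lemma chan_channel:
  assumes C: "bdd (din * dout) C" "0 \<le> C" "marg din dout C = idn din"
  shows "q_channel din dout (chan din dout C)"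
  unfolding q_channel_def
proof (intro conjI ballI allI impI)
  fix A :: cmat assume A: "A \<in> carrier_mat din din"
  show c: "chan din dout C A \<in> carrier_mat dout dout" by (simp add: chan_def)
  show "q_tr (chan din dout C A) = q_tr A"
    unfolding q_tr_fo[OF c] q_tr_fo[OF A] chan_act[OF A]
    using ctr_act[of 1 din "fo A" dout C 1] bdd_fo[OF A] C by simp
  fix B :: cmat assume B: "B \<in> carrier_mat din din"
  show "chan din dout C (A + B) = chan din dout C A + chan din dout C B"
    using A B by (intro eq_matI) (auto simp: chan_def distrib_right sum.distrib)
next
  fix A :: cmat and c assume A: "A \<in> carrier_mat din din"
  show "chan din dout C (c \<cdot>\<^sub>m A) = c \<cdot>\<^sub>m chan din dout C A"
    using A by (intro eq_matI) (auto simp: chan_def sum_distrib_left mult.assoc)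
next
  fix k X assume X: "q_psd (k * din) X"
  then show "q_psd (k * dout) (q_id_tensor k din dout (chan din dout C) X)"
    using act_psd[OF bdd_fo _ C(1,2)] by (auto simp: q_psd_fo id_tensor_carrier id_tensor_act)
qed

definition maxent :: "nat \<Rightarrow> cmat" where
  "maxent d = mat (d * d) (d * d) (\<lambda>(z,w). if z div d = z mod d \<and> w div d = w mod d then complex_of_real (1 / real d) else 0)"

lemma maxent_state: assumes "0 < d" shows "q_state (d * d) (maxent d)"
proof -
  define Y where "Y = mkop (d * d) (\<lambda>z c. if c = 0 \<and> z div d = z mod d then 1 else 0)"
  have "fo (maxent d) = (1 / real d) *\<^sub>R (Y * adj Y)"
  proof (rule fop_eqI)
    fix z w
    have "ent (Y * adj Y) z w = (\<Sum>c<d * d. if c = 0 then ent Y z 0 * cnj (ent Y w 0) else 0)"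
      unfolding ent_times_left[of "d * d" Y, unfolded Y_def, OF bdd_mkop, folded Y_def]
      by (intro sum.cong) (auto simp: ent_adj Y_def ent_mkop)
    then have "ent (Y * adj Y) z w = ent Y z 0 * cnj (ent Y w 0)" using assms by (simp add: sum.delta)
    then show "ent (fo (maxent d)) z w = ent ((1 / real d) *\<^sub>R (Y * adj Y)) z w"
      by (auto simp: ent_simps maxent_def ent_fo Y_def ent_mkop scaleR_conv_of_real)
  qed
  then have p: "0 \<le> fo (maxent d)" using psd_sq[of "adj Y"] by (auto intro!: scaleR_nonneg_nonneg)
  have c: "maxent d \<in> carrier_mat (d * d) (d * d)" by (simp add: maxent_def)
  have "ctr (fo (maxent d)) = (\<Sum>r<d. \<Sum>a<d. if a = r then complex_of_real (1 / real d) else 0)"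
    unfolding ctr_bdd[OF bdd_fo[OF c]] sum_bip[OF bip_div_mod]
    by (intro sum.cong refl) (auto simp: ent_fo maxent_def idx_less)
  then have "tr (fo (maxent d)) = 1" using assms by (simp add: tr_def sum.delta)
  then show ?thesis using c p by (simp add: q_state_fo)
qed

lemma act_maxent:
  assumes "bdd (d * dout) C"
  shows "act d d dout C (fo (maxent d)) = (1 / real d) *\<^sub>R C"
proof (rule fop_eq_bddI[of "d * dout"])
  fix z w assume zw: "z < d * dout" "w < d * dout"
  have lt: "z div dout < d" "w div dout < d" using zw div_less_prod by auto
  have "ent (act d d dout C (fo (maxent d))) z w = (\<Sum>a<d. \<Sum>b<d. if b = w div dout then if a = z div dout then complex_of_real (1 / real d) * ent C z w else 0 else 0)"
  proof -
    have "ent (act d d dout C (fo (maxent d))) z w = (\<Sum>a<d. \<Sum>b<d.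
      ent (fo (maxent d)) (z div dout * d + a) (w div dout * d + b) * ent C (a * dout + z mod dout) (b * dout + w mod dout))"
      using zw by (simp add: act_def ent_mkop)
    also have "\<dots> = (\<Sum>a<d. \<Sum>b<d. if b = w div dout then if a = z div dout then complex_of_real (1 / real d) * ent C z w else 0 else 0)"
      by (intro sum.cong refl) (use lt in \<open>auto simp: maxent_def ent_fo idx_less\<close>)
    finally show ?thesis .
  qed
  then show "ent (act d d dout C (fo (maxent d))) z w = ent ((1 / real d) *\<^sub>R C) z w"
    using lt by (simp add: sum.delta ent_simps scaleR_conv_of_real)
qed (use assms in auto)

lemma bdd_choi [simp]: "bdd (din * dout) (choi din dout N)" by (simp add: choi_def)

lemma choi_channel:
  assumes N: "q_channel din dout N" and d: "0 < din"
  shows "0 \<le> choi din dout N" "marg din dout (choi din dout N) = idn din"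
proof -
  have st: "q_psd (din * din) (maxent din)" using maxent_state[OF d] by (simp add: q_state_def)
  then have "q_psd (din * dout) (q_id_tensor din din dout N (maxent din))" using N by (simp add: q_channel_def)
  then have "0 \<le> (1 / real din) *\<^sub>R choi din dout N"
    using id_tensor_act[OF channel_chan[OF N], of "maxent din" din] st
    by (auto simp: q_psd_fo act_maxent)
  from scaleR_nonneg_nonneg[OF _ this, of "real din"] show "0 \<le> choi din dout N" using d by simp
  show "marg din dout (choi din dout N) = idn din"
  proof (rule fop_eq_bddI[of din])
    fix a b assume ab: "a < din" "b < din"
    have "(\<Sum>i<dout. ent (choi din dout N) (a * dout + i) (b * dout + i)) = q_tr (N (q_ketbra din a b))"
    proof -
      have "dim_row (N (q_ketbra din a b)) = dout" using N ketbra_carrier unfolding q_channel_def by blast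
      then show ?thesis using ab by (auto simp: q_tr_def choi_def ent_mkop idx_less intro!: sum.cong)
    qed
    also have "\<dots> = q_tr (q_ketbra din a b)" using N by (simp add: q_channel_def)
    also have "\<dots> = (\<Sum>i<din. if i = a then (if a = b then 1 else 0) else 0)"
      unfolding q_tr_def q_ketbra_def by (intro sum.cong) auto
    finally show "ent (marg din dout (choi din dout N)) a b = ent (idn din) a b"
      using ab by (simp add: ent_ptr ent_dg sum.delta)
  qed auto
qed

text \<open>Serves to evaluate the \<open>n\<close>-fold channel on \<open>n\<close> copies of one
  input whose reference system has arbitrary dimension \<open>k\<close>; the summation over input
  words factors by applying \<open>sum_code\<close> twice.\<close>

lemma act_tp:
  assumes cK: "code k n K eK" and cI: "code din n DI eI" and cO: "code dout n DO eO"
  shows "act K DI DO (tp (DI * DO) n (pairc dout DO eI eO) (\<lambda>_. C)) (tp (K * DI) n (pairc din DI eK eI) (\<lambda>_. X))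
    = tp (K * DO) n (pairc dout DO eK eO) (\<lambda>_. act k din dout C X)"
proof (rule fop_eq_bddI[of "K * DO"])
  fix z w assume zw: "z < K * DO" "w < K * DO"
  have lt: "z div DO < K" "w div DO < K" "z mod DO < DO" "w mod DO < DO"
    using zw div_less_prod mod_less_prod by auto
  define F where "F = (\<lambda>m a b. ent X (eK (z div DO) m * din + a) (eK (w div DO) m * din + b) *
    ent C (a * dout + eO (z mod DO) m) (b * dout + eO (w mod DO) m))"
  have "ent (act K DI DO (tp (DI * DO) n (pairc dout DO eI eO) (\<lambda>_. C)) (tp (K * DI) n (pairc din DI eK eI) (\<lambda>_. X))) z w
    = (\<Sum>a<DI. \<Sum>b<DI. \<Prod>m<n. F m (eI a m) (eI b m))"
    using zw lt by (auto simp: act_def ent_mkop ent_tp idx_less pairc_def F_def prod.distrib intro!: sum.cong)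
  also have "\<dots> = (\<Sum>a<DI. \<Prod>m<n. \<Sum>b<din. F m (eI a m) b)"
    by (intro sum.cong refl sum_code[OF cI])
  also have "\<dots> = (\<Prod>m<n. \<Sum>a<din. \<Sum>b<din. F m a b)" by (rule sum_code[OF cI])
  also have "\<dots> = ent (tp (K * DO) n (pairc dout DO eK eO) (\<lambda>_. act k din dout C X)) z w"
  proof -
    have "(\<Sum>a<din. \<Sum>b<din. F m a b) = ent (act k din dout C X) (pairc dout DO eK eO z m) (pairc dout DO eK eO w m)"
      if "m < n" for m
      using code_lt[OF cK lt(1) that] code_lt[OF cK lt(2) that] code_lt[OF cO lt(3) that] code_lt[OF cO lt(4) that]
      by (simp add: act_def ent_mkop idx_less pairc_def F_def)
    then show ?thesis using zw by (simp add: ent_tp)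
  qed
  finally show "ent (act K DI DO (tp (DI * DO) n (pairc dout DO eI eO) (\<lambda>_. C)) (tp (K * DI) n (pairc din DI eK eI) (\<lambda>_. X))) z w
    = ent (tp (K * DO) n (pairc dout DO eK eO) (\<lambda>_. act k din dout C X)) z w" .
qed auto

text \<open>The support condition as typicality uses it: no weight on eigenvectors of
  \<open>\<tau>\<close> with eigenvalue 0. All diagonalizations are quantified over because the one
  picked inside \<open>q_matfun\<close> is not known.\<close>

definition supported_in :: "nat \<Rightarrow> fop \<Rightarrow> fop \<Rightarrow> bool" where
  "supported_in d \<omega> \<tau> \<longleftrightarrow> (\<forall>U q. unitary_on d U \<longrightarrow> \<tau> = U * dg d q * adj U \<longrightarrow>
    (\<forall>j<d. q j = 0 \<longrightarrow> ent (adj U * \<omega> * U) j j = 0))"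

lemma supported_in_le:
  assumes "0 \<le> \<omega>" "\<omega> \<le> c *\<^sub>R \<tau>"
  shows "supported_in d \<omega> \<tau>"
  unfolding supported_in_def
proof (intro allI impI)
  fix U q j assume U: "unitary_on d U" and \<tau>: "\<tau> = U * dg d q * adj U" and j: "j < d" "q j = 0"
  have "adj U * \<omega> * U \<le> c *\<^sub>R dg d q"
    using conj_mono[OF assms(2), of U] unitary_diag[OF U, of q] by (simp add: \<tau>)
  then have "0 \<le> c *\<^sub>R dg d q - adj U * \<omega> * U" by simp
  from psd_ent_diag[OF this, of j] psd_ent_diag[OF conj_psd[OF assms(1), of U], of j]
  show "ent (adj U * \<omega> * U) j j = 0" using j by (simp add: ent_simps ent_dg)
qed

lemma supported_in_kernel:
  assumes c: "\<omega> \<in> carrier_mat d d" "\<tau> \<in> carrier_mat d d"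
    and ker: "\<And>v. v \<in> carrier_vec d \<Longrightarrow> \<tau> *\<^sub>v v = 0\<^sub>v d \<Longrightarrow> \<omega> *\<^sub>v v = 0\<^sub>v d"
  shows "supported_in d (fo \<omega>) (fo \<tau>)"
  unfolding supported_in_def
proof (intro allI impI)
  fix U q j assume U: "unitary_on d U" and \<tau>: "fo \<tau> = U * dg d q * adj U" and j: "j < d" "q j = 0"
  note u = unitary_onD[OF U]
  define v where "v = vec d (\<lambda>i. ent U i j)"
  have mv: "(A *\<^sub>v v) $ i = ent (fo A * U) i j" if "A \<in> carrier_mat d d" "i < d" for A i
    using that by (simp add: ent_times_left[OF bdd_fo] v_def scalar_prod_def atLeast0LessThan ent_fo)
  have "fo \<tau> * U = U * dg d q" unfolding \<tau> using u by (simp add: mult.assoc)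
  then have "\<tau> *\<^sub>v v = 0\<^sub>v d"
    using c j by (intro eq_vecI) (auto simp: mv ent_times_dg simp del: index_mult_mat_vec)
  then have "\<omega> *\<^sub>v v = 0\<^sub>v d" using ker[of v] by (simp add: v_def)
  then have "ent (fo \<omega> * U) i j = 0" if "i < d" for i using mv[OF c(1) that] that by simp
  then show "ent (adj U * fo \<omega> * U) j j = 0"
    unfolding mult.assoc ent_times_left[OF u(2)] by (intro sum.neutral) auto
qed

text \<open>On the kernel of \<open>\<tau>\<close> the form of \<open>\<omega>\<close> is squeezed
  to 0; writing \<open>\<omega>\<close> as the square of \<open>R\<close> turns this into
  \<open>R v = 0\<close>. It decides the case distinction in \<open>q_rel_ent\<close> in favour of a
  finite value.\<close>

lemma kernel_le:
  assumes c: "\<omega> \<in> carrier_mat d d" "\<tau> \<in> carrier_mat d d" and le: "0 \<le> fo \<omega>" "fo \<omega> \<le> k *\<^sub>R fo \<tau>"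
    and v: "v \<in> carrier_vec d" "\<tau> *\<^sub>v v = 0\<^sub>v d"
  shows "\<omega> *\<^sub>v v = 0\<^sub>v d"
proof -
  let ?v = "\<lambda>i. v $ i"
  have mv: "(A *\<^sub>v v) $ i = (\<Sum>j<d. ent (fo A) i j * v $ j)" if "A \<in> carrier_mat d d" "i < d" for A i
    using that v by (auto simp: scalar_prod_def atLeast0LessThan ent_fo intro!: sum.cong)
  have "qf (fo \<tau>) ?v = 0"
  proof -
    have "v \<bullet>c (\<tau> *\<^sub>v v) = 0" using v by simp
    then show ?thesis using qf_fo[OF c(2) v(1)] by simp
  qed
  moreover have "qf (fo \<omega>) ?v \<le> qf (k *\<^sub>R fo \<tau>) ?v" "0 \<le> qf (fo \<omega>) ?v"
    using le unfolding fop_le_iff[of "fo \<omega>"] psd_iff by blast+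
  ultimately have q0: "qf (fo \<omega>) ?v = 0" by (simp add: qf_simps)
  obtain R where R: "bdd d R" "0 \<le> R" "R * R = fo \<omega>" using psd_sqrt[OF bdd_fo[OF c(1)] le(1)] by auto
  define w where "w = (\<lambda>i. \<Sum>j<d. ent R i j * v $ j)"
  have "qf (idn d) w = qf (adj R * idn d * R) ?v" unfolding w_def by (rule qf_conj[symmetric]) (use R in auto)
  also have "\<dots> = 0" using R q0 by (simp add: psd_adj)
  finally have "complex_of_real (\<Sum>i<d. (cmod (w i))\<^sup>2) = 0" by (simp add: qf_dg)
  then have "(\<Sum>i<d. (cmod (w i))\<^sup>2) = 0" by (simp only: of_real_eq_0_iff)
  then have w: "w i = 0" if "i < d" for i
    using that sum_nonneg_eq_0_iff[of "{..<d}" "\<lambda>i. (cmod (w i))\<^sup>2"] by simp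
  have "(\<omega> *\<^sub>v v) $ i = 0" if i: "i < d" for i
  proof -
    have "(\<omega> *\<^sub>v v) $ i = (\<Sum>j<d. \<Sum>k<d. ent R i k * (ent R k j * v $ j))"
      unfolding mv[OF c(1) i] R(3)[symmetric] ent_times_left[OF R(1)] by (simp add: sum_distrib_right mult.assoc)
    also have "\<dots> = (\<Sum>k<d. \<Sum>j<d. ent R i k * (ent R k j * v $ j))" by (rule sum.swap)
    also have "\<dots> = (\<Sum>k<d. ent R i k * w k)" by (simp add: w_def sum_distrib_left)
    also have "\<dots> = 0" using w by simp
    finally show ?thesis .
  qed
  then show ?thesis using c v by (intro eq_vecI) auto
qed

text \<open>The last clause lets the typical projection inherit every symmetry of \<open>\<tau>\<close>.\<close>

definition typical_proj :: "nat \<Rightarrow> fop \<Rightarrow> fop \<Rightarrow> real \<Rightarrow> real \<Rightarrow> real \<Rightarrow> fop \<Rightarrow> bool" where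
  "typical_proj D \<omega> \<tau> lo hi \<eta> P \<longleftrightarrow> proj_on D P \<and> tr (\<omega> * (idn D - P)) \<le> \<eta> \<and> P * \<tau> = \<tau> * P \<and>
    lo *\<^sub>R P \<le> \<tau> * P \<and> \<tau> * P \<le> hi *\<^sub>R P \<and>
    (\<forall>M. bdd D M \<longrightarrow> M * \<tau> = \<tau> * M \<longrightarrow> M * P = P * M)"

text \<open>With \<open>\<tau> = \<omega>\<close> the exponent \<open>t\<close> is minus the
  entropy; with another \<open>\<tau>\<close> it is the cross term of the relative entropy. So both
  terms of a relative entropy become eigenvalue windows for the same state.\<close>

lemma typical_log:
  assumes \<omega>: "q_state d \<omega>" and \<tau>: "\<tau> \<in> carrier_mat d d" "0 \<le> fo \<tau>" and s: "supported_in d (fo \<omega>) (fo \<tau>)"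
    and \<delta>: "0 < \<delta>" and \<eta>: "0 < \<eta>"
  defines "t \<equiv> tr (fo \<omega> * fo (q_log \<tau>))"
  shows "\<exists>n0. \<forall>n\<ge>n0. \<forall>D e. code d n D e \<longrightarrow> (\<exists>P. typical_proj D (tp D n e (\<lambda>_. fo \<omega>)) (tp D n e (\<lambda>_. fo \<tau>))
    (2 powr (real n * (t - \<delta>))) (2 powr (real n * (t + \<delta>))) \<eta> P)"
proof -
  obtain U q where U: "unitary_on d U" "fo \<tau> = U * dg d q * adj U"
    and f: "\<And>f. fo (q_matfun f \<tau>) = U * dg d (\<lambda>i. f (q i)) * adj U"
    using q_matfun_spectral[OF \<tau>(1) psd_adj[OF \<tau>(2)]] by blast
  have "0 \<le> dg d q" using conj_psd[OF \<tau>(2), of U] unitary_diag[OF U(1)] U(2) by simp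
  then have q: "0 \<le> q j" if "j < d" for j using dg_psdD that by blast
  have t: "t = tr (fo \<omega> * (U * dg d (\<lambda>j. if q j > 0 then log 2 (q j) else 0) * adj U))"
    unfolding t_def q_log_def f ..
  have "fo \<omega> = fo \<omega> \<and> 0 \<le> fo \<omega> \<and> tr (fo \<omega>) = 1 \<and> bdd d (fo \<omega>)" using \<omega> by (auto simp: q_state_fo bdd_fo)
  moreover have "ent (adj U * fo \<omega> * U) j j = 0" if "j < d" "q j = 0" for j
    using s U that unfolding supported_in_def by blast
  ultimately have "\<exists>n0. \<forall>n\<ge>n0. \<forall>D e. code d n D e \<longrightarrow> (\<exists>P. bdd D P \<and> adj P = P \<and> P * P = P \<and>
    tr (tp D n e (\<lambda>_. fo \<omega>) * (idn D - P)) \<le> \<eta> \<and>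
    P * tp D n e (\<lambda>_. fo \<tau>) = tp D n e (\<lambda>_. fo \<tau>) * P \<and>
    2 powr (real n * (t - \<delta>)) *\<^sub>R P \<le> tp D n e (\<lambda>_. fo \<tau>) * P \<and>
    tp D n e (\<lambda>_. fo \<tau>) * P \<le> 2 powr (real n * (t + \<delta>)) *\<^sub>R P \<and>
    (\<forall>M. bdd D M \<longrightarrow> M * tp D n e (\<lambda>_. fo \<tau>) = tp D n e (\<lambda>_. fo \<tau>) * M \<longrightarrow> M * P = P * M))"
    unfolding t by (intro typical_projection[OF _ _ _ U(1) q U(2) _ \<delta> \<eta>]) blast+
  then show ?thesis unfolding typical_proj_def proj_on_def conj_assoc .
qed

lemma ent_log_tr: "\<rho> \<in> carrier_mat d d \<Longrightarrow> q_log \<rho> \<in> carrier_mat d d \<Longrightarrow> q_entropy \<rho> = - tr (fo \<rho> * fo (q_log \<rho>))"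
  unfolding q_entropy_def using q_tr_fo[of "\<rho> * q_log \<rho>" d] by (simp add: tr_def fo_times)

lemma q_log_carrier: "\<rho> \<in> carrier_mat d d \<Longrightarrow> 0 \<le> fo \<rho> \<Longrightarrow> q_log \<rho> \<in> carrier_mat d d"
  using q_matfun_spectral[OF _ psd_adj] unfolding q_log_def by blast

lemma typical_proj_le: assumes "typical_proj D \<omega> \<tau> lo hi \<eta> P" "0 \<le> \<tau>" shows "\<tau> * P \<le> \<tau>"
  by (rule conj_proj_commute) (use assms in \<open>auto simp: typical_proj_def proj_on_def\<close>)

lemma idx_div [simp]: "y < b \<Longrightarrow> (x * b + y) div b = (x::nat)"
  and idx_mod [simp]: "y < b \<Longrightarrow> (x * b + y) mod b = (y::nat)"
  by auto

subsection \<open>The Choi matrix as a bipartite operator\<close>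

text \<open>Choi matrices are indexed in the order \<open>A' B' A B\<close>, whereas the entropies refer to the cut
  \<open>A' A | B' B\<close>; with \<open>r\<close>, \<open>a\<close>, \<open>b\<close> the dimensions of \<open>B'\<close>, \<open>A\<close>, \<open>B\<close>, these maps translate.\<close>

definition ptX :: "nat \<Rightarrow> nat \<Rightarrow> nat \<Rightarrow> nat \<Rightarrow> nat" where
  "ptX r a b z = z div (a * b) div r * a + z mod (a * b) div b"
definition ptY :: "nat \<Rightarrow> nat \<Rightarrow> nat \<Rightarrow> nat \<Rightarrow> nat" where
  "ptY r a b z = z div (a * b) mod r * b + z mod (a * b) mod b"
definition ptI :: "nat \<Rightarrow> nat \<Rightarrow> nat \<Rightarrow> nat \<Rightarrow> nat \<Rightarrow> nat" where
  "ptI r a b x y = (x div a * r + y div b) * (a * b) + (x mod a * b + y mod b)"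

lemma bip_choi: "bip ((p * r) * (a * b)) (p * a) (r * b) (ptX r a b) (ptY r a b) (ptI r a b)"
  unfolding bip_def
proof (intro conjI allI impI)
  fix z assume z: "z < p * r * (a * b)"
  have 1: "z div (a * b) < p * r" "z mod (a * b) < a * b" using div_less_prod[OF z] mod_less_prod[OF z] by auto
  have 2: "z div (a * b) div r < p" "z div (a * b) mod r < r" "z mod (a * b) div b < a" "z mod (a * b) mod b < b"
    using div_less_prod[OF 1(1)] mod_less_prod[OF 1(1)] div_less_prod[OF 1(2)] mod_less_prod[OF 1(2)] by auto
  show "ptX r a b z < p * a" "ptY r a b z < r * b" unfolding ptX_def ptY_def using 2 by (auto intro: idx_less)
  show "ptI r a b (ptX r a b z) (ptY r a b z) = z"
    unfolding ptI_def ptX_def ptY_def idx_div[OF 2(3)] idx_mod[OF 2(3)] idx_div[OF 2(4)] idx_mod[OF 2(4)] div_mult_mod_eq ..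
next
  fix x y assume x: "x < p * a" and y: "y < r * b"
  have 1: "x div a < p" "x mod a < a" "y div b < r" "y mod b < b"
    using div_less_prod[OF x] mod_less_prod[OF x] div_less_prod[OF y] mod_less_prod[OF y] by auto
  have 2: "x div a * r + y div b < p * r" "x mod a * b + y mod b < a * b" using 1 by (auto intro: idx_less)
  show "ptI r a b x y < p * r * (a * b)" unfolding ptI_def using 2 by (rule idx_less)
  have d: "ptI r a b x y div (a * b) = x div a * r + y div b" "ptI r a b x y mod (a * b) = x mod a * b + y mod b"
    unfolding ptI_def by (rule idx_div[OF 2(2)], rule idx_mod[OF 2(2)])
  show "ptX r a b (ptI r a b x y) = x" "ptY r a b (ptI r a b x y) = y"
    unfolding ptX_def ptY_def d using 1 by simp_all
qed

text \<open>Across the cut \<open>A'A | B'B\<close> the Choi matrix of replacer tensor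
  \<open>Q\<close> is the identity tensor the Choi matrix of \<open>Q\<close>. Hence domination by
  such a channel is an operator inequality of the form that conditional entropies measure.\<close>

lemma choi_tensor_replacer:
  assumes "X \<in> carrier_mat (p * r) (p * r)"
  shows "q_tensor_map p r a b (q_replacer a) Q X
    = chan (p * r) (a * b) (ten ((p * r) * (a * b)) (ptX r a b) (ptY r a b) (idn (p * a)) (choi r b Q)) X"
  unfolding q_tensor_map_def chan_def
proof (rule cong_mat[OF refl refl], unfold split, intro sum.cong refl)
  fix i j k l assume ij: "i < a * b" "j < a * b" and kl: "k \<in> {..<p * r}" "l \<in> {..<p * r}"
  have 1: "k div r < p" "l div r < p" "k mod r < r" "l mod r < r" "i div b < a" "j div b < a" "i mod b < b" "j mod b < b"
    using div_less_prod[of k p r] mod_less_prod[of k p r] div_less_prod[of l p r] mod_less_prod[of l p r]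
      div_less_prod[OF ij(1)] mod_less_prod[OF ij(1)] div_less_prod[OF ij(2)] mod_less_prod[OF ij(2)] kl by auto
  have lt: "k * (a * b) + i < p * r * (a * b)" "l * (a * b) + j < p * r * (a * b)" using kl ij by (auto intro: idx_less)
  have px: "ptX r a b (k * (a * b) + i) = k div r * a + i div b" "ptY r a b (k * (a * b) + i) = k mod r * b + i mod b"
    "ptX r a b (l * (a * b) + j) = l div r * a + j div b" "ptY r a b (l * (a * b) + j) = l mod r * b + j mod b"
    unfolding ptX_def ptY_def idx_div[OF ij(1)] idx_div[OF ij(2)] idx_mod[OF ij(1)] idx_mod[OF ij(2)] by (rule refl)+
  have "q_tr (q_ketbra p (k div r) (l div r)) = (if k div r = l div r then 1 else 0)"
  proof -
    have "q_tr (q_ketbra p (k div r) (l div r)) = (\<Sum>i<p. if i = k div r then if k div r = l div r then 1 else 0 else 0)"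
      unfolding q_tr_def q_ketbra_def by (intro sum.cong) auto
    then show ?thesis using 1 by (simp add: sum.delta)
  qed
  then have rep: "q_replacer a (q_ketbra p (k div r) (l div r)) $$ (i div b, j div b)
      = (if k div r = l div r \<and> i div b = j div b then 1 else 0)"
    using 1 by (simp add: q_replacer_def)
  have eqX: "k div r * a + i div b = l div r * a + j div b \<longleftrightarrow> k div r = l div r \<and> i div b = j div b"
  proof
    assume e: "k div r * a + i div b = l div r * a + j div b"
    show "k div r = l div r \<and> i div b = j div b"
      using arg_cong[OF e, of "\<lambda>u. u div a"] arg_cong[OF e, of "\<lambda>u. u mod a"] 1(5,6) by simp
  qed simp
  have "ent (ten ((p * r) * (a * b)) (ptX r a b) (ptY r a b) (idn (p * a)) (choi r b Q)) (k * (a * b) + i) (l * (a * b) + j)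
    = (if k div r = l div r \<and> i div b = j div b then 1 else 0) * Q (q_ketbra r (k mod r) (l mod r)) $$ (i mod b, j mod b)"
    using lt 1 by (simp add: ent_ten px ent_dg eqX idx_less choi_def ent_mkop)
  then show "X $$ (k, l) * q_replacer a (q_ketbra p (k div r) (l div r)) $$ (i div b, j div b) *
      Q (q_ketbra r (k mod r) (l mod r)) $$ (i mod b, j mod b) =
    X $$ (k, l) * ent (ten ((p * r) * (a * b)) (ptX r a b) (ptY r a b) (idn (p * a)) (choi r b Q)) (k * (a * b) + i) (l * (a * b) + j)"
    unfolding rep by (simp only: mult.assoc)
qed

text \<open>\<open>q_choi\<close> lists the systems as \<open>A' A B' B\<close>, \<open>choi\<close>
  as \<open>A' B' A B\<close>; up to this permutation they differ by the factor
  \<open>1 / (p r)\<close>.\<close>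

lemma q_choi_index:
  assumes z: "z < (p * r) * (a * b)" and w: "w < (p * r) * (a * b)"
  shows "ent (fo (q_choi p r a b N)) (ptX r a b z * (r * b) + ptY r a b z) (ptX r a b w * (r * b) + ptY r a b w)
    = ent (choi (p * r) (a * b) N) z w / of_nat (p * r)"
proof -
  have dec: "ptX r a b v * (r * b) + ptY r a b v < p * a * r * b \<and>
     (ptX r a b v * (r * b) + ptY r a b v) div (a * r * b) * r + (ptX r a b v * (r * b) + ptY r a b v) div b mod r = v div (a * b) \<and>
     (ptX r a b v * (r * b) + ptY r a b v) div (r * b) mod a * b + (ptX r a b v * (r * b) + ptY r a b v) mod b = v mod (a * b)"
    if v: "v < (p * r) * (a * b)" for v
  proof -
    have 1: "v div (a * b) < p * r" "v mod (a * b) < a * b" using div_less_prod[OF v] mod_less_prod[OF v] by auto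
    have 2: "v div (a * b) mod r < r" "v mod (a * b) div b < a" "v mod (a * b) mod b < b"
      using mod_less_prod[OF 1(1)] div_less_prod[OF 1(2)] mod_less_prod[OF 1(2)] by auto
    have y: "ptY r a b v < r * b" using bipD(2)[OF bip_choi v] .
    define u where "u = ptX r a b v * (r * b) + ptY r a b v"
    have u1: "u div (r * b) = ptX r a b v" "u mod (r * b) = ptY r a b v" unfolding u_def by (rule idx_div[OF y], rule idx_mod[OF y])
    have "u div (a * r * b) = u div (r * b) div a" by (simp add: div_mult2_eq[symmetric] mult_ac)
    then have ra: "u div (a * r * b) = v div (a * b) div r" using 2 by (simp add: u1 ptX_def)
    have al: "u div (r * b) mod a = v mod (a * b) div b" using 2 by (simp add: u1 ptX_def)
    have rb: "u div b mod r = v div (a * b) mod r"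
    proof -
      have "u div b = ptX r a b v * r + ptY r a b v div b"
        using 2 by (simp add: u_def mult.assoc[symmetric] del: mult.assoc)
      then show ?thesis using 2 by (simp add: ptY_def)
    qed
    have be: "u mod b = v mod (a * b) mod b"
    proof -
      have "u mod b = ptY r a b v mod b" by (simp add: u_def mult.assoc[symmetric] del: mult.assoc)
      then show ?thesis using 2 by (simp add: ptY_def)
    qed
    have "u < (p * a) * (r * b)" unfolding u_def using bipD(1)[OF bip_choi v] y by (rule idx_less)
    then show ?thesis unfolding u_def[symmetric] ra al rb be by (simp add: mult_ac)
  qed
  show ?thesis
    using dec[OF z] dec[OF w] z w by (simp add: q_choi_def ent_fo Let_def choi_def ent_mkop)
qed

lemma psd_reindex:
  assumes f: "bij_betw f {..<D} {..<D}" and A: "bdd D A" and B: "bdd D B"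
    and e: "\<And>z w. z < D \<Longrightarrow> w < D \<Longrightarrow> ent B (f z) (f w) = ent A z w"
  shows "0 \<le> A \<Longrightarrow> 0 \<le> B" "tr B = tr A"
proof -
  have s: "(\<Sum>z<D. g (f z)) = (\<Sum>z<D. g z)" for g :: "nat \<Rightarrow> complex"
    using f by (rule sum.reindex_bij_betw)
  have "qf B v = qf A (\<lambda>z. v (f z))" for v
  proof -
    have "qf B v = (\<Sum>z<D. \<Sum>w<D. cnj (v (f z)) * ent B (f z) w * v w)"
      unfolding qf_bdd[OF B] by (rule s[symmetric])
    also have "\<dots> = (\<Sum>z<D. \<Sum>w<D. cnj (v (f z)) * ent B (f z) (f w) * v (f w))"
      by (rule sum.cong[OF refl], rule s[symmetric])
    finally show ?thesis unfolding qf_bdd[OF A] by (simp add: e)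
  qed
  then show "0 \<le> A \<Longrightarrow> 0 \<le> B" by (simp add: psd_iff)
  have "ctr B = (\<Sum>z<D. ent B (f z) (f z))" unfolding ctr_bdd[OF B] by (rule s[symmetric])
  then show "tr B = tr A" by (simp add: tr_def ctr_bdd[OF A] e)
qed

text \<open>The inner projection flattens \<open>\<omega>\<close> to at most \<open>hi\<close> times
  the identity, the outer one turns that identity into \<open>Q\<close>, and \<open>Q\<close> is
  replaced by its bound. The order of the two projections matters, since they need not
  commute.\<close>

lemma smooth_dom:
  assumes P: "typical_proj D \<omega> \<omega> lo hi \<eta> P" and \<omega>: "0 \<le> \<omega>" and Q: "proj_on D Q" "Q \<le> c *\<^sub>R \<tau>" and hi: "0 \<le> hi"
  shows "Q * P * \<omega> * adj (Q * P) \<le> (hi * c) *\<^sub>R \<tau>"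
proof -
  have p: "proj_on D P" "P * \<omega> = \<omega> * P" "\<omega> * P \<le> hi *\<^sub>R P" using P by (auto simp: typical_proj_def)
  have "Q * P * \<omega> * adj (Q * P) = adj Q * (P * \<omega> * P) * Q" using p(1) Q(1) by (simp add: proj_onD mult.assoc)
  also have "P * \<omega> * P = \<omega> * P" using p(2) proj_onD(3)[OF p(1)] by (metis mult.assoc)
  also have "adj Q * (\<omega> * P) * Q \<le> adj Q * (hi *\<^sub>R idn D) * Q"
    using order_trans[OF p(3) scaleR_left_mono[OF proj_le[OF p(1)] hi]] by (rule conj_mono)
  also have "\<dots> = hi *\<^sub>R Q" using Q by (simp add: proj_onD)
  also have "\<dots> \<le> hi *\<^sub>R (c *\<^sub>R \<tau>)" by (intro scaleR_left_mono Q hi)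
  finally show ?thesis by simp
qed

lemma typical_proj_proj_le:
  assumes "typical_proj D \<omega> \<tau> lo hi \<eta> P" "0 \<le> \<tau>" "0 < lo"
  shows "P \<le> (1 / lo) *\<^sub>R \<tau>"
proof -
  have "lo *\<^sub>R P \<le> \<tau>" using typical_proj_le[OF assms(1,2)] assms(1) unfolding typical_proj_def by (meson order_trans)
  from scaleR_left_mono[OF this, of "1 / lo"] show ?thesis using assms(3) by simp
qed

text \<open>For any test, acceptance by \<open>\<omega>\<close> is controlled by acceptance by the
  smoothed operator, at the price of a factor \<open>1 + s\<close> and an additive \<open>s\<close>
  from the discarded part.\<close>

lemma smooth_test:
  assumes \<omega>: "bdd D \<omega>" "0 \<le> \<omega>" and P: "proj_on D P" "proj_on D P'" and s: "0 < s"
    and \<eta>: "tr (\<omega> * (idn D - P)) \<le> s\<^sup>2 / (4 * (1 + s))" "tr (\<omega> * (idn D - P')) \<le> s\<^sup>2 / (4 * (1 + s))"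
    and T: "0 \<le> T" "T \<le> idn D"
  shows "tr (\<omega> * T) \<le> (1 + s) * tr (P' * P * \<omega> * adj (P' * P) * T) + s"
proof -
  let ?L = "idn D - P' * P"
  note sm = smoothing[OF \<omega> P s \<eta>]
  have "tr (\<omega> * T) \<le> tr (((1 + s) *\<^sub>R (P' * P * \<omega> * adj (P' * P)) + (1 + 1 / s) *\<^sub>R (?L * \<omega> * adj ?L)) * T)"
    by (intro tr_mult_mono sm(1) T)
  also have "\<dots> = (1 + s) * tr (P' * P * \<omega> * adj (P' * P) * T) + (1 + 1 / s) * tr (T * (?L * \<omega> * adj ?L))"
    by (simp only: distrib_right tr_simps mult_scaleR_left tr_mult_commute[of T])
  also have "(1 + 1 / s) * tr (T * (?L * \<omega> * adj ?L)) \<le> (1 + 1 / s) * tr (idn D * (?L * \<omega> * adj ?L))"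
    using s by (intro mult_left_mono tr_mult_mono T conj_psd' \<omega>) auto
  also have "idn D * (?L * \<omega> * adj ?L) = ?L * \<omega> * adj ?L"
    by (rule idn_times(1)) (use \<omega> P in \<open>simp add: proj_onD\<close>)
  finally show ?thesis using sm(2) by simp
qed

text \<open>The device that turns estimates on \<open>n\<close> copies into inequalities between
  entropies: a power of 2 bounded away from 0 along all large \<open>n\<close> cannot have a
  negative rate.\<close>

lemma powr_exponent_nonneg:
  fixes x c :: real
  assumes "0 < c" "\<And>n. n0 \<le> n \<Longrightarrow> c \<le> 2 powr (real n * x)"
  shows "0 \<le> x"
proof (rule ccontr)
  assume "\<not> 0 \<le> x"
  then have x: "x < 0" by simp
  obtain k where k: "log 2 c / x < real k" using reals_Archimedean2 by blast
  define n where "n = max k n0"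
  have "real k \<le> real n" by (simp add: n_def)
  then have n: "log 2 c / x < real n" "n0 \<le> n" using k by (simp_all add: n_def)
  from n(1) have "real n * x < log 2 c" using x by (simp add: neg_divide_less_eq)
  moreover have "log 2 c \<le> real n * x" using assms(2)[OF n(2)] assms(1) by (simp add: log_le_iff)
  ultimately show False by simp
qed

section \<open>The channel, its tensor powers and its Choi state\<close>

locale bichan =
  fixes p r a b :: nat and N :: "cmat \<Rightarrow> cmat"
  assumes pos: "0 < p" "0 < r" "0 < a" "0 < b"
    and N: "q_channel (p * r) (a * b) N"
begin

abbreviation "DI n \<equiv> p ^ n * r ^ n"
abbreviation "DO n \<equiv> a ^ n * b ^ n"
abbreviation "DD n \<equiv> (p ^ n * r ^ n) * (a ^ n * b ^ n)"
abbreviation "DX n \<equiv> p ^ n * a ^ n"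
abbreviation "DY n \<equiv> r ^ n * b ^ n"
abbreviation "\<pi>X n \<equiv> ptX (r ^ n) (a ^ n) (b ^ n)"
abbreviation "\<pi>Y n \<equiv> ptY (r ^ n) (a ^ n) (b ^ n)"
abbreviation "\<iota> n \<equiv> ptI (r ^ n) (a ^ n) (b ^ n)"
abbreviation "eI n \<equiv> pairc r (r ^ n) (dgt p n) (dgt r n)"
abbreviation "eO n \<equiv> pairc b (b ^ n) (dgt a n) (dgt b n)"
abbreviation "eS n \<equiv> pairc (a * b) (a ^ n * b ^ n) (eI n) (eO n)"
abbreviation "eX n \<equiv> pairc a (a ^ n) (dgt p n) (dgt a n)"
abbreviation "eY n \<equiv> pairc b (b ^ n) (dgt r n) (dgt b n)"
text \<open>Reads the index of an \<open>n\<close>-fold Choi operator letter by letter in the order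
  \<open>A' A B' B\<close> of \<open>q_choi\<close>. The code \<open>eS\<close> reads the same index
  in the order \<open>A' B' A B\<close>.\<close>

definition "eC n z m = eX n (\<pi>X n z) m * (r * b) + eY n (\<pi>Y n z) m"
abbreviation "lf n S \<equiv> ten (DD n) (\<pi>X n) (\<pi>Y n) (idn (DX n)) S"
abbreviation "pY n M \<equiv> ptr (DX n) (DY n) (\<iota> n) M"
abbreviation "C \<equiv> choi (p * r) (a * b) N"
abbreviation "\<phi> \<equiv> q_choi p r a b N"
abbreviation "\<phi>Y \<equiv> q_ptrace1 (p * a) (r * b) \<phi>"
definition "Cn n = tp (DD n) n (eS n) (\<lambda>_. C)"
definition "\<omega>n n = tp (DD n) n (eC n) (\<lambda>_. fo \<phi>)"
definition "yn n = tp (DY n) n (eY n) (\<lambda>_. fo \<phi>Y)"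

lemma codes: "code (p * r) n (DI n) (eI n)" "code (a * b) n (DO n) (eO n)" "code (p * a) n (DX n) (eX n)"
  "code (r * b) n (DY n) (eY n)" "code ((p * r) * (a * b)) n (DD n) (eS n)"
  using pos by (auto intro!: code_pair code_dgt)

lemma bipn: "bip (DD n) (DX n) (DY n) (\<pi>X n) (\<pi>Y n) (\<iota> n)" by (rule bip_choi)

lemma code_eC: "code ((p * a) * (r * b)) n (DD n) (eC n)"
  by (rule code_bip[OF bipn bip_div_mod codes(3,4)]) (simp add: eC_def)

lemma eS_ptI:
  assumes "z < DD n" "m < n"
  shows "eS n z m = ptI r a b (eX n (\<pi>X n z) m) (eY n (\<pi>Y n z) m)"
proof -
  have 1: "z div DO n < DI n" "z mod DO n < DO n" using div_less_prod[OF assms(1)] mod_less_prod[OF assms(1)] by auto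
  have 2: "z div DO n mod r ^ n < r ^ n" "z mod DO n div b ^ n < a ^ n" "z mod DO n mod b ^ n < b ^ n"
    using mod_less_prod[OF 1(1)] div_less_prod[OF 1(2)] mod_less_prod[OF 1(2)] by auto
  have 3: "dgt a n (z mod DO n div b ^ n) m < a" "dgt b n (z mod DO n mod b ^ n) m < b"
    using code_lt[OF code_dgt] 2 assms(2) pos by auto
  show ?thesis
    unfolding ptI_def pairc_def ptX_def ptY_def idx_div[OF 2(2)] idx_mod[OF 2(2)] idx_div[OF 2(3)] idx_mod[OF 2(3)]
      idx_div[OF 3(1)] idx_mod[OF 3(1)] idx_div[OF 3(2)] idx_mod[OF 3(2)] ..
qed

lemma eC_eS:
  assumes "z < DD n" "m < n"
  shows "eC n z m = ptX r a b (eS n z m) * (r * b) + ptY r a b (eS n z m)"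
proof -
  have "eX n (\<pi>X n z) m < p * a" "eY n (\<pi>Y n z) m < r * b"
    using code_lt[OF codes(3)] code_lt[OF codes(4)] bipD(1,2)[OF bipn assms(1)] assms(2) by auto
  then show ?thesis unfolding eS_ptI[OF assms] eC_def using bipD(5,6)[OF bip_choi] by simp
qed

text \<open>By \<open>eC_eS\<close> the two codes assign to an index the same letters up to the
  permutation of \<open>q_choi_index\<close>. So the powers of both Choi matrices live on one index
  set and differ only in normalization.\<close>

lemma \<omega>n_Cn: "\<omega>n n = (1 / real (DI n)) *\<^sub>R Cn n"
proof (rule fop_eq_bddI[of "DD n"])
  fix z w assume zw: "z < DD n" "w < DD n"
  have "ent (fo \<phi>) (eC n z m) (eC n w m) = complex_of_real (1 / real (p * r)) * ent C (eS n z m) (eS n w m)" if "m < n" for m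
    unfolding eC_eS[OF zw(1) that] eC_eS[OF zw(2) that]
    using q_choi_index[OF code_lt[OF codes(5) zw(1) that] code_lt[OF codes(5) zw(2) that]] by simp
  then have "(\<Prod>m<n. ent (fo \<phi>) (eC n z m) (eC n w m)) = (\<Prod>m<n. complex_of_real (1 / real (p * r)) * ent C (eS n z m) (eS n w m))"
    by (intro prod.cong) auto
  then show "ent (\<omega>n n) z w = ent ((1 / real (DI n)) *\<^sub>R Cn n) z w"
    using zw by (simp add: \<omega>n_def Cn_def ent_tp ent_simps prod.distrib prod_dividef scaleR_conv_of_real power_mult_distrib power_divide)
qed (auto simp: \<omega>n_def Cn_def)

lemma chan_pow: "X \<in> carrier_mat (DI n) (DI n) \<Longrightarrow> q_chan_pow p r a b n N X = chan (DI n) (DO n) (Cn n) X"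
  unfolding q_chan_pow_def chan_def
proof (rule cong_mat[OF refl refl], unfold split, intro sum.cong refl)
  fix i j k l assume ij: "i < DO n" "j < DO n" and kl: "k \<in> {..<DI n}" "l \<in> {..<DI n}"
  have lt: "k * DO n + i < DD n" "l * DO n + j < DD n" using kl ij by (auto intro: idx_less)
  have "ent C (eS n (k * DO n + i) m) (eS n (l * DO n + j) m)
    = N (q_ketbra (p * r) (q_bip_idx p r n m k) (q_bip_idx p r n m l)) $$ (q_bip_idx a b n m i, q_bip_idx a b n m j)"
    if m: "m < n" for m
  proof -
    have 1: "eI n k m < p * r" "eI n l m < p * r" "eO n i m < a * b" "eO n j m < a * b"
      using code_lt[OF codes(1)] code_lt[OF codes(2)] kl ij m by auto
    have s: "eS n (k * DO n + i) m = eI n k m * (a * b) + eO n i m" "eS n (l * DO n + j) m = eI n l m * (a * b) + eO n j m"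
      unfolding pairc_def[of "a * b" "DO n"] idx_div[OF ij(1)] idx_mod[OF ij(1)] idx_div[OF ij(2)] idx_mod[OF ij(2)] by simp_all
    show ?thesis unfolding s q_bip_idx_pairc choi_def ent_mkop idx_div[OF 1(3)] idx_mod[OF 1(3)] idx_div[OF 1(4)] idx_mod[OF 1(4)]
      using idx_less[OF 1(1,3)] idx_less[OF 1(2,4)] by simp
  qed
  then show "X $$ (k, l) * (\<Prod>m<n. N (q_ketbra (p * r) (q_bip_idx p r n m k) (q_bip_idx p r n m l)) $$
      (q_bip_idx a b n m i, q_bip_idx a b n m j)) = X $$ (k, l) * ent (Cn n) (k * DO n + i) (l * DO n + j)"
    using lt by (simp add: Cn_def ent_tp)
qed

lemma pr_pos: "0 < p * r" using pos by simp

lemmas C_channel = choi_channel[OF N pr_pos]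

lemma tr_C: "tr C = real (p * r)"
  using arg_cong[OF C_channel(2), of tr] tr_ptr[OF bip_out bdd_choi[of "p * r" "a * b" N]] by (simp add: tr_dg)

lemma \<phi>_carrier: "\<phi> \<in> carrier_mat ((p * a) * (r * b)) ((p * a) * (r * b))"
  by (simp add: q_choi_def mult.assoc)

lemma \<phi>_state: "q_state ((p * a) * (r * b)) \<phi>"
proof -
  define f where "f = (\<lambda>z. ptX r a b z * (r * b) + ptY r a b z)"
  have D: "(p * r) * (a * b) = (p * a) * (r * b)" by simp
  have f: "bij_betw f {..<(p * r) * (a * b)} {..<(p * r) * (a * b)}"
  proof (rule bij_betwI[where g = "\<lambda>u. ptI r a b (u div (r * b)) (u mod (r * b))"])
    show "f \<in> {..<(p * r) * (a * b)} \<rightarrow> {..<(p * r) * (a * b)}"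
      unfolding f_def using bipD(1,2)[OF bip_choi[of p r a b]] unfolding D by (auto intro: idx_less)
    show "(\<lambda>u. ptI r a b (u div (r * b)) (u mod (r * b))) \<in> {..<(p * r) * (a * b)} \<rightarrow> {..<(p * r) * (a * b)}"
    proof
      fix u assume "u \<in> {..<(p * r) * (a * b)}"
      then have "u < (p * a) * (r * b)" unfolding D by simp
      from bipD(4)[OF bip_choi div_less_prod[OF this] mod_less_prod[OF this]]
      show "ptI r a b (u div (r * b)) (u mod (r * b)) \<in> {..<(p * r) * (a * b)}" by simp
    qed
    fix z assume z: "z \<in> {..<(p * r) * (a * b)}"
    then have y: "ptY r a b z < r * b" using bipD(2)[OF bip_choi] by blast
    show "ptI r a b (f z div (r * b)) (f z mod (r * b)) = z"
      unfolding f_def idx_div[OF y] idx_mod[OF y] using bipD(3)[OF bip_choi] z by blast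
    from z have "z < (p * a) * (r * b)" unfolding D by simp
    from bipD(5,6)[OF bip_choi div_less_prod[OF this] mod_less_prod[OF this]]
    show "f (ptI r a b (z div (r * b)) (z mod (r * b))) = z" unfolding f_def by (simp only: div_mult_mod_eq)
  qed
  have e: "ent (fo \<phi>) (f z) (f w) = ent ((1 / real (p * r)) *\<^sub>R C) z w"
    if "z < (p * r) * (a * b)" "w < (p * r) * (a * b)" for z w
    unfolding f_def q_choi_index[OF that] by (simp add: ent_simps scaleR_conv_of_real)
  have b: "bdd ((p * r) * (a * b)) (fo \<phi>)" using bdd_fo[OF \<phi>_carrier] unfolding D .
  have bC: "bdd ((p * r) * (a * b)) ((1 / real (p * r)) *\<^sub>R C)" by simp
  have "0 \<le> (1 / real (p * r)) *\<^sub>R C" by (intro scaleR_nonneg_nonneg C_channel) simp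
  from psd_reindex(1)[OF f bC b e this] psd_reindex(2)[OF f bC b e]
  show ?thesis using \<phi>_carrier pos by (simp add: q_state_fo tr_C)
qed

lemma fo_\<phi>Y: "fo \<phi>Y = ptr (p * a) (r * b) (\<lambda>x y. x * (r * b) + y) (fo \<phi>)"
proof (rule fop_eq_bddI[of "r * b"])
  fix y y' assume y: "y < r * b" "y' < r * b"
  show "ent (fo \<phi>Y) y y' = ent (ptr (p * a) (r * b) (\<lambda>x y. x * (r * b) + y) (fo \<phi>)) y y'"
    using y idx_less[OF _ y(1), of _ "p * a"] idx_less[OF _ y(2), of _ "p * a"]
    by (simp add: ent_ptr ent_fo_carrier[OF \<phi>_carrier] q_ptrace1_def fo_mat ent_mkop)
qed (auto simp: q_ptrace1_def fo_mat)

lemma \<phi>Y_carrier: "\<phi>Y \<in> carrier_mat (r * b) (r * b)" by (simp add: q_ptrace1_def)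

lemma \<phi>Y_state: "q_state (r * b) \<phi>Y"
  using psd_le_lift_ptr(1)[OF bip_div_mod bdd_fo[OF \<phi>_carrier]] tr_ptr[OF bip_div_mod bdd_fo[OF \<phi>_carrier]] \<phi>_state \<phi>Y_carrier
  by (simp add: q_state_fo fo_\<phi>Y)

lemma pY_\<omega>n: "pY n (\<omega>n n) = yn n"
  unfolding \<omega>n_def yn_def fo_\<phi>Y
  by (rule ptr_tp[OF bipn bip_div_mod codes(3,4)]) (simp add: eC_def)

lemma \<omega>n_props: "bdd (DD n) (\<omega>n n)" "0 \<le> \<omega>n n" "tr (\<omega>n n) = 1"
proof -
  show "bdd (DD n) (\<omega>n n)" by (simp add: \<omega>n_def)
  note s = \<phi>_state[unfolded q_state_fo]
  show "0 \<le> \<omega>n n" unfolding \<omega>n_def by (rule tp_psd[OF code_eC]) (use s bdd_fo in auto)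
  have "ctr (\<omega>n n) = (\<Prod>m<n. ctr (fo \<phi>))" unfolding \<omega>n_def by (rule ctr_tp[OF code_eC]) (use s bdd_fo in auto)
  also have "ctr (fo \<phi>) = 1" using s psd_ctr[of "fo \<phi>"] by simp
  finally show "tr (\<omega>n n) = 1" by (simp add: tr_def)
qed

lemma yn_props: "bdd (DY n) (yn n)" "0 \<le> yn n" "tr (yn n) = 1"
  using psd_le_lift_ptr(1)[OF bipn \<omega>n_props(1,2)] tr_ptr[OF bipn \<omega>n_props(1)] \<omega>n_props(3)
  by (simp_all add: pY_\<omega>n yn_def)

lemma tr_lf: "bdd (DY n) S \<Longrightarrow> bdd (DD n) M \<Longrightarrow> tr (lf n S * M) = tr (S * pY n M)"
  by (rule tr_lift[OF bipn])

lemma lf_times: "bdd (DY n) S \<Longrightarrow> lf n S * lf n T = lf n (S * T)"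
  using ten_times[OF bipn, where A = "idn (DX n)" and A' = "idn (DX n)" and B = S and B' = T] by simp

lemma lf_idn: "lf n (idn (DY n)) = idn (DD n)" by (rule ten_idn[OF bipn])

lemma lf_adj: "adj (lf n S) = lf n (adj S)" by (simp add: ten_adj)

lemma lf_proj: "proj_on (DY n) Q \<Longrightarrow> proj_on (DD n) (lf n Q)"
  by (simp add: proj_on_def lf_adj lf_times)

definition "SX = q_entropy \<phi>"
definition "SY = q_entropy \<phi>Y"
definition "rate = q_cond_entropy (p * a) (r * b) \<phi> - log 2 (real p)"

lemma rate: "rate = SX - SY - log 2 (real p)" by (simp add: rate_def q_cond_entropy_def SX_def SY_def)

section \<open>Typical projections of the Choi state and the converse test\<close>

lemma projections:
  assumes \<delta>: "0 < \<delta>" and \<eta>: "0 < \<eta>"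
  shows "\<exists>n0. \<forall>n\<ge>n0. \<exists>P Q. typical_proj (DD n) (\<omega>n n) (\<omega>n n) (2 powr (real n * (- SX - \<delta>))) (2 powr (real n * (- SX + \<delta>))) \<eta> P
    \<and> typical_proj (DY n) (yn n) (yn n) (2 powr (real n * (- SY - \<delta>))) (2 powr (real n * (- SY + \<delta>))) \<eta> Q
    \<and> tr (\<omega>n n * (idn (DD n) - lf n Q)) \<le> \<eta>"
proof -
  note s = \<phi>_state[unfolded q_state_fo] and sY = \<phi>Y_state[unfolded q_state_fo]
  have sp: "supported_in ((p * a) * (r * b)) (fo \<phi>) (fo \<phi>)" "supported_in (r * b) (fo \<phi>Y) (fo \<phi>Y)"
    using supported_in_le[of "fo \<phi>" 1 "fo \<phi>"] supported_in_le[of "fo \<phi>Y" 1 "fo \<phi>Y"] s sY by auto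
  have t: "tr (fo \<phi> * fo (q_log \<phi>)) = - SX" "tr (fo \<phi>Y * fo (q_log \<phi>Y)) = - SY"
    unfolding SX_def SY_def using ent_log_tr[of \<phi>] ent_log_tr[of \<phi>Y] q_log_carrier s sY by auto
  have "\<exists>n1. \<forall>n\<ge>n1. \<forall>D e. code ((p * a) * (r * b)) n D e \<longrightarrow> (\<exists>P. typical_proj D (tp D n e (\<lambda>_. fo \<phi>)) (tp D n e (\<lambda>_. fo \<phi>))
    (2 powr (real n * (- SX - \<delta>))) (2 powr (real n * (- SX + \<delta>))) \<eta> P)"
    by (rule typical_log[OF \<phi>_state conjunct1[OF s] conjunct1[OF conjunct2[OF s]] sp(1) \<delta> \<eta>, unfolded t])
  then obtain n1 where n1: "\<forall>n\<ge>n1. \<forall>D e. code ((p * a) * (r * b)) n D e \<longrightarrow> (\<exists>P. typical_proj D (tp D n e (\<lambda>_. fo \<phi>)) (tp D n e (\<lambda>_. fo \<phi>))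
    (2 powr (real n * (- SX - \<delta>))) (2 powr (real n * (- SX + \<delta>))) \<eta> P)" ..
  have "\<exists>n2. \<forall>n\<ge>n2. \<forall>D e. code (r * b) n D e \<longrightarrow> (\<exists>P. typical_proj D (tp D n e (\<lambda>_. fo \<phi>Y)) (tp D n e (\<lambda>_. fo \<phi>Y))
    (2 powr (real n * (- SY - \<delta>))) (2 powr (real n * (- SY + \<delta>))) \<eta> P)"
    by (rule typical_log[OF \<phi>Y_state conjunct1[OF sY] conjunct1[OF conjunct2[OF sY]] sp(2) \<delta> \<eta>, unfolded t])
  then obtain n2 where n2: "\<forall>n\<ge>n2. \<forall>D e. code (r * b) n D e \<longrightarrow> (\<exists>P. typical_proj D (tp D n e (\<lambda>_. fo \<phi>Y)) (tp D n e (\<lambda>_. fo \<phi>Y))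
    (2 powr (real n * (- SY - \<delta>))) (2 powr (real n * (- SY + \<delta>))) \<eta> P)" ..
  show ?thesis
  proof (intro exI[of _ "max n1 n2"] allI impI)
    fix n assume n: "max n1 n2 \<le> n"
    then have n': "n1 \<le> n" "n2 \<le> n" by simp_all
    obtain P where P: "typical_proj (DD n) (\<omega>n n) (\<omega>n n) (2 powr (real n * (- SX - \<delta>))) (2 powr (real n * (- SX + \<delta>))) \<eta> P"
      using n1[rule_format, OF n'(1) code_eC] unfolding \<omega>n_def ..
    obtain Q where Q: "typical_proj (DY n) (yn n) (yn n) (2 powr (real n * (- SY - \<delta>))) (2 powr (real n * (- SY + \<delta>))) \<eta> Q"
      using n2[rule_format, OF n'(2) codes(4)] unfolding yn_def ..
    have bQ: "bdd (DY n) Q" using Q by (simp add: typical_proj_def proj_on_def)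
    \<comment> \<open>The lifted projection sees only the marginal on \<open>Y\<close>, so it misses
      exactly the mass that \<open>Q\<close> misses on \<open>yn n\<close>.\<close>
    have "tr (\<omega>n n * (idn (DD n) - lf n Q)) = tr (lf n (idn (DY n) - Q) * \<omega>n n)"
      unfolding lf_idn[symmetric] ten_linear(2) by (rule tr_mult_commute)
    also have "\<dots> = tr (yn n * (idn (DY n) - Q))"
      using tr_lf[of n "idn (DY n) - Q" "\<omega>n n"] bQ \<omega>n_props(1) by (simp add: pY_\<omega>n tr_mult_commute)
    also have "\<dots> \<le> \<eta>" using Q by (simp add: typical_proj_def)
    finally show "\<exists>P Q. typical_proj (DD n) (\<omega>n n) (\<omega>n n) (2 powr (real n * (- SX - \<delta>))) (2 powr (real n * (- SX + \<delta>))) \<eta> P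
      \<and> typical_proj (DY n) (yn n) (yn n) (2 powr (real n * (- SY - \<delta>))) (2 powr (real n * (- SY + \<delta>))) \<eta> Q
      \<and> tr (\<omega>n n * (idn (DD n) - lf n Q)) \<le> \<eta>"
      using P Q by blast
  qed
qed

text \<open>Replacing \<open>P\<close> by \<open>\<omega>n n / lo\<close> allows the
  \<open>X\<close> part to be traced out, which leaves \<open>yn n\<close> compressed by
  \<open>Q\<close>, at most \<open>hi'\<close>. The outer copies of \<open>lf n Q\<close> are there
  for this last step: without them an arbitrary \<open>\<sigma>\<close> would meet the largest
  eigenvalue of \<open>yn n\<close>.\<close>

lemma test_bound:
  assumes P: "typical_proj (DD n) (\<omega>n n) (\<omega>n n) lo hi \<eta> P" and Q: "typical_proj (DY n) (yn n) (yn n) lo' hi' \<eta> Q"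
    and lo: "0 < lo" "0 \<le> hi'" and \<sigma>: "bdd (DY n) \<sigma>" "0 \<le> \<sigma>"
  shows "tr (lf n \<sigma> * (lf n Q * P * lf n Q)) \<le> hi' / lo * tr \<sigma>"
proof -
  have q: "proj_on (DY n) Q" "yn n * Q \<le> hi' *\<^sub>R Q" "Q * yn n = yn n * Q" using Q by (auto simp: typical_proj_def)
  note qq = proj_onD[OF q(1)] and lq = proj_onD[OF lf_proj[OF q(1)]]
  have "lf n Q * P * lf n Q \<le> lf n Q * ((1 / lo) *\<^sub>R \<omega>n n) * lf n Q"
    using conj_mono[OF typical_proj_proj_le[OF P \<omega>n_props(2) lo(1)], of "lf n Q"] by (simp add: lq)
  moreover have p\<sigma>: "0 \<le> lf n \<sigma>" by (rule ten_psd[OF bipn _ \<sigma>(1) idn_psd[OF bipn] \<sigma>(2)]) simp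
  ultimately have "tr (lf n Q * P * lf n Q * lf n \<sigma>) \<le> tr (lf n Q * ((1 / lo) *\<^sub>R \<omega>n n) * lf n Q * lf n \<sigma>)"
    by (rule tr_mult_mono)
  also have "\<dots> = (1 / lo) * tr (\<omega>n n * (lf n Q * lf n \<sigma> * lf n Q))"
    using tr_mult_commute[of "lf n Q" "\<omega>n n * lf n Q * lf n \<sigma>"] by (simp add: mult.assoc)
  also have "tr (\<omega>n n * (lf n Q * lf n \<sigma> * lf n Q)) = tr (lf n (Q * \<sigma> * Q) * \<omega>n n)"
    using qq \<sigma> by (subst tr_mult_commute) (simp add: lf_times)
  also have "\<dots> = tr (Q * \<sigma> * Q * yn n)" using tr_lf[of n "Q * \<sigma> * Q" "\<omega>n n"] qq \<sigma> \<omega>n_props(1) by (simp add: pY_\<omega>n)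
  also have "\<dots> = tr (yn n * Q * \<sigma>)"
  proof -
    have "tr (Q * \<sigma> * Q * yn n) = tr (\<sigma> * (Q * yn n * Q))" using tr_mult_commute[of Q "\<sigma> * Q * yn n"] by (simp add: mult.assoc)
    also have "Q * yn n * Q = yn n * Q" using q(3) qq by (simp add: mult.assoc)
    finally show ?thesis by (simp add: tr_mult_commute)
  qed
  also have "\<dots> \<le> tr (hi' *\<^sub>R Q * \<sigma>)" by (intro tr_mult_mono q \<sigma>)
  also have "\<dots> = hi' * tr (Q * \<sigma>)" by simp
  also have "tr (Q * \<sigma>) \<le> tr (idn (DY n) * \<sigma>)" by (intro tr_mult_mono proj_le q \<sigma>)
  finally have "tr (lf n Q * P * lf n Q * lf n \<sigma>) \<le> (1 / lo) * (hi' * tr (idn (DY n) * \<sigma>))"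
    using lo by (simp add: divide_right_mono mult_left_mono)
  then show ?thesis using \<sigma> by (simp add: tr_mult_commute)
qed

lemma converse_test:
  assumes \<delta>: "0 < \<delta>"
  shows "\<exists>n0. \<forall>n\<ge>n0. \<exists>T. bdd (DD n) T \<and> 0 \<le> T \<and> T \<le> idn (DD n) \<and> tr (\<omega>n n * (idn (DD n) - T)) \<le> 1/16 \<and>
    (\<forall>\<sigma>. bdd (DY n) \<sigma> \<longrightarrow> 0 \<le> \<sigma> \<longrightarrow> tr (lf n \<sigma> * T) \<le> 2 powr (real n * (SX - SY + 2 * \<delta>)) * tr \<sigma>)"
proof -
  \<comment> \<open>For this value \<open>(1 - s) / (1 + s) = 31/33\<close>, just above the
    acceptance \<open>15/16\<close> required by \<open>q_fidelity_test\<close>.\<close>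
  define s :: real where "s = 1/32"
  have s: "0 < s" "0 < s\<^sup>2 / (4 * (1 + s))" by (simp_all add: s_def)
  obtain n0 where n0: "\<And>n. n0 \<le> n \<Longrightarrow> \<exists>P Q. typical_proj (DD n) (\<omega>n n) (\<omega>n n) (2 powr (real n * (- SX - \<delta>))) (2 powr (real n * (- SX + \<delta>))) (s\<^sup>2 / (4 * (1 + s))) P
    \<and> typical_proj (DY n) (yn n) (yn n) (2 powr (real n * (- SY - \<delta>))) (2 powr (real n * (- SY + \<delta>))) (s\<^sup>2 / (4 * (1 + s))) Q
    \<and> tr (\<omega>n n * (idn (DD n) - lf n Q)) \<le> s\<^sup>2 / (4 * (1 + s))"
    using projections[OF \<delta> s(2)] by blast
  show ?thesis
  proof (intro exI[of _ n0] allI impI)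
    fix n assume "n0 \<le> n"
    from n0[OF this] obtain P Q where P: "typical_proj (DD n) (\<omega>n n) (\<omega>n n) (2 powr (real n * (- SX - \<delta>))) (2 powr (real n * (- SX + \<delta>))) (s\<^sup>2 / (4 * (1 + s))) P"
      and Q: "typical_proj (DY n) (yn n) (yn n) (2 powr (real n * (- SY - \<delta>))) (2 powr (real n * (- SY + \<delta>))) (s\<^sup>2 / (4 * (1 + s))) Q"
      and tQ: "tr (\<omega>n n * (idn (DD n) - lf n Q)) \<le> s\<^sup>2 / (4 * (1 + s))" by blast
    have p: "proj_on (DD n) P" "tr (\<omega>n n * (idn (DD n) - P)) \<le> s\<^sup>2 / (4 * (1 + s))" using P by (auto simp: typical_proj_def)
    have q: "proj_on (DD n) (lf n Q)" using Q lf_proj by (simp add: typical_proj_def)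
    define T where "T = lf n Q * P * lf n Q"
    note st = sandwich_test[OF p(1) q, folded T_def]
    have "(1 - s) / (1 + s) \<le> tr (\<omega>n n * T)"
      unfolding st(3) by (rule smoothing_trace[OF \<omega>n_props q p(1) s(1) tQ p(2)])
    then have "tr (\<omega>n n * (idn (DD n) - T)) \<le> 1/16"
      using \<omega>n_props by (simp add: right_diff_distrib s_def)
    moreover have "tr (lf n \<sigma> * T) \<le> 2 powr (real n * (SX - SY + 2 * \<delta>)) * tr \<sigma>" if "bdd (DY n) \<sigma>" "0 \<le> \<sigma>" for \<sigma>
    proof -
      have "2 powr (real n * (- SY + \<delta>)) / 2 powr (real n * (- SX - \<delta>)) = 2 powr (real n * (SX - SY + 2 * \<delta>))"
        unfolding powr_diff[symmetric] by (simp add: algebra_simps)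
      then show ?thesis using test_bound[OF P Q _ _ that] by (simp add: T_def)
    qed
    moreover have "bdd (DD n) T" using p q by (simp add: T_def proj_onD)
    ultimately show "\<exists>T. bdd (DD n) T \<and> 0 \<le> T \<and> T \<le> idn (DD n) \<and> tr (\<omega>n n * (idn (DD n) - T)) \<le> 1/16 \<and>
      (\<forall>\<sigma>. bdd (DY n) \<sigma> \<longrightarrow> 0 \<le> \<sigma> \<longrightarrow> tr (lf n \<sigma> * T) \<le> 2 powr (real n * (SX - SY + 2 * \<delta>)) * tr \<sigma>)"
      using st(1,2) by blast
  qed
qed

end

section \<open>Purified distance and channel divergences\<close>

lemma pdist_fidelity:
  assumes "q_pdist din dout M1 M2 \<le> \<epsilon>" "0 < k" "q_state (k * din) \<rho>"
  shows "sqrt (1 - q_fidelity (q_id_tensor k din dout M1 \<rho>) (q_id_tensor k din dout M2 \<rho>)) \<le> \<epsilon>"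
proof -
  let ?f = "\<lambda>p. sqrt (1 - q_fidelity (q_id_tensor (fst p) din dout M1 (snd p)) (q_id_tensor (fst p) din dout M2 (snd p)))"
  \<comment> \<open>A supremum of reals dominates its members only if the set is bounded above; here
    1 is a bound because \<open>q_fidelity\<close> is a square.\<close>
  have "bdd_above (?f ` {(k, \<rho>). 0 < k \<and> q_state (k * din) \<rho>})"
    by (intro bdd_aboveI[of _ 1]) (auto simp: q_fidelity_def)
  from cSUP_upper[OF _ this, of "(k, \<rho>)"] assms show ?thesis by (simp add: q_pdist_def)
qed

lemma Dmax_lower:
  assumes "\<And>c. 0 < c \<Longrightarrow> q_psd (dim_row \<rho>) (complex_of_real c \<cdot>\<^sub>m \<sigma> - \<rho>) \<Longrightarrow> x \<le> log 2 c"
  shows "ereal x \<le> q_Dmax \<rho> \<sigma>"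
  unfolding q_Dmax_def using assms by (auto intro!: Inf_greatest)

lemma Dmax_upper:
  assumes "0 < c" "\<rho> \<in> carrier_mat d d" "\<sigma> \<in> carrier_mat d d" "fo \<rho> \<le> c *\<^sub>R fo \<sigma>"
  shows "q_Dmax \<rho> \<sigma> \<le> ereal (log 2 c)"
proof -
  have "q_psd (dim_row \<rho>) (complex_of_real c \<cdot>\<^sub>m \<sigma> - \<rho>)"
    using assms fo_minus[of "complex_of_real c \<cdot>\<^sub>m \<sigma>" d \<rho>] by (auto simp: q_psd_fo fo_smult)
  then show ?thesis unfolding q_Dmax_def using assms(1) by (intro Inf_lower) blast
qed

lemma chan_div_ge: "0 < k \<Longrightarrow> q_state (k * din) \<rho> \<Longrightarrow>
    Dv (q_id_tensor k din dout M \<rho>) (q_id_tensor k din dout M' \<rho>) \<le> q_chan_div Dv din dout M M'"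
  unfolding q_chan_div_def by (rule SUP_upper2[of "(k, \<rho>)"]) auto

lemma chan_div_le:
  assumes "\<And>k \<rho>. 0 < k \<Longrightarrow> q_state (k * din) \<rho> \<Longrightarrow> Dv (q_id_tensor k din dout M \<rho>) (q_id_tensor k din dout M' \<rho>) \<le> x"
  shows "q_chan_div Dv din dout M M' \<le> x"
  unfolding q_chan_div_def using assms by (auto intro!: SUP_least)

section \<open>Converse bound for the smoothed min-entropy\<close>

context bichan
begin

lemma Cn_props: "bdd (DD n) (Cn n)" "0 \<le> Cn n" "marg (DI n) (DO n) (Cn n) = idn (DI n)"
proof -
  show "bdd (DD n) (Cn n)" by (simp add: Cn_def)
  show "0 \<le> Cn n" unfolding Cn_def by (rule tp_psd[OF codes(5)]) (use C_channel in auto)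
  have "marg (DI n) (DO n) (Cn n) = tp (DI n) n (eI n) (\<lambda>_. marg (p * r) (a * b) C)"
    unfolding Cn_def by (rule ptr_tp[OF bip_out bip_out codes(2,1)]) (simp add: pairc_def)
  then show "marg (DI n) (DO n) (Cn n) = idn (DI n)" by (simp add: C_channel tp_idn[OF codes(1)])
qed

lemma id_pow: "X \<in> carrier_mat (k * DI n) (k * DI n) \<Longrightarrow>
    fo (q_id_tensor k (DI n) (DO n) (q_chan_pow p r a b n N) X) = act k (DI n) (DO n) (Cn n) (fo X)"
  by (rule id_tensor_act[OF chan_pow])

lemma id_RQ: "X \<in> carrier_mat (k * DI n) (k * DI n) \<Longrightarrow>
    fo (q_id_tensor k (DI n) (DO n) (q_tensor_map (p ^ n) (r ^ n) (a ^ n) (b ^ n) (q_replacer (a ^ n)) Q) X)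
      = act k (DI n) (DO n) (lf n (choi (r ^ n) (b ^ n) Q)) (fo X)"
  by (rule id_tensor_act[OF choi_tensor_replacer])

lemma DI_pos: "0 < DI n" using pos by simp

lemma tr_choi: "q_channel (r ^ n) (b ^ n) Q \<Longrightarrow> tr (choi (r ^ n) (b ^ n) Q) = real r ^ n"
  using arg_cong[OF choi_channel(2)[of "r ^ n" "b ^ n" Q], of tr] tr_ptr[OF bip_out bdd_choi[of "r ^ n" "b ^ n" Q]] pos
  by (simp add: tr_dg)

lemma pow_powr: "real p ^ n = 2 powr (real n * log 2 (real p))"
proof -
  have "2 powr (real n * log 2 (real p)) = (2 powr log 2 (real p)) powr real n"
    unfolding powr_powr by (simp only: mult.commute)
  then show ?thesis using pos by (simp add: powr_realpow)
qed

text \<open>The maximally entangled input already gives the bound, since its outputs are normalized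
  Choi matrices. The smoothed channel still passes the test with probability 1/4. Domination with
  constant \<open>c\<close> limits that probability by \<open>c / (p r)^n\<close> times the bound
  for \<open>\<sigma>\<close> of trace \<open>r^n\<close>; the remaining \<open>1 / p^n\<close> is
  the source of the term \<open>- log |A'|\<close>.\<close>

lemma chan_div_Dmax_lower:
  assumes T: "bdd (DD n) T" "0 \<le> T" "T \<le> idn (DD n)" "tr (\<omega>n n * (idn (DD n) - T)) \<le> 1/16"
    and Tb: "\<And>\<sigma>. bdd (DY n) \<sigma> \<Longrightarrow> 0 \<le> \<sigma> \<Longrightarrow> tr (lf n \<sigma> * T) \<le> 2 powr (real n * (SX - SY + 2 * \<delta>)) * tr \<sigma>"
    and Q: "q_channel (r ^ n) (b ^ n) Q" and M: "q_channel (DI n) (DO n) M"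
    and e: "q_pdist (DI n) (DO n) (q_chan_pow p r a b n N) M \<le> \<epsilon>" "\<epsilon> \<le> 1/4"
  shows "ereal (- (real n * (rate + 2 * \<delta>) + 2)) \<le> q_chan_div q_Dmax (DI n) (DO n) M
    (q_tensor_map (p ^ n) (r ^ n) (a ^ n) (b ^ n) (q_replacer (a ^ n)) Q)"
proof -
  define \<Phi> where "\<Phi> = maxent (DI n)"
  define \<omega> where "\<omega> = q_id_tensor (DI n) (DI n) (DO n) (q_chan_pow p r a b n N) \<Phi>"
  define \<omega>' where "\<omega>' = q_id_tensor (DI n) (DI n) (DO n) M \<Phi>"
  define \<tau> where "\<tau> = q_id_tensor (DI n) (DI n) (DO n) (q_tensor_map (p ^ n) (r ^ n) (a ^ n) (b ^ n) (q_replacer (a ^ n)) Q) \<Phi>"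
  have \<Phi>: "q_state (DI n * DI n) \<Phi>" unfolding \<Phi>_def by (rule maxent_state[OF DI_pos])
  then have \<Phi>c: "\<Phi> \<in> carrier_mat (DI n * DI n) (DI n * DI n)" by (simp add: q_state_fo)
  let ?S = "choi (r ^ n) (b ^ n) Q"
  have fo1: "fo \<omega> = \<omega>n n"
    unfolding \<omega>_def id_pow[OF \<Phi>c] \<omega>n_Cn unfolding \<Phi>_def by (rule act_maxent) (rule Cn_props)
  have "fo \<omega>' = act (DI n) (DI n) (DO n) (choi (DI n) (DO n) M) (fo \<Phi>)"
    unfolding \<omega>'_def by (rule id_tensor_act[OF _ \<Phi>c]) (rule channel_chan[OF M])
  then have fo2: "fo \<omega>' = (1 / real (DI n)) *\<^sub>R choi (DI n) (DO n) M"
    unfolding \<Phi>_def by (simp only: act_maxent[OF bdd_choi])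
  have fo3: "fo \<tau> = (1 / real (DI n)) *\<^sub>R lf n ?S"
    unfolding \<tau>_def id_RQ[OF \<Phi>c] unfolding \<Phi>_def by (rule act_maxent) simp
  note fo = fo1 fo2 fo3
  have carr: "\<omega> \<in> carrier_mat (DD n) (DD n)" "\<omega>' \<in> carrier_mat (DD n) (DD n)" "\<tau> \<in> carrier_mat (DD n) (DD n)"
    unfolding \<omega>_def \<omega>'_def \<tau>_def by (rule id_tensor_carrier)+
  have st: "q_state (DD n) \<omega>" using carr \<omega>n_props by (simp add: q_state_fo fo)
  have "tr (choi (DI n) (DO n) M) = real (DI n)"
    using arg_cong[OF choi_channel(2)[OF M DI_pos], of tr] tr_ptr[OF bip_out bdd_choi[of "DI n" "DO n" M]] by (simp add: tr_dg)
  then have st': "q_state (DD n) \<omega>'"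
    using carr choi_channel(1)[OF M DI_pos] pos by (simp add: q_state_fo fo scaleR_nonneg_nonneg)
  have "sqrt (1 - q_fidelity \<omega> \<omega>') \<le> 1/4"
    using pdist_fidelity[OF e(1) DI_pos \<Phi>] e(2) by (simp add: \<omega>_def \<omega>'_def)
  then have "1 - q_fidelity \<omega> \<omega>' \<le> (1/4)\<^sup>2" by (rule sqrt_le_D)
  then have "9/16 \<le> q_fidelity \<omega> \<omega>'" by (simp add: power2_eq_square)
  then have quarter: "1/4 \<le> tr (fo \<omega>' * T)"
    by (rule q_fidelity_test[OF st st']) (use T in \<open>simp_all add: fo1\<close>)
  have S: "0 \<le> ?S" using choi_channel(1)[OF Q] pos by simp
  have "ereal (- (real n * (rate + 2 * \<delta>) + 2)) \<le> q_Dmax \<omega>' \<tau>"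
  proof (rule Dmax_lower)
    fix c :: real assume c: "0 < c" and psd: "q_psd (dim_row \<omega>') (complex_of_real c \<cdot>\<^sub>m \<tau> - \<omega>')"
    have "fo \<omega>' \<le> c *\<^sub>R fo \<tau>"
      using psd carr fo_minus[of "complex_of_real c \<cdot>\<^sub>m \<tau>" "DD n" \<omega>'] by (simp add: q_psd_fo fo_smult)
    then have "tr (fo \<omega>' * T) \<le> tr (c *\<^sub>R fo \<tau> * T)" using T(2) by (rule tr_mult_mono)
    also have "\<dots> = c / real (DI n) * tr (lf n ?S * T)" by (simp add: fo)
    also have "\<dots> \<le> c / real (DI n) * (2 powr (real n * (SX - SY + 2 * \<delta>)) * real r ^ n)"
      using Tb[of ?S] S c tr_choi[OF Q] by (intro mult_left_mono) auto
    also have "\<dots> = c * (2 powr (real n * (SX - SY + 2 * \<delta>)) / real p ^ n)" using pos by simp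
    also have "2 powr (real n * (SX - SY + 2 * \<delta>)) / real p ^ n = 2 powr (real n * (rate + 2 * \<delta>))"
      unfolding pow_powr powr_diff[symmetric] rate by (simp add: algebra_simps)
    finally have "1/4 \<le> c * 2 powr (real n * (rate + 2 * \<delta>))" using quarter by simp
    then have "log 2 (1/4) \<le> log 2 (c * 2 powr (real n * (rate + 2 * \<delta>)))" using c by (subst log_le_cancel_iff) auto
    also have "\<dots> = log 2 c + real n * (rate + 2 * \<delta>)" using c by (simp add: log_mult)
    \<comment> \<open>The additive constant 2 of the claim is the price of the acceptance
      probability 1/4; it disappears after division by \<open>n\<close>.\<close>
    also have "log 2 (1/4) = - 2"
    proof -
      have "log 2 (1/4) = log 2 (2 powr - 2)" by (simp add: powr_minus_divide)
      then show ?thesis by simp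
    qed
    finally show "- (real n * (rate + 2 * \<delta>) + 2) \<le> log 2 c" by simp
  qed
  then show ?thesis unfolding \<omega>'_def \<tau>_def using chan_div_ge[OF DI_pos \<Phi>] by (rule order_trans)
qed

text \<open>The threshold for \<open>n\<close> is uniform in \<open>\<epsilon>\<close>, so the limit
  in \<open>n\<close> can be bounded for each small \<open>\<epsilon>\<close> by the same
  number.\<close>

lemma smooth_upper:
  assumes \<delta>: "0 < \<delta>"
  shows "\<exists>n0. \<forall>n\<ge>n0. \<forall>\<epsilon>\<le>1/4. q_smooth_min_entropy \<epsilon> (p ^ n) (r ^ n) (a ^ n) (b ^ n) (q_chan_pow p r a b n N)
    \<le> ereal (real n * (rate + 2 * \<delta>) + 2)"
proof -
  from converse_test[OF \<delta>] obtain n0 where n0: "\<forall>n\<ge>n0. \<exists>T. bdd (DD n) T \<and> 0 \<le> T \<and> T \<le> idn (DD n) \<and> tr (\<omega>n n * (idn (DD n) - T)) \<le> 1/16 \<and>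
    (\<forall>\<sigma>. bdd (DY n) \<sigma> \<longrightarrow> 0 \<le> \<sigma> \<longrightarrow> tr (lf n \<sigma> * T) \<le> 2 powr (real n * (SX - SY + 2 * \<delta>)) * tr \<sigma>)" ..
  show ?thesis
  proof (intro exI[of _ n0] allI impI)
    fix n and \<epsilon> :: real assume n: "n0 \<le> n" and \<epsilon>: "\<epsilon> \<le> 1/4"
    from n0[rule_format, OF n] obtain T where T: "bdd (DD n) T" "0 \<le> T" "T \<le> idn (DD n)" "tr (\<omega>n n * (idn (DD n) - T)) \<le> 1/16"
      and Tb: "\<And>\<sigma>. bdd (DY n) \<sigma> \<Longrightarrow> 0 \<le> \<sigma> \<Longrightarrow> tr (lf n \<sigma> * T) \<le> 2 powr (real n * (SX - SY + 2 * \<delta>)) * tr \<sigma>" by blast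
    have "- ereal (real n * (rate + 2 * \<delta>) + 2) \<le> (INF Q \<in> {Q. q_channel (r ^ n) (b ^ n) Q}.
         INF Nt \<in> {Nt. q_channel (DI n) (DO n) Nt \<and> q_pdist (DI n) (DO n) (q_chan_pow p r a b n N) Nt \<le> \<epsilon>}.
          q_chan_div q_Dmax (DI n) (DO n) Nt (q_tensor_map (p ^ n) (r ^ n) (a ^ n) (b ^ n) (q_replacer (a ^ n)) Q))"
      using chan_div_Dmax_lower[OF T Tb _ _ _ \<epsilon>] by (intro INF_greatest) auto
    then show "q_smooth_min_entropy \<epsilon> (p ^ n) (r ^ n) (a ^ n) (b ^ n) (q_chan_pow p r a b n N) \<le> ereal (real n * (rate + 2 * \<delta>) + 2)"
      unfolding q_smooth_min_entropy_def by (subst ereal_uminus_le_reorder)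
  qed
qed

section \<open>Lower bound on the relative entropy to a replacer\<close>

lemma tp_RQ: "tp (DD n) n (eS n) (\<lambda>_. c *\<^sub>R ten ((p * r) * (a * b)) (ptX r a b) (ptY r a b) (idn (p * a)) S)
    = c ^ n *\<^sub>R lf n (tp (DY n) n (eY n) (\<lambda>_. S))"
proof -
  have "tp (DD n) n (eS n) (\<lambda>_. ten ((p * r) * (a * b)) (ptX r a b) (ptY r a b) (idn (p * a)) S)
    = ten (DD n) (\<pi>X n) (\<pi>Y n) (tp (DX n) n (eX n) (\<lambda>_. idn (p * a))) (tp (DY n) n (eY n) (\<lambda>_. S))"
    by (rule ten_tp[OF bipn bip_choi codes(3) codes(4)]) (rule eS_ptI)
  then show ?thesis by (simp only: tp_scaleR tp_idn[OF codes(3)])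
qed

text \<open>If the support condition fails the divergence is infinite. Otherwise, smoothing with the
  typical projections for exponents \<open>t1\<close> and \<open>t2\<close> dominates most of the
  \<open>n\<close>-fold Choi state by \<open>2 powr (n (t1 - t2 + 2 \<delta>))\<close> times the
  power of \<open>\<tau>\<close>. The converse test accepts the Choi state but little of that power,
  which forces \<open>t1 - t2 + rate + 4 \<delta>\<close> to be nonnegative.\<close>

lemma rel_ent_lower:
  assumes Q: "q_channel r b Q"
  shows "ereal (- rate) \<le> q_chan_div q_rel_ent (p * r) (a * b) N (q_tensor_map p r a b (q_replacer a) Q)"
proof -
  let ?d = "(p * r) * (a * b)"
  define \<Phi> where "\<Phi> = maxent (p * r)"
  define \<omega> where "\<omega> = q_id_tensor (p * r) (p * r) (a * b) N \<Phi>"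
  define \<tau> where "\<tau> = q_id_tensor (p * r) (p * r) (a * b) (q_tensor_map p r a b (q_replacer a) Q) \<Phi>"
  have \<Phi>: "q_state ((p * r) * (p * r)) \<Phi>" unfolding \<Phi>_def by (rule maxent_state[OF pr_pos])
  then have \<Phi>c: "\<Phi> \<in> carrier_mat ((p * r) * (p * r)) ((p * r) * (p * r))" by (simp add: q_state_fo)
  let ?S = "choi r b Q"
  have "fo \<omega> = act (p * r) (p * r) (a * b) C (fo \<Phi>)"
    unfolding \<omega>_def by (rule id_tensor_act[OF _ \<Phi>c]) (rule channel_chan[OF N])
  then have fo1: "fo \<omega> = (1 / real (p * r)) *\<^sub>R C"
    unfolding \<Phi>_def by (simp only: act_maxent[OF bdd_choi])
  have "fo \<tau> = act (p * r) (p * r) (a * b) (ten ?d (ptX r a b) (ptY r a b) (idn (p * a)) ?S) (fo \<Phi>)"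
    unfolding \<tau>_def by (rule id_tensor_act[OF _ \<Phi>c]) (rule choi_tensor_replacer)
  then have fo2: "fo \<tau> = (1 / real (p * r)) *\<^sub>R ten ?d (ptX r a b) (ptY r a b) (idn (p * a)) ?S"
    unfolding \<Phi>_def by (simp only: act_maxent[OF bdd_ten])
  note fo = fo1 fo2
  have carr: "\<omega> \<in> carrier_mat ?d ?d" "\<tau> \<in> carrier_mat ?d ?d"
    unfolding \<omega>_def \<tau>_def by (rule id_tensor_carrier)+
  have S: "0 \<le> ?S" "bdd (r * b) ?S" using choi_channel(1)[OF Q] pos by simp_all
  have p0: "0 \<le> fo \<omega>" "0 \<le> fo \<tau>" unfolding fo
    using C_channel ten_psd[OF bip_choi bdd_dg S(2) idn_psd[OF bip_choi] S(1)] by (auto intro!: scaleR_nonneg_nonneg)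
  have st: "q_state ?d \<omega>" using carr p0 pos by (simp add: q_state_fo fo tr_C)
  have dims: "dim_row \<omega> = ?d" "dim_row \<tau> = ?d" using carr by auto
  have "ereal (- rate) \<le> q_rel_ent \<omega> \<tau>"
  proof (cases "\<forall>v \<in> carrier_vec ?d. \<tau> *\<^sub>v v = 0\<^sub>v ?d \<longrightarrow> \<omega> *\<^sub>v v = 0\<^sub>v ?d")
    case False
    then have "q_rel_ent \<omega> \<tau> = \<infinity>" unfolding q_rel_ent_def dims by (rule if_not_P)
    then show ?thesis by simp
  next
    case True
    define t1 t2 where "t1 = tr (fo \<omega> * fo (q_log \<omega>))" and "t2 = tr (fo \<omega> * fo (q_log \<tau>))"
    note lc = q_log_carrier[OF carr(1) p0(1)] q_log_carrier[OF carr(2) p0(2)]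
    have "q_rel_ent \<omega> \<tau> = ereal (Re (q_tr (\<omega> * (q_log \<omega> - q_log \<tau>))))"
      using True unfolding q_rel_ent_def dims by (rule if_P)
    also have "Re (q_tr (\<omega> * (q_log \<omega> - q_log \<tau>))) = tr (fo (\<omega> * (q_log \<omega> - q_log \<tau>)))"
      unfolding tr_def using carr lc by (subst q_tr_fo[of _ ?d]) auto
    also have "\<dots> = t1 - t2"
    proof -
      have "fo (\<omega> * (q_log \<omega> - q_log \<tau>)) = fo \<omega> * (fo (q_log \<omega>) - fo (q_log \<tau>))"
        using fo_times[OF carr(1) minus_carrier_mat[OF lc(2)]] fo_minus[OF lc] by simp
      then show ?thesis by (simp add: right_diff_distrib t1_def t2_def)
    qed
    finally have D: "q_rel_ent \<omega> \<tau> = ereal (t1 - t2)" .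
    have sp: "supported_in ?d (fo \<omega>) (fo \<omega>)" "supported_in ?d (fo \<omega>) (fo \<tau>)"
      using supported_in_le[of "fo \<omega>" 1 "fo \<omega>"] p0 supported_in_kernel[OF carr] True by auto
    have "0 \<le> t1 - t2 + rate + 4 * \<delta>" if \<delta>: "0 < \<delta>" for \<delta>
    proof -
      define s :: real where "s = 1/32"
      define \<eta> where "\<eta> = s\<^sup>2 / (4 * (1 + s))"
      have s: "0 < s" "0 < \<eta>" by (simp_all add: s_def \<eta>_def)
      from typical_log[OF st carr(1) p0(1) sp(1) \<delta> s(2), folded t1_def]
      obtain n1 where n1: "\<forall>n\<ge>n1. \<forall>D e. code ?d n D e \<longrightarrow> (\<exists>P. typical_proj D (tp D n e (\<lambda>_. fo \<omega>)) (tp D n e (\<lambda>_. fo \<omega>))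
        (2 powr (real n * (t1 - \<delta>))) (2 powr (real n * (t1 + \<delta>))) \<eta> P)" ..
      from typical_log[OF st carr(2) p0(2) sp(2) \<delta> s(2), folded t2_def]
      obtain n2 where n2: "\<forall>n\<ge>n2. \<forall>D e. code ?d n D e \<longrightarrow> (\<exists>P. typical_proj D (tp D n e (\<lambda>_. fo \<omega>)) (tp D n e (\<lambda>_. fo \<tau>))
        (2 powr (real n * (t2 - \<delta>))) (2 powr (real n * (t2 + \<delta>))) \<eta> P)" ..
      from converse_test[OF \<delta>] obtain n3 where n3: "\<forall>n\<ge>n3. \<exists>T. bdd (DD n) T \<and> 0 \<le> T \<and> T \<le> idn (DD n) \<and> tr (\<omega>n n * (idn (DD n) - T)) \<le> 1/16 \<and>
        (\<forall>\<sigma>. bdd (DY n) \<sigma> \<longrightarrow> 0 \<le> \<sigma> \<longrightarrow> tr (lf n \<sigma> * T) \<le> 2 powr (real n * (SX - SY + 2 * \<delta>)) * tr \<sigma>)" ..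
      have "1/2 \<le> 2 powr (real n * (t1 - t2 + rate + 4 * \<delta>))" if n: "max n1 (max n2 n3) \<le> n" for n
      proof -
        have n': "n1 \<le> n" "n2 \<le> n" "n3 \<le> n" using n by simp_all
        define \<tau>n where "\<tau>n = tp (DD n) n (eS n) (\<lambda>_. fo \<tau>)"
        define \<sigma> where "\<sigma> = tp (DY n) n (eY n) (\<lambda>_. ?S)"
        have \<omega>n: "tp (DD n) n (eS n) (\<lambda>_. fo \<omega>) = \<omega>n n"
          unfolding fo tp_scaleR \<omega>n_Cn Cn_def by (simp add: power_mult_distrib power_divide)
        have \<tau>n: "\<tau>n = (1 / real (p * r)) ^ n *\<^sub>R lf n \<sigma>" unfolding \<tau>n_def fo tp_RQ \<sigma>_def ..
        have \<sigma>: "bdd (DY n) \<sigma>" "0 \<le> \<sigma>" unfolding \<sigma>_def by (simp, rule tp_psd[OF codes(4) S(2,1)])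
        have "ctr \<sigma> = (\<Prod>m<n. ctr ?S)" unfolding \<sigma>_def by (rule ctr_tp[OF codes(4)]) simp
        also have "ctr ?S = complex_of_real (real r)"
          using psd_ctr[OF S(1)] tr_choi[of 1 Q] Q by simp
        finally have tr\<sigma>: "tr \<sigma> = real r ^ n" by (simp add: tr_def flip: of_real_power)
        obtain P1 where P1: "typical_proj (DD n) (\<omega>n n) (\<omega>n n) (2 powr (real n * (t1 - \<delta>))) (2 powr (real n * (t1 + \<delta>))) \<eta> P1"
          using n1[rule_format, OF n'(1) codes(5)] unfolding \<omega>n ..
        obtain P2 where P2: "typical_proj (DD n) (\<omega>n n) \<tau>n (2 powr (real n * (t2 - \<delta>))) (2 powr (real n * (t2 + \<delta>))) \<eta> P2"
          using n2[rule_format, OF n'(2) codes(5)] unfolding \<omega>n \<tau>n_def[symmetric] ..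
        from n3[rule_format, OF n'(3)] obtain T where T: "bdd (DD n) T" "0 \<le> T" "T \<le> idn (DD n)" "tr (\<omega>n n * (idn (DD n) - T)) \<le> 1/16"
          and Tb: "\<And>\<sigma>. bdd (DY n) \<sigma> \<Longrightarrow> 0 \<le> \<sigma> \<Longrightarrow> tr (lf n \<sigma> * T) \<le> 2 powr (real n * (SX - SY + 2 * \<delta>)) * tr \<sigma>" by blast
        have \<tau>n0: "0 \<le> \<tau>n" unfolding \<tau>n_def by (rule tp_psd[OF codes(5)]) (use p0 bdd_fo[OF carr(2)] in auto)
        have p: "proj_on (DD n) P1" "proj_on (DD n) P2" "tr (\<omega>n n * (idn (DD n) - P1)) \<le> s\<^sup>2 / (4 * (1 + s))"
          "tr (\<omega>n n * (idn (DD n) - P2)) \<le> s\<^sup>2 / (4 * (1 + s))" using P1 P2 by (auto simp: typical_proj_def \<eta>_def)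
        have dom: "P2 * P1 * \<omega>n n * adj (P2 * P1) \<le> (2 powr (real n * (t1 + \<delta>)) * (1 / 2 powr (real n * (t2 - \<delta>)))) *\<^sub>R \<tau>n"
          by (rule smooth_dom[OF P1 \<omega>n_props(2) p(2) typical_proj_proj_le[OF P2 \<tau>n0]]) auto
        have "15/16 \<le> tr (\<omega>n n * T)" using T(4) \<omega>n_props by (simp add: right_diff_distrib)
        also have "\<dots> \<le> (1 + s) * tr (P2 * P1 * \<omega>n n * adj (P2 * P1) * T) + s"
          by (rule smooth_test[OF \<omega>n_props(1,2) p(1,2) s(1) p(3,4) T(2,3)])
        finally have "1/2 \<le> tr (P2 * P1 * \<omega>n n * adj (P2 * P1) * T)" by (simp add: s_def)
        also have "\<dots> \<le> tr ((2 powr (real n * (t1 + \<delta>)) * (1 / 2 powr (real n * (t2 - \<delta>)))) *\<^sub>R \<tau>n * T)"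
          by (rule tr_mult_mono[OF dom T(2)])
        also have "\<dots> = 2 powr (real n * (t1 + \<delta>)) / 2 powr (real n * (t2 - \<delta>)) / real (p * r) ^ n * tr (lf n \<sigma> * T)"
          by (simp add: \<tau>n power_divide)
        also have "\<dots> \<le> 2 powr (real n * (t1 + \<delta>)) / 2 powr (real n * (t2 - \<delta>)) / real (p * r) ^ n
            * (2 powr (real n * (SX - SY + 2 * \<delta>)) * real r ^ n)"
          using Tb[OF \<sigma>] tr\<sigma> by (intro mult_left_mono) auto
        also have "\<dots> = 2 powr (real n * (t1 + \<delta>)) / 2 powr (real n * (t2 - \<delta>)) * 2 powr (real n * (SX - SY + 2 * \<delta>)) / real p ^ n"
          using pos by (simp add: power_mult_distrib)
        also have "\<dots> = 2 powr (real n * (t1 - t2 + rate + 4 * \<delta>))"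
          unfolding pow_powr powr_diff[symmetric] powr_add[symmetric] rate by (simp add: algebra_simps)
        finally show ?thesis .
      qed
      then show ?thesis by (intro powr_exponent_nonneg[of "1/2" "max n1 (max n2 n3)"]) simp_all
    qed
    note le = this
    have "- rate \<le> t1 - t2"
    proof (rule field_le_epsilon)
      fix e :: real assume "0 < e"
      then show "- rate \<le> t1 - t2 + e" using le[of "e / 4"] by simp
    qed
    then show ?thesis by (simp add: D)
  qed
  then show ?thesis unfolding \<omega>_def \<tau>_def using chan_div_ge[OF pr_pos \<Phi>] by (rule order_trans)
qed

end

section \<open>Symmetries of Choi matrices\<close>

lift_definition cj :: "fop \<Rightarrow> fop" is "\<lambda>A i j. cnj (A i j)" by auto

lemma ent_cj: "ent (cj A) i j = cnj (ent A i j)" by transfer simp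
lemma bdd_cj [simp]: "bdd D (cj A) \<longleftrightarrow> bdd D A" by (auto simp: bdd_def ent_cj)
lemma cj_adj: "adj (cj A) = cj (adj A)" by (rule fop_eqI) (simp add: ent_cj ent_adj)
lemma cj_dg: "cj (dg D f) = dg D f" by (rule fop_eqI) (simp add: ent_cj ent_dg)
lemma cj_times: "cj (A * B) = cj A * cj B"
proof (rule fop_eqI)
  obtain D where D: "bdd D A" using ex_bdd by auto
  then have D': "bdd D (cj A)" by simp
  show "ent (cj (A * B)) i j = ent (cj A * cj B) i j" for i j
    by (simp add: ent_cj ent_times_left[OF D] ent_times_left[OF D'])
qed
lemma cj_unitary: "unitary_on D U \<Longrightarrow> unitary_on D (cj U)"
  unfolding unitary_on_def by (metis bdd_cj cj_adj cj_dg cj_times)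

lemma ten_swap: "ten D f g A B = ten D g f B A"
  unfolding ten_def by (simp add: mult.commute)

lemma fo_kron:
  assumes "A \<in> carrier_mat m m" "B \<in> carrier_mat k k"
  shows "fo (q_kron A B) = ten (m * k) (\<lambda>z. z div k) (\<lambda>z. z mod k) (fo A) (fo B)"
proof (rule fop_eqI)
  fix i j
  show "ent (fo (q_kron A B)) i j = ent (ten (m * k) (\<lambda>z. z div k) (\<lambda>z. z mod k) (fo A) (fo B)) i j"
    using assms div_less_prod[of i m k] div_less_prod[of j m k] mod_less_prod[of i m k] mod_less_prod[of j m k]
    by (auto simp: ent_fo q_kron_def ent_ten)
qed

lemma kron_carrier: "A \<in> carrier_mat m m \<Longrightarrow> B \<in> carrier_mat k k \<Longrightarrow> q_kron A B \<in> carrier_mat (m * k) (m * k)"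
  by (auto simp: q_kron_def)

lemma fo_kron_unitary:
  assumes "q_unitary m A" "q_unitary k B"
  shows "unitary_on (m * k) (fo (q_kron A B))"
  using assms ten_unitary[OF bip_div_mod] by (auto simp: q_unitary_fo fo_kron)

definition mconj :: "cmat \<Rightarrow> cmat \<Rightarrow> cmat" where "mconj k X = k * X * mat_adjoint k"

lemma mconj_props:
  assumes k: "k \<in> carrier_mat n n" and A: "A \<in> carrier_mat n n" and B: "B \<in> carrier_mat n n"
  shows "mconj k A \<in> carrier_mat n n" "mconj k (A + B) = mconj k A + mconj k B"
    "mconj k (c \<cdot>\<^sub>m A) = c \<cdot>\<^sub>m mconj k A"
proof -
  note a = mat_adjoint_carrier[OF k]
  show "mconj k A \<in> carrier_mat n n" using k A a by (simp add: mconj_def)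
  show "mconj k (A + B) = mconj k A + mconj k B"
    unfolding mconj_def mult_add_distrib_mat[OF k A B]
    by (rule add_mult_distrib_mat[OF mult_carrier_mat[OF k A] mult_carrier_mat[OF k B] a])
  show "mconj k (c \<cdot>\<^sub>m A) = c \<cdot>\<^sub>m mconj k A"
    unfolding mconj_def mult_smult_distrib[OF k A] by (rule mult_smult_assoc_mat[OF mult_carrier_mat[OF k A] a])
qed

lemma fo_mconj: "k \<in> carrier_mat n n \<Longrightarrow> X \<in> carrier_mat n n \<Longrightarrow> fo (mconj k X) = fo k * fo X * adj (fo k)"
  using mat_adjoint_carrier[of k n n] by (simp add: mconj_def fo_times[of _ n] fo_adj mult.assoc)

lemma lin_ent: "i < n \<Longrightarrow> j < n \<Longrightarrow> k \<in> carrier_mat n n \<Longrightarrow> lin_on n (\<lambda>X. mconj k X $$ (i,j))"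
proof -
  assume ij: "i < n" "j < n" and k: "k \<in> carrier_mat n n"
  have "mconj k (A + B) $$ (i,j) = mconj k A $$ (i,j) + mconj k B $$ (i,j)" "mconj k (c \<cdot>\<^sub>m A) $$ (i,j) = c * mconj k A $$ (i,j)"
    if A: "A \<in> carrier_mat n n" and B: "B \<in> carrier_mat n n" for A B c
    unfolding mconj_props(2,3)[OF k A B]
    using carrier_matD[OF mconj_props(1)[OF k A A]] carrier_matD[OF mconj_props(1)[OF k B B]] ij by simp_all
  then show ?thesis unfolding lin_on_def by blast
qed

lemma lin_on_diff: "lin_on n f \<Longrightarrow> lin_on n g \<Longrightarrow> lin_on n (\<lambda>X. f X - g X)"
  unfolding lin_on_def by (auto simp: algebra_simps)

lemma lin_on_scale: "lin_on n f \<Longrightarrow> lin_on n (\<lambda>X. c * f X)"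
  unfolding lin_on_def by (auto simp: algebra_simps)

lemma lin_on_sum: "finite I \<Longrightarrow> (\<And>i. i \<in> I \<Longrightarrow> lin_on n (f i)) \<Longrightarrow> lin_on n (\<lambda>X. \<Sum>i\<in>I. f i X)"
  unfolding lin_on_def by (simp add: sum.distrib sum_distrib_left)

lemma lin_on_tr: "lin_on n q_tr"
  unfolding lin_on_def q_tr_def by (auto simp: sum.distrib sum_distrib_left)

lemma tr_ketbra: "k < d \<Longrightarrow> q_tr (q_ketbra d k l) = (if k = l then 1 else 0)"
proof -
  assume k: "k < d"
  have "q_tr (q_ketbra d k l) = (\<Sum>i<d. if i = k then if k = l then 1 else 0 else 0)"
    unfolding q_tr_def q_ketbra_def by (intro sum.cong) auto
  then show ?thesis using k by (simp add: sum.delta)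
qed

text \<open>Schur orthogonality, extracted from the twirl condition by linearity.\<close>

lemma twirl_orthogonality:
  assumes fin: "finite (carrier G)" and ne: "carrier G \<noteq> {}" and d: "0 < d"
    and U: "\<And>g. g \<in> carrier G \<Longrightarrow> U g \<in> carrier_mat d d"
    and tw: "\<And>\<rho>. q_state d \<rho> \<Longrightarrow> q_twirl G d U \<rho> = (1 / of_nat d) \<cdot>\<^sub>m 1\<^sub>m d"
    and ij: "i < d" "j < d" "k < d" "l < d"
  shows "(\<Sum>g\<in>carrier G. cnj (ent (fo (U g)) i k) * ent (fo (U g)) j l)
    = of_nat (card (carrier G)) * (if i = j \<and> k = l then 1 / of_nat d else 0)"
proof -
  have c: "of_nat (card (carrier G)) \<noteq> (0::complex)" using fin ne by simp
  define f where "f = (\<lambda>X. (1 / of_nat (card (carrier G))) * (\<Sum>g\<in>carrier G. mconj (U g) X $$ (j,i))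
    - (if i = j then 1 / of_nat d else 0) * q_tr X)"
  have lin: "lin_on d f" unfolding f_def
    by (intro lin_on_diff lin_on_scale lin_on_sum fin lin_ent ij U lin_on_tr)
  have "f \<rho> = 0" if "q_state d \<rho>" for \<rho>
    using arg_cong[OF tw[OF that], of "\<lambda>M. M $$ (j,i)"] that ij
    by (auto simp: f_def q_twirl_def mconj_def q_state_def)
  from lin_state_zero[OF lin this ketbra_carrier[of d l k]]
  have 1: "(\<Sum>g\<in>carrier G. mconj (U g) (q_ketbra d l k) $$ (j,i))
    = of_nat (card (carrier G)) * ((if i = j then 1 / of_nat d else 0) * q_tr (q_ketbra d l k))"
    using c by (simp add: f_def field_simps)
  have "mconj (U g) (q_ketbra d l k) $$ (j,i) = cnj (ent (fo (U g)) i k) * ent (fo (U g)) j l" if g: "g \<in> carrier G" for g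
  proof -
    note u = U[OF g]
    have ke: "ent (fo (q_ketbra d l k)) x y = (if y = k then if x = l then 1 else 0 else 0)" for x y
      using ij by (auto simp: ent_fo q_ketbra_def)
    have "mconj (U g) (q_ketbra d l k) $$ (j,i) = ent (fo (mconj (U g) (q_ketbra d l k))) j i"
      using mconj_props(1)[OF u ketbra_carrier[of d l k] ketbra_carrier[of d l k]] ij by (simp add: ent_fo_carrier)
    also have "\<dots> = ent (fo (U g) * fo (q_ketbra d l k) * adj (fo (U g))) j i"
      by (simp add: fo_mconj[OF u])
    also have "\<dots> = (\<Sum>y<d. \<Sum>x<d. ent (fo (U g)) j x * ent (fo (q_ketbra d l k)) x y * cnj (ent (fo (U g)) i y))"
      using u by (simp add: ent_times_right[of d] bdd_fo ent_adj sum_distrib_right)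
    also have "\<dots> = (\<Sum>y<d. if y = k then (\<Sum>x<d. if x = l then ent (fo (U g)) j l * cnj (ent (fo (U g)) i k) else 0) else 0)"
      by (intro sum.cong refl) (auto simp: ke simp del: sum.delta sum.delta' intro!: sum.cong)
    also have "\<dots> = cnj (ent (fo (U g)) i k) * ent (fo (U g)) j l" using ij by (simp add: sum.delta mult.commute)
    finally show ?thesis .
  qed
  then show ?thesis using 1 ij by (auto simp: tr_ketbra)
qed

lemma ent_act1: "i < dout \<Longrightarrow> j < dout \<Longrightarrow>
    ent (act 1 din dout C X) i j = (\<Sum>k<din. \<Sum>l<din. ent X k l * ent C (k * dout + i) (l * dout + j))"
  by (simp add: act_def ent_mkop)

text \<open>Covariance in the Choi picture; the input unitary acts on the reference side and appears
  there conjugated. Applying \<open>cov\<close> to \<open>adj K * E\<close>, with \<open>E\<close> a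
  matrix unit, cancels one \<open>K\<close>; a factor \<open>K'\<close> moved to the other side
  leaves an identity whose entries are those of \<open>Y * C\<close> and
  \<open>C * Y\<close>.\<close>

lemma covariant_commute:
  assumes K: "unitary_on din K" and K': "unitary_on dout K'" and C: "bdd (din * dout) C"
    and cov: "\<And>X. bdd din X \<Longrightarrow> act 1 din dout C (K * X * adj K) = K' * act 1 din dout C X * adj K'"
  defines "Y \<equiv> ten (din * dout) (\<lambda>z. z div dout) (\<lambda>z. z mod dout) (cj K) K'"
  shows "Y * C = C * Y"
proof (rule fop_eq_bddI[of "din * dout"])
  note uK = unitary_onD[OF K] and uK' = unitary_onD[OF K']
  have bact: "bdd dout (act 1 din dout C X)" for X using bdd_act[of 1 dout din C X] by simp
  fix z w assume zw: "z < din * dout" "w < din * dout"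
  define k i l j where "k = z div dout" and "i = z mod dout" and "l = w div dout" and "j = w mod dout"
  have lt: "k < din" "i < dout" "l < din" "j < dout"
    unfolding k_def i_def l_def j_def using zw div_less_prod mod_less_prod by auto
  have z: "z = k * dout + i" "w = l * dout + j" by (simp_all add: k_def i_def l_def j_def)
  define E where "E = mkop din (\<lambda>x y. if x = k \<and> y = l then 1 else 0)"
  have bE: "bdd din E" by (simp add: E_def)
  have "K * (adj K * E) * adj K = E * adj K" using uK bE by (simp add: mult.assoc[symmetric])
  then have "act 1 din dout C (E * adj K) = K' * act 1 din dout C (adj K * E) * adj K'"
    using cov[of "adj K * E"] uK bE by simp
  then have "act 1 din dout C (E * adj K) * K' = K' * act 1 din dout C (adj K * E) * (adj K' * K')"
    by (simp only: mult.assoc)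
  then have main: "act 1 din dout C (E * adj K) * K' = K' * act 1 din dout C (adj K * E)"
    using uK' bact by simp
  have e1: "ent (adj K * E) x y = (if y = l then cnj (ent K k x) else 0)" for x y
  proof -
    have "ent (adj K * E) x y = (\<Sum>m<din. if m = k then if y = l then cnj (ent K k x) else 0 else 0)"
      unfolding ent_times_left[OF uK(2)] by (intro sum.cong) (use lt in \<open>auto simp: ent_adj E_def ent_mkop\<close>)
    then show ?thesis using lt by (simp add: sum.delta)
  qed
  have e2: "ent (E * adj K) x y = (if x = k then cnj (ent K y l) else 0)" for x y
  proof -
    have "ent (E * adj K) x y = (\<Sum>m<din. if m = l then if x = k then cnj (ent K y l) else 0 else 0)"
      unfolding ent_times_left[OF bE] by (intro sum.cong) (use lt in \<open>auto simp: ent_adj E_def ent_mkop\<close>)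
    then show ?thesis using lt by (simp add: sum.delta)
  qed
  have a1: "ent (act 1 din dout C (adj K * E)) i' j = (\<Sum>k'<din. cnj (ent K k k') * ent C (k' * dout + i') (l * dout + j))" if "i' < dout" for i'
  proof -
    have "ent (act 1 din dout C (adj K * E)) i' j
      = (\<Sum>k'<din. \<Sum>l'<din. if l' = l then cnj (ent K k k') * ent C (k' * dout + i') (l * dout + j) else 0)"
      unfolding ent_act1[OF that lt(4)] e1 by (intro sum.cong refl) auto
    then show ?thesis using lt by (simp add: sum.delta)
  qed
  have a2: "ent (act 1 din dout C (E * adj K)) i j' = (\<Sum>l'<din. cnj (ent K l' l) * ent C (k * dout + i) (l' * dout + j'))" if "j' < dout" for j'
  proof -
    have "ent (act 1 din dout C (E * adj K)) i j'
      = (\<Sum>k'<din. if k' = k then (\<Sum>l'<din. cnj (ent K l' l) * ent C (k * dout + i) (l' * dout + j')) else 0)"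
      unfolding ent_act1[OF lt(2) that] e2 by (intro sum.cong refl) auto
    then show ?thesis using lt by (simp add: sum.delta)
  qed
  have "ent (Y * C) z w = (\<Sum>k'<din. \<Sum>i'<dout. cnj (ent K k k') * ent K' i i' * ent C (k' * dout + i') w)"
    unfolding Y_def ent_times_left[OF bdd_ten] sum_bip[OF bip_div_mod]
    by (intro sum.cong refl) (use zw lt in \<open>simp add: ent_ten idx_less ent_cj k_def i_def\<close>)
  also have "\<dots> = (\<Sum>i'<dout. \<Sum>k'<din. cnj (ent K k k') * ent K' i i' * ent C (k' * dout + i') w)"
    by (rule sum.swap)
  also have "\<dots> = ent (K' * act 1 din dout C (adj K * E)) i j"
    unfolding ent_times_left[OF uK'(1)]
    by (intro sum.cong refl) (simp add: a1 z(2) sum_distrib_left mult.left_commute mult.assoc del: One_nat_def)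
  also have "\<dots> = ent (act 1 din dout C (E * adj K) * K') i j" using main by simp
  also have "\<dots> = (\<Sum>j'<dout. \<Sum>l'<din. ent C z (l' * dout + j') * (cnj (ent K l' l) * ent K' j' j))"
    unfolding ent_times_right[OF uK'(1)]
    by (intro sum.cong refl) (simp add: a2 z(1) sum_distrib_right sum_distrib_left mult_ac del: One_nat_def)
  also have "\<dots> = (\<Sum>l'<din. \<Sum>j'<dout. ent C z (l' * dout + j') * (cnj (ent K l' l) * ent K' j' j))"
    by (rule sum.swap)
  also have "\<dots> = ent (C * Y) z w"
    unfolding Y_def ent_times_right[OF bdd_ten] sum_bip[OF bip_div_mod]
    by (intro sum.cong refl) (use zw lt in \<open>simp add: ent_ten idx_less ent_cj l_def j_def\<close>)
  finally show "ent (Y * C) z w = ent (C * Y) z w" .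
qed (use C in \<open>auto simp: Y_def\<close>)

lemma choi_chan:
  assumes "bdd (din * dout) C"
  shows "choi din dout (chan din dout C) = C"
proof (rule fop_eq_bddI[of "din * dout"])
  fix z w assume zw: "z < din * dout" "w < din * dout"
  have lt: "z div dout < din" "w div dout < din" "z mod dout < dout" "w mod dout < dout"
    using zw div_less_prod mod_less_prod by auto
  have "ent (choi din dout (chan din dout C)) z w
    = (\<Sum>k<din. \<Sum>l<din. q_ketbra din (z div dout) (w div dout) $$ (k,l) * ent C (k * dout + z mod dout) (l * dout + w mod dout))"
    using zw lt by (simp add: choi_def ent_mkop chan_def)
  also have "\<dots> = (\<Sum>k<din. \<Sum>l<din. if l = w div dout then if k = z div dout then ent C z w else 0 else 0)"
    by (intro sum.cong refl) (use lt in \<open>auto simp: q_ketbra_def\<close>)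
  also have "\<dots> = ent C z w" using lt by (simp add: sum.delta)
  finally show "ent (choi din dout (chan din dout C)) z w = ent C z w" .
qed (use assms in auto)

section \<open>Tele-covariant channels and invariant operators\<close>

locale tele = bichan p r a b N for p r a b :: nat and N :: "cmat \<Rightarrow> cmat" +
  fixes G :: "('g, 'x) monoid_scheme" and H :: "('h, 'y) monoid_scheme"
    and U :: "'g \<Rightarrow> cmat" and V :: "'h \<Rightarrow> cmat" and W Z :: "'g \<Rightarrow> 'h \<Rightarrow> cmat"
  assumes tele: "q_tele_covariant G H U V W Z p r a b N"
begin

abbreviation "GH \<equiv> carrier G \<times> carrier H"
abbreviation "kin x \<equiv> q_kron (U (fst x)) (V (snd x))"
abbreviation "kout x \<equiv> q_kron (W (fst x) (snd x)) (Z (fst x) (snd x))"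

lemma tele_facts:
  shows group: "group G" "group H" "finite (carrier G)" "finite (carrier H)"
    and cov_state: "\<And>\<rho> g h. q_state (p * r) \<rho> \<Longrightarrow> g \<in> carrier G \<Longrightarrow> h \<in> carrier H \<Longrightarrow>
      N (q_kron (U g) (V h) * \<rho> * mat_adjoint (q_kron (U g) (V h))) =
      q_kron (W g h) (Z g h) * N \<rho> * mat_adjoint (q_kron (W g h) (Z g h))"
    and twirl: "\<And>\<rho>. q_state p \<rho> \<Longrightarrow> q_twirl G p U \<rho> = (1 / of_nat p) \<cdot>\<^sub>m 1\<^sub>m p"
      "\<And>\<rho>. q_state r \<rho> \<Longrightarrow> q_twirl H r V \<rho> = (1 / of_nat r) \<cdot>\<^sub>m 1\<^sub>m r"
    and unit: "\<And>g. g \<in> carrier G \<Longrightarrow> q_unitary p (U g)" "\<And>h. h \<in> carrier H \<Longrightarrow> q_unitary r (V h)"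
      "\<And>g h. g \<in> carrier G \<Longrightarrow> h \<in> carrier H \<Longrightarrow> q_unitary a (W g h)"
      "\<And>g h. g \<in> carrier G \<Longrightarrow> h \<in> carrier H \<Longrightarrow> q_unitary b (Z g h)"
proof -
  note t = tele[unfolded q_tele_covariant_def q_unitary_rep_def q_unitary_rep2_def]
  show "group G" "group H" "finite (carrier G)" "finite (carrier H)"
    by (rule t[THEN conjunct1], rule t[THEN conjunct2, THEN conjunct1], rule t[THEN conjunct2, THEN conjunct2, THEN conjunct1], rule t[THEN conjunct2, THEN conjunct2, THEN conjunct2, THEN conjunct1])
  show "N (q_kron (U g) (V h) * \<rho> * mat_adjoint (q_kron (U g) (V h))) =
      q_kron (W g h) (Z g h) * N \<rho> * mat_adjoint (q_kron (W g h) (Z g h))"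
    if "q_state (p * r) \<rho>" "g \<in> carrier G" "h \<in> carrier H" for \<rho> g h
    by (rule t[THEN conjunct2, THEN conjunct2, THEN conjunct2, THEN conjunct2, THEN conjunct2, THEN conjunct2, THEN conjunct2, THEN conjunct2, THEN conjunct1, rule_format, OF conjI[OF that(1) conjI[OF that(2,3)]]])
  show "q_twirl G p U \<rho> = (1 / of_nat p) \<cdot>\<^sub>m 1\<^sub>m p" if "q_state p \<rho>" for \<rho>
    by (rule t[THEN conjunct2, THEN conjunct2, THEN conjunct2, THEN conjunct2, THEN conjunct2, THEN conjunct2, THEN conjunct2, THEN conjunct2, THEN conjunct2, THEN conjunct1, rule_format, OF that])
  show "q_twirl H r V \<rho> = (1 / of_nat r) \<cdot>\<^sub>m 1\<^sub>m r" if "q_state r \<rho>" for \<rho>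
    by (rule t[THEN conjunct2, THEN conjunct2, THEN conjunct2, THEN conjunct2, THEN conjunct2, THEN conjunct2, THEN conjunct2, THEN conjunct2, THEN conjunct2, THEN conjunct2, rule_format, OF that])
  show "q_unitary p (U g)" if "g \<in> carrier G" for g
    by (rule t[THEN conjunct2, THEN conjunct2, THEN conjunct2, THEN conjunct2, THEN conjunct1, THEN conjunct1, rule_format, OF that])
  show "q_unitary r (V h)" if "h \<in> carrier H" for h
    by (rule t[THEN conjunct2, THEN conjunct2, THEN conjunct2, THEN conjunct2, THEN conjunct2, THEN conjunct1, THEN conjunct1, rule_format, OF that])
  show "q_unitary a (W g h)" if "g \<in> carrier G" "h \<in> carrier H" for g h
    by (rule t[THEN conjunct2, THEN conjunct2, THEN conjunct2, THEN conjunct2, THEN conjunct2, THEN conjunct2, THEN conjunct1, THEN conjunct1, rule_format, OF that])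
  show "q_unitary b (Z g h)" if "g \<in> carrier G" "h \<in> carrier H" for g h
    by (rule t[THEN conjunct2, THEN conjunct2, THEN conjunct2, THEN conjunct2, THEN conjunct2, THEN conjunct2, THEN conjunct2, THEN conjunct1, THEN conjunct1, rule_format, OF that])
qed

lemma GH: "finite GH" "0 < card GH" "finite (carrier G)" "finite (carrier H)" "carrier G \<noteq> {}" "carrier H \<noteq> {}"
proof -
  have f: "finite (carrier G)" "finite (carrier H)" by (rule tele_facts)+
  from group have "\<one>\<^bsub>G\<^esub> \<in> carrier G" "\<one>\<^bsub>H\<^esub> \<in> carrier H"
    by (simp_all add: group.is_monoid monoid.one_closed)
  then show "finite GH" "0 < card GH" "finite (carrier G)" "finite (carrier H)" "carrier G \<noteq> {}" "carrier H \<noteq> {}"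
    using f by (auto simp: card_gt_0_iff)
qed

lemma unitaries:
  assumes "x \<in> GH"
  shows "q_unitary p (U (fst x))" "q_unitary r (V (snd x))" "q_unitary a (W (fst x) (snd x))" "q_unitary b (Z (fst x) (snd x))"
  using assms unit(1)[of "fst x"] unit(2)[of "snd x"] unit(3,4)[of "fst x" "snd x"] by (simp_all only: mem_Times_iff)

lemma carriers:
  assumes "x \<in> GH"
  shows "U (fst x) \<in> carrier_mat p p" "V (snd x) \<in> carrier_mat r r" "W (fst x) (snd x) \<in> carrier_mat a a" "Z (fst x) (snd x) \<in> carrier_mat b b"
    "kin x \<in> carrier_mat (p * r) (p * r)" "kout x \<in> carrier_mat (a * b) (a * b)"
proof -
  show c: "U (fst x) \<in> carrier_mat p p" "V (snd x) \<in> carrier_mat r r" "W (fst x) (snd x) \<in> carrier_mat a a" "Z (fst x) (snd x) \<in> carrier_mat b b"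
    using unitaries[OF assms] unfolding q_unitary_def by blast+
  show "kin x \<in> carrier_mat (p * r) (p * r)" "kout x \<in> carrier_mat (a * b) (a * b)"
    using c by (blast intro: kron_carrier)+
qed

lemma kinout_unitary: "x \<in> GH \<Longrightarrow> unitary_on (p * r) (fo (kin x))" "x \<in> GH \<Longrightarrow> unitary_on (a * b) (fo (kout x))"
  by (rule fo_kron_unitary[OF unitaries(1,2)], assumption+, rule fo_kron_unitary[OF unitaries(3,4)], assumption+)

text \<open>Both sides are linear in \<open>X\<close> entry by entry and agree on states, so
  \<open>lin_state_zero\<close> applies to their difference.\<close>

lemma covariant:
  assumes x: "x \<in> GH" and X: "X \<in> carrier_mat (p * r) (p * r)"
  shows "N (mconj (kin x) X) = mconj (kout x) (N X)"
proof (rule eq_matI)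
  note c = carriers(5,6)[OF x]
  have Nc: "N A \<in> carrier_mat (a * b) (a * b)" if "A \<in> carrier_mat (p * r) (p * r)" for A using N that by (simp add: q_channel_def)
  have m: "mconj (kin x) A \<in> carrier_mat (p * r) (p * r)" if "A \<in> carrier_mat (p * r) (p * r)" for A
    using mconj_props(1)[OF c(1) that that] .
  have cc: "N (mconj (kin x) X) \<in> carrier_mat (a * b) (a * b)" "mconj (kout x) (N X) \<in> carrier_mat (a * b) (a * b)"
    using Nc[OF m[OF X]] mconj_props(1)[OF c(2) Nc[OF X] Nc[OF X]] by auto
  then show "dim_row (N (mconj (kin x) X)) = dim_row (mconj (kout x) (N X))"
    "dim_col (N (mconj (kin x) X)) = dim_col (mconj (kout x) (N X))" by auto
  fix i j assume "i < dim_row (mconj (kout x) (N X))" "j < dim_col (mconj (kout x) (N X))"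
  then have ij: "i < a * b" "j < a * b" using cc by auto
  define f where "f = (\<lambda>X. N (mconj (kin x) X) $$ (i,j))"
  define g where "g = (\<lambda>X. mconj (kout x) (N X) $$ (i,j))"
  have Nl: "N (A + B) = N A + N B" "N (s \<cdot>\<^sub>m A) = s \<cdot>\<^sub>m N A"
    if "A \<in> carrier_mat (p * r) (p * r)" "B \<in> carrier_mat (p * r) (p * r)" for A B s
    using N that by (simp_all add: q_channel_def)
  have "f (A + B) = f A + f B" "f (s \<cdot>\<^sub>m A) = s * f A" "g (A + B) = g A + g B" "g (s \<cdot>\<^sub>m A) = s * g A"
    if A: "A \<in> carrier_mat (p * r) (p * r)" and B: "B \<in> carrier_mat (p * r) (p * r)" for A B s
  proof -
    note d = carrier_matD[OF Nc[OF m[OF A]]] carrier_matD[OF Nc[OF m[OF B]]]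
      carrier_matD[OF mconj_props(1)[OF c(2) Nc[OF A] Nc[OF A]]] carrier_matD[OF mconj_props(1)[OF c(2) Nc[OF B] Nc[OF B]]]
    show "f (A + B) = f A + f B" unfolding f_def mconj_props(2)[OF c(1) A B] Nl(1)[OF m[OF A] m[OF B]] using d ij by simp
    show "f (s \<cdot>\<^sub>m A) = s * f A" unfolding f_def mconj_props(3)[OF c(1) A B] Nl(2)[OF m[OF A] m[OF B]] using d ij by simp
    show "g (A + B) = g A + g B" unfolding g_def Nl(1)[OF A B] mconj_props(2)[OF c(2) Nc[OF A] Nc[OF B]] using d ij by simp
    show "g (s \<cdot>\<^sub>m A) = s * g A" unfolding g_def Nl(2)[OF A B] mconj_props(3)[OF c(2) Nc[OF A] Nc[OF B]] using d ij by simp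
  qed
  then have "lin_on (p * r) f" "lin_on (p * r) g" unfolding lin_on_def by blast+
  then have "lin_on (p * r) (\<lambda>X. f X - g X)" by (rule lin_on_diff)
  moreover have "f \<rho> - g \<rho> = 0" if "q_state (p * r) \<rho>" for \<rho>
    using cov_state[OF that, of "fst x" "snd x"] x unfolding f_def g_def mconj_def by (simp add: mem_Times_iff)
  ultimately have "f X - g X = 0" using X by (rule lin_state_zero)
  then show "N (mconj (kin x) X) $$ (i,j) = mconj (kout x) (N X) $$ (i,j)" by (simp add: f_def g_def)
qed

definition "Ys x = ten ((p * r) * (a * b)) (\<lambda>z. z div (a * b)) (\<lambda>z. z mod (a * b)) (cj (fo (kin x))) (fo (kout x))"

lemma Ys_commute: "x \<in> GH \<Longrightarrow> Ys x * C = C * Ys x"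
  unfolding Ys_def
proof (rule covariant_commute[OF kinout_unitary bdd_choi])
  fix X assume x: "x \<in> GH" and X: "bdd (p * r) X"
  note c = carriers(5,6)[OF x]
  have Nc: "N (to_mat (p * r) X) \<in> carrier_mat (a * b) (a * b)" using N by (simp add: q_channel_def)
  have act: "fo (N A) = act 1 (p * r) (a * b) C (fo A)" if "A \<in> carrier_mat (p * r) (p * r)" for A
    using channel_chan[OF N that] chan_act[OF that] by simp
  have "fo (N (mconj (kin x) (to_mat (p * r) X))) = fo (mconj (kout x) (N (to_mat (p * r) X)))"
    using covariant[OF x to_mat_carrier] by simp
  then show "act 1 (p * r) (a * b) C (fo (kin x) * X * adj (fo (kin x))) = fo (kout x) * act 1 (p * r) (a * b) C X * adj (fo (kout x))"
    unfolding fo_mconj[OF c(2) Nc] act[OF mconj_props(1)[OF c(1) to_mat_carrier to_mat_carrier]] act[OF to_mat_carrier]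
      fo_mconj[OF c(1) to_mat_carrier] fo_tm[OF X] .
qed

lemma Ys_unitary: "x \<in> GH \<Longrightarrow> unitary_on ((p * r) * (a * b)) (Ys x)"
  unfolding Ys_def by (rule ten_unitary[OF bip_div_mod cj_unitary[OF kinout_unitary(1)] kinout_unitary(2)])

definition "YX x = ten (p * a) (\<lambda>z. z div a) (\<lambda>z. z mod a) (cj (fo (U (fst x)))) (fo (W (fst x) (snd x)))"
definition "YY x = ten (r * b) (\<lambda>z. z div b) (\<lambda>z. z mod b) (cj (fo (V (snd x)))) (fo (Z (fst x) (snd x)))"

lemma YXY_unitary: "x \<in> GH \<Longrightarrow> unitary_on (p * a) (YX x)" "x \<in> GH \<Longrightarrow> unitary_on (r * b) (YY x)"
proof -
  assume x: "x \<in> GH"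
  note u = unitaries[OF x, unfolded q_unitary_fo, THEN conjunct2]
  show "unitary_on (p * a) (YX x)" unfolding YX_def by (rule ten_unitary[OF bip_div_mod cj_unitary[OF u(1)] u(3)])
next
  assume x: "x \<in> GH"
  note u = unitaries[OF x, unfolded q_unitary_fo, THEN conjunct2]
  show "unitary_on (r * b) (YY x)" unfolding YY_def by (rule ten_unitary[OF bip_div_mod cj_unitary[OF u(2)] u(4)])
qed

text \<open>The input and output unitaries are both products over the two parties, so after
  regrouping the symmetry of \<open>C\<close> is a product across the cut \<open>A'A | B'B\<close>.
  This is what lets the marginal on \<open>B'B\<close> inherit a symmetry of its own.\<close>

lemma Ys_split: assumes x: "x \<in> GH" shows "Ys x = ten ((p * r) * (a * b)) (ptX r a b) (ptY r a b) (YX x) (YY x)"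
proof (rule fop_eq_bddI[of "(p * r) * (a * b)"])
  fix z w assume zw: "z < (p * r) * (a * b)" "w < (p * r) * (a * b)"
  have l: "v div (a * b) < p * r" "v mod (a * b) < a * b" "v mod (a * b) div b < a" "v mod (a * b) mod b < b"
    "ptX r a b v < p * a" "ptY r a b v < r * b" if "v < (p * r) * (a * b)" for v
    by (rule div_less_prod[OF that], rule mod_less_prod[OF that], rule div_less_prod[OF mod_less_prod[OF that]],
      rule mod_less_prod[OF mod_less_prod[OF that]], rule bipD(1)[OF bip_choi that], rule bipD(2)[OF bip_choi that])
  note lz = l[OF zw(1)] and lw = l[OF zw(2)]
  have d: "ptX r a b v div a = v div (a * b) div r" "ptX r a b v mod a = v mod (a * b) div b"
    "ptY r a b v div b = v div (a * b) mod r" "ptY r a b v mod b = v mod (a * b) mod b" if "v < (p * r) * (a * b)" for v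
    unfolding ptX_def ptY_def
    by (rule idx_div[OF l(3)[OF that]], rule idx_mod[OF l(3)[OF that]], rule idx_div[OF l(4)[OF that]], rule idx_mod[OF l(4)[OF that]])
  show "ent (Ys x) z w = ent (ten ((p * r) * (a * b)) (ptX r a b) (ptY r a b) (YX x) (YY x)) z w"
    unfolding Ys_def YX_def YY_def fo_kron[OF carriers(1,2)[OF x]] fo_kron[OF carriers(3,4)[OF x]]
    unfolding ent_ten ent_cj d[OF zw(1)] d[OF zw(2)]
    by (simp only: zw lz lw simp_thms if_True complex_cnj_mult mult.assoc mult.left_commute)
qed (auto simp: Ys_def)

abbreviation "GS n \<equiv> {..<n::nat} \<rightarrow>\<^sub>E GH"
definition "UU n gs = tp (DD n) n (eS n) (\<lambda>m. Ys (gs m))"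
definition "KI n gs = tp (DI n) n (eI n) (\<lambda>m. cj (fo (kin (gs m))))"
definition "KO n gs = tp (DO n) n (eO n) (\<lambda>m. fo (kout (gs m)))"
definition "UX n gs = tp (DX n) n (eX n) (\<lambda>m. YX (gs m))"
definition "UY n gs = tp (DY n) n (eY n) (\<lambda>m. YY (gs m))"
text \<open>The word \<open>gs\<close> assigns an independent group element to every copy, so that
  averaging over all words twirls each tensor factor separately.\<close>

definition "invar n X \<longleftrightarrow> (\<forall>gs\<in>GS n. UU n gs * X = X * UU n gs)"

lemma GS_mem: "gs \<in> GS n \<Longrightarrow> m < n \<Longrightarrow> gs m \<in> GH"
  using PiE_mem[of gs "{..<n}" "\<lambda>_. GH" m] by blast

lemma U_unitary:
  assumes "gs \<in> GS n"
  shows "unitary_on (DD n) (UU n gs)" "unitary_on (DI n) (KI n gs)" "unitary_on (DO n) (KO n gs)"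
    "unitary_on (DX n) (UX n gs)" "unitary_on (DY n) (UY n gs)"
  unfolding UU_def KI_def KO_def UX_def UY_def
  by (rule tp_unitary, rule codes, rule Ys_unitary cj_unitary kinout_unitary YXY_unitary, (rule kinout_unitary)?, rule GS_mem[OF assms], assumption)+

text \<open>The same unitary factors along two cuts: output against input here, as the input
  marginal requires, and \<open>A'A\<close> against \<open>B'B\<close> in \<open>UU_XY\<close>, as
  the lifted projections require.\<close>

lemma UU_IO: "UU n gs = ten (DD n) (\<lambda>z. z mod DO n) (\<lambda>z. z div DO n) (KO n gs) (KI n gs)"
  unfolding ten_swap[of "DD n" "\<lambda>z. z mod DO n"] UU_def KI_def KO_def Ys_def
  by (rule ten_tp[OF bip_div_mod bip_div_mod codes(1,2)]) (simp add: pairc_def)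

lemma UU_XY:
  assumes "gs \<in> GS n"
  shows "UU n gs = ten (DD n) (\<pi>X n) (\<pi>Y n) (UX n gs) (UY n gs)"
proof -
  have "UU n gs = tp (DD n) n (eS n) (\<lambda>m. ten ((p * r) * (a * b)) (ptX r a b) (ptY r a b) (YX (gs m)) (YY (gs m)))"
    unfolding UU_def by (rule tp_cong[OF codes(5)]) (rule Ys_split[OF GS_mem[OF assms]])
  also have "\<dots> = ten (DD n) (\<pi>X n) (\<pi>Y n) (UX n gs) (UY n gs)"
    unfolding UX_def UY_def by (rule ten_tp[OF bipn bip_choi codes(3) codes(4)]) (rule eS_ptI)
  finally show ?thesis .
qed

lemma invar_times: "invar n X \<Longrightarrow> invar n Y \<Longrightarrow> invar n (X * Y)"
  unfolding invar_def by (metis mult.assoc)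
lemma invar_diff: "invar n X \<Longrightarrow> invar n Y \<Longrightarrow> invar n (X - Y)"
  unfolding invar_def by (simp add: algebra_simps)
lemma invar_scaleR: "invar n X \<Longrightarrow> invar n (s *\<^sub>R X)"
  unfolding invar_def by simp
lemma invar_idn: "invar n (idn (DD n))"
  unfolding invar_def using unitary_onD(1)[OF U_unitary(1)] by simp

lemma invar_Cn: "invar n (Cn n)"
  unfolding invar_def
proof
  fix gs assume gs: "gs \<in> GS n"
  have "UU n gs * Cn n = tp (DD n) n (eS n) (\<lambda>m. Ys (gs m) * C)"
    unfolding UU_def Cn_def by (rule tp_times[OF codes(5)]) (rule unitary_onD(1)[OF Ys_unitary[OF GS_mem[OF gs]]])
  also have "\<dots> = tp (DD n) n (eS n) (\<lambda>m. C * Ys (gs m))"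
    by (rule tp_cong[OF codes(5)]) (rule Ys_commute[OF GS_mem[OF gs]])
  also have "\<dots> = Cn n * UU n gs"
    unfolding UU_def Cn_def by (rule tp_times[OF codes(5), symmetric]) simp
  finally show "UU n gs * Cn n = Cn n * UU n gs" .
qed

lemma invar_\<omega>n: "invar n (\<omega>n n)" unfolding \<omega>n_Cn by (rule invar_scaleR[OF invar_Cn])

lemma invar_typl: "typical_proj (DD n) X (\<omega>n n) lo hi \<eta> P \<Longrightarrow> invar n P"
  using invar_\<omega>n unitary_onD(1)[OF U_unitary(1)] unfolding invar_def typical_proj_def by blast

text \<open>Conjugation by \<open>UU\<close> fixes \<open>\<omega>n n\<close>; under the partial
  trace the \<open>X\<close> part of the product unitary cancels and conjugation by
  \<open>UY\<close> remains.\<close>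

lemma UY_yn: assumes gs: "gs \<in> GS n" shows "UY n gs * yn n = yn n * UY n gs"
proof -
  note u = unitary_onD[OF U_unitary(1)[OF gs]] and uy = unitary_onD[OF U_unitary(5)[OF gs]]
  have "UU n gs * \<omega>n n * adj (UU n gs) = \<omega>n n * (UU n gs * adj (UU n gs))"
    using invar_\<omega>n gs unfolding invar_def by (simp only: mult.assoc)
  then have "UU n gs * \<omega>n n * adj (UU n gs) = \<omega>n n" using u \<omega>n_props by simp
  then have "pY n (UU n gs * \<omega>n n * adj (UU n gs)) = yn n" by (simp add: pY_\<omega>n)
  then have "UY n gs * yn n * adj (UY n gs) = yn n"
    unfolding UU_XY[OF gs] ptr_conj[OF bipn U_unitary(4)[OF gs] uy(1) \<omega>n_props(1)] pY_\<omega>n .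
  then have "UY n gs * yn n * (adj (UY n gs) * UY n gs) = yn n * UY n gs" by (simp only: mult.assoc[symmetric])
  then show ?thesis using uy yn_props by simp
qed

lemma invar_lf: assumes Q: "typical_proj (DY n) X (yn n) lo hi \<eta> Q" shows "invar n (lf n Q)"
  unfolding invar_def
proof
  fix gs assume gs: "gs \<in> GS n"
  note ux = unitary_onD[OF U_unitary(4)[OF gs]] and uy = unitary_onD[OF U_unitary(5)[OF gs]]
  have c: "UY n gs * Q = Q * UY n gs" using Q UY_yn[OF gs] uy(1) unfolding typical_proj_def by blast
  have bQ: "bdd (DY n) Q" using Q by (simp add: typical_proj_def proj_on_def)
  show "UU n gs * lf n Q = lf n Q * UU n gs"
    unfolding UU_XY[OF gs] ten_times[OF bipn ux(1) uy(1)] ten_times[OF bipn bdd_dg bQ] using c ux by simp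
qed

lemma kin_orthogonality:
  assumes "x < p * r" "y < p * r" "u < p * r" "v < p * r"
  shows "(\<Sum>g\<in>GH. cnj (ent (fo (kin g)) x u) * ent (fo (kin g)) y v)
    = of_nat (card GH) * (if x = y \<and> u = v then 1 / of_nat (p * r) else 0)"
proof -
  have l: "c div r < p" "c mod r < r" if "c < p * r" for c using div_less_prod[OF that] mod_less_prod[OF that] by auto
  have "(\<Sum>g\<in>GH. cnj (ent (fo (kin g)) x u) * ent (fo (kin g)) y v)
    = (\<Sum>g\<in>carrier G. \<Sum>h\<in>carrier H. (cnj (ent (fo (U g)) (x div r) (u div r)) * ent (fo (U g)) (y div r) (v div r)) *
       (cnj (ent (fo (V h)) (x mod r) (u mod r)) * ent (fo (V h)) (y mod r) (v mod r)))"
    unfolding sum.cartesian_product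
    by (intro sum.cong refl) (use assms carriers(1,2) in \<open>force simp: fo_kron ent_ten\<close>)
  also have "\<dots> = (\<Sum>g\<in>carrier G. cnj (ent (fo (U g)) (x div r) (u div r)) * ent (fo (U g)) (y div r) (v div r)) *
      (\<Sum>h\<in>carrier H. cnj (ent (fo (V h)) (x mod r) (u mod r)) * ent (fo (V h)) (y mod r) (v mod r))"
    by (rule sum_product[symmetric])
  also have "(\<Sum>g\<in>carrier G. cnj (ent (fo (U g)) (x div r) (u div r)) * ent (fo (U g)) (y div r) (v div r))
     = of_nat (card (carrier G)) * (if x div r = y div r \<and> u div r = v div r then 1 / of_nat p else 0)"
    by (rule twirl_orthogonality) (use GH assms l pos twirl unit in \<open>simp_all add: q_unitary_def\<close>)
  also have "(\<Sum>h\<in>carrier H. cnj (ent (fo (V h)) (x mod r) (u mod r)) * ent (fo (V h)) (y mod r) (v mod r))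
     = of_nat (card (carrier H)) * (if x mod r = y mod r \<and> u mod r = v mod r then 1 / of_nat r else 0)"
    by (rule twirl_orthogonality) (use GH assms l pos twirl unit in \<open>simp_all add: q_unitary_def\<close>)
  also have "of_nat (card (carrier G)) * (if x div r = y div r \<and> u div r = v div r then 1 / of_nat p else 0) *
      (of_nat (card (carrier H)) * (if x mod r = y mod r \<and> u mod r = v mod r then 1 / of_nat r else 0))
    = of_nat (card GH) * (if (x div r = y div r \<and> x mod r = y mod r) \<and> (u div r = v div r \<and> u mod r = v mod r) then 1 / of_nat (p * r) else (0::complex))"
    by (auto simp: card_cartesian_product)
  also have "(x div r = y div r \<and> x mod r = y mod r) \<and> (u div r = v div r \<and> u mod r = v mod r) \<longleftrightarrow> x = y \<and> u = v"
    by (metis div_mult_mod_eq)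
  finally show ?thesis .
qed

text \<open>The twirl makes the input marginal of every invariant operator scalar; hence a smoothed
  Choi operator that is still invariant is, up to normalization, the Choi operator of a channel.\<close>

lemma marg_invar:
  assumes X: "bdd (DD n) X" "0 \<le> X" and invar: "invar n X"
  shows "marg (DI n) (DO n) X = (tr X / real (DI n)) *\<^sub>R idn (DI n)"
proof (rule fop_eq_bddI[of "DI n"])
  fix x y assume xy: "x < DI n" "y < DI n"
  let ?M = "marg (DI n) (DO n) X"
  let ?\<gamma> = "of_nat (card GH) :: complex"
  have M: "?M = KI n gs * ?M * adj (KI n gs)" if gs: "gs \<in> GS n" for gs
  proof -
    note u = unitary_onD[OF U_unitary(1)[OF gs]]
    have "UU n gs * X * adj (UU n gs) = X * (UU n gs * adj (UU n gs))"
      using invar gs unfolding invar_def by (simp only: mult.assoc)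
    then have "marg (DI n) (DO n) (UU n gs * X * adj (UU n gs)) = ?M" using u X by simp
    then show ?thesis
      unfolding UU_IO ptr_conj[OF bip_out U_unitary(3)[OF gs] unitary_onD(1)[OF U_unitary(2)[OF gs]] X(1)] by simp
  qed
  have bM: "bdd (DI n) ?M" by simp
  have e: "ent ?M x y = (\<Sum>v<DI n. \<Sum>u<DI n. ent ?M u v * (\<Prod>m<n.
      cnj (ent (fo (kin (gs m))) (eI n x m) (eI n u m)) * ent (fo (kin (gs m))) (eI n y m) (eI n v m)))"
    if gs: "gs \<in> GS n" for gs
  proof -
    have "ent ?M x y = ent (KI n gs * ?M * adj (KI n gs)) x y" using M[OF gs] by simp
    also have "\<dots> = (\<Sum>v<DI n. \<Sum>u<DI n. ent (KI n gs) x u * ent ?M u v * cnj (ent (KI n gs) y v))"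
      using unitary_onD(1,2)[OF U_unitary(2)[OF gs]] by (simp add: ent_times_right[of "DI n"] ent_adj sum_distrib_right)
    also have "\<dots> = (\<Sum>v<DI n. \<Sum>u<DI n. ent ?M u v * (\<Prod>m<n.
      cnj (ent (fo (kin (gs m))) (eI n x m) (eI n u m)) * ent (fo (kin (gs m))) (eI n y m) (eI n v m)))"
      by (intro sum.cong refl) (use xy in \<open>simp add: KI_def ent_tp ent_cj prod.distrib cnj_prod mult_ac\<close>)
    finally show ?thesis .
  qed
  have avg: "(\<Sum>gs\<in>GS n. \<Prod>m<n. cnj (ent (fo (kin (gs m))) (eI n x m) (eI n u m)) * ent (fo (kin (gs m))) (eI n y m) (eI n v m))
    = ?\<gamma> ^ n * (if x = y \<and> u = v then 1 / of_nat (DI n) else 0)" if uv: "u < DI n" "v < DI n" for u v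
  proof -
    have lt: "eI n c m < p * r" if "c < DI n" "m < n" for c m using code_lt[OF codes(1)] that by blast
    have "(\<Sum>gs\<in>GS n. \<Prod>m<n. cnj (ent (fo (kin (gs m))) (eI n x m) (eI n u m)) * ent (fo (kin (gs m))) (eI n y m) (eI n v m))
      = (\<Prod>m<n. \<Sum>g\<in>GH. cnj (ent (fo (kin g)) (eI n x m) (eI n u m)) * ent (fo (kin g)) (eI n y m) (eI n v m))"
      by (rule prod_sum_PiE[symmetric]) (use GH in auto)
    also have "\<dots> = (\<Prod>m<n. ?\<gamma> * (if eI n x m = eI n y m \<and> eI n u m = eI n v m then 1 / of_nat (p * r) else 0))"
      by (intro prod.cong refl kin_orthogonality lt xy uv) auto
    also have "\<dots> = ?\<gamma> ^ n * (if x = y \<and> u = v then 1 / of_nat (DI n) else 0)"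
    proof (cases "x = y \<and> u = v")
      case True
      then show ?thesis by (simp add: prod.distrib power_mult_distrib power_divide)
    next
      case False
      then obtain m where m: "m < n" "\<not> (eI n x m = eI n y m \<and> eI n u m = eI n v m)"
        using code_inj[OF codes(1) xy] code_inj[OF codes(1) uv] by blast
      then have "(\<Prod>m<n. ?\<gamma> * (if eI n x m = eI n y m \<and> eI n u m = eI n v m then 1 / of_nat (p * r) else 0)) = 0"
        by (intro prod_zero) auto
      then show ?thesis by (simp only: False if_False mult_zero_right)
    qed
    finally show ?thesis .
  qed
  have card: "of_nat (card (GS n)) = ?\<gamma> ^ n" by (simp add: card_PiE)
  \<comment> \<open>The marginal equals its conjugate for every word \<open>gs\<close>, hence its
    average over all words; orthogonality in each copy leaves only the trace times the
    identity.\<close>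
  have "?\<gamma> ^ n * ent ?M x y = (\<Sum>gs\<in>GS n. ent ?M x y)" by (simp add: card[symmetric])
  also have "\<dots> = (\<Sum>gs\<in>GS n. \<Sum>v<DI n. \<Sum>u<DI n. ent ?M u v * (\<Prod>m<n.
      cnj (ent (fo (kin (gs m))) (eI n x m) (eI n u m)) * ent (fo (kin (gs m))) (eI n y m) (eI n v m)))"
    by (rule sum.cong[OF refl]) (rule e)
  also have "\<dots> = (\<Sum>v<DI n. \<Sum>u<DI n. \<Sum>gs\<in>GS n. ent ?M u v * (\<Prod>m<n.
      cnj (ent (fo (kin (gs m))) (eI n x m) (eI n u m)) * ent (fo (kin (gs m))) (eI n y m) (eI n v m)))"
    by (subst sum.swap, rule sum.cong[OF refl], rule sum.swap)
  also have "\<dots> = (\<Sum>v<DI n. \<Sum>u<DI n. if u = v then ?\<gamma> ^ n * (if x = y then ent ?M v v / of_nat (DI n) else 0) else 0)"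
    by (rule sum.cong[OF refl], rule sum.cong[OF refl])
      (simp only: sum_distrib_left[symmetric] avg lessThan_iff, auto)
  also have "\<dots> = ?\<gamma> ^ n * (if x = y then ctr ?M / of_nat (DI n) else 0)"
    by (simp add: sum.delta ctr_bdd[OF bM] sum_distrib_left[symmetric] sum_divide_distrib[symmetric])
  finally have "ent ?M x y = (if x = y then ctr ?M / of_nat (DI n) else 0)" using GH(2) by (auto simp: card_gt_0_iff)
  also have "ctr ?M = complex_of_real (tr X)" unfolding ctr_ptr[OF bip_out X(1)] by (rule psd_ctr[OF X(2)])
  finally show "ent ?M x y = ent ((tr X / real (DI n)) *\<^sub>R idn (DI n)) x y"
    using xy by (simp add: ent_simps ent_dg scaleR_conv_of_real)
qed auto

end

section \<open>The reference channel built from the Choi marginal\<close>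

context bichan
begin

lemma ptr_C: "ptr (p * a) (r * b) (ptI r a b) C = real (p * r) *\<^sub>R fo \<phi>Y"
proof (rule fop_eq_bddI[of "r * b"])
  fix y y' assume y: "y < r * b" "y' < r * b"
  have "ent (fo \<phi>) (x * (r * b) + y) (x * (r * b) + y') = ent C (ptI r a b x y) (ptI r a b x y') / of_nat (p * r)"
    if x: "x < p * a" for x
    using q_choi_index[OF bipD(4)[OF bip_choi x y(1)] bipD(4)[OF bip_choi x y(2)], of N]
    unfolding bipD(5,6)[OF bip_choi x y(1)] bipD(5,6)[OF bip_choi x y(2)] .
  then have "ent (fo \<phi>Y) y y' = (\<Sum>x<p * a. ent C (ptI r a b x y) (ptI r a b x y')) / of_nat (p * r)"
    unfolding fo_\<phi>Y sum_divide_distrib using y by (simp add: ent_ptr)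
  then show "ent (ptr (p * a) (r * b) (ptI r a b) C) y y' = ent (real (p * r) *\<^sub>R fo \<phi>Y) y y'"
    using y pos by (simp add: ent_ptr ent_simps scaleR_conv_of_real)
qed (use bdd_fo[OF \<phi>Y_carrier] in auto)

text \<open>Tracing \<open>C\<close> over \<open>A'\<close>, \<open>A\<close> and \<open>B\<close>
  leaves \<open>p\<close> times the identity on \<open>B'\<close>, since the input marginal of
  \<open>C\<close> is the identity. So \<open>r\<close> times the Choi marginal is itself a Choi
  matrix: that of the channel which feeds the maximally mixed state into \<open>A'\<close> and
  discards \<open>A\<close>.\<close>

lemma marg_\<phi>Y: "marg r b (real r *\<^sub>R fo \<phi>Y) = idn r"
proof -
  have "marg r b (ptr (p * a) (r * b) (ptI r a b) C) = real p *\<^sub>R idn r"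
  proof (rule fop_eq_bddI[of r])
    fix c c' assume c: "c < r" "c' < r"
    have i: "ptI r a b (k * a + i) (d * b + u) = (k * r + d) * (a * b) + (i * b + u)" if "i < a" "u < b" for k i d u
      unfolding ptI_def idx_div[OF that(1)] idx_mod[OF that(1)] idx_div[OF that(2)] idx_mod[OF that(2)] ..
    have "ent (marg r b (ptr (p * a) (r * b) (ptI r a b) C)) c c'
      = (\<Sum>u<b. \<Sum>k<p. \<Sum>i<a. ent C ((k * r + c) * (a * b) + (i * b + u)) ((k * r + c') * (a * b) + (i * b + u)))"
      using c idx_less[OF c(1)] idx_less[OF c(2)] by (simp add: ent_ptr sum_bip[OF bip_div_mod[of p a]] i)
    also have "\<dots> = (\<Sum>k<p. \<Sum>i<a. \<Sum>u<b. ent C ((k * r + c) * (a * b) + (i * b + u)) ((k * r + c') * (a * b) + (i * b + u)))"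
      by (subst sum.swap, rule sum.cong[OF refl], rule sum.swap)
    also have "\<dots> = (\<Sum>k<p. \<Sum>j<a * b. ent C ((k * r + c) * (a * b) + j) ((k * r + c') * (a * b) + j))"
      by (simp only: sum_bip[OF bip_div_mod[of a b]])
    also have "\<dots> = (\<Sum>k<p. ent (marg (p * r) (a * b) C) (k * r + c) (k * r + c'))"
      by (intro sum.cong refl) (use c in \<open>simp add: ent_ptr idx_less\<close>)
    also have "\<dots> = (\<Sum>k<p. if c = c' then 1 else 0)"
      unfolding C_channel(2) by (intro sum.cong refl) (use c in \<open>auto simp: ent_dg idx_less\<close>)
    finally show "ent (marg r b (ptr (p * a) (r * b) (ptI r a b) C)) c c' = ent (real p *\<^sub>R idn r) c c'"
      using c by (simp add: ent_simps ent_dg scaleR_conv_of_real)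
  qed auto
  then have "real (p * r) *\<^sub>R marg r b (fo \<phi>Y) = real p *\<^sub>R idn r" unfolding ptr_C ptr_linear(2) .
  from arg_cong[OF this, of "\<lambda>X. (1 / real p) *\<^sub>R X"] show ?thesis using pos by (simp add: ptr_linear)
qed

text \<open>The Choi matrix of the \<open>n\<close>-fold power of this channel. It supplies the
  competitor in the infimum over channels from \<open>B'^n\<close> to \<open>B^n\<close>.\<close>

definition "Qn n = real r ^ n *\<^sub>R yn n"

lemma Qn_tp: "Qn n = tp (DY n) n (eY n) (\<lambda>_. real r *\<^sub>R fo \<phi>Y)"
  unfolding Qn_def yn_def tp_scaleR ..

lemma Qn_props: "bdd (DY n) (Qn n)" "0 \<le> Qn n" "marg (r ^ n) (b ^ n) (Qn n) = idn (r ^ n)"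
proof -
  show "bdd (DY n) (Qn n)" "0 \<le> Qn n" using yn_props by (auto simp: Qn_def intro!: scaleR_nonneg_nonneg)
  have "marg (r ^ n) (b ^ n) (Qn n) = tp (r ^ n) n (dgt r n) (\<lambda>_. marg r b (real r *\<^sub>R fo \<phi>Y))"
    unfolding Qn_tp by (rule ptr_tp[OF bip_out bip_out code_dgt[OF pos(4)] code_dgt[OF pos(2)]]) (simp add: pairc_def)
  then show "marg (r ^ n) (b ^ n) (Qn n) = idn (r ^ n)" by (simp only: marg_\<phi>Y tp_idn[OF code_dgt[OF pos(2)]])
qed

lemma Qn_channel: "q_channel (r ^ n) (b ^ n) (chan (r ^ n) (b ^ n) (Qn n))"
  by (rule chan_channel[OF Qn_props])

lemma lf_mono: "bdd (DY n) S \<Longrightarrow> bdd (DY n) T \<Longrightarrow> S \<le> T \<Longrightarrow> lf n S \<le> lf n T"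
  by (rule ten_mono[OF bipn bdd_dg _ _ idn_psd[OF bipn]])

lemma lf_Qn_psd: "0 \<le> lf n (Qn n)"
  by (rule ten_psd[OF bipn bdd_dg Qn_props(1) idn_psd[OF bipn] Qn_props(2)])

text \<open>Up to the small error \<open>E\<close>, the channel with Choi matrix \<open>Ct\<close> dominates the \<open>n\<close>-th power of \<open>N\<close>
  and is dominated by \<open>c\<close> times a replacer. The marginal of \<open>E\<close> being scalar makes the error small
  for every input, not only for the maximally entangled one.\<close>

definition "simulates n s c Ct E \<eta> \<longleftrightarrow> bdd (DD n) Ct \<and> 0 \<le> Ct \<and> marg (DI n) (DO n) Ct = idn (DI n) \<and>
  bdd (DD n) E \<and> 0 \<le> E \<and> marg (DI n) (DO n) E = \<eta> *\<^sub>R idn (DI n) \<and> \<eta> \<le> s \<and>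
  Cn n \<le> (1 + s) *\<^sub>R Ct + E \<and> Ct \<le> c *\<^sub>R lf n (Qn n)"

end

section \<open>Simulation of the tensor power by a smoothed channel\<close>

context tele
begin

lemma simulation:
  assumes \<delta>: "0 < \<delta>" and s: "0 < s" "s < 1"
  shows "\<exists>n0. \<forall>n\<ge>n0. \<exists>Ct E \<eta>. simulates n s ((1 + s) / (1 - s) * 2 powr (- (real n * (rate - 2 * \<delta>)))) Ct E \<eta>"
proof -
  define \<epsilon> where "\<epsilon> = s\<^sup>2 / (4 * (1 + s))"
  have \<epsilon>: "0 < \<epsilon>" using s by (simp add: \<epsilon>_def)
  from projections[OF \<delta> \<epsilon>] obtain n0 where n0: "\<forall>n\<ge>n0. \<exists>P Q. typical_proj (DD n) (\<omega>n n) (\<omega>n n) (2 powr (real n * (- SX - \<delta>))) (2 powr (real n * (- SX + \<delta>))) \<epsilon> P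
    \<and> typical_proj (DY n) (yn n) (yn n) (2 powr (real n * (- SY - \<delta>))) (2 powr (real n * (- SY + \<delta>))) \<epsilon> Q
    \<and> tr (\<omega>n n * (idn (DD n) - lf n Q)) \<le> \<epsilon>" ..
  show ?thesis
  proof (rule exI[of _ n0], rule allI, rule impI)
    fix n assume n: "n0 \<le> n"
    define lo hi where "lo = 2 powr (real n * (- SY - \<delta>))" and "hi = 2 powr (real n * (- SX + \<delta>))"
    from n0[rule_format, OF n] obtain P Q where PQ: "typical_proj (DD n) (\<omega>n n) (\<omega>n n) (2 powr (real n * (- SX - \<delta>))) hi \<epsilon> P
      \<and> typical_proj (DY n) (yn n) (yn n) lo (2 powr (real n * (- SY + \<delta>))) \<epsilon> Q \<and> tr (\<omega>n n * (idn (DD n) - lf n Q)) \<le> \<epsilon>"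
      unfolding lo_def hi_def by (elim exE)
    note P = PQ[THEN conjunct1] and Q = PQ[THEN conjunct2, THEN conjunct1] and tQ = PQ[THEN conjunct2, THEN conjunct2]
    have p: "proj_on (DD n) P" "tr (\<omega>n n * (idn (DD n) - P)) \<le> s\<^sup>2 / (4 * (1 + s))"
      using P by (auto simp: typical_proj_def \<epsilon>_def)
    have q0: "proj_on (DY n) Q" using Q by (simp add: typical_proj_def)
    note q = lf_proj[OF q0]
    define K L where "K = lf n Q * P" and "L = idn (DD n) - lf n Q * P"
    define t where "t = tr (K * \<omega>n n * adj K)"
    have aK: "adj K = P * lf n Q" and aL: "adj L = idn (DD n) - P * lf n Q"
      unfolding K_def L_def using p(1) q by (simp_all add: proj_onD)
    have bKL: "bdd (DD n) K" "bdd (DD n) L" unfolding K_def L_def using p(1) q by (simp_all add: proj_onD)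
    note iP = invar_typl[OF P] and iQ = invar_lf[OF Q]
    have iK: "invar n (K * \<omega>n n * adj K)" unfolding aK unfolding K_def
      by (intro invar_times iP iQ invar_\<omega>n)
    have iL: "invar n (L * \<omega>n n * adj L)" unfolding aL unfolding L_def
      by (intro invar_times invar_diff iP iQ invar_\<omega>n invar_idn)
    have bK: "bdd (DD n) (K * \<omega>n n * adj K)" and bL: "bdd (DD n) (L * \<omega>n n * adj L)"
      using bKL \<omega>n_props by simp_all
    have pK: "0 \<le> K * \<omega>n n * adj K" and pL: "0 \<le> L * \<omega>n n * adj L" by (rule conj_psd'[OF \<omega>n_props(2)])+
    have t1: "(1 - s) / (1 + s) \<le> t" unfolding t_def K_def
      by (rule smoothing_trace[OF \<omega>n_props p(1) q s(1) p(2)]) (use tQ in \<open>simp add: \<epsilon>_def\<close>)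
    have t0: "0 < t" 
    proof -
      have "0 < (1 - s) / (1 + s)" using s by simp
      then show ?thesis using t1 by linarith
    qed
    have t2: "t \<le> 1"
    proof -
      have "t = tr (P * lf n Q * P * \<omega>n n)" unfolding t_def K_def
        using sandwich_test(3)[OF q p(1), of "\<omega>n n"] by (simp add: tr_mult_commute)
      also have "\<dots> \<le> tr (idn (DD n) * \<omega>n n)" by (rule tr_mult_mono[OF sandwich_test(2)[OF q p(1)] \<omega>n_props(2)])
      finally show ?thesis using \<omega>n_props by simp
    qed
    note sm = smoothing[OF \<omega>n_props(1,2) p(1) q s(1) p(2) tQ[unfolded \<epsilon>_def], folded K_def L_def]
    \<comment> \<open>Division by the weight \<open>t\<close> restores the input marginal of a
      channel. From \<open>t \<le> 1\<close> the factor \<open>(1 + s) t\<close> relaxes to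
      \<open>1 + s\<close>, and from \<open>(1 - s)/(1 + s) \<le> t\<close> comes the prefactor of
      the bound by \<open>lf n (Qn n)\<close>. In the exponent, \<open>DI n / r^n = p^n\<close>
      contributes the summand \<open>log |A'|\<close>.\<close>
    define Ct where "Ct = (real (DI n) / t) *\<^sub>R (K * \<omega>n n * adj K)"
    define E where "E = (real (DI n) * (1 + 1 / s)) *\<^sub>R (L * \<omega>n n * adj L)"
    define \<eta> where "\<eta> = (1 + 1 / s) * tr (L * \<omega>n n * adj L)"
    have DI: "0 < real (DI n)" using pos by simp
    have Ct: "bdd (DD n) Ct" "0 \<le> Ct" unfolding Ct_def using bK pK t0 DI by (auto intro!: scaleR_nonneg_nonneg)
    have E: "bdd (DD n) E" "0 \<le> E" unfolding E_def using bL pL s DI by (auto intro!: scaleR_nonneg_nonneg)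
    have mC: "marg (DI n) (DO n) Ct = idn (DI n)"
      unfolding Ct_def ptr_linear marg_invar[OF bK pK iK] t_def[symmetric] using t0 pos by simp
    have mE: "marg (DI n) (DO n) E = \<eta> *\<^sub>R idn (DI n)"
      unfolding E_def ptr_linear marg_invar[OF bL pL iL] \<eta>_def using pos by simp
    have "Cn n = real (DI n) *\<^sub>R \<omega>n n" unfolding \<omega>n_Cn using pos by simp
    also have "\<dots> \<le> real (DI n) *\<^sub>R ((1 + s) *\<^sub>R (K * \<omega>n n * adj K) + (1 + 1 / s) *\<^sub>R (L * \<omega>n n * adj L))"
      using DI by (intro scaleR_left_mono sm(1)) simp
    also have "\<dots> = ((1 + s) * t) *\<^sub>R Ct + E" unfolding Ct_def E_def scaleR_add_right scaleR_scaleR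
      using t0 by (simp add: mult_ac)
    also have "\<dots> \<le> (1 + s) *\<^sub>R Ct + E"
      using t2 s Ct(2) by (intro add_right_mono scaleR_right_mono) auto
    finally have le: "Cn n \<le> (1 + s) *\<^sub>R Ct + E" .
    have lo: "0 < lo" and hi: "0 \<le> hi" by (simp_all add: lo_def hi_def)
    have "lf n Q \<le> lf n ((1 / lo) *\<^sub>R yn n)"
      by (rule lf_mono[OF proj_onD(1)[OF q0] _ typical_proj_proj_le[OF Q yn_props(2) lo]]) (simp add: yn_props)
    also have "\<dots> = (1 / lo / real r ^ n) *\<^sub>R lf n (Qn n)"
      unfolding Qn_def ten_linear(3) using pos by simp
    finally have qle: "lf n Q \<le> (1 / lo / real r ^ n) *\<^sub>R lf n (Qn n)" .
    have "K * \<omega>n n * adj K \<le> (hi * (1 / lo / real r ^ n)) *\<^sub>R lf n (Qn n)"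
      unfolding K_def by (rule smooth_dom[OF P \<omega>n_props(2) q qle hi])
    then have "Ct \<le> (real (DI n) / t) *\<^sub>R ((hi * (1 / lo / real r ^ n)) *\<^sub>R lf n (Qn n))"
      unfolding Ct_def using t0 DI by (intro scaleR_left_mono) auto
    also have "\<dots> = (1 / t * (real p ^ n * hi / lo)) *\<^sub>R lf n (Qn n)" using pos by simp
    also have "real p ^ n * hi / lo = 2 powr (- (real n * (rate - 2 * \<delta>)))"
      unfolding pow_powr hi_def lo_def powr_add[symmetric] powr_diff[symmetric] rate by (simp add: algebra_simps)
    also have "(1 / t * 2 powr (- (real n * (rate - 2 * \<delta>)))) *\<^sub>R lf n (Qn n)
      \<le> ((1 + s) / (1 - s) * 2 powr (- (real n * (rate - 2 * \<delta>)))) *\<^sub>R lf n (Qn n)"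
    proof (intro scaleR_right_mono mult_right_mono lf_Qn_psd)
      show "1 / t \<le> (1 + s) / (1 - s)" using t1 t0 s by (simp add: field_simps)
    qed simp
    finally have "Ct \<le> ((1 + s) / (1 - s) * 2 powr (- (real n * (rate - 2 * \<delta>)))) *\<^sub>R lf n (Qn n)" .
    then have "simulates n s ((1 + s) / (1 - s) * 2 powr (- (real n * (rate - 2 * \<delta>)))) Ct E \<eta>"
      unfolding simulates_def by (intro conjI Ct E mC mE sm(2)[folded \<eta>_def] le)
    then show "\<exists>Ct E \<eta>. simulates n s ((1 + s) / (1 - s) * 2 powr (- (real n * (rate - 2 * \<delta>)))) Ct E \<eta>" by blast
  qed
qed

end

section \<open>Achievability of the smoothed min-entropy\<close>

context bichan
begin

text \<open>Supplies \<open>q_fidelity_lower\<close> for an arbitrary input: \<open>T\<close> lies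
  above both outputs, and \<open>1 + 1 - tr T\<close> is at least \<open>1 - 2 s\<close>. The scalar
  marginal of \<open>E\<close> makes these bounds independent of the input.\<close>

lemma simulates_act:
  assumes S: "simulates n s c Ct E \<eta>" and s: "0 < s" and \<rho>: "bdd (k * DI n) \<rho>" "0 \<le> \<rho>" "tr \<rho> = 1"
  defines "T \<equiv> (1 + s) *\<^sub>R act k (DI n) (DO n) Ct \<rho> + act k (DI n) (DO n) E \<rho>"
  shows "act k (DI n) (DO n) (Cn n) \<rho> \<le> T" "act k (DI n) (DO n) Ct \<rho> \<le> T" "tr T \<le> 1 + 2 * s"
    "0 \<le> act k (DI n) (DO n) Ct \<rho>" "0 \<le> act k (DI n) (DO n) E \<rho>" "tr (act k (DI n) (DO n) E \<rho>) \<le> s"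
    "tr (act k (DI n) (DO n) Ct \<rho>) = 1"
    "act k (DI n) (DO n) Ct \<rho> \<le> c *\<^sub>R act k (DI n) (DO n) (lf n (Qn n)) \<rho>"
proof -
  have f: "bdd (DD n) Ct" "0 \<le> Ct" "marg (DI n) (DO n) Ct = idn (DI n)" "bdd (DD n) E" "0 \<le> E"
    "marg (DI n) (DO n) E = \<eta> *\<^sub>R idn (DI n)" "\<eta> \<le> s" "Cn n \<le> (1 + s) *\<^sub>R Ct + E" "Ct \<le> c *\<^sub>R lf n (Qn n)"
    using S unfolding simulates_def by blast+
  show p: "0 \<le> act k (DI n) (DO n) Ct \<rho>" "0 \<le> act k (DI n) (DO n) E \<rho>"
    by (rule act_psd[OF \<rho>(1,2) f(1,2)], rule act_psd[OF \<rho>(1,2) f(4,5)])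
  have "act k (DI n) (DO n) (Cn n) \<rho> \<le> act k (DI n) (DO n) ((1 + s) *\<^sub>R Ct + E) \<rho>"
    by (rule act_mono[OF \<rho>(1,2) Cn_props(1) _ f(8)]) (use f in simp)
  then show "act k (DI n) (DO n) (Cn n) \<rho> \<le> T" by (simp only: act_linear T_def)
  have "T - act k (DI n) (DO n) Ct \<rho> = s *\<^sub>R act k (DI n) (DO n) Ct \<rho> + act k (DI n) (DO n) E \<rho>"
    by (simp add: T_def algebra_simps)
  moreover have "0 \<le> s *\<^sub>R act k (DI n) (DO n) Ct \<rho> + act k (DI n) (DO n) E \<rho>"
    using p s by (intro add_nonneg_nonneg scaleR_nonneg_nonneg) auto
  ultimately have "0 \<le> T - act k (DI n) (DO n) Ct \<rho>" by (simp only:)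
  then show "act k (DI n) (DO n) Ct \<rho> \<le> T" by (simp only: diff_ge_0_iff_ge)
  show tC: "tr (act k (DI n) (DO n) Ct \<rho>) = 1" using tr_act[OF \<rho>(1), of "DO n" Ct 1] f(3) \<rho>(3) by simp
  have tE: "tr (act k (DI n) (DO n) E \<rho>) = \<eta>" using tr_act[OF \<rho>(1) f(6)] \<rho>(3) by simp
  then show "tr (act k (DI n) (DO n) E \<rho>) \<le> s" using f(7) by simp
  show "tr T \<le> 1 + 2 * s" using f(7) by (simp add: T_def tC tE)
  have "act k (DI n) (DO n) Ct \<rho> \<le> act k (DI n) (DO n) (c *\<^sub>R lf n (Qn n)) \<rho>"
    by (rule act_mono[OF \<rho>(1,2) f(1) _ f(9)]) simp
  then show "act k (DI n) (DO n) Ct \<rho> \<le> c *\<^sub>R act k (DI n) (DO n) (lf n (Qn n)) \<rho>" by (simp only: act_linear)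
qed

text \<open>The fidelity of the outputs is at least \<open>(1 - 2 s)^2\<close>, so the squared
  distance is at most \<open>4 s\<close>; this is where \<open>s = \<epsilon>\<^sup>2 / 4\<close>
  comes from. The simulating channel and the reference channel are the witnesses for the two
  infima.\<close>

lemma simulates_smooth:
  assumes S: "simulates n s c Ct E \<eta>" and c: "0 < c" and \<epsilon>: "0 < \<epsilon>" "\<epsilon> < 1" and s: "s = \<epsilon>\<^sup>2 / 4"
  shows "ereal (- log 2 c) \<le> q_smooth_min_entropy \<epsilon> (p ^ n) (r ^ n) (a ^ n) (b ^ n) (q_chan_pow p r a b n N)"
proof -
  define M where "M = chan (DI n) (DO n) Ct"
  define Q where "Q = chan (r ^ n) (b ^ n) (Qn n)"
  have s0: "0 < s" and s1: "2 * s \<le> 1"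
    using \<epsilon> power_le_one[of \<epsilon> 2] by (simp_all add: s)
  have M: "q_channel (DI n) (DO n) M" unfolding M_def by (rule chan_channel) (use S in \<open>unfold simulates_def, blast+\<close>)
  have Q: "q_channel (r ^ n) (b ^ n) Q" unfolding Q_def by (rule Qn_channel)
  let ?id = "\<lambda>k X \<rho>. q_id_tensor k (DI n) (DO n) X \<rho>"
  let ?RQ = "q_tensor_map (p ^ n) (r ^ n) (a ^ n) (b ^ n) (q_replacer (a ^ n)) Q"
  have foM: "fo (?id k M \<rho>) = act k (DI n) (DO n) Ct (fo \<rho>)" if "\<rho> \<in> carrier_mat (k * DI n) (k * DI n)" for k \<rho>
    unfolding M_def by (rule id_tensor_act[OF refl that])
  have foQ: "fo (?id k ?RQ \<rho>) = act k (DI n) (DO n) (lf n (Qn n)) (fo \<rho>)" if "\<rho> \<in> carrier_mat (k * DI n) (k * DI n)" for k \<rho>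
    unfolding id_RQ[OF that] Q_def choi_chan[OF Qn_props(1)] ..
  have fid: "sqrt (1 - q_fidelity (?id k (q_chan_pow p r a b n N) \<rho>) (?id k M \<rho>)) \<le> \<epsilon>" if \<rho>: "q_state (k * DI n) \<rho>" for k \<rho>
  proof -
    have r: "\<rho> \<in> carrier_mat (k * DI n) (k * DI n)" "0 \<le> fo \<rho>" "tr (fo \<rho>) = 1" using \<rho> unfolding q_state_fo by blast+
    note b = bdd_fo[OF r(1)]
    note sa = simulates_act[OF S s0 b r(2,3)]
    have t1: "tr (act k (DI n) (DO n) (Cn n) (fo \<rho>)) = 1"
      using tr_act[OF b, of "DO n" "Cn n" 1] Cn_props(3) r(3) by simp
    have p1: "0 \<le> act k (DI n) (DO n) (Cn n) (fo \<rho>)" by (rule act_psd[OF b r(2) Cn_props(1,2)])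
    note f1 = id_pow[OF r(1)] and f2 = foM[OF r(1)]
    have "(1 - 2 * s)\<^sup>2 \<le> q_fidelity (?id k (q_chan_pow p r a b n N) \<rho>) (?id k M \<rho>)"
    proof (rule q_fidelity_lower[OF id_tensor_carrier _ id_tensor_carrier])
      show "0 \<le> fo (?id k (q_chan_pow p r a b n N) \<rho>)" "0 \<le> fo (?id k M \<rho>)"
        unfolding f1 f2 by (rule p1, rule sa(4))
      show "fo (?id k (q_chan_pow p r a b n N) \<rho>) \<le> (1 + s) *\<^sub>R act k (DI n) (DO n) Ct (fo \<rho>) + act k (DI n) (DO n) E (fo \<rho>)"
        "fo (?id k M \<rho>) \<le> (1 + s) *\<^sub>R act k (DI n) (DO n) Ct (fo \<rho>) + act k (DI n) (DO n) E (fo \<rho>)"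
        unfolding f1 f2 by (rule sa(1), rule sa(2))
      show "0 \<le> 1 - 2 * s" using s1 by simp
      show "1 - 2 * s \<le> tr (fo (?id k (q_chan_pow p r a b n N) \<rho>)) + tr (fo (?id k M \<rho>)) -
        tr ((1 + s) *\<^sub>R act k (DI n) (DO n) Ct (fo \<rho>) + act k (DI n) (DO n) E (fo \<rho>))"
        unfolding f1 f2 t1 sa(7) using sa(3) by linarith
    qed
    moreover have "1 - (1 - 2 * s)\<^sup>2 \<le> 4 * s" using s0 by (simp add: power2_eq_square algebra_simps)
    ultimately have "1 - q_fidelity (?id k (q_chan_pow p r a b n N) \<rho>) (?id k M \<rho>) \<le> \<epsilon>\<^sup>2"
      unfolding s by linarith
    then have "sqrt (1 - q_fidelity (?id k (q_chan_pow p r a b n N) \<rho>) (?id k M \<rho>)) \<le> sqrt (\<epsilon>\<^sup>2)"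
      by (rule real_sqrt_le_mono)
    then show ?thesis using \<epsilon>(1) by simp
  qed
  have pd: "q_pdist (DI n) (DO n) (q_chan_pow p r a b n N) M \<le> \<epsilon>"
    unfolding q_pdist_def
  proof (rule cSUP_least)
    have "(DI n, maxent (DI n)) \<in> {(k, \<rho>). 0 < k \<and> q_state (k * DI n) \<rho>}" using maxent_state[OF DI_pos] DI_pos by simp
    then show "{(k, \<rho>). 0 < k \<and> q_state (k * DI n) \<rho>} \<noteq> {}" by blast
    fix x assume "x \<in> {(k, \<rho>). 0 < k \<and> q_state (k * DI n) \<rho>}"
    then have "q_state (fst x * DI n) (snd x)" by (simp add: case_prod_unfold)
    then show "sqrt (1 - q_fidelity (?id (fst x) (q_chan_pow p r a b n N) (snd x)) (?id (fst x) M (snd x))) \<le> \<epsilon>" by (rule fid)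
  qed
  have "q_chan_div q_Dmax (DI n) (DO n) M ?RQ \<le> ereal (log 2 c)"
  proof (rule chan_div_le)
    fix k \<rho> assume "q_state (k * DI n) \<rho>"
    then have r: "\<rho> \<in> carrier_mat (k * DI n) (k * DI n)" "0 \<le> fo \<rho>" "tr (fo \<rho>) = 1" unfolding q_state_fo by blast+
    show "q_Dmax (?id k M \<rho>) (?id k ?RQ \<rho>) \<le> ereal (log 2 c)"
      by (rule Dmax_upper[OF c id_tensor_carrier id_tensor_carrier])
        (unfold foM[OF r(1)] foQ[OF r(1)], rule simulates_act(8)[OF S s0 bdd_fo[OF r(1)] r(2,3)])
  qed
  then have "(INF Nt \<in> {Nt. q_channel (DI n) (DO n) Nt \<and> q_pdist (DI n) (DO n) (q_chan_pow p r a b n N) Nt \<le> \<epsilon>}.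
          q_chan_div q_Dmax (DI n) (DO n) Nt ?RQ) \<le> ereal (log 2 c)"
    using M pd by (intro INF_lower2[of M]) blast+
  note h = this
  have "(INF Q \<in> {Q. q_channel (r ^ n) (b ^ n) Q}.
         INF Nt \<in> {Nt. q_channel (DI n) (DO n) Nt \<and> q_pdist (DI n) (DO n) (q_chan_pow p r a b n N) Nt \<le> \<epsilon>}.
          q_chan_div q_Dmax (DI n) (DO n) Nt (q_tensor_map (p ^ n) (r ^ n) (a ^ n) (b ^ n) (q_replacer (a ^ n)) Q)) \<le> ereal (log 2 c)"
    by (rule INF_lower2[of Q]) (simp add: Q, rule h)
  then show ?thesis unfolding q_smooth_min_entropy_def uminus_ereal.simps(1)[symmetric] ereal_minus_le_minus .
qed

text \<open>Because \<open>Q\<close> commutes with \<open>\<tau>\<close>, cyclicity collapses the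
  sandwich to \<open>tr (\<tau> * Q * P)\<close>. There \<open>\<tau> * Q\<close> is at most
  \<open>hi' Q\<close>, and the rank of \<open>P\<close> is at most \<open>1 / lo\<close> since
  \<open>P \<le> \<omega> / lo\<close>.\<close>

lemma sandwich_upper:
  assumes P: "typical_proj D \<omega> \<omega> lo hi \<eta> P" and Q: "typical_proj D \<omega> \<tau> lo' hi' \<eta> Q"
    and \<omega>: "0 \<le> \<omega>" "tr \<omega> = 1" and lo: "0 < lo" "0 \<le> hi'"
  shows "tr (\<tau> * (Q * P * Q)) \<le> hi' / lo"
proof -
  have p: "proj_on D P" and q: "proj_on D Q" "\<tau> * Q \<le> hi' *\<^sub>R Q" "Q * \<tau> = \<tau> * Q"
    using P Q unfolding typical_proj_def by blast+
  have "tr (\<tau> * (Q * P * Q)) = tr (Q * (\<tau> * Q * P))"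
    using tr_mult_commute[of "\<tau> * Q * P" Q] by (simp only: mult.assoc)
  also have "\<dots> = tr (\<tau> * (Q * Q) * P)" using q(3) by (simp only: mult.assoc[symmetric])
  also have "\<dots> = tr (\<tau> * Q * P)" using q(1) by (simp only: proj_onD)
  also have "\<dots> \<le> tr (hi' *\<^sub>R Q * P)" by (rule tr_mult_mono[OF q(2) proj_psd[OF p]])
  also have "\<dots> = hi' * tr (Q * P)" by simp
  also have "\<dots> \<le> hi' * tr (idn D * P)"
    by (intro mult_left_mono tr_mult_mono proj_le[OF q(1)] proj_psd[OF p] lo)
  also have "idn D * P = P" using p by (simp add: proj_onD)
  also have "hi' * tr P \<le> hi' * tr ((1 / lo) *\<^sub>R \<omega>)"
    by (intro mult_left_mono tr_mono typical_proj_proj_le[OF P \<omega>(1) lo(1)] lo)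
  finally show ?thesis using \<omega>(2) by simp
qed

end

section \<open>Upper bound on the relative entropy for tele-covariant channels\<close>

context tele
begin

text \<open>For an arbitrary input, the test \<open>P2 P1 P2\<close> made from the windows for
  \<open>t1\<close> and \<open>t2\<close> accepts the \<open>n\<close>-fold output of
  \<open>N\<close> almost surely but the power of \<open>\<tau>\<close> with probability at most
  \<open>2 powr (n (t2 - t1 + 2 \<delta>))\<close>. The simulating channel connects the two: applied
  to \<open>n\<close> copies of the input, its output captures all but little of the true one and is
  at most \<open>c\<close> times the power of \<open>\<tau>\<close>. Comparing exponents gives
  \<open>t1 - t2 \<le> - rate + 4 \<delta>\<close>.\<close>

lemma rel_ent_upper:
  "q_chan_div q_rel_ent (p * r) (a * b) N (q_tensor_map p r a b (q_replacer a) (chan r b (real r *\<^sub>R fo \<phi>Y))) \<le> ereal (- rate)"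
proof (rule chan_div_le)
  let ?d = "(p * r) * (a * b)"
  let ?S = "real r *\<^sub>R fo \<phi>Y"
  let ?R = "q_tensor_map p r a b (q_replacer a) (chan r b ?S)"
  define CR where "CR = ten ?d (ptX r a b) (ptY r a b) (idn (p * a)) ?S"
  have bS: "bdd (r * b) ?S" and pS: "0 \<le> ?S" using bdd_fo[OF \<phi>Y_carrier] \<phi>Y_state
    by (auto simp: q_state_fo intro!: scaleR_nonneg_nonneg)
  have bCR: "bdd ?d CR" by (simp add: CR_def)
  have pCR: "0 \<le> CR" unfolding CR_def by (rule ten_psd[OF bip_choi bdd_dg bS idn_psd[OF bip_choi] pS])
  have CRn: "tp (DD n) n (eS n) (\<lambda>_. CR) = lf n (Qn n)" for n
    unfolding CR_def Qn_tp using tp_RQ[of n 1 ?S] by simp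
  \<comment> \<open>The pinching bound costs the dimension \<open>p a\<close> of the traced-out
    system, and the marginal of \<open>C\<close> is \<open>p\<close> times the operator inside
    \<open>CR\<close>. The domination passes to every output, so the support condition holds and the
    relative entropy is finite.\<close>
  have dom: "C \<le> (real (p * a) * real p) *\<^sub>R CR"
  proof -
    have "C \<le> real (p * a) *\<^sub>R ten ?d (ptX r a b) (ptY r a b) (idn (p * a)) (real (p * r) *\<^sub>R fo \<phi>Y)"
      using psd_le_lift_ptr(2)[OF bip_choi bdd_choi C_channel(1)] unfolding ptr_C .
    also have "\<dots> = (real (p * a) * real p) *\<^sub>R CR" unfolding CR_def ten_linear(3) by simp
    finally show ?thesis .
  qed
  fix k \<rho> assume k: "0 < k" and \<rho>: "q_state (k * (p * r)) \<rho>"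
  then have r: "\<rho> \<in> carrier_mat (k * (p * r)) (k * (p * r))" "0 \<le> fo \<rho>" "tr (fo \<rho>) = 1" by (auto simp: q_state_fo)
  note b\<rho> = bdd_fo[OF r(1)]
  let ?K = "k * (a * b)"
  define \<omega> where "\<omega> = q_id_tensor k (p * r) (a * b) N \<rho>"
  define \<tau> where "\<tau> = q_id_tensor k (p * r) (a * b) ?R \<rho>"
  have carr: "\<omega> \<in> carrier_mat ?K ?K" "\<tau> \<in> carrier_mat ?K ?K" unfolding \<omega>_def \<tau>_def by (rule id_tensor_carrier)+
  have fo1: "fo \<omega> = act k (p * r) (a * b) C (fo \<rho>)"
    unfolding \<omega>_def by (rule id_tensor_act[OF _ r(1)]) (rule channel_chan[OF N])
  have fo2: "fo \<tau> = act k (p * r) (a * b) CR (fo \<rho>)"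
    unfolding \<tau>_def CR_def
    by (rule id_tensor_act[OF _ r(1)]) (simp only: choi_tensor_replacer choi_chan[OF bS])
  have p0: "0 \<le> fo \<omega>" "0 \<le> fo \<tau>" unfolding fo1 fo2
    by (rule act_psd[OF b\<rho> r(2) bdd_choi C_channel(1)], rule act_psd[OF b\<rho> r(2) bCR pCR])
  have "tr (fo \<omega>) = 1" unfolding fo1 using tr_act[OF b\<rho>, of "a * b" C 1] C_channel(2) r(3) by simp
  then have st: "q_state ?K \<omega>" using carr p0 by (simp add: q_state_fo)
  have le: "fo \<omega> \<le> (real (p * a) * real p) *\<^sub>R fo \<tau>"
    unfolding fo1 fo2 act_linear(3)[symmetric] by (rule act_mono[OF b\<rho> r(2) bdd_choi _ dom]) (simp add: bCR)
  have dims: "dim_row \<omega> = ?K" "dim_row \<tau> = ?K" using carr by auto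
  define t1 t2 where "t1 = tr (fo \<omega> * fo (q_log \<omega>))" and "t2 = tr (fo \<omega> * fo (q_log \<tau>))"
  note lc = q_log_carrier[OF carr(1) p0(1)] q_log_carrier[OF carr(2) p0(2)]
  have "q_rel_ent \<omega> \<tau> = ereal (Re (q_tr (\<omega> * (q_log \<omega> - q_log \<tau>))))"
    unfolding q_rel_ent_def dims by (rule if_P) (use kernel_le[OF carr p0(1) le] in blast)
  also have "Re (q_tr (\<omega> * (q_log \<omega> - q_log \<tau>))) = tr (fo (\<omega> * (q_log \<omega> - q_log \<tau>)))"
    unfolding tr_def using carr lc by (subst q_tr_fo[of _ ?K]) auto
  also have "\<dots> = t1 - t2"
  proof -
    have "fo (\<omega> * (q_log \<omega> - q_log \<tau>)) = fo \<omega> * (fo (q_log \<omega>) - fo (q_log \<tau>))"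
      using fo_times[OF carr(1) minus_carrier_mat[OF lc(2)]] fo_minus[OF lc] by simp
    then show ?thesis by (simp add: right_diff_distrib t1_def t2_def)
  qed
  finally have D: "q_rel_ent \<omega> \<tau> = ereal (t1 - t2)" .
  have sp: "supported_in ?K (fo \<omega>) (fo \<omega>)" "supported_in ?K (fo \<omega>) (fo \<tau>)"
    by (rule supported_in_le[OF p0(1), of 1], simp, rule supported_in_le[OF p0(1) le])
  have main: "0 \<le> - rate - (t1 - t2) + 4 * \<delta>" if \<delta>: "0 < \<delta>" for \<delta>
  proof -
    define s :: real where "s = 1/32"
    define \<eta> where "\<eta> = s\<^sup>2 / (4 * (1 + s))"
    have s: "0 < s" "s < 1" "0 < \<eta>" by (simp_all add: s_def \<eta>_def)
    from typical_log[OF st carr(1) p0(1) sp(1) \<delta> s(3), folded t1_def]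
    obtain n1 where n1: "\<forall>n\<ge>n1. \<forall>D e. code ?K n D e \<longrightarrow> (\<exists>P. typical_proj D (tp D n e (\<lambda>_. fo \<omega>)) (tp D n e (\<lambda>_. fo \<omega>))
      (2 powr (real n * (t1 - \<delta>))) (2 powr (real n * (t1 + \<delta>))) \<eta> P)" ..
    from typical_log[OF st carr(2) p0(2) sp(2) \<delta> s(3), folded t2_def]
    obtain n2 where n2: "\<forall>n\<ge>n2. \<forall>D e. code ?K n D e \<longrightarrow> (\<exists>P. typical_proj D (tp D n e (\<lambda>_. fo \<omega>)) (tp D n e (\<lambda>_. fo \<tau>))
      (2 powr (real n * (t2 - \<delta>))) (2 powr (real n * (t2 + \<delta>))) \<eta> P)" ..
    from simulation[OF \<delta> s(1,2)]
    obtain n3 where n3: "\<forall>n\<ge>n3. \<exists>Ct E \<eta>. simulates n s ((1 + s) / (1 - s) * 2 powr (- (real n * (rate - 2 * \<delta>)))) Ct E \<eta>" ..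
    have "1/4 \<le> 2 powr (real n * (- rate - (t1 - t2) + 4 * \<delta>))" if n: "max n1 (max n2 n3) \<le> n" for n
    proof -
      have n': "n1 \<le> n" "n2 \<le> n" "n3 \<le> n" using n by simp_all
      let ?D = "k ^ n * DO n"
      let ?e = "pairc (a * b) (DO n) (dgt k n) (eO n)"
      define X where "X = tp (k ^ n * DI n) n (pairc (p * r) (DI n) (dgt k n) (eI n)) (\<lambda>_. fo \<rho>)"
      define \<omega>' where "\<omega>' = tp ?D n ?e (\<lambda>_. fo \<omega>)"
      define \<tau>' where "\<tau>' = tp ?D n ?e (\<lambda>_. fo \<tau>)"
      have cin: "code (k * (p * r)) n (k ^ n * DI n) (pairc (p * r) (DI n) (dgt k n) (eI n))"
        by (rule code_pair[OF code_dgt[OF k] codes(1)])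
      have cout: "code ?K n ?D ?e" by (rule code_pair[OF code_dgt[OF k] codes(2)])
      have X: "bdd (k ^ n * DI n) X" "0 \<le> X" "tr X = 1"
      proof -
        show "bdd (k ^ n * DI n) X" by (simp add: X_def)
        show "0 \<le> X" unfolding X_def by (rule tp_psd[OF cin b\<rho> r(2)])
        have "ctr X = (\<Prod>m<n. ctr (fo \<rho>))" unfolding X_def by (rule ctr_tp[OF cin b\<rho>])
        also have "ctr (fo \<rho>) = 1" using psd_ctr[OF r(2)] r(3) by simp
        finally show "tr X = 1" by (simp add: tr_def)
      qed
      have \<omega>': "\<omega>' = act (k ^ n) (DI n) (DO n) (Cn n) X"
        unfolding \<omega>'_def fo1 X_def Cn_def by (rule act_tp[OF code_dgt[OF k] codes(1,2), symmetric])
      have \<tau>': "\<tau>' = act (k ^ n) (DI n) (DO n) (lf n (Qn n)) X"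
        unfolding \<tau>'_def fo2 X_def CRn[symmetric] by (rule act_tp[OF code_dgt[OF k] codes(1,2), symmetric])
      have b\<omega>': "bdd ?D \<omega>'" by (simp add: \<omega>'_def)
      have p\<omega>': "0 \<le> \<omega>'" unfolding \<omega>' by (rule act_psd[OF X(1,2) Cn_props(1,2)])
      have t\<omega>': "tr \<omega>' = 1" unfolding \<omega>' using tr_act[OF X(1), of "DO n" "Cn n" 1] Cn_props(3) X(3) by simp
      obtain P1 where P1: "typical_proj ?D \<omega>' \<omega>' (2 powr (real n * (t1 - \<delta>))) (2 powr (real n * (t1 + \<delta>))) \<eta> P1"
        using n1[rule_format, OF n'(1) cout] unfolding \<omega>'_def ..
      obtain P2 where P2: "typical_proj ?D \<omega>' \<tau>' (2 powr (real n * (t2 - \<delta>))) (2 powr (real n * (t2 + \<delta>))) \<eta> P2"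
        using n2[rule_format, OF n'(2) cout] unfolding \<omega>'_def \<tau>'_def ..
      define c where "c = (1 + s) / (1 - s) * 2 powr (- (real n * (rate - 2 * \<delta>)))"
      obtain Ct E \<eta>' where S: "simulates n s c Ct E \<eta>'" using n3[rule_format, OF n'(3)] unfolding c_def by (elim exE)
      note sa = simulates_act[OF S s(1) X]
      define A where "A = act (k ^ n) (DI n) (DO n) Ct X"
      define B where "B = act (k ^ n) (DI n) (DO n) E X"
      have pr: "proj_on ?D P1" "proj_on ?D P2" "tr (\<omega>' * (idn ?D - P1)) \<le> s\<^sup>2 / (4 * (1 + s))"
        "tr (\<omega>' * (idn ?D - P2)) \<le> s\<^sup>2 / (4 * (1 + s))"
        using P1 P2 by (auto simp: typical_proj_def \<eta>_def)
      define T where "T = P2 * P1 * P2"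
      note sw = sandwich_test[OF pr(1,2), folded T_def]
      have c0: "0 \<le> c" by (simp add: c_def s_def)
      have "(1 - s) / (1 + s) \<le> tr (\<omega>' * T)"
        unfolding sw(3) by (rule smoothing_trace[OF b\<omega>' p\<omega>' t\<omega>' pr(2,1) s(1) pr(4,3)])
      also have "\<dots> \<le> tr (((1 + s) *\<^sub>R A + B) * T)"
        unfolding \<omega>' A_def B_def by (rule tr_mult_mono[OF sa(1) sw(1)])
      also have "\<dots> = (1 + s) * tr (A * T) + tr (T * B)"
        by (simp only: distrib_right tr_simps mult_scaleR_left tr_mult_commute[of T])
      also have "\<dots> \<le> (1 + s) * tr (c *\<^sub>R \<tau>' * T) + tr (idn ?D * B)"
      proof (intro add_mono mult_left_mono)
        show "tr (A * T) \<le> tr (c *\<^sub>R \<tau>' * T)" unfolding A_def \<tau>' by (rule tr_mult_mono[OF sa(8) sw(1)])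
        show "tr (T * B) \<le> tr (idn ?D * B)" unfolding B_def by (rule tr_mult_mono[OF sw(2) sa(5)])
      qed (use s in simp)
      also have "idn ?D * B = B" unfolding B_def by (rule idn_times(1)) simp
      also have "(1 + s) * tr (c *\<^sub>R \<tau>' * T) + tr B \<le> (1 + s) * (c * (2 powr (real n * (t2 + \<delta>)) / 2 powr (real n * (t1 - \<delta>)))) + s"
      proof (intro add_mono mult_left_mono)
        have *: "tr (\<tau>' * T) \<le> 2 powr (real n * (t2 + \<delta>)) / 2 powr (real n * (t1 - \<delta>))"
          unfolding T_def by (rule sandwich_upper[OF P1 P2 p\<omega>' t\<omega>']) auto
        show "tr (c *\<^sub>R \<tau>' * T) \<le> c * (2 powr (real n * (t2 + \<delta>)) / 2 powr (real n * (t1 - \<delta>)))"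
          using mult_left_mono[OF * c0] by simp
        show "tr B \<le> s" unfolding B_def by (rule sa(6))
      qed (use s in simp)
      finally have "(1 - s) / (1 + s) - s \<le> (1 + s) * (c * (2 powr (real n * (t2 + \<delta>)) / 2 powr (real n * (t1 - \<delta>))))" by simp
      also have "c * (2 powr (real n * (t2 + \<delta>)) / 2 powr (real n * (t1 - \<delta>)))
          = (1 + s) / (1 - s) * (2 powr (- (real n * (rate - 2 * \<delta>))) * 2 powr (real n * (t2 + \<delta>)) / 2 powr (real n * (t1 - \<delta>)))"
        by (simp add: c_def)
      also have "2 powr (- (real n * (rate - 2 * \<delta>))) * 2 powr (real n * (t2 + \<delta>)) / 2 powr (real n * (t1 - \<delta>))
          = 2 powr (real n * (- rate - (t1 - t2) + 4 * \<delta>))"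
        unfolding powr_add[symmetric] powr_diff[symmetric] by (simp add: algebra_simps)
      finally show ?thesis by (simp add: s_def)
    qed
    then show ?thesis by (intro powr_exponent_nonneg[of "1/4" "max n1 (max n2 n3)"]) simp_all
  qed
  have "t1 - t2 \<le> - rate"
  proof (rule field_le_epsilon)
    fix e :: real assume "0 < e"
    then show "t1 - t2 \<le> - rate + e" using main[of "e / 4"] by simp
  qed
  then show "q_rel_ent (q_id_tensor k (p * r) (a * b) N \<rho>) (q_id_tensor k (p * r) (a * b) ?R \<rho>) \<le> ereal (- rate)"
    unfolding \<omega>_def[symmetric] \<tau>_def[symmetric] D by simp
qed

lemma chan_entropy_lower: "ereal rate \<le> q_cond_chan_entropy p r a b N"
proof -
  have Q: "q_channel r b (chan r b (real r *\<^sub>R fo \<phi>Y))"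
  proof (rule chan_channel[OF _ _ marg_\<phi>Y])
    show "bdd (r * b) (real r *\<^sub>R fo \<phi>Y)" "0 \<le> real r *\<^sub>R fo \<phi>Y" using bdd_fo[OF \<phi>Y_carrier] \<phi>Y_state
      by (auto simp: q_state_fo intro!: scaleR_nonneg_nonneg)
  qed
  have "(INF Q \<in> {Q. q_channel r b Q}. q_chan_div q_rel_ent (p * r) (a * b) N (q_tensor_map p r a b (q_replacer a) Q)) \<le> - ereal rate"
    by (rule INF_lower2[of "chan r b (real r *\<^sub>R fo \<phi>Y)"]) (simp add: Q, use rel_ent_upper in simp)
  then show ?thesis unfolding q_cond_chan_entropy_def by (subst ereal_minus_le_minus[symmetric]) simp
qed

lemma smooth_lower:
  assumes \<epsilon>: "0 < \<epsilon>" "\<epsilon> < 1" and \<delta>: "0 < \<delta>"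
  shows "\<exists>c n0. \<forall>n\<ge>n0. ereal (real n * (rate - 2 * \<delta>) - c)
    \<le> q_smooth_min_entropy \<epsilon> (p ^ n) (r ^ n) (a ^ n) (b ^ n) (q_chan_pow p r a b n N)"
proof -
  define s where "s = \<epsilon>\<^sup>2 / 4"
  have s: "0 < s" "s < 1" using \<epsilon> power_le_one[of \<epsilon> 2] by (simp_all add: s_def)
  from simulation[OF \<delta> s] obtain n0 where n0: "\<forall>n\<ge>n0. \<exists>Ct E \<eta>. simulates n s ((1 + s) / (1 - s) * 2 powr (- (real n * (rate - 2 * \<delta>)))) Ct E \<eta>" ..
  show ?thesis
  proof (rule exI[of _ "log 2 ((1 + s) / (1 - s))"], rule exI[of _ n0], rule allI, rule impI)
    fix n assume n: "n0 \<le> n"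
    let ?c = "(1 + s) / (1 - s) * 2 powr (- (real n * (rate - 2 * \<delta>)))"
    from n0[rule_format, OF n] obtain Ct E \<eta> where S: "simulates n s ?c Ct E \<eta>" by (elim exE)
    have c: "0 < (1 + s) / (1 - s)" using s by simp
    have "log 2 ?c = log 2 ((1 + s) / (1 - s)) - real n * (rate - 2 * \<delta>)"
      using c by (subst log_mult) auto
    moreover have "ereal (- log 2 ?c) \<le> q_smooth_min_entropy \<epsilon> (p ^ n) (r ^ n) (a ^ n) (b ^ n) (q_chan_pow p r a b n N)"
      by (rule simulates_smooth[OF S _ \<epsilon> s_def]) (rule mult_pos_pos[OF c], simp)
    ultimately show "ereal (real n * (rate - 2 * \<delta>) - log 2 ((1 + s) / (1 - s)))
      \<le> q_smooth_min_entropy \<epsilon> (p ^ n) (r ^ n) (a ^ n) (b ^ n) (q_chan_pow p r a b n N)" by simp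
  qed
qed

section \<open>Limits\<close>

lemma liminf_ge:
  assumes \<epsilon>: "0 < \<epsilon>" "\<epsilon> < 1"
  shows "ereal rate \<le> liminf (\<lambda>n. q_smooth_min_entropy \<epsilon> (p ^ n) (r ^ n) (a ^ n) (b ^ n) (q_chan_pow p r a b n N) / ereal (real n))"
    (is "_ \<le> liminf ?f")
proof (rule ereal_le_epsilon2)
  fix e :: real assume e: "0 < e"
  \<comment> \<open>Two thirds of \<open>e\<close> pay for the loss \<open>2 \<delta>\<close> in the
    rate; the last third absorbs \<open>c / n\<close> as soon as \<open>n \<delta>\<close> exceeds
    \<open>c\<close>.\<close>
  define \<delta> where "\<delta> = e / 3"
  have \<delta>: "0 < \<delta>" using e by (simp add: \<delta>_def)
  from smooth_lower[OF \<epsilon> \<delta>] obtain c n0 where n0: "\<forall>n\<ge>n0. ereal (real n * (rate - 2 * \<delta>) - c)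
    \<le> q_smooth_min_entropy \<epsilon> (p ^ n) (r ^ n) (a ^ n) (b ^ n) (q_chan_pow p r a b n N)" by (elim exE)
  obtain n1 where n1: "c / \<delta> < real n1" using reals_Archimedean2 by blast
  have "ereal (rate - e) \<le> ?f n" if n: "max n0 (max n1 1) \<le> n" for n
  proof -
    have n': "0 < real n" "n0 \<le> n" "real n1 \<le> real n" using n by simp_all
    have "c \<le> real n1 * \<delta>" using n1 \<delta> by (simp add: pos_divide_less_eq)
    also have "\<dots> \<le> real n * \<delta>" using mult_right_mono[OF n'(3)] \<delta> by simp
    finally have "(rate - e) * real n \<le> real n * (rate - 2 * \<delta>) - c" by (simp add: \<delta>_def algebra_simps)
    then have "rate - e \<le> (real n * (rate - 2 * \<delta>) - c) / real n" by (rule pos_le_divide_eq[OF n'(1), THEN iffD2])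
    then have "ereal (rate - e) \<le> ereal (real n * (rate - 2 * \<delta>) - c) / ereal (real n)" using n'(1) by simp
    also have "\<dots> \<le> ?f n"
      by (rule ereal_divide_right_mono[OF n0[rule_format, OF n'(2)]]) (use n'(1) in simp)
    finally show ?thesis .
  qed
  then have "eventually (\<lambda>n. ereal (rate - e) \<le> ?f n) sequentially"
    unfolding eventually_sequentially by (intro exI[of _ "max n0 (max n1 1)"] allI impI)
  then have "ereal (rate - e) \<le> liminf ?f" by (rule Liminf_bounded)
  then have "ereal (rate - e) + ereal e \<le> liminf ?f + ereal e" by (rule add_right_mono)
  then show "ereal rate \<le> liminf ?f + ereal e" by simp
qed

end

context bichan
begin

lemma limsup_le:
  "Limsup (at_right (0::real)) (\<lambda>\<epsilon>. limsup (\<lambda>n. q_smooth_min_entropy \<epsilon> (p ^ n) (r ^ n) (a ^ n) (b ^ n) (q_chan_pow p r a b n N) / ereal (real n)))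
    \<le> ereal rate"
proof (rule ereal_le_epsilon2)
  let ?f = "\<lambda>\<epsilon> n. q_smooth_min_entropy \<epsilon> (p ^ n) (r ^ n) (a ^ n) (b ^ n) (q_chan_pow p r a b n N) / ereal (real n)"
  fix e :: real assume e: "0 < e"
  define \<delta> where "\<delta> = e / 3"
  have \<delta>: "0 < \<delta>" using e by (simp add: \<delta>_def)
  from smooth_upper[OF \<delta>] obtain n0 where n0: "\<forall>n\<ge>n0. \<forall>\<epsilon>\<le>1/4. q_smooth_min_entropy \<epsilon> (p ^ n) (r ^ n) (a ^ n) (b ^ n) (q_chan_pow p r a b n N)
    \<le> ereal (real n * (rate + 2 * \<delta>) + 2)" ..
  obtain n1 where n1: "2 / \<delta> < real n1" using reals_Archimedean2 by blast
  \<comment> \<open>The budget is the same as in \<open>liminf_ge\<close>, with the constant 2 in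
    place of \<open>c\<close>. The estimate holds for all \<open>\<epsilon>\<close> up to 1/4 at
    once, hence eventually as \<open>\<epsilon>\<close> tends to 0 from the right.\<close>
  have le: "?f \<epsilon> n \<le> ereal (rate + e)" if n: "max n0 (max n1 1) \<le> n" and \<epsilon>: "\<epsilon> \<le> 1/4" for n \<epsilon>
  proof -
    have n': "0 < real n" "n0 \<le> n" "real n1 \<le> real n" using n by simp_all
    have "2 \<le> real n1 * \<delta>" using n1 \<delta> by (simp add: pos_divide_less_eq)
    also have "\<dots> \<le> real n * \<delta>" using mult_right_mono[OF n'(3)] \<delta> by simp
    finally have "real n * (rate + 2 * \<delta>) + 2 \<le> (rate + e) * real n" by (simp add: \<delta>_def algebra_simps)
    then have "(real n * (rate + 2 * \<delta>) + 2) / real n \<le> rate + e" by (rule pos_divide_le_eq[OF n'(1), THEN iffD2])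
    then have *: "ereal (real n * (rate + 2 * \<delta>) + 2) / ereal (real n) \<le> ereal (rate + e)" using n'(1) by simp
    have "?f \<epsilon> n \<le> ereal (real n * (rate + 2 * \<delta>) + 2) / ereal (real n)"
      by (rule ereal_divide_right_mono[OF n0[rule_format, OF n'(2) \<epsilon>]]) (use n'(1) in simp)
    then show ?thesis using * by (rule order_trans)
  qed
  have "limsup (?f \<epsilon>) \<le> ereal (rate + e)" if "\<epsilon> \<le> 1/4" for \<epsilon>
  proof -
    have "eventually (\<lambda>n. ?f \<epsilon> n \<le> ereal (rate + e)) sequentially"
      unfolding eventually_sequentially using le[OF _ that] by (intro exI[of _ "max n0 (max n1 1)"] allI impI)
    then show ?thesis by (rule Limsup_bounded)
  qed
  moreover have "eventually (\<lambda>\<epsilon>::real. \<epsilon> \<le> 1/4) (at_right 0)"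
    unfolding eventually_at_right_field by (intro exI[of _ "1/4"]) auto
  ultimately have "eventually (\<lambda>\<epsilon>. limsup (?f \<epsilon>) \<le> ereal (rate + e)) (at_right 0)"
    by (rule eventually_mono[rotated])
  then have "Limsup (at_right (0::real)) (\<lambda>\<epsilon>. limsup (?f \<epsilon>)) \<le> ereal (rate + e)" by (rule Limsup_bounded)
  then show "Limsup (at_right (0::real)) (\<lambda>\<epsilon>. limsup (?f \<epsilon>)) \<le> ereal rate + ereal e" by simp
qed

lemma chan_entropy_upper: "q_cond_chan_entropy p r a b N \<le> ereal rate"
proof -
  have "- ereal rate \<le> (INF Q \<in> {Q. q_channel r b Q}. q_chan_div q_rel_ent (p * r) (a * b) N (q_tensor_map p r a b (q_replacer a) Q))"
    by (rule INF_greatest) (use rel_ent_lower in simp)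
  then show ?thesis unfolding q_cond_chan_entropy_def by (subst ereal_uminus_le_reorder)
qed

end

text \<open>Limits are read as \<open>limsup\<close> in the upper bounds and as
  \<open>liminf\<close> in the lower bound, so that their existence is not presupposed. The number
  \<open>rate\<close> separates the two sides: \<open>limsup_le\<close> and \<open>liminf_ge\<close>
  compare the smoothed entropies with it, \<open>chan_entropy_lower\<close> and
  \<open>chan_entropy_upper\<close> the channel entropy.\<close>

theorem theorem4:
  fixes dA' dB' dA dB :: nat and N :: "cmat \<Rightarrow> cmat"
    and G :: "('g, 'x) monoid_scheme" and H :: "('h, 'y) monoid_scheme"
    and U :: "'g \<Rightarrow> cmat" and V :: "'h \<Rightarrow> cmat" and W Z :: "'g \<Rightarrow> 'h \<Rightarrow> cmat"
  assumes "0 < dA'" "0 < dB'" "0 < dA" "0 < dB"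
    and "q_channel (dA' * dB') (dA * dB) N"
  shows "Limsup (at_right (0::real)) (\<lambda>\<epsilon>. limsup (\<lambda>n.
            q_smooth_min_entropy \<epsilon> (dA' ^ n) (dB' ^ n) (dA ^ n) (dB ^ n) (q_chan_pow dA' dB' dA dB n N)
              / ereal (real n)))
          \<le> ereal (q_cond_entropy (dA' * dA) (dB' * dB) (q_choi dA' dB' dA dB N) - log 2 (real dA'))
       \<and> (q_tele_covariant G H U V W Z dA' dB' dA dB N \<longrightarrow>
           Limsup (at_right (0::real)) (\<lambda>\<epsilon>. limsup (\<lambda>n.
              q_smooth_min_entropy \<epsilon> (dA' ^ n) (dB' ^ n) (dA ^ n) (dB ^ n) (q_chan_pow dA' dB' dA dB n N)
                / ereal (real n)))
             \<le> q_cond_chan_entropy dA' dB' dA dB N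
         \<and> (\<forall>\<epsilon>::real. 0 < \<epsilon> \<and> \<epsilon> < 1 \<longrightarrow>
              q_cond_chan_entropy dA' dB' dA dB N
                \<le> liminf (\<lambda>n. q_smooth_min_entropy \<epsilon> (dA' ^ n) (dB' ^ n) (dA ^ n) (dB ^ n)
                                (q_chan_pow dA' dB' dA dB n N) / ereal (real n))))"
proof -
  interpret bichan dA' dB' dA dB N using assms by unfold_locales
  show ?thesis
  proof (intro conjI impI allI)
    show "Limsup (at_right (0::real)) (\<lambda>\<epsilon>. limsup (\<lambda>n.
            q_smooth_min_entropy \<epsilon> (dA' ^ n) (dB' ^ n) (dA ^ n) (dB ^ n) (q_chan_pow dA' dB' dA dB n N)
              / ereal (real n)))
          \<le> ereal (q_cond_entropy (dA' * dA) (dB' * dB) (q_choi dA' dB' dA dB N) - log 2 (real dA'))"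
      using limsup_le unfolding rate_def .
  next
    assume "q_tele_covariant G H U V W Z dA' dB' dA dB N"
    then interpret tele dA' dB' dA dB N G H U V W Z by unfold_locales
    show "Limsup (at_right (0::real)) (\<lambda>\<epsilon>. limsup (\<lambda>n.
              q_smooth_min_entropy \<epsilon> (dA' ^ n) (dB' ^ n) (dA ^ n) (dB ^ n) (q_chan_pow dA' dB' dA dB n N)
                / ereal (real n)))
             \<le> q_cond_chan_entropy dA' dB' dA dB N"
      using limsup_le chan_entropy_lower by (rule order_trans)
  next
    fix \<epsilon> :: real
    assume "q_tele_covariant G H U V W Z dA' dB' dA dB N"
    then interpret tele dA' dB' dA dB N G H U V W Z by unfold_locales
    assume "0 < \<epsilon> \<and> \<epsilon> < 1"
    then have \<epsilon>: "0 < \<epsilon>" "\<epsilon> < 1" by simp_all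
    show "q_cond_chan_entropy dA' dB' dA dB N
                \<le> liminf (\<lambda>n. q_smooth_min_entropy \<epsilon> (dA' ^ n) (dB' ^ n) (dA ^ n) (dB ^ n)
                                (q_chan_pow dA' dB' dA dB n N) / ereal (real n))"
      using chan_entropy_upper liminf_ge[OF \<epsilon>] by (rule order_trans)
  qed
qed

end
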